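(* Suppose the parabolic subalgebra $\mathfrak p\subset\mathfrak g$ has a finite branching problem over $i(\bar{\mathfrak g})$. Let $\lambda\in\mathfrak h^*$ be dominant with respect to $\mathfrak b\cap\mathfrak s$ and integral with respect to $\mathfrak s$. Then there is an isomorphism of $\bar{\mathfrak g}$-modules $$Q_\lambda\simeq M_\lambda(\mathfrak g,\mathfrak p).$$
   Context: The base field is $\mathbb C$. $\mathfrak g,\bar{\mathfrak g}$ are finite-dimensional reductive Lie algebras and $i:\bar{\mathfrak g}\hookrightarrow\mathfrak g$ is an embedding such that $i(\bar{\mathfrak g})$ is reductive in $\mathfrak g$ (every irreducible finite-dimensional $\mathfrak g$-module is semisimple over $i(\bar{\mathfrak g})$). Cartan subalgebras $\bar{\mathfrak h}\subset\bar{\mathfrak g}$, $\mathfrak h\subset\mathfrak g$ with $i(\bar{\mathfrak h})\subset\mathfrak h$ and Borel subalgebras $\bar{\mathfrak b}\supset\bar{\mathfrak h}$, $\mathfrak b\supset\mathfrak h$ with $i(\bar{\mathfrak b})\subset\mathfrak b$ are fixed. $\mathfrak p\supset\mathfrak b$ is a parabolic subalgebra of $\mathfrak g$, and $\bar{\mathfrak p}:=i^{-1}(i(\bar{\mathfrak g})\cap\mathfrak p)$, a parabolic subalgebra of $\bar{\mathfrak g}$ containing $\bar{\mathfrak b}$. $\mathfrak n,\bar{\mathfrak n}$ are the nilradicals of $\mathfrak p,\bar{\mathfrak p}$ and $\mathfrak n_-,\bar{\mathfrak n}_-$ their opposites; $\mathfrak l\supset\mathfrak h$ and $\bar{\mathfrak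 l}\supset\bar{\mathfrak h}$ are the reductive Levi parts of $\mathfrak p,\bar{\mathfrak p}$ (so $i(\bar{\mathfrak l})=\mathfrak l\cap i(\bar{\mathfrak g})$), and $\mathfrak s=[\mathfrak l,\mathfrak l]$. Modules over $\mathfrak g$, $\mathfrak l$ are regarded as modules over $\bar{\mathfrak g}$, $\bar{\mathfrak l}$ via $i$; $\mathfrak n_-$ is an $\bar{\mathfrak l}$-module under $\mathrm{ad}\circ i$. "$\lambda$ dominant with respect to $\mathfrak b\cap\mathfrak s$ and integral with respect to $\mathfrak s$" means $2\langle\lambda,\beta\rangle/\langle\beta,\beta\rangle\in\mathbb Z_{\ge0}$ for all positive roots $\beta$ of $\mathfrak l$; $V_\lambda(\mathfrak l)$ is the irreducible finite-dimensional $\mathfrak l$-module of highest weight $\lambda$, viewed as a $\mathfrak p$-module with trivial $\mathfrak n$-action, and $M_\lambda(\mathfrak g,\mathfrak p)=U(\mathfrak g)\otimes_{U(\mathfrak p)}V_\lambda(\mathfrak l)$. $V_\mu(\bar{\mathfrak l})$ is the irreducible finite-dimensional $\bar{\mathfrak l}$-module of highest weight $\mu\in\bar{\mathfrak h}^*$. The "top level" module is the $\bar{\mathfrak g}$-submodule $Q_\lambda:=i(U(\bar{\mathfrak g}))\otimes_{i(U(\bar{\mathfrak p}))}V_\lambda(\mathfrak l)$ of $M_\lambda(\mathfrak g,\mathfrak p)$, where $V_\lambda(\mathfrak l)$ carries the $\bar{\mathfrak p}$-action obtained from its $\mathfrak p$-action through $i:\bar{\mathfrak p}\to\mathfrak p$.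 Let $N$ be any $\bar{\mathfrak l}$-submodule of $\mathfrak n_-$ isomorphic to $\bar{\mathfrak n}_-$ (one exists), and $m(\mu,\lambda):=\dim\mathrm{Hom}_{\bar{\mathfrak l}}(V_\mu(\bar{\mathfrak l}),V_\lambda(\mathfrak l)\otimes S^\star(\mathfrak n_-/N))$. $\mathfrak p$ has a finite branching problem over $i(\bar{\mathfrak g})$ if for each $\lambda\in\mathfrak h^*$ that is dominant with respect to $\mathfrak b\cap\mathfrak s$ and integral with respect to $\mathfrak s$ there are only finitely many $\mu\in\bar{\mathfrak h}^*$ with $m(\mu,\lambda)\ne0$. (This is taken to be equivalent to $M_\lambda(\mathfrak g,\mathfrak p)$ having a finite Jordan-Hölder series as a $\bar{\mathfrak g}$-module, and to $\dim\mathfrak n=\dim\bar{\mathfrak n}$.)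
   Formalization: Finite branching is taken to require also that every multiplicity m(μ,λ) is finite; read literally the claim fails, e.g. for the zero subalgebra of sl2 with p = b, where only μ = 0 occurs, with infinite multiplicity. *)

theory Defs
  imports Complex_Main "HOL-Algebra.QuotRing" "HOL-Algebra.Module"
    "HOL-Library.Poly_Mapping" "HOL-Library.Extended_Nat" "HOL-Library.FuncSet"
begin

section \<open>Finite-dimensional complex Lie algebras\<close>

class complex_vector = ab_group_add +
  fixes scaleC :: "complex \<Rightarrow> 'a \<Rightarrow> 'a" (infixr "*\<^sub>C" 75)
  assumes scaleC_add_right: "c *\<^sub>C (x + y) = c *\<^sub>C x + c *\<^sub>C y"
    and scaleC_add_left: "(c + d) *\<^sub>C x = c *\<^sub>C x + d *\<^sub>C x"
    and scaleC_scaleC: "c *\<^sub>C d *\<^sub>C x = (c * d) *\<^sub>C x"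
    and scaleC_one: "1 *\<^sub>C x = x"

global_interpretation complex_vector: vector_space "scaleC :: complex \<Rightarrow> 'a \<Rightarrow> 'a::complex_vector"
  by unfold_locales (simp_all add: scaleC_add_right scaleC_add_left scaleC_scaleC scaleC_one)

class lie_algebra = complex_vector +
  fixes bracket :: "'a \<Rightarrow> 'a \<Rightarrow> 'a"
  assumes bracket_add_left: "bracket (x + y) z = bracket x z + bracket y z"
    and bracket_add_right: "bracket x (y + z) = bracket x y + bracket x z"
    and bracket_scaleC_left: "bracket (c *\<^sub>C x) y = c *\<^sub>C bracket x y"
    and bracket_scaleC_right: "bracket x (c *\<^sub>C y) = c *\<^sub>C bracket x y"
    and bracket_self: "bracket x x = 0"
    and jacobi: "bracket x (bracket y z) + bracket y (bracket z x) + bracket z (bracket x y) = 0"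

class fin_dim_lie_algebra = lie_algebra +
  assumes ex_finite_spanning: "\<exists>S. finite S \<and> (\<forall>x. \<exists>c. x = (\<Sum>s\<in>S. c s *\<^sub>C s))"

definition lie_hom :: "('k::lie_algebra \<Rightarrow> 'g::lie_algebra) \<Rightarrow> bool" where
  "lie_hom i \<longleftrightarrow> (\<forall>x y. i (x + y) = i x + i y) \<and> (\<forall>c x. i (c *\<^sub>C x) = c *\<^sub>C i x) \<and>
     (\<forall>x y. i (bracket x y) = bracket (i x) (i y))"

definition subalgebra :: "'g::lie_algebra set \<Rightarrow> bool" where
  "subalgebra P \<longleftrightarrow> complex_vector.subspace P \<and> (\<forall>x\<in>P. \<forall>y\<in>P. bracket x y \<in> P)"

definition lie_ideal :: "'g::lie_algebra set \<Rightarrow> 'g set \<Rightarrow> bool" where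
  "lie_ideal I P \<longleftrightarrow> complex_vector.subspace I \<and> I \<subseteq> P \<and> (\<forall>x\<in>P. \<forall>y\<in>I. bracket x y \<in> I)"

definition bracket_set :: "'g::lie_algebra set \<Rightarrow> 'g set \<Rightarrow> 'g set" where
  "bracket_set A B = complex_vector.span {bracket a b | a b. a \<in> A \<and> b \<in> B}"

definition lie_solvable :: "'g::lie_algebra set \<Rightarrow> bool" where
  "lie_solvable P \<longleftrightarrow> (\<exists>n. ((\<lambda>A. bracket_set A A) ^^ n) P = {0})"

definition lie_nilpotent :: "'g::lie_algebra set \<Rightarrow> bool" where
  "lie_nilpotent P \<longleftrightarrow> (\<exists>n. (bracket_set P ^^ n) P = {0})"

definition radical :: "'g::lie_algebra set \<Rightarrow> 'g set" where
  "radical P = complex_vector.span (\<Union>{I. lie_ideal I P \<and> lie_solvable I})"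

definition nilradical :: "'g::lie_algebra set \<Rightarrow> 'g set" where
  "nilradical P = complex_vector.span (\<Union>{I. lie_ideal I P \<and> lie_nilpotent I})"

definition lie_center :: "'g::lie_algebra set \<Rightarrow> 'g set" where
  "lie_center P = {x \<in> P. \<forall>y\<in>P. bracket x y = 0}"

definition reductive :: "'g::lie_algebra set \<Rightarrow> bool" where
  "reductive P \<longleftrightarrow> subalgebra P \<and> radical P = lie_center P"

definition cartan_subalgebra :: "'g::lie_algebra set \<Rightarrow> bool" where
  "cartan_subalgebra H \<longleftrightarrow>
     subalgebra H \<and> lie_nilpotent H \<and> {x. \<forall>y\<in>H. bracket x y \<in> H} = H"

definition borel_subalgebra :: "'g::lie_algebra set \<Rightarrow> bool" where
  "borel_subalgebra B \<longleftrightarrow> subalgebra B \<and> lie_solvable B \<and>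
     (\<forall>B'. subalgebra B' \<and> lie_solvable B' \<and> B \<subseteq> B' \<longrightarrow> B' = B)"


section \<open>Roots, parabolic subalgebras, dominance\<close>

text \<open>The dual of a subspace \<open>H\<close>; functionals are set to 0 outside \<open>H\<close>, so that two
  elements agreeing on \<open>H\<close> are equal (the weights \<open>\<mu>\<close> have to be counted).\<close>

definition dual_space :: "'g::complex_vector set \<Rightarrow> ('g \<Rightarrow> complex) set" where
  "dual_space H = {f. (\<forall>x\<in>H. \<forall>y\<in>H. f (x + y) = f x + f y) \<and>
     (\<forall>c. \<forall>x\<in>H. f (c *\<^sub>C x) = c * f x) \<and> (\<forall>x. x \<notin> H \<longrightarrow> f x = 0)}"

definition root_space :: "'g::lie_algebra set \<Rightarrow> ('g \<Rightarrow> complex) \<Rightarrow> 'g set" where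
  "root_space H \<alpha> = {x. \<forall>y\<in>H. bracket y x = \<alpha> y *\<^sub>C x}"

definition roots_in :: "'g::lie_algebra set \<Rightarrow> 'g set \<Rightarrow> ('g \<Rightarrow> complex) set" where
  "roots_in H L = {\<alpha> \<in> dual_space H. \<alpha> \<noteq> (\<lambda>_. 0) \<and> root_space H \<alpha> \<inter> L \<noteq> {0}}"

text \<open>If the ambient reductive algebra has a centre, the largest nilpotent ideal of a parabolic
  subalgebra \<open>P\<close> contains it, whereas in the decomposition \<open>P = L \<oplus> N\<close> the centre belongs to
  the Levi part; the intersection with the derived algebra removes it. For a semisimple ambient
  algebra this is the nilradical of \<open>P\<close>.\<close>

definition parabolic_nilradical :: "'g::lie_algebra set \<Rightarrow> 'g set" where
  "parabolic_nilradical P = nilradical P \<inter> bracket_set UNIV UNIV"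

definition opposite_nilradical :: "'g::lie_algebra set \<Rightarrow> 'g set \<Rightarrow> 'g set" where
  "opposite_nilradical H P = complex_vector.span
     (\<Union>\<alpha>\<in>roots_in H (parabolic_nilradical P). root_space H (\<lambda>x. - \<alpha> x))"

definition levi_part :: "'g::lie_algebra set \<Rightarrow> 'g set \<Rightarrow> 'g set \<Rightarrow> bool" where
  "levi_part H P L \<longleftrightarrow> reductive L \<and> H \<subseteq> L \<and> L \<inter> parabolic_nilradical P = {0} \<and>
     {x + y | x y. x \<in> L \<and> y \<in> parabolic_nilradical P} = P"

definition invariant_form :: "('g::lie_algebra \<Rightarrow> 'g \<Rightarrow> complex) \<Rightarrow> bool" where
  "invariant_form B \<longleftrightarrow> (\<forall>x y z. B (x + y) z = B x z + B y z) \<and>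
     (\<forall>c x y. B (c *\<^sub>C x) y = c * B x y) \<and> (\<forall>x y. B x y = B y x) \<and>
     (\<forall>x y z. B (bracket x y) z = B x (bracket y z)) \<and> (\<forall>x. (\<forall>y. B x y = 0) \<longrightarrow> x = 0)"

text \<open>The form on the dual of \<open>H\<close> transported from \<open>B\<close> restricted to \<open>H\<close>.\<close>

definition form_vec :: "('g::lie_algebra \<Rightarrow> 'g \<Rightarrow> complex) \<Rightarrow> 'g set \<Rightarrow> ('g \<Rightarrow> complex) \<Rightarrow> 'g" where
  "form_vec B H lam = (THE t. t \<in> H \<and> (\<forall>y\<in>H. B t y = lam y))"

definition dual_form ::
  "('g::lie_algebra \<Rightarrow> 'g \<Rightarrow> complex) \<Rightarrow> 'g set \<Rightarrow> ('g \<Rightarrow> complex) \<Rightarrow> ('g \<Rightarrow> complex) \<Rightarrow> complex" where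
  "dual_form B H lam \<mu> = B (form_vec B H lam) (form_vec B H \<mu>)"

definition dominant_integral ::
  "('g::lie_algebra \<Rightarrow> 'g \<Rightarrow> complex) \<Rightarrow> 'g set \<Rightarrow> 'g set \<Rightarrow> 'g set \<Rightarrow> ('g \<Rightarrow> complex) \<Rightarrow> bool" where
  "dominant_integral B H Bo L lam \<longleftrightarrow>
     (\<forall>\<beta>\<in>roots_in H (Bo \<inter> L). \<exists>k::nat. 2 * dual_form B H lam \<beta> / dual_form B H \<beta> \<beta> = of_nat k)"


section \<open>Modules over Lie algebras\<close>

definition complex_ring :: "complex ring" where
  "complex_ring = \<lparr>carrier = UNIV, mult = (*), one = 1, zero = 0, add = (+)\<rparr>"

text \<open>The ring components \<open>mult\<close> and \<open>one\<close> inherited from the library record play no role.\<close>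

record ('x, 'v) lie_module = "(complex, 'v) module" +
  act :: "'x \<Rightarrow> 'v \<Rightarrow> 'v"

definition vspan :: "(complex, 'v, 'm) module_scheme \<Rightarrow> 'v set \<Rightarrow> 'v set" where
  "vspan V S = \<Inter>{W. submodule W complex_ring V \<and> S \<subseteq> W}"

definition vdim :: "(complex, 'v, 'm) module_scheme \<Rightarrow> enat" where
  "vdim V = Inf {enat (card S) | S. finite S \<and> S \<subseteq> carrier V \<and> vspan V S = carrier V}"

definition is_lie_module :: "'x::lie_algebra set \<Rightarrow> ('x, 'v) lie_module \<Rightarrow> bool" where
  "is_lie_module L V \<longleftrightarrow> Module.module complex_ring V \<and>
     (\<forall>x\<in>L. \<forall>v\<in>carrier V. act V x v \<in> carrier V) \<and>
     (\<forall>x\<in>L. \<forall>v\<in>carrier V. \<forall>w\<in>carrier V. act V x (v \<oplus>\<^bsub>V\<^esub> w) = act V x v \<oplus>\<^bsub>V\<^esub> act V x w) \<and>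
     (\<forall>x\<in>L. \<forall>c. \<forall>v\<in>carrier V. act V x (c \<odot>\<^bsub>V\<^esub> v) = c \<odot>\<^bsub>V\<^esub> act V x v) \<and>
     (\<forall>x\<in>L. \<forall>y\<in>L. \<forall>v\<in>carrier V. act V (x + y) v = act V x v \<oplus>\<^bsub>V\<^esub> act V y v) \<and>
     (\<forall>x\<in>L. \<forall>c. \<forall>v\<in>carrier V. act V (c *\<^sub>C x) v = c \<odot>\<^bsub>V\<^esub> act V x v) \<and>
     (\<forall>x\<in>L. \<forall>y\<in>L. \<forall>v\<in>carrier V.
        act V (bracket x y) v = act V x (act V y v) \<ominus>\<^bsub>V\<^esub> act V y (act V x v))"

definition lie_submodule :: "'x set \<Rightarrow> 'v set \<Rightarrow> ('x, 'v) lie_module \<Rightarrow> bool" where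
  "lie_submodule L W V \<longleftrightarrow> submodule W complex_ring V \<and> (\<forall>x\<in>L. \<forall>w\<in>W. act V x w \<in> W)"

definition irreducible_module :: "'x set \<Rightarrow> ('x, 'v) lie_module \<Rightarrow> bool" where
  "irreducible_module L V \<longleftrightarrow> carrier V \<noteq> {\<zero>\<^bsub>V\<^esub>} \<and>
     (\<forall>W. lie_submodule L W V \<longrightarrow> W = {\<zero>\<^bsub>V\<^esub>} \<or> W = carrier V)"

definition semisimple_module :: "'x set \<Rightarrow> ('x, 'v) lie_module \<Rightarrow> bool" where
  "semisimple_module L V \<longleftrightarrow> (\<forall>W. lie_submodule L W V \<longrightarrow>
     (\<exists>W'. lie_submodule L W' V \<and> W \<inter> W' = {\<zero>\<^bsub>V\<^esub>} \<and> W <+>\<^bsub>V\<^esub> W' = carrier V))"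

definition lie_isomorphic :: "'x set \<Rightarrow> ('x, 'v) lie_module \<Rightarrow> ('x, 'w) lie_module \<Rightarrow> bool" where
  "lie_isomorphic L V W \<longleftrightarrow> (\<exists>f. bij_betw f (carrier V) (carrier W) \<and>
     (\<forall>v\<in>carrier V. \<forall>w\<in>carrier V. f (v \<oplus>\<^bsub>V\<^esub> w) = f v \<oplus>\<^bsub>W\<^esub> f w) \<and>
     (\<forall>c. \<forall>v\<in>carrier V. f (c \<odot>\<^bsub>V\<^esub> v) = c \<odot>\<^bsub>W\<^esub> f v) \<and>
     (\<forall>x\<in>L. \<forall>v\<in>carrier V. f (act V x v) = act W x (f v)))"

definition hom_module ::
  "'x set \<Rightarrow> ('x, 'v) lie_module \<Rightarrow> ('x, 'w) lie_module \<Rightarrow> (complex, 'v \<Rightarrow> 'w) module" where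
  "hom_module L V W =
     \<lparr>carrier = {f \<in> carrier V \<rightarrow>\<^sub>E carrier W.
        (\<forall>v\<in>carrier V. \<forall>w\<in>carrier V. f (v \<oplus>\<^bsub>V\<^esub> w) = f v \<oplus>\<^bsub>W\<^esub> f w) \<and>
        (\<forall>c. \<forall>v\<in>carrier V. f (c \<odot>\<^bsub>V\<^esub> v) = c \<odot>\<^bsub>W\<^esub> f v) \<and>
        (\<forall>x\<in>L. \<forall>v\<in>carrier V. f (act V x v) = act W x (f v))},
      mult = undefined, one = undefined,
      zero = (\<lambda>v\<in>carrier V. \<zero>\<^bsub>W\<^esub>),
      add = (\<lambda>f g. \<lambda>v\<in>carrier V. f v \<oplus>\<^bsub>W\<^esub> g v),
      smult = (\<lambda>c f. \<lambda>v\<in>carrier V. c \<odot>\<^bsub>W\<^esub> f v)\<rparr>"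

definition pullback :: "('y \<Rightarrow> 'x) \<Rightarrow> ('x, 'v) lie_module \<Rightarrow> ('y, 'v) lie_module" where
  "pullback i V = \<lparr>carrier = carrier V, mult = mult V, one = one V, zero = zero V, add = add V,
     smult = smult V, act = (\<lambda>y. act V (i y))\<rparr>"

definition adjoint_module :: "'g::lie_algebra set \<Rightarrow> ('g, 'g) lie_module" where
  "adjoint_module W = \<lparr>carrier = W, mult = undefined, one = undefined, zero = 0, add = (+),
     smult = scaleC, act = bracket\<rparr>"

definition quotient_module :: "('x, 'v) lie_module \<Rightarrow> 'v set \<Rightarrow> ('x, 'v set) lie_module" where
  "quotient_module V N = \<lparr>carrier = a_rcosets\<^bsub>V\<^esub> N, mult = undefined, one = undefined,
     zero = N, add = set_add V,
     smult = (\<lambda>c C. \<Union>v\<in>C. N +>\<^bsub>V\<^esub> (c \<odot>\<^bsub>V\<^esub> v)),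
     act = (\<lambda>x C. \<Union>v\<in>C. N +>\<^bsub>V\<^esub> act V x v)\<rparr>"

text \<open>Every finite-dimensional complex module is isomorphic to one whose underlying set
  is a set of functions \<^typ>\<open>nat \<Rightarrow> complex\<close>, so the bound variable \<open>V\<close> in the next definition
  ranges, up to isomorphism, over all irreducible finite-dimensional modules.\<close>

definition reductive_in :: "('k::lie_algebra \<Rightarrow> 'g::lie_algebra) \<Rightarrow> bool" where
  "reductive_in i \<longleftrightarrow> (\<forall>V :: ('g, nat \<Rightarrow> complex) lie_module.
     is_lie_module UNIV V \<and> vdim V \<noteq> \<infinity> \<and> irreducible_module UNIV V \<longrightarrow>
     semisimple_module UNIV (pullback i V))"

text \<open>\<open>V\<close> is an irreducible finite-dimensional \<open>L\<close>-module of highest weight \<open>lam\<close>, with respect to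
  the Cartan subalgebra \<open>H\<close> and the positive roots determined by the Borel subalgebra \<open>Bo\<close>.\<close>

definition irreducible_highest_weight ::
  "'g::lie_algebra set \<Rightarrow> 'g set \<Rightarrow> 'g set \<Rightarrow> ('g \<Rightarrow> complex) \<Rightarrow> ('g, 'v) lie_module \<Rightarrow> bool" where
  "irreducible_highest_weight H Bo L lam V \<longleftrightarrow>
     is_lie_module L V \<and> vdim V \<noteq> \<infinity> \<and> irreducible_module L V \<and>
     (\<exists>v\<in>carrier V. v \<noteq> \<zero>\<^bsub>V\<^esub> \<and> (\<forall>x\<in>H. act V x v = lam x \<odot>\<^bsub>V\<^esub> v) \<and>
        (\<forall>\<beta>\<in>roots_in H (Bo \<inter> L). \<forall>x\<in>root_space H \<beta> \<inter> L. act V x v = \<zero>\<^bsub>V\<^esub>))"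

text \<open>A model of the module, which is unique up to isomorphism; meaningful only if one exists.\<close>

definition irr_module ::
  "'g::lie_algebra set \<Rightarrow> 'g set \<Rightarrow> 'g set \<Rightarrow> ('g \<Rightarrow> complex) \<Rightarrow> ('g, nat \<Rightarrow> complex) lie_module" where
  "irr_module H Bo L lam = (SOME V. irreducible_highest_weight H Bo L lam V)"


section \<open>Free algebras and free vector spaces\<close>

datatype 'a fword = FWord (letters: "'a list")

instantiation fword :: (type) monoid_add
begin

definition zero_fword :: "'a fword" where
  "zero_fword = FWord []"

definition plus_fword :: "'a fword \<Rightarrow> 'a fword \<Rightarrow> 'a fword" where
  "plus_fword u v = FWord (letters u @ letters v)"

instance
  by standard (simp_all add: zero_fword_def plus_fword_def)

end

text \<open>Words form a monoid under concatenation, so the library type \<^typ>\<open>'a fword \<Rightarrow>\<^sub>0 complex\<close>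
  with its convolution product is the free unital associative complex algebra on \<^typ>\<open>'a\<close>.\<close>

type_synonym 'a free_algebra = "'a fword \<Rightarrow>\<^sub>0 complex"

definition gen :: "'a \<Rightarrow> 'a free_algebra" where
  "gen x = Poly_Mapping.single (FWord [x]) 1"

definition const :: "complex \<Rightarrow> 'a free_algebra" where
  "const c = Poly_Mapping.single 0 c"

definition free_ring :: "'a set \<Rightarrow> 'a free_algebra ring" where
  "free_ring X = \<lparr>carrier = {p. \<forall>w\<in>Poly_Mapping.keys p. set (letters w) \<subseteq> X},
     mult = (*), one = 1, zero = 0, add = (+)\<rparr>"

definition pm_scale :: "complex \<Rightarrow> ('a \<Rightarrow>\<^sub>0 complex) \<Rightarrow> ('a \<Rightarrow>\<^sub>0 complex)" where
  "pm_scale c = Poly_Mapping.map ((*) c)"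

definition lin_ext :: "('a \<Rightarrow> ('b \<Rightarrow>\<^sub>0 complex)) \<Rightarrow> ('a \<Rightarrow>\<^sub>0 complex) \<Rightarrow> ('b \<Rightarrow>\<^sub>0 complex)" where
  "lin_ext f p = (\<Sum>k\<in>Poly_Mapping.keys p. pm_scale (Poly_Mapping.lookup p k) (f k))"

text \<open>The free vector space on the set \<open>X\<close>, with a prescribed action.\<close>

definition free_module ::
  "'a set \<Rightarrow> ('x \<Rightarrow> ('a \<Rightarrow>\<^sub>0 complex) \<Rightarrow> ('a \<Rightarrow>\<^sub>0 complex)) \<Rightarrow> ('x, 'a \<Rightarrow>\<^sub>0 complex) lie_module" where
  "free_module X a = \<lparr>carrier = {p. Poly_Mapping.keys p \<subseteq> X}, mult = undefined, one = undefined,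
     zero = 0, add = (+), smult = pm_scale, act = a\<rparr>"

text \<open>Dividing the free algebra on the set \<open>carrier W\<close> by these relations gives the tensor algebra
  of the vector space \<open>W\<close>.\<close>

definition linear_rels :: "(complex, 'a, 'm) module_scheme \<Rightarrow> 'a free_algebra set" where
  "linear_rels W =
     {gen (x \<oplus>\<^bsub>W\<^esub> y) - gen x - gen y | x y. x \<in> carrier W \<and> y \<in> carrier W} \<union>
     {gen (c \<odot>\<^bsub>W\<^esub> x) - const c * gen x | c x. x \<in> carrier W}"

text \<open>Dividing the free vector space on \<open>carrier A \<times> carrier V\<close> by these relations gives the
  tensor product over the complex numbers.\<close>

definition bilinear_rels ::
  "(complex, 'a, 'm) module_scheme \<Rightarrow> (complex, 'v, 'n) module_scheme \<Rightarrow> ('a \<times> 'v \<Rightarrow>\<^sub>0 complex) set" where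
  "bilinear_rels A V =
     {Poly_Mapping.single (a \<oplus>\<^bsub>A\<^esub> b, v) 1 - Poly_Mapping.single (a, v) 1 - Poly_Mapping.single (b, v) 1
       | a b v. a \<in> carrier A \<and> b \<in> carrier A \<and> v \<in> carrier V} \<union>
     {Poly_Mapping.single (a, v \<oplus>\<^bsub>V\<^esub> w) 1 - Poly_Mapping.single (a, v) 1 - Poly_Mapping.single (a, w) 1
       | a v w. a \<in> carrier A \<and> v \<in> carrier V \<and> w \<in> carrier V} \<union>
     {Poly_Mapping.single (c \<odot>\<^bsub>A\<^esub> a, v) 1 - Poly_Mapping.single (a, v) c
       | c a v. a \<in> carrier A \<and> v \<in> carrier V} \<union>
     {Poly_Mapping.single (a, c \<odot>\<^bsub>V\<^esub> v) 1 - Poly_Mapping.single (a, v) c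
       | c a v. a \<in> carrier A \<and> v \<in> carrier V}"

definition tensor_module ::
  "('x, 'v) lie_module \<Rightarrow> ('x, 'w) lie_module \<Rightarrow> ('x, ('v \<times> 'w \<Rightarrow>\<^sub>0 complex) set) lie_module" where
  "tensor_module V W =
     (let F = free_module (carrier V \<times> carrier W)
                (\<lambda>x. lin_ext (\<lambda>(v, w). Poly_Mapping.single (act V x v, w) 1
                                       + Poly_Mapping.single (v, act W x w) 1))
      in quotient_module F (vspan F (bilinear_rels V W)))"


section \<open>The symmetric algebra of a module\<close>

definition sym_ideal :: "(complex, 'v, 'm) module_scheme \<Rightarrow> 'v free_algebra set" where
  "sym_ideal W = genideal (free_ring (carrier W)) (linear_rels W \<union>
     {gen x * gen y - gen y * gen x | x y. x \<in> carrier W \<and> y \<in> carrier W})"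

text \<open>The derivation of the free algebra that extends a map \<open>f\<close> of the generators.\<close>

definition derivation :: "('v \<Rightarrow> 'v) \<Rightarrow> 'v free_algebra \<Rightarrow> 'v free_algebra" where
  "derivation f = lin_ext (\<lambda>w. \<Sum>k<length (letters w).
     Poly_Mapping.single (FWord ((letters w)[k := f (letters w ! k)])) 1)"

definition sym_module :: "('x, 'v) lie_module \<Rightarrow> ('x, 'v free_algebra set) lie_module" where
  "sym_module W =
     (let R = free_ring (carrier W); I = sym_ideal W; S = R Quot I
      in \<lparr>carrier = carrier S, mult = mult S, one = one S, zero = zero S, add = add S,
          smult = (\<lambda>c C. (I +>\<^bsub>R\<^esub> const c) \<otimes>\<^bsub>S\<^esub> C),
          act = (\<lambda>x C. \<Union>p\<in>C. I +>\<^bsub>R\<^esub> derivation (act W x) p)\<rparr>)"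


section \<open>Enveloping algebras and induced modules\<close>

definition env_ideal :: "'g::lie_algebra free_algebra set" where
  "env_ideal = genideal (free_ring UNIV) (linear_rels (adjoint_module UNIV) \<union>
     {gen x * gen y - gen y * gen x - gen (bracket x y) | x y. True})"

definition env_class :: "'g::lie_algebra free_algebra \<Rightarrow> 'g free_algebra set" where
  "env_class p = env_ideal +>\<^bsub>free_ring UNIV\<^esub> p"

definition env_ring :: "'g::lie_algebra free_algebra set ring" where
  "env_ring = free_ring UNIV Quot env_ideal"

text \<open>The subalgebra of the enveloping algebra generated by a Lie subalgebra \<open>P\<close>. By the
  Poincare-Birkhoff-Witt theorem it is the enveloping algebra of \<open>P\<close>, and
  \<open>env_sub (i ` K)\<close> is the image of \<open>U(K)\<close> under the extension of a homomorphism \<open>i\<close>.\<close>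

definition env_sub :: "'g::lie_algebra set \<Rightarrow> 'g free_algebra set set" where
  "env_sub P = env_class ` carrier (free_ring P)"

definition env_module :: "'g::lie_algebra free_algebra set set \<Rightarrow> ('g, 'g free_algebra set) lie_module" where
  "env_module A = \<lparr>carrier = A, mult = mult env_ring, one = one env_ring, zero = zero env_ring,
     add = add env_ring, smult = (\<lambda>c a. env_class (const c) \<otimes>\<^bsub>env_ring\<^esub> a),
     act = (\<lambda>x a. env_class (gen x) \<otimes>\<^bsub>env_ring\<^esub> a)\<rparr>"

definition free_act :: "('g, 'v) lie_module \<Rightarrow> 'g free_algebra \<Rightarrow> 'v \<Rightarrow> 'v" where
  "free_act V p v =
     finsum V (\<lambda>w. Poly_Mapping.lookup p w \<odot>\<^bsub>V\<^esub> foldr (act V) (letters w) v) (Poly_Mapping.keys p)"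

text \<open>The action on a \<open>P\<close>-module of an element \<open>r\<close> of \<open>env_sub P\<close>: all representatives of \<open>r\<close>
  by expressions in elements of \<open>P\<close> act in the same way.\<close>

definition env_act ::
  "'g::lie_algebra set \<Rightarrow> ('g, 'v) lie_module \<Rightarrow> 'g free_algebra set \<Rightarrow> 'v \<Rightarrow> 'v" where
  "env_act P V r v = the_elem ((\<lambda>p. free_act V p v) ` (r \<inter> carrier (free_ring P)))"

text \<open>The tensor product of \<open>A\<close> and \<open>V\<close> over \<open>R\<close>, for subalgebras \<open>R\<close> of \<open>A\<close> and of \<open>env_sub P\<close>,
  and a \<open>P\<close>-module \<open>V\<close>; Lie algebra elements lying in \<open>A\<close> act by left multiplication on \<open>A\<close>.\<close>

definition env_tensor ::
  "'g::lie_algebra free_algebra set set \<Rightarrow> 'g free_algebra set set \<Rightarrow> 'g set \<Rightarrow> ('g, 'v) lie_module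
     \<Rightarrow> ('g, ('g free_algebra set \<times> 'v \<Rightarrow>\<^sub>0 complex) set) lie_module" where
  "env_tensor A R P V =
     (let F = free_module (A \<times> carrier V)
                (\<lambda>x. lin_ext (\<lambda>(a, v). Poly_Mapping.single (env_class (gen x) \<otimes>\<^bsub>env_ring\<^esub> a, v) 1))
      in quotient_module F (vspan F (bilinear_rels (env_module A) V \<union>
           {Poly_Mapping.single (a \<otimes>\<^bsub>env_ring\<^esub> r, v) 1 - Poly_Mapping.single (a, env_act P V r v) 1
             | a r v. a \<in> A \<and> r \<in> R \<and> v \<in> carrier V})))"

text \<open>An \<open>L\<close>-module as a module over \<open>P = L \<oplus> N\<close>, the nilradical \<open>N\<close> acting trivially.\<close>

definition inflate :: "'g::lie_algebra set \<Rightarrow> 'g set \<Rightarrow> ('g, 'v) lie_module \<Rightarrow> ('g, 'v) lie_module" where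
  "inflate P L V = V\<lparr>act := (\<lambda>x. act V (THE y. y \<in> L \<and> x - y \<in> parabolic_nilradical P))\<rparr>"

definition gen_verma_module ::
  "'g::lie_algebra set \<Rightarrow> 'g set \<Rightarrow> ('g, 'v) lie_module
     \<Rightarrow> ('g, ('g free_algebra set \<times> 'v \<Rightarrow>\<^sub>0 complex) set) lie_module" where
  "gen_verma_module P L V = env_tensor (env_sub UNIV) (env_sub P) P (inflate P L V)"

definition top_level_module ::
  "('k::lie_algebra \<Rightarrow> 'g::lie_algebra) \<Rightarrow> 'k set \<Rightarrow> 'g set \<Rightarrow> 'g set \<Rightarrow> ('g, 'v) lie_module
     \<Rightarrow> ('k, ('g free_algebra set \<times> 'v \<Rightarrow>\<^sub>0 complex) set) lie_module" where
  "top_level_module i Pbar P L V =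
     pullback i (env_tensor (env_sub (range i)) (env_sub (i ` Pbar)) P (inflate P L V))"


section \<open>The branching problem\<close>

text \<open>The dimension of
  \<open>Hom(V_mu(Lbar), V_lam(L) \<otimes> S(nminus / N))\<close>, an extended natural number; it is 0 if there is no
  irreducible finite-dimensional module of highest weight \<open>\<mu>\<close>.\<close>

definition branching_mult ::
  "('k::lie_algebra \<Rightarrow> 'g::lie_algebra) \<Rightarrow> 'k set \<Rightarrow> 'k set \<Rightarrow> 'k set \<Rightarrow> 'g set \<Rightarrow> 'g set \<Rightarrow> 'g set \<Rightarrow> 'g set
     \<Rightarrow> 'g set \<Rightarrow> ('k \<Rightarrow> complex) \<Rightarrow> ('g \<Rightarrow> complex) \<Rightarrow> enat" where
  "branching_mult i Hbar Bbar Lbar H Bo P L N \<mu> lam =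
     (if \<exists>V :: ('k, nat \<Rightarrow> complex) lie_module. irreducible_highest_weight Hbar Bbar Lbar \<mu> V
      then vdim (hom_module Lbar (irr_module Hbar Bbar Lbar \<mu>)
             (tensor_module (pullback i (irr_module H Bo L lam))
                (sym_module (quotient_module
                   (pullback i (adjoint_module (opposite_nilradical H P))) N))))
      else 0)"

text \<open>The highest weights \<open>\<mu>\<close> are counted with multiplicity: finitely many of them occur and the
  multiplicity of each is a natural number. Finiteness of the multiplicities is needed for the
  equivalence with the finite length of the generalized Verma module over the subalgebra and with
  equality of the dimensions of the two nilradicals: if the subalgebra is 0, then \<open>\<mu> = 0\<close> is the
  only possible weight, but its multiplicity is infinite unless \<open>P\<close> is everything.\<close>

definition finite_branching ::
  "('k::lie_algebra \<Rightarrow> 'g::lie_algebra) \<Rightarrow> 'k set \<Rightarrow> 'k set \<Rightarrow> 'k set \<Rightarrow> ('g \<Rightarrow> 'g \<Rightarrow> complex)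
     \<Rightarrow> 'g set \<Rightarrow> 'g set \<Rightarrow> 'g set \<Rightarrow> 'g set \<Rightarrow> 'g set \<Rightarrow> bool" where
  "finite_branching i Hbar Bbar Lbar B H Bo P L N \<longleftrightarrow>
     (\<forall>lam\<in>dual_space H. dominant_integral B H Bo L lam \<longrightarrow>
        finite {\<mu> \<in> dual_space Hbar. branching_mult i Hbar Bbar Lbar H Bo P L N \<mu> lam \<noteq> 0} \<and>
        (\<forall>\<mu>\<in>dual_space Hbar. branching_mult i Hbar Bbar Lbar H Bo P L N \<mu> lam \<noteq> \<infinity>))"

end

theory Submission
  imports Defs "HOL-Library.Function_Algebras" "HOL-Computational_Algebra.Fundamental_Theorem_Algebra"
begin

text \<open>Let \<open>k\<close> be the subalgebra. In \<open>V \<otimes> S(n\<^sub>- / N)\<close> every graded piece contains a simple submodule with a highest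
weight, while finitely many homomorphisms reach only finitely many pieces. So a finite branching problem forces
\<open>N = n\<^sub>-\<close>, and comparing dimensions with the triangular decompositions gives \<open>g = k + p\<close>. By the
Poincare-Birkhoff-Witt theorem for a basis adapted to \<open>k\<close> and \<open>p\<close>, both induced modules are then
\<open>V\<close> tensored with the span of the sorted words in a complement of \<open>k \<inter> p\<close> in \<open>k\<close>.\<close>

section \<open>Linear algebra\<close>

text \<open>The hypotheses speak of subalgebras only through maximality, self-normalization,
  nilpotency and reductivity. Root strings, one-dimensional root spaces and the splitting of the
  algebra into \<open>p\<close> and its opposite nilradical are therefore extracted from Lie's
  theorem and Cartan's criterion. Multiplicities are defined by one chosen model of each simple
  module, so a simple submodule of a graded piece yields a homomorphism only through the uniqueness
  of highest weight modules. For \<open>g = k + p\<close>, the opposite nilradical of the subalgebra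
  is projected to that of \<open>g\<close> along \<open>p\<close>; this is injective because
  \<open>pbar\<close> is the preimage of \<open>p\<close>, and equality of dimensions makes it onto.
  In the comparison of the induced modules, sorting words gives surjectivity. Injectivity is the
  obstacle, since the larger enveloping algebra could impose new relations on the smaller module. It
  follows from an invariant of words that respects all relations over \<open>g\<close> and reads off
  the coefficients of sorted words; that this invariant exists is the confluence of sorting.\<close>

abbreviation cdim where "cdim \<equiv> complex_vector.dim"
abbreviation (input) keys where "keys \<equiv> Poly_Mapping.keys"
abbreviation (input) lookup where "lookup \<equiv> Poly_Mapping.lookup"
notation scaleC (infixr "*c" 75)

abbreviation csub :: "'a::complex_vector set => bool" where "csub \<equiv> complex_vector.subspace"
abbreviation cspan :: "'a::complex_vector set => 'a set" where "cspan \<equiv> complex_vector.span"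
abbreviation cindep :: "'a::complex_vector set => bool" where "cindep S \<equiv> \<not> complex_vector.dependent S"
abbreviation coord :: "'a::complex_vector set => 'a => 'a => complex" where
	"coord \<equiv> complex_vector.representation"

lemmas cspan_base = complex_vector.span_base
lemmas cspan_superset = complex_vector.span_superset
lemmas cspan_add = complex_vector.span_add
lemmas cspan_scale = complex_vector.span_scale
lemmas cspan_mono = complex_vector.span_mono
lemmas cspan_0 = complex_vector.span_zero
lemmas cspan_sum = complex_vector.span_sum
lemmas cspan_Un = complex_vector.span_Un
lemmas cspan_neg = complex_vector.span_neg
lemmas cspan_diff = complex_vector.span_diff
lemmas csub_Int = complex_vector.subspace_inter
lemmas csub_def = complex_vector.subspace_def
lemmas scaleC_diff_right = complex_vector.scale_right_diff_distrib
lemmas scaleC_diff_left = complex_vector.scale_left_diff_distrib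
lemmas scaleC_sum = complex_vector.scale_sum_right
lemmas csub_add = complex_vector.subspace_add
lemmas csub_diff = complex_vector.subspace_diff
lemmas csub_scale = complex_vector.subspace_scale
lemmas csub_0 = complex_vector.subspace_0
lemmas csub_neg = complex_vector.subspace_neg
lemmas csub_sum = complex_vector.subspace_sum
lemmas csubI = complex_vector.subspaceI

lemma cspan_least: "S\<subseteq>W ==> csub W ==> cspan S\<subseteq>W"
	by (rule complex_vector.span_minimal)

lemma cspan_eq: "csub W ==> cspan W = W"
	using complex_vector.span_eq_iff by blast

text \<open>Module actions are controlled on carriers only, so linearity is relative to a set rather
  than to a whole type.\<close>

definition lin_on :: "'a::complex_vector set => ('a => 'b::complex_vector) => bool" where
	"lin_on W f \<longleftrightarrow> (\<forall>x\<in>W. \<forall>y\<in>W. f (x + y) = f x + f y) \<and> (\<forall>c. \<forall>x\<in>W. f (c *c x) = c *c f x)"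

lemma lin_on_add: "lin_on W f ==> x\<in>W ==> y\<in>W ==> f (x + y) = f x + f y"
	and lin_on_scale: "lin_on W f ==> x\<in>W ==> f (c *c x) = c *c f x"
	by (auto simp: lin_on_def)

lemma lin_on_0: "csub W ==> lin_on W f ==> f 0 = 0"
	using lin_on_scale[of W f 0 0] csub_0[of W] by simp

lemma csub_image: "csub W ==> lin_on W f ==> csub (f ` W)"
proof (rule csubI)
	assume "csub W" "lin_on W f"
	note * = csub_0[OF this(1)] csub_add[OF this(1)] csub_scale[OF this(1)] lin_on_0[OF this] lin_on_add[OF this(2)] lin_on_scale[OF this(2)]
	show "0\<in>f ` W" using * by force
	show "x + y\<in>f ` W" if "x\<in>f ` W" "y\<in>f ` W" for x y using that * by (auto simp: image_iff) metis
	show "c *c x\<in>f ` W" if "x\<in>f ` W" for c x using that * by (auto simp: image_iff) metis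
qed

lemma lin_on_diff: "csub W ==> lin_on W f ==> x\<in>W ==> y\<in>W ==> f (x - y) = f x - f y"
	using lin_on_add[of W f "x - y" y] csub_diff[of W x y] by (simp add: algebra_simps)

lemma lin_on_mono: "lin_on W f ==> W'\<subseteq>W ==> lin_on W' f"
	unfolding lin_on_def by blast

lemma lin_on_sum:
	assumes "csub W" "lin_on W f" "\<And>a. a\<in>A ==> g a\<in>W"
	shows "f (\<Sum>a\<in>A. g a) = (\<Sum>a\<in>A. f (g a))"
	using assms(3)
proof (induction A rule: infinite_finite_induct)
	case (insert x F)
	then have "g x\<in>W" "(\<Sum>a\<in>F. g a)\<in>W" by (auto intro: csub_sum assms(1))
	then show ?case using insert lin_on_add[OF assms(2)] by simp
qed (use lin_on_0[OF assms(1,2)] in auto)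

lemma lin_on_comb:
	assumes "csub W" "lin_on W f" "\<And>a. a\<in>A ==> g a\<in>W"
	shows "f (\<Sum>a\<in>A. c a *c g a) = (\<Sum>a\<in>A. c a *c f (g a))"
proof -
	have "f (\<Sum>a\<in>A. c a *c g a) = (\<Sum>a\<in>A. f (c a *c g a))"
		by (rule lin_on_sum[OF assms(1,2)]) (auto intro: csub_scale assms(1,3))
	also have "... = (\<Sum>a\<in>A. c a *c f (g a))"
		by (rule sum.cong[OF refl], rule lin_on_scale[OF assms(2,3)])
	finally show ?thesis .
qed

text \<open>The elements of \<open>W\<close> that \<open>f\<close> sends into \<open>U\<close> form
  a subspace. Most later membership claims are reduced to generators in this way.\<close>

lemma lin_on_span:
	assumes "lin_on W f" "csub W" "S\<subseteq>W" "\<And>s. s\<in>S ==> f s\<in>U" "csub U" "x\<in>cspan S"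
	shows "f x\<in>U"
proof -
	have "x\<in>{x\<in>W. f x\<in>U}"
		using assms(6)
	proof (rule rev_subsetD, intro cspan_least csubI)
		show "S\<subseteq>{x\<in>W. f x\<in>U}" using assms by auto
	qed (use assms lin_on_0[OF assms(2,1)] in \<open>auto simp: csub_0 csub_add csub_scale lin_on_add lin_on_scale\<close>)
	then show ?thesis by simp
qed

definition fin_dim :: "'a::complex_vector set => bool" where
	"fin_dim W \<longleftrightarrow> (\<exists>S. finite S \<and> W\<subseteq>cspan S)"

lemma fin_dim_mono: "fin_dim W ==> W'\<subseteq>W ==> fin_dim W'"
	by (auto simp: fin_dim_def)

lemma fin_dim_indep:
	assumes "fin_dim W" "B\<subseteq>W" "cindep B" shows "finite B"
proof -
	obtain S where "finite S" "W\<subseteq>cspan S" using assms(1) by (auto simp: fin_dim_def)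
	then show ?thesis using complex_vector.independent_span_bound[of S B] assms by auto
qed

lemma fin_dim_basis:
	assumes "fin_dim W" "csub W"
	obtains B where "finite B" "cindep B" "cspan B = W"
proof -
	obtain B where "B\<subseteq>W" "cindep B" "W\<subseteq>cspan B"
		using complex_vector.basis_exists[of W] by metis
	moreover from this have "cspan B = W" using cspan_least[of B W] assms(2) by auto
	ultimately show thesis using that[of B] fin_dim_indep[OF assms(1), of B] by simp
qed

lemma basis_extend:
	assumes "cindep B" "B\<subseteq>W" "csub W"
	obtains B' where "B\<subseteq>B'" "cindep B'" "cspan B' = W"
proof -
	obtain B' where "B\<subseteq>B'" "B'\<subseteq>W" "cindep B'" "W\<subseteq>cspan B'"
		using complex_vector.maximal_independent_subset_extend[OF assms(2,1)] by metis
	then show thesis using that[of B'] cspan_least[of B' W] assms(3) by auto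
qed

section \<open>Coordinates with respect to a basis, and traces\<close>

lemma coord_add: "cindep B ==> x\<in>cspan B ==> y\<in>cspan B ==> coord B (x + y) b = coord B x b + coord B y b"
	by (simp add: complex_vector.representation_add)

lemma coord_diff: "cindep B ==> x\<in>cspan B ==> y\<in>cspan B ==> coord B (x - y) b = coord B x b - coord B y b"
	by (simp add: complex_vector.representation_diff)

lemma coord_scale: "cindep B ==> x\<in>cspan B ==> coord B (c *c x) b = c * coord B x b"
	by (simp add: complex_vector.representation_scale)

lemma coord_sum: "cindep B ==> (\<And>i. i\<in>I ==> v i\<in>cspan B) ==> coord B (\<Sum>i\<in>I. v i) b = (\<Sum>i\<in>I. coord B (v i) b)"
	by (simp add: complex_vector.representation_sum)

lemma coord_lincomb:
	"cindep B ==> (\<And>i. i\<in>I ==> v i\<in>cspan B) ==>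
	 coord B (\<Sum>i\<in>I. c i *c v i) b = (\<Sum>i\<in>I. c i * coord B (v i) b)"
	by (simp add: coord_sum cspan_scale coord_scale cong: sum.cong)

lemma coord_basis: "cindep B ==> b\<in>B ==> coord B b b' = (if b' = b then 1 else 0)"
	by (simp add: complex_vector.representation_basis)

lemma coord_expand: "cindep B ==> finite B ==> x\<in>cspan B ==> (\<Sum>b\<in>B. coord B x b *c b) = x"
	by (simp add: complex_vector.sum_representation_eq)

lemma coord_lincomb_basis:
	assumes "cindep B" "finite B"
	shows "b\<in>B ==> coord B (\<Sum>b\<in>B. c b *c b) b = c b"
	using assms by (subst coord_lincomb) (auto simp: coord_basis cspan_base if_distrib cong: if_cong)

lemma coord_span_subset:
	assumes "cindep B" "A\<subseteq>B" "x\<in>cspan A" "b \<notin> A"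
	shows "coord B x b = 0"
proof -
	have "coord B x = coord A x"
		by (rule complex_vector.representation_extend) (use assms in auto)
	then show ?thesis using assms(4) complex_vector.representation_ne_zero by metis
qed

lemma coord_zero_in_span:
	assumes "cindep B" "finite B" "A\<subseteq>B" "x\<in>cspan B" "\<And>b. b\<in>B - A ==> coord B x b = 0"
	shows "x\<in>cspan A"
proof -
	have "x = (\<Sum>b\<in>B. coord B x b *c b)" using coord_expand[OF assms(1,2,4)] by simp
	also have "... = (\<Sum>b\<in>A. coord B x b *c b)"
		by (rule sum.mono_neutral_right) (use assms in auto)
	also have "...\<in>cspan A"
		by (intro cspan_sum cspan_scale cspan_base)
	finally show ?thesis .
qed

text \<open>For \<open>A = B\<close> this is the trace of a commutator on \<open>cspan B\<close>; in general it is the trace on the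
	quotient by \<open>cspan (B - A)\<close>.\<close>

lemma trace_comm:
	assumes B: "finite B" "cindep B" "A\<subseteq>B"
		and Y: "lin_on (cspan B) Y" "\<And>b. b\<in>B ==> Y b\<in>cspan B" "\<And>b. b\<in>B - A ==> Y b\<in>cspan (B - A)"
		and Z: "lin_on (cspan B) Z" "\<And>b. b\<in>B ==> Z b\<in>cspan B" "\<And>b. b\<in>B - A ==> Z b\<in>cspan (B - A)"
	shows "(\<Sum>b\<in>A. coord B (Y (Z b)) b) = (\<Sum>b\<in>A. coord B (Z (Y b)) b)"
proof -
	\<comment> \<open>This is the product of matrices with the summation cut down from \<open>B\<close>
	  to \<open>A\<close>: \<open>P\<close> maps the remaining basis vectors into the span of
	  \<open>B - A\<close>, where the coordinate at \<open>b\<close> vanishes.\<close>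
	have *: "coord B (P (Q b)) b = (\<Sum>b'\<in>A. coord B (Q b) b' * coord B (P b') b)"
		if P: "lin_on (cspan B) P" "\<And>b. b\<in>B ==> P b\<in>cspan B" "\<And>b. b\<in>B - A ==> P b\<in>cspan (B - A)"
		and Q: "Q b\<in>cspan B" and b: "b\<in>A" for P Q b
	proof -
		have "coord B (P (Q b)) b = coord B (P (\<Sum>b'\<in>B. coord B (Q b) b' *c b')) b"
			using coord_expand[OF B(2,1) Q] by simp
		also have "... = coord B (\<Sum>b'\<in>B. coord B (Q b) b' *c P b') b"
			by (subst lin_on_comb[OF _ P(1)]) (auto simp: cspan_base)
		also have "... = (\<Sum>b'\<in>B. coord B (Q b) b' * coord B (P b') b)"
			by (rule coord_lincomb) (use B P in auto)
		also have "... = (\<Sum>b'\<in>A. coord B (Q b) b' * coord B (P b') b)"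
			by (rule sum.mono_neutral_right) (use B P b coord_span_subset[OF B(2), of "B - A"] in auto)
		finally show ?thesis .
	qed
	have "(\<Sum>b\<in>A. coord B (Y (Z b)) b) = (\<Sum>b\<in>A. \<Sum>b'\<in>A. coord B (Z b) b' * coord B (Y b') b)"
		by (rule sum.cong[OF refl], rule *[OF Y]) (use Z B in auto)
	also have "... = (\<Sum>b\<in>A. \<Sum>b'\<in>A. coord B (Y b) b' * coord B (Z b') b)"
		by (subst sum.swap) (simp add: mult.commute)
	also have "... = (\<Sum>b\<in>A. coord B (Z (Y b)) b)"
		by (rule sum.cong[OF refl], rule *[OF Z, symmetric]) (use Y B in auto)
	finally show ?thesis .
qed

text \<open>\<open>n\<close> is the least index for which \<open>(T ^^ n) w\<close> depends on
  \<open>U\<close> and the earlier iterates. Minimality keeps these iterates independent modulo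
  \<open>U\<close>, finite dimension makes \<open>n\<close> exist, and \<open>w \<notin> U\<close>
  makes it positive.\<close>

lemma krylov:
	fixes w :: "'w::complex_vector"
	assumes W: "fin_dim W" "csub U" "U\<subseteq>W" "w\<in>W" "w \<notin> U" "\<And>x. x\<in>W ==> T x\<in>W"
	obtains n BU where "n > 0" "finite BU" "cspan BU = U" "cindep (BU\<union>(\<lambda>i. (T ^^ i) w) ` {..<n})"
		"inj_on (\<lambda>i. (T ^^ i) w) {..<n}" "BU\<inter>(\<lambda>i. (T ^^ i) w) ` {..<n} = {}"
		"(T ^^ n) w\<in>cspan (BU\<union>(\<lambda>i. (T ^^ i) w) ` {..<n})"
proof -
	define e where "e i = (T ^^ i) w" for i
	have eW: "e i\<in>W" for i unfolding e_def by (induction i) (use W in auto)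
	obtain BU where BU: "finite BU" "cindep BU" "cspan BU = U"
		using fin_dim_basis[OF fin_dim_mono[OF W(1,3)] W(2)] .
	define P where "P n \<longleftrightarrow> e n\<in>cspan (BU\<union>e ` {..<n})" for n
	have step: "cindep (BU\<union>e ` {..<m}) \<and> inj_on e {..<m} \<and> BU\<inter>e ` {..<m} = {}" if "\<forall>k<m. \<not> P k" for m
		using that
	proof (induction m)
		case (Suc m)
		then have IH: "cindep (BU\<union>e ` {..<m})" "inj_on e {..<m}" "BU\<inter>e ` {..<m} = {}" and
			np: "e m \<notin> cspan (BU\<union>e ` {..<m})" by (auto simp: P_def)
		have eq: "BU\<union>e ` {..<Suc m} = insert (e m) (BU\<union>e ` {..<m})" by (auto simp: lessThan_Suc)
		have nm: "e m \<notin> BU\<union>e ` {..<m}" by (rule contrapos_nn[OF np]) (rule cspan_base)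
		have "cindep (BU\<union>e ` {..<Suc m})"
			unfolding eq by (rule complex_vector.independent_insertI[OF np IH(1)])
		moreover have "inj_on e {..<Suc m}" using IH(2) nm by (simp add: lessThan_Suc)
		moreover have "BU\<inter>e ` {..<Suc m} = {}" using IH(3) nm by (simp add: lessThan_Suc)
		ultimately show ?case by simp
	qed (use BU in auto)
	have "\<exists>n. P n"
	proof (rule ccontr)
		assume "\<nexists>n. P n"
		then have s: "cindep (BU\<union>e ` {..<m})" "inj_on e {..<m}" for m using step by auto
		have sub: "BU\<union>e ` {..<m}\<subseteq>W" for m using eW BU W cspan_superset[of BU] by auto
		obtain S where S: "finite S" "W\<subseteq>cspan S" using W(1) by (auto simp: fin_dim_def)
		have "card (e ` {..<m}) \<le> card S" for m
			using complex_vector.independent_span_bound[OF S(1), of "e ` {..<m}"] s(1)[of m] sub[of m] S(2)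
				complex_vector.independent_mono[OF s(1)[of m], of "e ` {..<m}"] by auto
		from this[of "Suc (card S)"] s(2) show False by (simp add: card_image)
	qed
	then obtain n where n: "P n" "\<forall>k<n. \<not> P k" using exists_least_iff[of P] by auto
	have "n > 0" using n(1) W(5) BU by (cases n) (auto simp: P_def e_def)
	then show thesis using that[of n BU] step[OF n(2)] n(1) BU unfolding P_def e_def by auto
qed

text \<open>The first linear dependence among the iterates of \<open>w\<close> modulo
  \<open>U\<close> is a monic polynomial \<open>q\<close> with \<open>q(T) w\<close> in
  \<open>U\<close>. If \<open>c\<close> is a root and \<open>q = (X - c) q1\<close>, then
  \<open>q1(T) w\<close> is an eigenvector modulo \<open>U\<close>. Stating everything modulo
  \<open>U\<close> takes the place of forming the quotient space.\<close>

lemma relative_eigenvector: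
	fixes T :: "'w::complex_vector => 'w"
	assumes "fin_dim W" "csub W" "csub U" "U \<subset> W" "lin_on W T"
		"\<And>x. x\<in>W ==> T x\<in>W"
	obtains w c where "w\<in>W" "w \<notin> U" "T w - c *c w\<in>U"
proof -
	obtain w where w: "w\<in>W" "w \<notin> U" using assms(4) by blast
	obtain n BU where n: "n > 0" and BU: "finite BU" "cspan BU = U"
		and ind: "cindep (BU\<union>(\<lambda>i. (T ^^ i) w) ` {..<n})" (is "cindep ?B")
		and inj: "inj_on (\<lambda>i. (T ^^ i) w) {..<n}" and dis: "BU\<inter>(\<lambda>i. (T ^^ i) w) ` {..<n} = {}"
		and en: "(T ^^ n) w\<in>cspan (BU\<union>(\<lambda>i. (T ^^ i) w) ` {..<n})"
		by (rule krylov[OF assms(1,3) psubset_imp_subset[OF assms(4)] w assms(6)])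
	define e where "e i = (T ^^ i) w" for i
	note ind = ind[folded e_def] and inj = inj[folded e_def] and dis = dis[folded e_def] and en = en[folded e_def]
	have eW: "e i\<in>W" for i unfolding e_def by (induction i) (use w assms in auto)
	have finB: "finite (BU\<union>e ` {..<n})" using BU by auto
	define a where "a i = coord (BU\<union>e ` {..<n}) (e n) (e i)" for i
	have "e n = (\<Sum>b\<in>BU\<union>e ` {..<n}. coord (BU\<union>e ` {..<n}) (e n) b *c b)"
		using coord_expand[OF ind finB en] by simp
	also have "... = (\<Sum>b\<in>BU. coord (BU\<union>e ` {..<n}) (e n) b *c b) + (\<Sum>b\<in>e ` {..<n}. coord (BU\<union>e ` {..<n}) (e n) b *c b)"
		by (rule sum.union_disjoint) (use BU dis in auto)
	also have "(\<Sum>b\<in>e ` {..<n}. coord (BU\<union>e ` {..<n}) (e n) b *c b) = (\<Sum>i<n. a i *c e i)"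
		by (subst sum.reindex[OF inj]) (simp add: a_def)
	finally obtain u where u: "e n = u + (\<Sum>i<n. a i *c e i)" "u\<in>U"
		using that[of "\<Sum>b\<in>BU. coord (BU\<union>e ` {..<n}) (e n) b *c b"] BU(2)
		by (auto intro: cspan_sum cspan_scale cspan_base)
	define q :: "complex poly" where "q = monom 1 n - (\<Sum>i<n. monom (a i) i)"
	have cq: "coeff q i = (if i = n then 1 else if i < n then - a i else 0)" for i
		by (auto simp: q_def coeff_sum)
	have "degree q = n"
		using cq by (intro antisym degree_le le_degree) auto
	then obtain c where c: "poly q c = 0"
		using fundamental_theorem_of_algebra[of q] n by (auto simp: constant_degree)
	then obtain q1 where q1: "q = [:-c, 1:] * q1" by (auto simp: poly_eq_0_iff_dvd)
	have "q1\<noteq>0" using cq[of n] q1 by auto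
	then have dq1: "degree q1 = n - 1"
		using \<open>degree q = n\<close> degree_mult_eq[of "[:-c,1:]" q1] q1 by auto
	have rel: "coeff q i = (case i of 0 => 0 | Suc j => coeff q1 j) - c * coeff q1 i" for i
		unfolding q1 by (simp add: coeff_pCons split: nat.split)
	have q1n: "coeff q1 n = 0" using dq1 n by (simp add: coeff_eq_0)
	define w' where "w' = (\<Sum>i<n. coeff q1 i *c e i)"
	have "w'\<in>W" unfolding w'_def using eW assms(2) by (auto intro!: csub_sum csub_scale)
	have "T w' = (\<Sum>i<n. coeff q1 i *c e (Suc i))"
		unfolding w'_def by (subst lin_on_comb[OF assms(2,5)]) (use eW in \<open>auto simp: e_def\<close>)
	also have "... = (\<Sum>i<Suc n. (case i of 0 => 0 | Suc j => coeff q1 j) *c e i)"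
		by (subst sum.lessThan_Suc_shift) simp
	finally have "T w' - c *c w' = (\<Sum>i<Suc n. (case i of 0 => 0 | Suc j => coeff q1 j) *c e i) - (\<Sum>i<Suc n. (c * coeff q1 i) *c e i)"
		by (simp add: w'_def q1n scaleC_sum)
	also have "... = (\<Sum>i<Suc n. coeff q i *c e i)"
		by (simp only: rel scaleC_diff_left sum_subtractf)
	also have "... = e n - (\<Sum>i<n. a i *c e i)"
		by (simp add: cq sum_negf)
	also have "... = u" using u(1) by simp
	finally have "T w' - c *c w'\<in>U" using u by simp
	\<comment> \<open>The coordinate of \<open>w'\<close> at the last iterate \<open>e (n - 1)\<close>
	  is the leading coefficient of \<open>q1\<close>, which is 1 because \<open>q\<close> is
	  monic.\<close>
	moreover have "w' \<notin> U"
	proof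
		assume "w'\<in>U"
		have "e (n - 1) \<notin> BU" using dis n by auto
		with \<open>w'\<in>U\<close> have "coord (BU\<union>e ` {..<n}) w' (e (n - 1)) = 0"
			using coord_span_subset[OF ind, of BU w' "e (n - 1)"] BU dis n by auto
		moreover have "coord (BU\<union>e ` {..<n}) w' (e (n - 1)) = (\<Sum>i<n. coeff q1 i * coord (BU\<union>e ` {..<n}) (e i) (e (n - 1)))"
			unfolding w'_def by (rule coord_lincomb[OF ind]) (auto intro: cspan_base)
		also have "... = (\<Sum>i<n. coeff q1 i * (if n - 1 = i then 1 else 0))"
			using inj n by (intro sum.cong refl) (auto simp: coord_basis[OF ind] inj_on_def)
		also have "... = coeff q1 (n - 1)" using n by (simp add: if_distrib cong: if_cong)
		also have "... = 1" using rel[of n] cq[of n] n q1n by (cases n) auto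
		ultimately show False by simp
	qed
	ultimately show thesis using that \<open>w'\<in>W\<close> by blast
qed

text \<open>One vector outside \<open>D\<close> is removed from a basis of \<open>L\<close> that
  extends a basis of \<open>D\<close>. With \<open>D\<close> the derived algebra, \<open>K\<close>
  becomes an ideal of codimension one, the induction step of Lie's theorem.\<close>

lemma codim_one_subspace:
	assumes "csub D" "csub L" "D \<subset> L"
	obtains K z where "csub K" "D\<subseteq>K" "K\<subseteq>L" "z\<in>L" "z \<notin> K" "\<And>x. x\<in>L ==> \<exists>c. x - c *c z\<in>K"
proof -
	obtain B0 where B0: "B0\<subseteq>D" "cindep B0" "D\<subseteq>cspan B0"
		using complex_vector.basis_exists[of D] by metis
	obtain B where B: "B0\<subseteq>B" "cindep B" "cspan B = L"
		using basis_extend[OF B0(2) _ assms(2)] B0(1) assms(3) by blast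
	have "B0\<noteq>B" using B0 B assms cspan_least[of B0 D] by auto
	then obtain z where z: "z\<in>B" "z \<notin> B0" using B by blast
	define K where "K = cspan (B - {z})"
	have "D\<subseteq>K" using B0(3) cspan_mono[of B0 "B - {z}"] z B(1) unfolding K_def by blast
	moreover have "z \<notin> K" using B(2) z(1) unfolding K_def complex_vector.dependent_def by blast
	moreover have "K\<subseteq>L" unfolding K_def using B(3) cspan_mono[of "B - {z}" B] by blast
	moreover have "\<exists>c. x - c *c z\<in>K" if "x\<in>L" for x
		using complex_vector.span_breakdown[OF z(1), of x] that B(3) unfolding K_def by blast
	moreover have "z\<in>L" using B(3) z(1) cspan_base by blast
	ultimately show thesis using that[of K z] unfolding K_def by auto
qed

text \<open>With this instance and the next two, \<open>lin_on\<close> also covers functionals, maps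
  into function spaces and maps between free vector spaces.\<close>

instantiation complex :: complex_vector
begin
definition scaleC_complex_def [simp]: "c *c (x::complex) = c * x"
instance by standard (auto simp: algebra_simps)
end

instantiation "fun" :: (type, complex_vector) complex_vector
begin
definition scaleC_fun_def: "c *c f = (\<lambda>x. c *c f x)"
instance
	by standard (auto simp: scaleC_fun_def fun_eq_iff scaleC_add_right scaleC_add_left scaleC_scaleC scaleC_one)
end

lemma scaleC_fun_apply [simp]: "(c *c f) x = c *c f x"
	by (simp add: scaleC_fun_def)

instantiation poly_mapping :: (type, complex_vector) complex_vector
begin
definition scaleC_poly_mapping_def: "c *c p = Poly_Mapping.map (scaleC c) p"
lemma lookup_scaleC_aux: "lookup (c *c p) x = c *c lookup (p :: 'a \<Rightarrow>\<^sub>0 'b) x"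
	by (simp add: scaleC_poly_mapping_def map.rep_eq when_def)
instance
	by standard (auto intro!: poly_mapping_eqI simp: lookup_scaleC_aux lookup_add scaleC_add_right scaleC_add_left scaleC_scaleC scaleC_one)
end

lemma lookup_scaleC [simp]: "lookup (c *c p) x = c *c lookup p x"
	by (rule lookup_scaleC_aux)

lemma pm_scale_eq [simp]: "pm_scale c p = c *c p"
	by (rule poly_mapping_eqI) (simp add: pm_scale_def map.rep_eq when_def)

section \<open>Solvable Lie algebras: the theorems of Lie and Cartan\<close>

lemma bracket_0_left [simp]: "bracket 0 x = (0::'a::lie_algebra)"
	using bracket_scaleC_left[of 0 0 x] by simp
lemma bracket_0_right [simp]: "bracket x 0 = (0::'a::lie_algebra)"
	using bracket_scaleC_right[of x 0 0] by simp

lemma bracket_anti: "bracket x y = - bracket y (x::'a::lie_algebra)"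
proof -
	have "bracket (x + y) (x + y) = bracket x y + bracket y x"
		unfolding bracket_add_left[of x y] bracket_add_right by (simp add: bracket_self)
	from trans[OF this[symmetric] bracket_self] show ?thesis by (simp only: eq_neg_iff_add_eq_0)
qed

lemma bracket_minus_left: "bracket (- x) y = - bracket x (y::'a::lie_algebra)"
	using bracket_scaleC_left[of "-1" x y] by simp
lemma bracket_minus_right: "bracket x (- y) = - bracket x (y::'a::lie_algebra)"
	using bracket_scaleC_right[of x "-1" y] by simp
lemma bracket_diff_left: "bracket (x - x') y = bracket x y - bracket x' (y::'a::lie_algebra)"
	using bracket_add_left[of x "- x'" y] by (simp add: bracket_minus_left)
lemma bracket_diff_right: "bracket x (y - y') = bracket x y - bracket x (y'::'a::lie_algebra)"
	using bracket_add_right[of x y "- y'"] by (simp add: bracket_minus_right)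

lemma bracket_derivation: "bracket x (bracket y z) = bracket (bracket x y) z + bracket y (bracket x (z::'a::lie_algebra))"
proof -
	have "bracket (bracket x y) z = - bracket z (bracket x y)" by (rule bracket_anti)
	moreover have "bracket y (bracket z x) = - bracket y (bracket x z)"
		by (subst bracket_anti[of z x]) (simp add: bracket_minus_right)
	ultimately have "bracket x (bracket y z) - bracket y (bracket x z) - bracket (bracket x y) z = 0"
		using jacobi[of x y z] by simp
	then show ?thesis by (simp add: algebra_simps)
qed

lemma bracket_bracket_left: "bracket (bracket x y) z = bracket x (bracket y z) - bracket y (bracket x (z::'a::lie_algebra))"
	using bracket_derivation[of x y z] by simp

lemma lin_on_bracket [simp]: "lin_on W (bracket (x::'a::lie_algebra))"
	by (simp add: lin_on_def bracket_add_right bracket_scaleC_right)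
lemma lin_on_bracket' [simp]: "lin_on W (\<lambda>x. bracket x (y::'a::lie_algebra))"
	by (simp add: lin_on_def bracket_add_left bracket_scaleC_left)
lemma lin_on_bracket2 [simp]: "lin_on W (\<lambda>z. bracket x (bracket (y::'a::lie_algebra) z))"
	by (simp add: lin_on_def bracket_add_right bracket_scaleC_right)

lemma fin_dim_lie [simp]: "fin_dim (W :: 'a::fin_dim_lie_algebra set)"
proof -
	obtain S :: "'a set" where S: "finite S" "\<And>x. \<exists>c. x = (\<Sum>s\<in>S. c s *c s)"
		using ex_finite_spanning[where 'a='a] by metis
	have "x\<in>cspan S" for x
	proof -
		obtain c where "x = (\<Sum>s\<in>S. c s *c s)" using S(2)[of x] ..
		then show ?thesis by (simp add: cspan_sum cspan_scale cspan_base)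
	qed
	then show ?thesis using S(1) by (auto simp: fin_dim_def)
qed

lemma dim_less:
	fixes K L :: "'a::complex_vector set"
	assumes "fin_dim L" "csub K" "csub L" "K \<subset> L"
	shows "cdim K < cdim L"
proof -
	obtain B0 where B0: "finite B0" "cindep B0" "cspan B0 = K"
		using fin_dim_basis[OF fin_dim_mono[OF assms(1) psubset_imp_subset[OF assms(4)]] assms(2)] .
	have "B0\<subseteq>L" using B0(3) assms(4) cspan_superset[of B0] by auto
	then obtain B where B: "B0\<subseteq>B" "cindep B" "cspan B = L"
		using basis_extend[OF B0(2) _ assms(3)] by metis
	have "B\<subseteq>L" using B(3) cspan_superset[of B] by auto
	then have "finite B" using fin_dim_indep[OF assms(1) _ B(2)] by auto
	have "B0\<noteq>B" using B0(3) B(3) assms(4) by auto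
	then have "card B0 < card B" using B(1) \<open>finite B\<close> by (simp add: psubset_card_mono)
	moreover have "cdim (cspan B0) = card B0" by (rule complex_vector.dim_span_eq_card_independent[OF B0(2)])
	moreover have "cdim (cspan B) = card B" by (rule complex_vector.dim_span_eq_card_independent[OF B(2)])
	ultimately show ?thesis using B0(3) B(3) by simp
qed

lemma bracket_set_subspace [simp]: "csub (bracket_set A B)"
	by (simp add: bracket_set_def)

lemma bracket_in_set: "a\<in>A ==> b\<in>B ==> bracket a b\<in>bracket_set A B"
	unfolding bracket_set_def by (rule cspan_base) blast

lemma bracket_set_least: "csub W ==> (\<And>a b. a\<in>A ==> b\<in>B ==> bracket a b\<in>W) ==> bracket_set A B\<subseteq>W"
	unfolding bracket_set_def by (rule cspan_least) auto

lemma bracket_set_mono: "A\<subseteq>A' ==> B\<subseteq>B' ==> bracket_set A B\<subseteq>bracket_set A' B'"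
	unfolding bracket_set_def by (rule cspan_mono) blast

definition derived :: "nat => 'g::lie_algebra set => 'g set" where
	"derived n = ((\<lambda>A. bracket_set A A) ^^ n)"

lemma derived_0 [simp]: "derived 0 P = P" by (simp add: derived_def)
lemma derived_Suc: "derived (Suc n) P = bracket_set (derived n P) (derived n P)" by (simp add: derived_def)
lemma derived_Suc': "derived (Suc n) P = derived n (bracket_set P P)" by (simp add: derived_def funpow_Suc_right del: funpow.simps)

lemma derived_mono: "P\<subseteq>Q ==> derived n P\<subseteq>derived n Q"
	by (induction n) (auto simp: derived_Suc intro: subsetD[OF bracket_set_mono])

lemma derived_0_in: "csub P ==> 0\<in>derived n P"
	by (cases n) (auto simp: derived_Suc csub_0)

lemma lie_solvable_iff: "lie_solvable P \<longleftrightarrow> (\<exists>n. derived n P = {0})"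
	by (simp add: lie_solvable_def derived_def)

lemma lie_solvable_mono: "lie_solvable Q ==> P\<subseteq>Q ==> csub P ==> lie_solvable P"
	unfolding lie_solvable_iff using derived_mono derived_0_in by (metis empty_iff insert_iff subset_singleton_iff)

lemma lie_solvable_derived:
	assumes "lie_solvable Q" "bracket_set P P\<subseteq>Q"
	shows "lie_solvable P"
proof -
	have "lie_solvable (bracket_set P P)" using lie_solvable_mono[OF assms] by simp
	then show ?thesis unfolding lie_solvable_iff derived_Suc'[symmetric] by blast
qed

lemma subalg_csub: "subalgebra L ==> csub L" by (simp add: subalgebra_def)
lemma subalg_bracket: "subalgebra L ==> x\<in>L ==> y\<in>L ==> bracket x y\<in>L" by (simp add: subalgebra_def)

lemma solvable_derived_neq:
	assumes "lie_solvable L" "L\<noteq>{0}" "csub L" shows "bracket_set L L\<noteq>L"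
proof
	assume eq: "bracket_set L L = L"
	have "derived n L = L" for n by (induction n) (auto simp: derived_Suc eq)
	then show False using assms unfolding lie_solvable_iff by auto
qed

text \<open>The counterpart of \<open>is_lie_module\<close> whose carrier is a subspace of a type of
  vectors, so that spans, bases and dimensions are available. Module records are moved into this
  form by linear models.\<close>

locale lie_rep =
	fixes L :: "'x::lie_algebra set" and W :: "'w::complex_vector set" and a :: "'x => 'w => 'w"
	assumes L: "subalgebra L" and W: "csub W"
		and closed: "x\<in>L ==> w\<in>W ==> a x w\<in>W"
		and lin: "x\<in>L ==> lin_on W (a x)"
		and lin_left: "w\<in>W ==> lin_on L (\<lambda>x. a x w)"
		and comm: "x\<in>L ==> y\<in>L ==> w\<in>W ==> a (bracket x y) w = a x (a y w) - a y (a x w)"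

lemma lie_rep_subalgebra: "lie_rep L W a ==> subalgebra K ==> K\<subseteq>L ==> lie_rep K W a"
	unfolding lie_rep_def by (simp add: subset_iff) (meson lin_on_mono subsetI)

lemma lie_rep_ad:
	assumes "subalgebra L" "csub W" "\<And>x w. x\<in>L ==> w\<in>W ==> bracket x w\<in>W"
	shows "lie_rep L W bracket"
	using assms by unfold_locales (auto simp: bracket_bracket_left)

text \<open>The key step of Lie's theorem: the weight of an ideal vanishes on commutators. The trace of a
	commutator is computed on the quotient of the span of \<open>U\<close> and the vectors \<open>z\<^sup>i w\<close> by \<open>U\<close>.\<close>

lemma weight_commutator_0:
	assumes "lie_rep L W a" "fin_dim W" "csub U" "U\<subseteq>W" "\<And>x u. x\<in>L ==> u\<in>U ==> a x u\<in>U"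
		and K: "csub K" "K\<subseteq>L" "z\<in>L" "\<And>y. y\<in>K ==> bracket y z\<in>K"
		and w: "w\<in>W" "w \<notin> U" "\<And>y. y\<in>K ==> a y w - \<chi> y *c w\<in>U" and y: "y\<in>K"
	shows "\<chi> (bracket y z) = 0"
proof -
	interpret lie_rep L W a by fact
	obtain n BU where n: "n > 0" and BU: "finite BU" "cspan BU = U"
		and ind: "cindep (BU\<union>(\<lambda>i. (a z ^^ i) w) ` {..<n})"
		and inj: "inj_on (\<lambda>i. (a z ^^ i) w) {..<n}" and dis: "BU\<inter>(\<lambda>i. (a z ^^ i) w) ` {..<n} = {}"
		and en: "(a z ^^ n) w\<in>cspan (BU\<union>(\<lambda>i. (a z ^^ i) w) ` {..<n})"
		by (rule krylov[OF assms(2,3,4) w(1,2) closed[OF K(3)]])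
	define e where "e i = (a z ^^ i) w" for i
	note ind = ind[folded e_def] and inj = inj[folded e_def] and dis = dis[folded e_def] and en = en[folded e_def]
	have eW: "e i\<in>W" for i unfolding e_def by (induction i) (use w closed K in auto)
	have BUW: "BU\<subseteq>W" using BU(2) cspan_superset[of BU] assms(4) by auto
	define S where "S m = cspan (BU\<union>e ` {..<m})" for m
	have S_sub: "csub (S m)" for m by (simp add: S_def)
	have S_mono: "S m\<subseteq>S m'" if "m \<le> m'" for m m'
		unfolding S_def by (rule cspan_mono) (use that in auto)
	have U_S: "U\<subseteq>S m" for m unfolding S_def BU(2)[symmetric] by (rule cspan_mono) auto
	have e_S: "e i\<in>S m" if "i < m" for i m
		unfolding S_def by (rule cspan_base) (use that in auto)
	have S_W: "S m\<subseteq>W" for m unfolding S_def by (rule cspan_least) (use BUW eW W in auto)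
	have z_S: "a z s\<in>S (Suc m)" if "s\<in>S m" for s m
	proof (rule lin_on_span[OF lin[OF K(3)] W, of "BU\<union>e ` {..<m}"])
		show "BU\<union>e ` {..<m}\<subseteq>W" using BUW eW by auto
		fix t assume "t\<in>BU\<union>e ` {..<m}"
		then show "a z t\<in>S (Suc m)"
		proof
			assume "t\<in>BU"
			then have "t\<in>U" using BU(2) cspan_base[of t BU] by simp
			then show ?thesis using assms(5)[OF K(3)] U_S by auto
		next
			assume "t\<in>e ` {..<m}"
			then obtain i where "i < m" "t = e i" by auto
			then have "a z t = e (Suc i)" by (simp add: e_def)
			then show ?thesis using e_S[of "Suc i" "Suc m"] \<open>i < m\<close> by simp
		qed
	qed (use S_sub that in \<open>auto simp: S_def\<close>)
	\<comment> \<open>Modulo \<open>U\<close>, the elements of \<open>K\<close> are upper triangular in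
	  the iterates of \<open>w\<close> under \<open>z\<close>, with the constant
	  \<open>\<chi> x\<close> on the diagonal. Moving \<open>x\<close> past \<open>z\<close> costs
	  \<open>bracket x z\<close>, which stays in \<open>K\<close>.\<close>
	have tri: "a x (e i) - \<chi> x *c e i\<in>S i" if "x\<in>K" for x i
		using that
	proof (induction i arbitrary: x)
		case 0
		have "e 0 = w" by (simp add: e_def)
		then show ?case using w(3)[OF 0] U_S by auto
	next
		case (Suc i)
		have xL: "x\<in>L" "bracket x z\<in>K" using Suc K by auto
		have Suc_e: "e (Suc i) = a z (e i)" by (simp add: e_def)
		define s where "s = a x (e i) - \<chi> x *c e i"
		have s: "s\<in>S i" "s\<in>W" using Suc.IH[OF Suc.prems] S_W unfolding s_def by auto
		have "a x (e i) = \<chi> x *c e i + s" by (simp add: s_def)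
		then have "a z (a x (e i)) = \<chi> x *c a z (e i) + a z s"
			using s eW lin[OF K(3)] W by (simp add: lin_on_add lin_on_scale csub_scale)
		then have *: "a x (e (Suc i)) - \<chi> x *c e (Suc i) = a z s + a (bracket x z) (e i)"
			using comm[OF xL(1) K(3) eW[of i]] by (simp add: Suc_e)
		have "a (bracket x z) (e i) = (a (bracket x z) (e i) - \<chi> (bracket x z) *c e i) + \<chi> (bracket x z) *c e i" by simp
		also have "...\<in>S (Suc i)"
			using Suc.IH[OF xL(2)] S_mono[of i "Suc i"] e_S[of i "Suc i"] S_sub
			by (intro csub_add csub_scale) auto
		finally show ?case unfolding * using z_S[OF s(1)] S_sub by (intro csub_add)
	qed
	let ?B = "BU\<union>e ` {..<n}"
	have finB: "finite ?B" using BU by simp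
	have BmA: "?B - e ` {..<n} = BU" using dis by auto
	have Sn: "cspan ?B = S n" by (simp add: S_def)
	have stab: "a x b\<in>S n" if "x\<in>K" "b\<in>?B" for x b
		using that(2)
	proof
		assume "b\<in>BU"
		then have "b\<in>U" using BU(2) cspan_base[of b BU] by simp
		then show ?thesis using assms(5)[of x b] U_S K that by auto
	next
		assume "b\<in>e ` {..<n}"
		then obtain i where i: "i < n" "b = e i" by auto
		have "a x (e i) = (a x (e i) - \<chi> x *c e i) + \<chi> x *c e i" by simp
		also have "...\<in>S n"
			using tri[OF that(1), of i] S_mono[of i n] e_S[of i n] i(1) S_sub by (intro csub_add csub_scale) auto
		finally show ?thesis using i by simp
	qed
	have U_stab: "a x b\<in>U" if "x\<in>L" "b\<in>BU" for x b
		using that assms(5)[of x b] BU(2) cspan_base[of b BU] by simp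
	have z_stab: "a z b\<in>S n" if "b\<in>?B" for b
		using that
	proof
		assume "b\<in>BU" then show ?thesis using U_stab[OF K(3)] U_S by auto
	next
		assume "b\<in>e ` {..<n}"
		then obtain i where i: "i < n" "b = e i" by auto
		then have "a z b = e (Suc i)" by (simp add: e_def)
		then show ?thesis using e_S[of "Suc i" n] en Sn i(1) by (cases "Suc i = n") auto
	qed
	have ec: "coord ?B (e i) (e i) = 1" if "i < n" for i
		using coord_basis[OF ind, of "e i" "e i"] that by auto
	have tr: "coord ?B (a x (e i)) (e i) = \<chi> x" if "x\<in>K" "i < n" for x i
	proof -
		let ?s = "a x (e i) - \<chi> x *c e i"
		have "e i\<noteq>e j" if "j < i" for j using inj_onD[OF inj, of i j] that \<open>i < n\<close> by auto
		then have "e i \<notin> BU\<union>e ` {..<i}" using dis that(2) by auto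
		then have "coord ?B ?s (e i) = 0"
			by (intro coord_span_subset[OF ind, of "BU\<union>e ` {..<i}"]) (use tri[OF that(1), of i] that in \<open>auto simp: S_def\<close>)
		moreover have "coord ?B ?s (e i) = coord ?B (a x (e i)) (e i) - \<chi> x * coord ?B (e i) (e i)"
			using stab[OF that(1), of "e i"] e_S[OF that(2)] that S_sub[of n]
			by (subst coord_diff[OF ind]) (auto simp: Sn coord_scale[OF ind] csub_scale)
		ultimately show ?thesis using ec that by simp
	qed
	have yL: "y\<in>L" using y K by auto
	have comm0: "(\<Sum>b\<in>e ` {..<n}. coord ?B (a y (a z b)) b) = (\<Sum>b\<in>e ` {..<n}. coord ?B (a z (a y b)) b)"
		by (rule trace_comm[OF finB ind])
			(use stab[OF y] z_stab U_stab[OF K(3)] U_stab[OF yL] BU(2) S_W[of n] in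
				\<open>auto simp: Sn BmA intro: lin_on_mono[OF lin[OF yL]] lin_on_mono[OF lin[OF K(3)]]\<close>)
	have span_st: "a x s\<in>S n" if "\<And>b. b\<in>?B ==> a x b\<in>S n" "x\<in>L" "s\<in>S n" for x s
		by (rule lin_on_span[OF lin[OF that(2)] W, of ?B]) (use that S_W S_sub BUW eW Sn in auto)
	\<comment> \<open>Both sides are the trace of \<open>bracket y z\<close> on the quotient by
	  \<open>U\<close>: the triangular form gives \<open>n\<close> times the weight, and a commutator
	  has trace 0. Since \<open>n > 0\<close>, the weight vanishes.\<close>
	have "of_nat n * \<chi> (bracket y z) = (\<Sum>i<n. coord ?B (a (bracket y z) (e i)) (e i))"
		using tr[OF K(4)[OF y]] by simp
	also have "... = (\<Sum>i<n. coord ?B (a y (a z (e i))) (e i) - coord ?B (a z (a y (e i))) (e i))"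
	proof (rule sum.cong[OF refl])
		fix i assume "i\<in>{..<n}"
		then have "e i\<in>?B" by auto
		then have "a y (a z (e i))\<in>S n" "a z (a y (e i))\<in>S n"
			using span_st[OF stab[OF y] yL z_stab] span_st[OF z_stab K(3) stab[OF y]] by auto
		then show "coord ?B (a (bracket y z) (e i)) (e i) = coord ?B (a y (a z (e i))) (e i) - coord ?B (a z (a y (e i))) (e i)"
			unfolding comm[OF yL K(3) eW] by (intro coord_diff[OF ind]) (auto simp: Sn)
	qed
	also have "... = 0"
		using comm0 by (simp add: sum.reindex[OF inj] sum_subtractf)
	finally show ?thesis using n by simp
qed

text \<open>The form relative to a stable \<open>U\<close> is the common eigenvector theorem for the
  quotient. An ideal \<open>K\<close> of codimension one has a common eigenvector by induction; its
  weight space modulo \<open>U\<close> is preserved by the remaining direction \<open>z\<close>,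
  because the weight vanishes on commutators with \<open>z\<close>. An eigenvector of
  \<open>z\<close> inside that space serves all of \<open>L\<close>.\<close>

theorem lie_theorem:
	fixes L :: "'x::fin_dim_lie_algebra set" and W U :: "'w::complex_vector set"
	assumes "lie_rep L W a" "lie_solvable L" "fin_dim W" "csub U" "U \<subset> W"
		"\<And>x u. x\<in>L ==> u\<in>U ==> a x u\<in>U"
	shows "\<exists>w\<in>W - U. \<exists>\<chi>. \<forall>x\<in>L. a x w - \<chi> x *c w\<in>U"
	using assms
proof (induction "cdim L" arbitrary: L rule: less_induct)
	case less
	interpret lie_rep L W a by fact
	have Ls: "csub L" using L subalg_csub by auto
	show ?case
	proof (cases "L = {0}")
		case True
		obtain w where w: "w\<in>W" "w \<notin> U" using less.prems by auto
		have "a 0 w = 0" using lin_on_0[OF Ls lin_left[OF w(1)]] .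
		then have "\<forall>x\<in>L. a x w - 0 *c w\<in>U" using True less.prems(4) by (simp add: csub_0)
		then show ?thesis using w by (intro bexI[of _ w] exI[of _ "\<lambda>_. 0"]) auto
	next
		case False
		have "bracket_set L L\<subseteq>L" by (rule bracket_set_least[OF Ls]) (use L subalg_bracket in auto)
		then have "bracket_set L L \<subset> L" using solvable_derived_neq[OF less.prems(2) False Ls] by auto
		then obtain K z where K: "csub K" "bracket_set L L\<subseteq>K" "K\<subseteq>L" "z\<in>L" "z \<notin> K"
			"\<And>x. x\<in>L ==> \<exists>c. x - c *c z\<in>K"
			by (rule codim_one_subspace[OF bracket_set_subspace Ls]) auto
		have brK: "bracket x y\<in>K" if "x\<in>L" "y\<in>L" for x y
			using bracket_in_set[OF that] K(2) by auto
		have "subalgebra K" unfolding subalgebra_def using K(1,3) brK by auto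
		have "\<exists>w\<in>W - U. \<exists>\<chi>. \<forall>x\<in>K. a x w - \<chi> x *c w\<in>U"
		proof (rule less.hyps)
			show "cdim K < cdim L"
				using K by (intro dim_less) (auto simp: Ls)
			show "lie_rep K W a" by (rule lie_rep_subalgebra[OF less.prems(1) \<open>subalgebra K\<close> K(3)])
			show "lie_solvable K" by (rule lie_solvable_mono[OF less.prems(2) K(3,1)])
		qed (use less.prems K(3) in auto)
		then obtain w0 \<chi> where w0: "w0\<in>W" "w0 \<notin> U" "\<And>y. y\<in>K ==> a y w0 - \<chi> y *c w0\<in>U" by blast
		\<comment> \<open>The preimage in \<open>W\<close> of the \<open>\<chi>\<close>-weight space of
		  \<open>K\<close> in the quotient by \<open>U\<close>.\<close>
		define W' where "W' = {w\<in>W. \<forall>y\<in>K. a y w - \<chi> y *c w\<in>U}"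
		have U_W': "U\<subseteq>W'" unfolding W'_def using less.prems(4,5,6) K(3)
			by (auto intro!: csub_diff csub_scale)
		have W'_W: "W'\<subseteq>W" by (auto simp: W'_def)
		have W'_sub: "csub W'"
		proof (rule csubI)
			show "0\<in>W'" using U_W' csub_0[OF less.prems(4)] by auto
		next
			fix v w assume vw: "v\<in>W'" "w\<in>W'"
			have "a y (v + w) - \<chi> y *c (v + w) = (a y v - \<chi> y *c v) + (a y w - \<chi> y *c w)" if "y\<in>K" for y
				using that vw K(3) by (subst lin_on_add[OF lin]) (auto simp: W'_def scaleC_add_right)
			then show "v + w\<in>W'" using vw csub_add[OF W] csub_add[OF less.prems(4)] by (auto simp: W'_def)
		next
			fix c v assume v: "v\<in>W'"
			have "a y (c *c v) - \<chi> y *c (c *c v) = c *c (a y v - \<chi> y *c v)" if "y\<in>K" for y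
				using that v K(3) by (subst lin_on_scale[OF lin]) (auto simp: W'_def scaleC_diff_right mult.commute)
			then show "c *c v\<in>W'" using v csub_scale[OF W] csub_scale[OF less.prems(4)] by (auto simp: W'_def)
		qed
		have z_W': "a z w\<in>W'" if w: "w\<in>W'" for w
		proof (cases "w\<in>U")
			case True
			then show ?thesis using less.prems(6)[OF K(4)] U_W' by auto
		next
			case False
			have wW: "w\<in>W" using w by (simp add: W'_def)
			have "a y (a z w) - \<chi> y *c a z w\<in>U" if y: "y\<in>K" for y
			proof -
				have yL: "y\<in>L" using y K by auto
				have 0: "\<chi> (bracket y z) = 0"
					by (rule weight_commutator_0[OF less.prems(1,3,4) _ less.prems(6) K(1,3,4), of w])
						(use brK K(3,4) w wW False y less.prems(5) in \<open>auto simp: W'_def\<close>)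
				have 1: "a (bracket y z) w\<in>U" using w brK[OF yL K(4)] 0 by (force simp: W'_def)
				have 2: "a y w - \<chi> y *c w\<in>U" using w y by (auto simp: W'_def)
				have "a y w = \<chi> y *c w + (a y w - \<chi> y *c w)" by simp
				then have "a z (a y w) = \<chi> y *c a z w + a z (a y w - \<chi> y *c w)"
					using lin_on_add[OF lin[OF K(4)], of "\<chi> y *c w" "a y w - \<chi> y *c w"] 2 csub_scale[OF W wW]
						less.prems(5) lin_on_scale[OF lin[OF K(4)] wW] by auto
				then have "a y (a z w) - \<chi> y *c a z w = a z (a y w - \<chi> y *c w) + a (bracket y z) w"
					using comm[OF yL K(4) wW] by simp
				then show ?thesis using 1 less.prems(6)[OF K(4) 2] csub_add[OF less.prems(4)] by simp
			qed
			then show ?thesis using closed[OF K(4) wW] by (simp add: W'_def)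
		qed
		have "U \<subset> W'" using U_W' w0 by (auto simp: W'_def)
		then obtain w c where w: "w\<in>W'" "w \<notin> U" "a z w - c *c w\<in>U"
			using relative_eigenvector[OF fin_dim_mono[OF less.prems(3) W'_W] W'_sub less.prems(4) _ lin_on_mono[OF lin[OF K(4)] W'_W] z_W']
			by blast
		have wW: "w\<in>W" using w W'_W by auto
		have "\<exists>d. a x w - d *c w\<in>U" if x: "x\<in>L" for x
		proof -
			obtain d where d: "x - d *c z\<in>K" using K(6)[OF x] by blast
			have "a x w = a ((x - d *c z) + d *c z) w" by simp
			also have "... = a (x - d *c z) w + d *c a z w"
				using d K(3,4) csub_scale[OF Ls K(4)] by (subst lin_on_add[OF lin_left[OF wW]]) (auto simp: lin_on_scale[OF lin_left[OF wW]])
			finally have "a x w - (\<chi> (x - d *c z) + d * c) *c w = (a (x - d *c z) w - \<chi> (x - d *c z) *c w) + d *c (a z w - c *c w)"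
				by (simp add: scaleC_add_left scaleC_diff_right)
			also have "...\<in>U" using w d less.prems(4) by (intro csub_add csub_scale) (auto simp: W'_def)
			finally show ?thesis by blast
		qed
		then obtain \<chi>' where "\<forall>x\<in>L. a x w - \<chi>' x *c w\<in>U" by metis
		then show ?thesis using w wW by blast
	qed
qed

section \<open>Induction over spans\<close>

lemma cspan_induct [consumes 1, case_names zero base add scale]:
	assumes "x\<in>cspan S" "P 0" "\<And>x. x\<in>S ==> P x" "\<And>x y. P x ==> P y ==> P (x + y)"
		"\<And>c x. P x ==> P (c *c x)"
	shows "P x"
proof -
	have "cspan S\<subseteq>Collect P" by (rule cspan_least) (use assms in \<open>auto intro!: csubI\<close>)
	then show ?thesis using assms(1) by auto
qed

subsection \<open>Generalized weight vectors\<close>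

definition adm :: "'g::lie_algebra => complex => 'g => 'g" where
	"adm y c v = bracket y v - c *c v"

definition gen_eig :: "'g::lie_algebra => complex => 'g set" where
	"gen_eig y c = {x. \<exists>n. (adm y c ^^ n) x = 0}"

lemma adm_add: "adm y c (u + v) = adm y c u + adm y c v"
	by (simp add: adm_def bracket_add_right scaleC_add_right)
lemma adm_scale: "adm y c (k *c v) = k *c adm y c v"
	by (simp add: adm_def bracket_scaleC_right scaleC_diff_right mult.commute)
lemma adm_diff: "adm y c (u - v) = adm y c u - adm y c v"
	by (simp add: adm_def bracket_diff_right scaleC_diff_right)
lemma adm_0 [simp]: "adm y c 0 = 0" by (simp add: adm_def)
lemma adm_pow_add: "(adm y c ^^ n) (u + v) = (adm y c ^^ n) u + (adm y c ^^ n) v"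
	by (induction n) (auto simp: adm_add)
lemma adm_pow_scale: "(adm y c ^^ n) (k *c v) = k *c (adm y c ^^ n) v"
	by (induction n) (auto simp: adm_scale)
lemma adm_pow_0 [simp]: "(adm y c ^^ n) 0 = 0" by (induction n) auto
lemma adm_pow_mono: "(adm y c ^^ n) x = 0 ==> n \<le> m ==> (adm y c ^^ m) x = 0"
	by (metis adm_pow_0 comp_apply funpow_add le_add_diff_inverse2)

lemma gen_eig_subspace [simp]: "csub (gen_eig y c)"
proof (rule csubI)
	fix u v assume "u\<in>gen_eig y c" "v\<in>gen_eig y c"
	then obtain n m where "(adm y c ^^ n) u = 0" "(adm y c ^^ m) v = 0" by (auto simp: gen_eig_def)
	then have "(adm y c ^^ (max n m)) (u + v) = 0"
		using adm_pow_mono[of n y c u "max n m"] adm_pow_mono[of m y c v "max n m"] by (simp add: adm_pow_add)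
	then show "u + v\<in>gen_eig y c" by (auto simp: gen_eig_def)
qed (auto simp: gen_eig_def adm_pow_scale)

lemma gen_eig_step: "adm y c x\<in>gen_eig y c ==> x\<in>gen_eig y c"
	unfolding gen_eig_def mem_Collect_eq by (metis comp_apply funpow_Suc_right)

lemma adm_gen_eig: "x\<in>gen_eig y c ==> adm y d x\<in>gen_eig y c"
proof -
	assume x: "x\<in>gen_eig y c"
	then obtain n where "(adm y c ^^ n) x = 0" by (auto simp: gen_eig_def)
	then have "(adm y c ^^ n) (adm y c x) = 0" by (metis adm_0 funpow_swap1)
	then have "adm y c x\<in>gen_eig y c" by (auto simp: gen_eig_def)
	then have "adm y c x + (c - d) *c x\<in>gen_eig y c" using x by (intro csub_add csub_scale) auto
	then show ?thesis by (simp add: adm_def scaleC_diff_left)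
qed

text \<open>\<open>ad y\<close> is a derivation, so \<open>ad y - (a + b)\<close> acts on a bracket
  by applying \<open>ad y - a\<close> to the left or \<open>ad y - b\<close> to the right entry.
  Each application lowers the sum of the two nilpotency exponents.\<close>

lemma gen_eig_bracket:
	assumes "x\<in>gen_eig y a" "z\<in>gen_eig y b"
	shows "bracket x z\<in>gen_eig y (a + b)"
proof -
	have "bracket x z\<in>gen_eig y (a + b)" if "(adm y a ^^ m) x = 0" "(adm y b ^^ n) z = 0" for m n x z
		using that
	proof (induction "m + n" arbitrary: m n x z rule: less_induct)
		case less
		show ?case
		proof (cases "m = 0 \<or> n = 0")
			case True
			then have "x = 0 \<or> z = 0" using less.prems by auto
			then show ?thesis by (auto simp: csub_0)
		next
			case False
			then obtain m' n' where mn: "m = Suc m'" "n = Suc n'" using not0_implies_Suc by blast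
			have 1: "bracket (adm y a x) z\<in>gen_eig y (a + b)"
				using less.hyps[of m' n "adm y a x" z] less.prems mn by (simp add: funpow_swap1)
			have 2: "bracket x (adm y b z)\<in>gen_eig y (a + b)"
				using less.hyps[of m n' x "adm y b z"] less.prems mn by (simp add: funpow_swap1)
			have "adm y (a + b) (bracket x z) = bracket (adm y a x) z + bracket x (adm y b z)"
				unfolding adm_def bracket_derivation[of y x z]
				by (simp add: bracket_diff_left bracket_diff_right bracket_scaleC_left bracket_scaleC_right scaleC_add_left)
			then show ?thesis using gen_eig_step csub_add[OF gen_eig_subspace 1 2] by metis
		qed
	qed
	then show ?thesis using assms by (auto simp: gen_eig_def)
qed

text \<open>A vector killed by \<open>ad y - d\<close> is multiplied by \<open>d - c\<close> under
  \<open>ad y - c\<close>, which is nilpotent on it.\<close>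

lemma adm_injective:
	assumes "u\<in>gen_eig y c" "adm y d u = 0" "d\<noteq>c" shows "u = 0"
proof -
	obtain n where n: "(adm y c ^^ n) u = 0" using assms by (auto simp: gen_eig_def)
	have "adm y c u = (d - c) *c u" using assms(2) by (simp add: adm_def scaleC_diff_left)
	then have "(adm y c ^^ k) u = (d - c) ^ k *c u" for k
		by (induction k) (auto simp: adm_scale)
	then show ?thesis using n assms(3) by simp
qed

text \<open>On this space \<open>ad y - d\<close> is the nonzero scalar \<open>c - d\<close> plus a
  locally nilpotent operator. The recursion on the exponent solves the equation while remaining in
  \<open>W\<close>.\<close>

lemma adm_surjective:
	assumes "x\<in>W" "x\<in>gen_eig y c" "d\<noteq>c" "csub W" "\<And>w. w\<in>W ==> bracket y w\<in>W"
	shows "\<exists>u\<in>W\<inter>gen_eig y c. adm y d u = x"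
proof -
	obtain n where "(adm y c ^^ n) x = 0" using assms by (auto simp: gen_eig_def)
	then show ?thesis using assms(1)
	proof (induction n arbitrary: x)
		case 0
		then show ?case using csub_0[OF assms(4)] by (auto intro!: bexI[of _ 0] simp: csub_0)
	next
		case (Suc n)
		have "adm y c x\<in>W" using Suc.prems assms(4,5) unfolding adm_def by (intro csub_diff csub_scale)
		then obtain u' where u': "u'\<in>W" "u'\<in>gen_eig y c" "adm y d u' = adm y c x"
			using Suc.IH[of "adm y c x"] Suc.prems by (auto simp: funpow_swap1)
		have xg: "x\<in>gen_eig y c" using Suc.prems(1) unfolding gen_eig_def by blast
		have "adm y d (x - u') = (c - d) *c x"
			unfolding adm_diff u'(3) by (simp add: adm_def scaleC_diff_left)
		then have "adm y d (inverse (c - d) *c (x - u')) = x"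
			using assms(3) by (simp add: adm_scale scaleC_scaleC scaleC_one)
		moreover have "inverse (c - d) *c (x - u')\<in>W\<inter>gen_eig y c"
			using u' xg Suc.prems assms(4) by (intro IntI csub_scale csub_diff) auto
		ultimately show ?case by blast
	qed
qed

text \<open>If the sum \<open>U\<close> of the generalized eigenspaces were proper, there would be
  an eigenvector \<open>w\<close> modulo \<open>U\<close>, for some \<open>c\<close>. Subtracting a
  suitable \<open>u\<close> from \<open>U\<close> brings \<open>w\<close> into the generalized
  eigenspace of \<open>c\<close> itself, hence into \<open>U\<close>.\<close>

lemma single_decomposition:
	fixes W :: "'g::fin_dim_lie_algebra set"
	assumes W: "csub W" "\<And>w. w\<in>W ==> bracket y w\<in>W"
	shows "W\<subseteq>cspan (\<Union>c. W\<inter>gen_eig y c)"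
proof (rule ccontr)
	define U where "U = cspan (\<Union>c. W\<inter>gen_eig y c)"
	assume "\<not> W\<subseteq>cspan (\<Union>c. W\<inter>gen_eig y c)"
	moreover have U_W: "U\<subseteq>W" unfolding U_def by (rule cspan_least) (use W in auto)
	ultimately have "U \<subset> W" unfolding U_def by auto
	then obtain w c where w: "w\<in>W" "w \<notin> U" "bracket y w - c *c w\<in>U"
		using relative_eigenvector[of W U "bracket y"] W by (auto simp: U_def)
	\<comment> \<open>\<open>ad y - c\<close> is onto on every summand with eigenvalue different from
	  \<open>c\<close>. The part of \<open>v\<close> in the summand of \<open>c\<close> may be left
	  over, as it does no harm to the conclusion.\<close>
	have "\<exists>u\<in>U. adm y c u - v\<in>W\<inter>gen_eig y c" if "v\<in>U" for v
		using that unfolding U_def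
	proof (induction rule: cspan_induct)
		case zero
		show ?case using csub_0[OF W(1)] by (intro bexI[of _ 0]) (auto simp: csub_0 cspan_0)
	next
		case (base v)
		then obtain d where v: "v\<in>W" "v\<in>gen_eig y d" by auto
		show ?case
		proof (cases "d = c")
			case True
			then show ?thesis using v W csub_neg[OF W(1) v(1)] csub_neg[OF gen_eig_subspace v(2)]
				by (intro bexI[of _ 0]) (auto simp: cspan_0)
		next
			case False
			then obtain u where u: "u\<in>W\<inter>gen_eig y d" "adm y c u = v"
				using adm_surjective[OF v, of c] W by auto
			then have "u\<in>cspan (\<Union>c. W\<inter>gen_eig y c)" by (intro cspan_base) auto
			then show ?thesis using csub_0[OF W(1)] u by (intro bexI[of _ u]) (auto simp: csub_0)
		qed
	next
		case (add v v')
		then obtain u u' where u: "u\<in>cspan (\<Union>c. W\<inter>gen_eig y c)" "adm y c u - v\<in>W\<inter>gen_eig y c"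
			"u'\<in>cspan (\<Union>c. W\<inter>gen_eig y c)" "adm y c u' - v'\<in>W\<inter>gen_eig y c" by blast
		have "adm y c (u + u') - (v + v') = (adm y c u - v) + (adm y c u' - v')" by (simp add: adm_add)
		also have "...\<in>W\<inter>gen_eig y c" using u W(1) by (auto intro!: csub_add)
		finally show ?case using cspan_add[OF u(1,3)] by blast
	next
		case (scale k v)
		then obtain u where u: "u\<in>cspan (\<Union>c. W\<inter>gen_eig y c)" "adm y c u - v\<in>W\<inter>gen_eig y c" by blast
		have "adm y c (k *c u) - k *c v = k *c (adm y c u - v)"
			by (simp add: adm_scale scaleC_diff_right)
		also have "...\<in>W\<inter>gen_eig y c" using u W(1) by (auto intro!: csub_scale)
		finally show ?case using cspan_scale[OF u(1)] by blast
	qed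
	from this[OF w(3)] obtain u where u: "u\<in>U" "adm y c u - adm y c w\<in>W\<inter>gen_eig y c"
		by (auto simp: adm_def)
	have "u - w\<in>gen_eig y c" using u(2) gen_eig_step[of y c "u - w"] by (simp add: adm_diff)
	moreover have "u - w\<in>W" using u(1) U_W w(1) W(1) by (auto intro: csub_diff)
	ultimately have "u - w\<in>U" unfolding U_def by (intro cspan_base) auto
	then have "w\<in>U" using cspan_diff[OF u(1)[unfolded U_def], of "u - w"] by (simp add: U_def)
	then show False using w(2) by simp
qed

lemma foldr_adm_add: "foldr (adm y) ds (u + v) = foldr (adm y) ds u + foldr (adm y) ds v"
	by (induction ds) (auto simp: adm_add)
lemma foldr_adm_scale: "foldr (adm y) ds (k *c u) = k *c foldr (adm y) ds u"
	by (induction ds) (auto simp: adm_scale)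
lemma foldr_adm_0 [simp]: "foldr (adm y) ds 0 = 0" by (induction ds) auto
lemma adm_commute: "adm y c (adm y d v) = adm y d (adm y c v)"
	by (simp add: adm_def bracket_diff_right bracket_scaleC_right scaleC_diff_right mult.commute algebra_simps)
lemma foldr_adm_commute1: "foldr (adm y) ds (adm y c v) = adm y c (foldr (adm y) ds v)"
	by (induction ds) (auto simp: adm_commute)
lemma foldr_adm_commute: "foldr (adm y) ds (foldr (adm y) es v) = foldr (adm y) es (foldr (adm y) ds v)"
	by (induction es) (auto simp: foldr_adm_commute1)

text \<open>A finite product of operators \<open>ad y - d\<close> with \<open>d \<noteq> c\<close>
  kills \<open>x\<close> as a sum of vectors from the other eigenspaces, while each factor is
  injective on the generalized eigenspace of \<open>c\<close>.\<close>

lemma gen_eig_disjoint: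
	assumes "x\<in>gen_eig y c" "x\<in>cspan (\<Union>d\<in>- {c}. gen_eig y d)"
	shows "x = 0"
proof -
	obtain ds where ds: "c \<notin> set ds" "foldr (adm y) ds x = 0"
		using assms(2)
	proof (induction arbitrary: thesis rule: cspan_induct)
		case zero
		show ?case by (rule zero[of "[]"]) auto
	next
		case (base v)
		then obtain d where d: "d\<noteq>c" "v\<in>gen_eig y d" by auto
		then obtain n where n: "(adm y d ^^ n) v = 0" by (auto simp: gen_eig_def)
		have "foldr (adm y) (replicate n d) v = (adm y d ^^ n) v" for n by (induction n) auto
		then show ?case using n d by (intro base(2)[of "replicate n d"]) auto
	next
		case (add u v)
		obtain ds where "c \<notin> set ds" "foldr (adm y) ds u = 0" by (rule add(1))
		moreover obtain es where "c \<notin> set es" "foldr (adm y) es v = 0" by (rule add(2))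
		ultimately show ?case
			by (intro add(3)[of "ds @ es"]) (auto simp: foldr_adm_add foldr_adm_commute[of y ds es u])
	next
		case (scale k v)
		obtain ds where "c \<notin> set ds" "foldr (adm y) ds v = 0" by (rule scale(1))
		then show ?case by (intro scale(2)[of ds]) (auto simp: foldr_adm_scale)
	qed
	have st: "foldr (adm y) es x\<in>gen_eig y c" for es by (induction es) (use assms(1) in \<open>auto simp: adm_gen_eig\<close>)
	show ?thesis using ds
	proof (induction ds)
		case (Cons d ds)
		then show ?case using adm_injective[OF st[of ds], of d] by auto
	qed simp
qed

lemma indep_union:
	fixes B1 B2 :: "'a::complex_vector set"
	assumes B: "finite B1" "cindep B1" "finite B2" "cindep B2" "cspan B1\<inter>cspan B2 = {0}"
	shows "cindep (B1\<union>B2)" "B1\<inter>B2 = {}"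
proof -
	show dis: "B1\<inter>B2 = {}"
	proof -
		have "x = 0" if "x\<in>B1\<inter>B2" for x
			using that B(5) cspan_base[of x B1] cspan_base[of x B2] by auto
		then show ?thesis using B(2) complex_vector.dependent_zero by auto
	qed
	show "cindep (B1\<union>B2)"
	proof (rule complex_vector.independent_if_scalars_zero)
		show "finite (B1\<union>B2)" using B by auto
		fix f x assume 0: "(\<Sum>x\<in>B1\<union>B2. f x *c x) = 0" and x: "x\<in>B1\<union>B2"
		have s: "(\<Sum>x\<in>B1. f x *c x) + (\<Sum>x\<in>B2. f x *c x) = 0"
			using 0 sum.union_disjoint[OF B(1,3) dis, of "\<lambda>x. f x *c x"] by simp
		have in1: "(\<Sum>x\<in>B1. f x *c x)\<in>cspan B1" and in2: "(\<Sum>x\<in>B2. f x *c x)\<in>cspan B2"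
			by (auto intro: cspan_sum cspan_scale cspan_base)
		have "(\<Sum>x\<in>B1. f x *c x) = - (\<Sum>x\<in>B2. f x *c x)" using s by (simp add: eq_neg_iff_add_eq_0)
		then have "(\<Sum>x\<in>B1. f x *c x)\<in>cspan B1\<inter>cspan B2" using in1 cspan_neg[OF in2] by auto
		then have z1: "(\<Sum>x\<in>B1. f x *c x) = 0" using B(5) by auto
		then have z2: "(\<Sum>x\<in>B2. f x *c x) = 0" using s by simp
		show "f x = 0"
			using x coord_lincomb_basis[OF B(2,1), of x f] coord_lincomb_basis[OF B(4,3), of x f] z1 z2
			by (auto simp: complex_vector.representation_zero)
	qed
qed

text \<open>A longest independent list in which the action is triangular must span \<open>W\<close>:
  otherwise Lie's theorem relative to its span supplies one more vector to append.\<close>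

lemma triangular_basis:
	fixes L :: "'x::fin_dim_lie_algebra set" and W :: "'w::complex_vector set"
	assumes "lie_rep L W a" "lie_solvable L" "fin_dim W"
	obtains ws \<chi> where "distinct ws" "cindep (set ws)" "cspan (set ws) = W"
		"\<And>i x. i < length ws ==> x\<in>L ==> a x (ws ! i) - \<chi> i x *c ws ! i\<in>cspan (set (take i ws))"
proof -
	interpret lie_rep L W a by fact
	define P where "P ws \<chi> \<longleftrightarrow> distinct ws \<and> cindep (set ws) \<and> set ws\<subseteq>W \<and>
		(\<forall>i x. i < length ws \<longrightarrow> x\<in>L \<longrightarrow> a x (ws ! i) - \<chi> i x *c ws ! i\<in>cspan (set (take i ws)))" for ws \<chi>
	obtain S where S: "finite S" "W\<subseteq>cspan S" using assms(3) by (auto simp: fin_dim_def)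
	have bound: "length ws \<le> card S" if "P ws \<chi>" for ws \<chi>
		using complex_vector.independent_span_bound[OF S(1), of "set ws"] that S(2)
		by (auto simp: P_def distinct_card)
	have "P [] (\<lambda>_ _. 0)" by (simp add: P_def complex_vector.independent_empty)
	then obtain ws where ws: "\<exists>\<chi>. P ws \<chi>" and max: "\<And>vs. \<exists>\<chi>. P vs \<chi> ==> length vs \<le> length ws"
		using ex_has_greatest_nat[of "\<lambda>ws. \<exists>\<chi>. P ws \<chi>" "[]" length "Suc (card S)"] bound by (metis le_imp_less_Suc)
	obtain \<chi> where P: "P ws \<chi>" using ws by blast
	define U where "U = cspan (set ws)"
	have UW: "U\<subseteq>W" unfolding U_def by (rule cspan_least) (use P W in \<open>auto simp: P_def\<close>)
	have stab: "a x u\<in>U" if "x\<in>L" "u\<in>U" for x u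
	proof (rule lin_on_span[OF lin[OF that(1)] W, of "set ws"])
		fix s assume "s\<in>set ws"
		then obtain i where i: "i < length ws" "s = ws ! i" by (auto simp: in_set_conv_nth)
		have "a x s - \<chi> i x *c s\<in>U"
			using P i that(1) cspan_mono[OF set_take_subset[of i ws]] unfolding P_def U_def by blast
		moreover have "\<chi> i x *c s\<in>U" unfolding U_def
			using \<open>s\<in>set ws\<close> by (intro cspan_scale cspan_base)
		ultimately have "(a x s - \<chi> i x *c s) + \<chi> i x *c s\<in>U" unfolding U_def by (rule cspan_add)
		then show "a x s\<in>U" by simp
	qed (use P that in \<open>auto simp: P_def U_def\<close>)
	have "U = W"
	proof (rule ccontr)
		assume "U\<noteq>W"
		then have "\<exists>w\<in>W - U. \<exists>\<chi>. \<forall>x\<in>L. a x w - \<chi> x *c w\<in>U"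
			using UW by (intro lie_theorem[OF assms]) (auto simp: stab, auto simp: U_def)
		then obtain w \<chi>' where w: "w\<in>W" "w \<notin> U" "\<forall>x\<in>L. a x w - \<chi>' x *c w\<in>U" by blast
		have "w \<notin> set ws" using w(2) cspan_base unfolding U_def by metis
		have "P (ws @ [w]) (\<lambda>i. if i < length ws then \<chi> i else \<chi>')"
			unfolding P_def
		proof (intro conjI allI impI)
			show "cindep (set (ws @ [w]))"
				using complex_vector.independent_insertI[of w "set ws"] w(2) P by (simp add: P_def U_def)
			fix i x assume "i < length (ws @ [w])" "x\<in>L"
			then show "a x ((ws @ [w]) ! i) - (if i < length ws then \<chi> i else \<chi>') x *c (ws @ [w]) ! i\<in>cspan (set (take i (ws @ [w])))"
				using P w(3) by (cases "i < length ws") (auto simp: P_def nth_append U_def)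
		qed (use P w \<open>w \<notin> set ws\<close> in \<open>auto simp: P_def\<close>)
		then have "length (ws @ [w]) \<le> length ws" by (intro max) blast
		then show False by simp
	qed
	then show thesis using that[of ws \<chi>] P unfolding P_def U_def by auto
qed

lemma nilpotent_ad:
	assumes "lie_nilpotent H" "y\<in>H" "z\<in>H"
	shows "z\<in>gen_eig y 0"
proof -
	obtain n where n: "(bracket_set H ^^ n) H = {0}" using assms(1) by (auto simp: lie_nilpotent_def)
	have "(bracket y ^^ k) z\<in>(bracket_set H ^^ k) H" for k
		by (induction k) (use assms(2,3) in \<open>auto intro: bracket_in_set\<close>)
	moreover have "adm y 0 = bracket y" by (rule ext) (simp add: adm_def)
	ultimately show ?thesis unfolding gen_eig_def using n by (metis (mono_tags) mem_Collect_eq singletonD)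
qed

lemma nilpotent_solvable:
	assumes "lie_nilpotent H" "subalgebra H" shows "lie_solvable H"
proof -
	obtain n where n: "(bracket_set H ^^ n) H = {0}" using assms(1) by (auto simp: lie_nilpotent_def)
	have sub: "derived k H\<subseteq>H" for k
	proof (induction k)
		case (Suc k)
		then show ?case unfolding derived_Suc
			by (intro bracket_set_least[OF subalg_csub[OF assms(2)]] subalg_bracket[OF assms(2)]) auto
	qed simp
	have "derived k H\<subseteq>(bracket_set H ^^ k) H" for k
		by (induction k) (auto simp: derived_Suc intro: subsetD[OF bracket_set_mono[OF sub]])
	then have "derived n H = {0}" using n derived_0_in[OF subalg_csub[OF assms(2)], of n] by auto
	then show ?thesis by (auto simp: lie_solvable_iff)
qed

text \<open>A weight basis: \<open>ad y\<close> is triangular inside each block of equal weight,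
  \<open>r\<close> being the order that makes it so. Weights are 0 outside \<open>H\<close>, in
  agreement with \<open>dual_space\<close>, so that equality of weights is equality of
  functions.\<close>

definition wb ::
	"'g::lie_algebra set => 'g set => 'g set => ('g => 'g => complex) => ('g => nat) => bool" where
	"wb H W B wt r \<longleftrightarrow> finite B \<and> cindep B \<and> cspan B = W \<and> (\<forall>b\<in>B. \<forall>y. y \<notin> H \<longrightarrow> wt b y = 0) \<and>
		 (\<forall>b\<in>B. \<forall>y\<in>H. bracket y b - wt b y *c b\<in>cspan {b'\<in>B. r b' < r b \<and> wt b' = wt b})"

text \<open>If some \<open>y\<close> has two eigenvalues on \<open>W\<close>, the space splits into
  one generalized eigenspace and the sum of the others, and induction on the dimension applies to
  both. If every \<open>y\<close> has a single eigenvalue, a triangular basis from Lie's theorem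
  already is a weight basis.\<close>

theorem wb_exists:
	fixes H W :: "'g::fin_dim_lie_algebra set"
	assumes H: "subalgebra H" "lie_nilpotent H"
		and W: "csub W" "\<And>y w. y\<in>H ==> w\<in>W ==> bracket y w\<in>W"
	shows "\<exists>B wt r. wb H W B wt r"
	using W
proof (induction "cdim W" arbitrary: W rule: less_induct)
	case less
	show ?case
	proof (cases "\<forall>y\<in>H. \<exists>c. W\<subseteq>gen_eig y c")
		case True
		then obtain \<alpha> where \<alpha>: "\<And>y. y\<in>H ==> W\<subseteq>gen_eig y (\<alpha> y)" by metis
		have rep: "lie_rep H W bracket" using lie_rep_ad[OF H(1) less.prems] .
		obtain ws \<chi> where ws: "distinct ws" "cindep (set ws)" "cspan (set ws) = W"
			and tri: "\<And>i x. i < length ws ==> x\<in>H ==> bracket x (ws ! i) - \<chi> i x *c ws ! i\<in>cspan (set (take i ws))"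
			by (rule triangular_basis[OF rep nilpotent_solvable[OF H(2,1)] fin_dim_lie]) blast
		\<comment> \<open>The diagonal entry is the eigenvalue of \<open>ad y\<close> on
		  \<open>ws ! i\<close> modulo the earlier vectors. A power of \<open>ad y - \<alpha> y\<close>
		  kills \<open>ws ! i\<close>, which leaves only \<open>\<alpha> y\<close>.\<close>
		have eq: "\<chi> i y = \<alpha> y" if i: "i < length ws" and y: "y\<in>H" for i y
		proof (rule ccontr)
			assume ne: "\<chi> i y\<noteq>\<alpha> y"
			let ?U = "cspan (set (take i ws))"
			have wi: "ws ! i\<in>W" using ws(3) i cspan_base[of "ws ! i" "set ws"] by auto
			then obtain n where n: "(adm y (\<alpha> y) ^^ n) (ws ! i) = 0" using \<alpha>[OF y] by (auto simp: gen_eig_def)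
			have Ustab: "adm y (\<alpha> y) u\<in>?U" if "u\<in>?U" for u
			proof (rule lin_on_span[of UNIV "adm y (\<alpha> y)" "set (take i ws)"])
				show "lin_on UNIV (adm y (\<alpha> y))" by (simp add: lin_on_def adm_add adm_scale)
				fix s assume "s\<in>set (take i ws)"
				then obtain j where j: "j < i" "s = ws ! j" using i by (auto simp: in_set_conv_nth)
				have "bracket y s - \<chi> j y *c s\<in>?U"
					using tri[of j y] i j y cspan_mono[OF set_take_subset_set_take[of j i ws]] by auto
				moreover have "(\<chi> j y - \<alpha> y) *c s\<in>?U"
					using \<open>s\<in>set (take i ws)\<close> by (intro cspan_scale cspan_base)
				ultimately have "(bracket y s - \<chi> j y *c s) + (\<chi> j y - \<alpha> y) *c s\<in>?U" by (rule cspan_add)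
				then show "adm y (\<alpha> y) s\<in>?U" by (simp add: adm_def scaleC_diff_left)
			qed (use that in auto)
			have pow: "(adm y (\<alpha> y) ^^ k) (ws ! i) - (\<chi> i y - \<alpha> y) ^ k *c ws ! i\<in>?U" for k
			proof (induction k)
				case (Suc k)
				let ?v = "(adm y (\<alpha> y) ^^ k) (ws ! i)" and ?c = "(\<chi> i y - \<alpha> y) ^ k"
				have "adm y (\<alpha> y) ?v - (\<chi> i y - \<alpha> y) ^ Suc k *c ws ! i
					= adm y (\<alpha> y) (?v - ?c *c ws ! i) + ?c *c (bracket y (ws ! i) - \<chi> i y *c ws ! i)"
					unfolding adm_diff[of _ _ ?v] adm_scale
					by (simp add: adm_def scaleC_diff_right
							scaleC_diff_left algebra_simps)
				also have "...\<in>?U"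
					using Suc Ustab tri[OF i y] by (intro cspan_add cspan_scale) auto
				finally show ?case by simp
			qed (simp add: cspan_0 scaleC_one)
			have "ws ! i\<in>?U" using pow[of n] n ne cspan_scale[of _ "set (take i ws)" "- inverse ((\<chi> i y - \<alpha> y) ^ n)"]
				by (force simp: scaleC_scaleC scaleC_one)
			moreover have "ws ! i \<notin> set (take i ws)"
				using ws(1) i by (auto simp: in_set_conv_nth nth_eq_iff_index_eq)
			ultimately have "complex_vector.dependent (set ws)"
				unfolding complex_vector.dependent_def
				using i cspan_mono[of "set (take i ws)" "set ws - {ws ! i}"] set_take_subset[of i ws]
				by (intro bexI[of _ "ws ! i"]) auto
			then show False using ws(2) by simp
		qed
		define wt where "wt = (\<lambda>b::'g. \<lambda>y. if y\<in>H then \<alpha> y else 0)"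
		define r where "r b = (THE i. i < length ws \<and> ws ! i = b)" for b
		have r: "r (ws ! i) = i" if "i < length ws" for i
			unfolding r_def using ws(1) that by (intro the_equality) (auto simp: nth_eq_iff_index_eq)
		have "wb H W (set ws) wt r"
			unfolding wb_def
		proof (intro conjI ballI allI impI)
			fix b y assume "b\<in>set ws" "y\<in>H"
			then obtain i where i: "i < length ws" "b = ws ! i" by (auto simp: in_set_conv_nth)
			have "set (take i ws)\<subseteq>{b'\<in>set ws. r b' < r b \<and> wt b' = wt b}"
				using i r by (auto simp: in_set_conv_nth[of _ "take i ws"] wt_def)
			then show "bracket y b - wt b y *c b\<in>cspan {b'\<in>set ws. r b' < r b \<and> wt b' = wt b}"
				using tri[OF i(1) \<open>y\<in>H\<close>] eq[OF i(1) \<open>y\<in>H\<close>] i(2) \<open>y\<in>H\<close> cspan_mono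
				by (auto simp: wt_def)
		qed (use ws in \<open>auto simp: wt_def\<close>)
		then show ?thesis by blast
	next
		case False
		then obtain y where y: "y\<in>H" "\<And>c. \<not> W\<subseteq>gen_eig y c" by blast
		have dec: "W\<subseteq>cspan (\<Union>c. W\<inter>gen_eig y c)" by (rule single_decomposition) (use less.prems y in auto)
		have "\<exists>c. W\<inter>gen_eig y c\<noteq>{0}"
		proof (rule ccontr)
			assume "\<nexists>c. W\<inter>gen_eig y c\<noteq>{0}"
			then have "W\<subseteq>cspan {0}" using dec by auto
			then have "W\<subseteq>gen_eig y 0" by (auto simp: csub_0)
			then show False using y(2) by blast
		qed
		then obtain c where c: "W\<inter>gen_eig y c\<noteq>{0}" by blast
		define W1 where "W1 = W\<inter>gen_eig y c"
		define W2 where "W2 = cspan (\<Union>d\<in>-{c}. W\<inter>gen_eig y d)"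
		have sub: "csub W1" "csub W2" using less.prems(1) by (auto simp: W1_def W2_def csub_Int)
		have W2W: "W2\<subseteq>W" unfolding W2_def by (rule cspan_least) (use less.prems in auto)
		\<comment> \<open>Since \<open>H\<close> is nilpotent, \<open>z\<close> belongs to the generalized
		  eigenspace of \<open>y\<close> for 0, so bracketing with it does not change eigenvalues of
		  \<open>y\<close>.\<close>
		have stab_ge: "bracket z x\<in>gen_eig y d" if "z\<in>H" "x\<in>gen_eig y d" for z x d
			using gen_eig_bracket[OF nilpotent_ad[OF H(2) y(1) that(1)] that(2)] by simp
		have st1: "bracket z x\<in>W1" if "z\<in>H" "x\<in>W1" for z x
			using that stab_ge less.prems(2) by (auto simp: W1_def)
		have st2: "bracket z x\<in>W2" if "z\<in>H" "x\<in>W2" for z x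
			by (rule lin_on_span[of UNIV "bracket z" "\<Union>d\<in>-{c}. W\<inter>gen_eig y d"])
				(use that stab_ge less.prems(2) in \<open>auto simp: W2_def intro!: cspan_base\<close>)
		have inter: "W1\<inter>W2 = {0}"
		proof -
			have "x = 0" if "x\<in>W1" "x\<in>W2" for x
			proof (rule gen_eig_disjoint[of x y c])
				show "x\<in>cspan (\<Union>d\<in>- {c}. gen_eig y d)"
					using that(2) cspan_mono[of "\<Union>d\<in>-{c}. W\<inter>gen_eig y d" "\<Union>d\<in>- {c}. gen_eig y d"]
					by (auto simp: W2_def)
			qed (use that in \<open>auto simp: W1_def\<close>)
			then show ?thesis using sub csub_0 by blast
		qed
		have sum: "\<exists>u\<in>W1. \<exists>v\<in>W2. x = u + v" if "x\<in>W" for x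
		proof -
			have "(\<Union>c. W\<inter>gen_eig y c)\<subseteq>W1\<union>W2"
				unfolding W1_def W2_def by (auto intro: cspan_base)
			then have "x\<in>cspan (W1\<union>W2)" using dec that cspan_mono by blast
			then show ?thesis using sub by (auto simp: cspan_Un cspan_eq)
		qed
		have "W1 \<subset> W" using y(2)[of c] by (auto simp: W1_def)
		moreover have "W2 \<subset> W"
		proof -
			obtain x where "x\<in>W1" "x\<noteq>0" using c sub(1) csub_0 by (auto simp: W1_def)
			then show ?thesis using inter W2W by (auto simp: W1_def)
		qed
		ultimately have "cdim W1 < cdim W" "cdim W2 < cdim W"
			using dim_less[OF fin_dim_lie] sub less.prems(1) by auto
		then obtain B1 wt1 r1 B2 wt2 r2 where B: "wb H W1 B1 wt1 r1" "wb H W2 B2 wt2 r2"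
			using less.hyps[of W1] less.hyps[of W2] sub st1 st2 by metis
		define wt where "wt b = (if b\<in>B1 then wt1 b else wt2 b)" for b
		define r where "r b = (if b\<in>B1 then r1 b else r2 b)" for b
		have un: "cindep (B1\<union>B2)" "B1\<inter>B2 = {}"
			using indep_union[of B1 B2] B inter by (auto simp: wb_def)
		have "wb H W (B1\<union>B2) wt r"
			unfolding wb_def
		proof (intro conjI ballI allI impI)
			show "cspan (B1\<union>B2) = W"
			proof
				show "cspan (B1\<union>B2)\<subseteq>W"
					by (rule cspan_least) (use B W2W less.prems(1) cspan_superset[of B1] cspan_superset[of B2] in
							\<open>auto simp: wb_def W1_def\<close>)
				show "W\<subseteq>cspan (B1\<union>B2)"
					unfolding cspan_Un using sum B by (force simp: wb_def)
			qed
			fix b y' assume b: "b\<in>B1\<union>B2" "y'\<in>H"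
			show "bracket y' b - wt b y' *c b\<in>cspan {b'\<in>B1\<union>B2. r b' < r b \<and> wt b' = wt b}"
			proof (cases "b\<in>B1")
				case True
				have "{b'\<in>B1. r1 b' < r1 b \<and> wt1 b' = wt1 b}\<subseteq>{b'\<in>B1\<union>B2. r b' < r b \<and> wt b' = wt b}"
					using True by (auto simp: r_def wt_def)
				then have "cspan {b'\<in>B1. r1 b' < r1 b \<and> wt1 b' = wt1 b}\<subseteq>cspan {b'\<in>B1\<union>B2. r b' < r b \<and> wt b' = wt b}"
					by (rule cspan_mono)
				moreover have "bracket y' b - wt b y' *c b\<in>cspan {b'\<in>B1. r1 b' < r1 b \<and> wt1 b' = wt1 b}"
					using B(1) True b by (simp add: wb_def wt_def)
				ultimately show ?thesis by blast
			next
				case False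
				have "{b'\<in>B2. r2 b' < r2 b \<and> wt2 b' = wt2 b}\<subseteq>{b'\<in>B1\<union>B2. r b' < r b \<and> wt b' = wt b}"
					using False un(2) by (auto simp: r_def wt_def)
				then have "cspan {b'\<in>B2. r2 b' < r2 b \<and> wt2 b' = wt2 b}\<subseteq>cspan {b'\<in>B1\<union>B2. r b' < r b \<and> wt b' = wt b}"
					by (rule cspan_mono)
				moreover have "bracket y' b - wt b y' *c b\<in>cspan {b'\<in>B2. r2 b' < r2 b \<and> wt2 b' = wt2 b}"
					using B(2) False b by (simp add: wb_def wt_def)
				ultimately show ?thesis by blast
			qed
		qed (use B un in \<open>auto simp: wb_def wt_def\<close>)
		then show ?thesis by blast
	qed
qed

lemma weight_basis_gen_eig:
	assumes "wb H W B wt r" "b\<in>B" "y\<in>H"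
	shows "b\<in>gen_eig y (wt b y)"
	using assms(2)
proof (induction "r b" arbitrary: b rule: less_induct)
	case less
	have "adm y (wt b y) b\<in>cspan {b'\<in>B. r b' < r b \<and> wt b' = wt b}"
		using assms(1,3) less.prems by (auto simp: wb_def adm_def)
	also have "...\<subseteq>gen_eig y (wt b y)"
		by (rule cspan_least) (use less.hyps in force)+
	finally show ?case by (rule gen_eig_step)
qed

lemma weight_basis_span:
	assumes "wb H W B wt r" shows "finite B" "cindep B" "cspan B = W"
	using assms by (auto simp: wb_def)

text \<open>The part of \<open>x\<close> carried by basis vectors of other eigenvalues lies both in
  the generalized eigenspace of \<open>c\<close> and in the sum of the others.\<close>

lemma weight_basis_coord:
	assumes wb: "wb H W B wt r" and "y\<in>H" "x\<in>W" "x\<in>gen_eig y c" "b\<in>B" "wt b y\<noteq>c"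
	shows "coord B x b = 0"
proof -
	note B = weight_basis_span[OF wb]
	let ?P = "{b\<in>B. wt b y = c}" and ?Q = "{b\<in>B. wt b y\<noteq>c}"
	have ex: "x = (\<Sum>b\<in>B. coord B x b *c b)" using coord_expand[OF B(2,1)] B(3) assms(3) by simp
	also have "... = (\<Sum>b\<in>?P. coord B x b *c b) + (\<Sum>b\<in>?Q. coord B x b *c b)"
		by (subst sum.union_disjoint[symmetric]) (use B(1) in \<open>auto intro!: sum.cong\<close>)
	finally have sum: "x - (\<Sum>b\<in>?P. coord B x b *c b) = (\<Sum>b\<in>?Q. coord B x b *c b)" by (simp add: algebra_simps)
	have "(\<Sum>b\<in>?P. coord B x b *c b)\<in>gen_eig y c"
		using weight_basis_gen_eig[OF wb _ assms(2)] by (intro csub_sum csub_scale) auto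
	then have "(\<Sum>b\<in>?Q. coord B x b *c b)\<in>gen_eig y c" unfolding sum[symmetric] using assms(4) by (intro csub_diff) auto
	moreover have "(\<Sum>b\<in>?Q. coord B x b *c b)\<in>cspan (\<Union>d\<in>-{c}. gen_eig y d)"
		using weight_basis_gen_eig[OF wb _ assms(2)]
		by (intro cspan_sum cspan_scale cspan_base) auto
	ultimately have "(\<Sum>b\<in>?Q. coord B x b *c b) = 0" by (rule gen_eig_disjoint)
	then have "x = (\<Sum>b\<in>?P. coord B x b *c b)" using sum by simp
	then have "x\<in>cspan ?P"
		by (metis (no_types, lifting) cspan_base cspan_scale cspan_sum)
	then show ?thesis by (rule coord_span_subset[OF B(2), rotated]) (use assms in auto)
qed

text \<open>Triangularity within the weight blocks: diagonal entries are the weights, and those of a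
  product are the products of weights. This turns the Killing form on \<open>H\<close> into a sum
  over weights.\<close>

lemma wb_coord_ad:
	assumes wb: "wb H W B wt r" and "b\<in>B" "y\<in>H"
	shows "coord B (bracket y b) b = wt b y"
		and "t\<in>H ==> coord B (bracket t (bracket y b)) b = wt b t * wt b y"
proof -
	note B = weight_basis_span[OF wb]
	let ?S = "{b'\<in>B. r b' < r b \<and> wt b' = wt b}"
	define s where "s y = bracket y b - wt b y *c b" for y
	have s: "s y\<in>cspan ?S" if "y\<in>H" for y using wb assms(2) that by (simp add: wb_def s_def)
	have SW: "cspan ?S\<subseteq>cspan B" by (rule cspan_mono) auto
	have bW: "b\<in>cspan B" using assms(2) by (rule cspan_base)
	have 1: "coord B (bracket y b) b = wt b y" if "y\<in>H" for y
	proof -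
		have "bracket y b = wt b y *c b + s y" by (simp add: s_def)
		moreover have "coord B (s y) b = 0" using coord_span_subset[OF B(2) _ s[OF that]] by auto
		ultimately show ?thesis using s[OF that] SW bW
			by (simp add: coord_add[OF B(2)] coord_scale[OF B(2)] coord_basis[OF B(2) assms(2)] cspan_scale subset_iff)
	qed
	then show "coord B (bracket y b) b = wt b y" using assms by simp
	assume t: "t\<in>H"
	have ts: "bracket t u\<in>cspan ?S" if "u\<in>cspan ?S" for u
	proof (rule lin_on_span[of UNIV "bracket t" ?S])
		fix b' assume b': "b'\<in>?S"
		have "b'\<in>B" using b' by auto
		then have "bracket t b' - wt b' t *c b'\<in>cspan {b''\<in>B. r b'' < r b' \<and> wt b'' = wt b'}"
			using wb t by (simp add: wb_def)
		also have "...\<subseteq>cspan ?S" by (rule cspan_mono) (use b' in auto)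
		finally have "(bracket t b' - wt b' t *c b') + wt b' t *c b'\<in>cspan ?S"
			by (rule cspan_add) (intro cspan_scale cspan_base b')
		then show "bracket t b'\<in>cspan ?S" by simp
	qed (use that in auto)
	have "bracket t (bracket y b) = wt b y *c bracket t b + bracket t (s y)"
		by (simp add: s_def bracket_diff_right bracket_scaleC_right)
	moreover have "coord B (bracket t (s y)) b = 0"
		using coord_span_subset[OF B(2) _ ts[OF s[OF assms(3)]]] by auto
	moreover have "bracket t b\<in>cspan B"
	proof -
		have "bracket t b = wt b t *c b + s t" by (simp add: s_def)
		then show ?thesis using s[OF t] SW bW by (auto intro: cspan_add cspan_scale)
	qed
	ultimately show "coord B (bracket t (bracket y b)) b = wt b t * wt b y"
		using ts[OF s[OF assms(3)]] SW 1[OF t]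
		by (simp add: coord_add[OF B(2)] coord_scale[OF B(2)] cspan_scale subset_iff)
qed

subsection \<open>Traces and the Killing form\<close>

definition trace_on :: "'a::complex_vector set => ('a => 'a) => complex" where
	"trace_on B f = (\<Sum>b\<in>B. coord B (f b) b)"

definition lie_basis :: "'g::fin_dim_lie_algebra set" where
	"lie_basis = (SOME B. finite B \<and> cindep B \<and> cspan B = UNIV)"

lemma lie_basis: "finite (lie_basis :: 'g::fin_dim_lie_algebra set)" "cindep (lie_basis :: 'g set)"
	"cspan (lie_basis :: 'g set) = UNIV"
proof -
	have "\<exists>B::'g set. finite B \<and> cindep B \<and> cspan B = UNIV"
		using fin_dim_basis[OF fin_dim_lie[of UNIV]] by (metis complex_vector.subspace_UNIV)
	from someI_ex[OF this] show "finite (lie_basis :: 'g set)" "cindep (lie_basis :: 'g set)" "cspan (lie_basis :: 'g set) = UNIV"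
		unfolding lie_basis_def by auto
qed

lemma trace_on_basis_indep:
	assumes B: "finite B" "cindep B" "cspan B = UNIV" and C: "finite C" "cindep C" "cspan C = UNIV"
		and f: "lin_on UNIV f"
	shows "trace_on B f = trace_on C f"
proof -
	have "trace_on B f = (\<Sum>b\<in>B. \<Sum>c\<in>C. coord C b c * coord B (f c) b)"
		unfolding trace_on_def
	proof (rule sum.cong[OF refl])
		fix b assume "b\<in>B"
		have "f b = f (\<Sum>c\<in>C. coord C b c *c c)" using coord_expand[OF C(2,1), of b] C(3) by simp
		also have "... = (\<Sum>c\<in>C. coord C b c *c f c)" by (rule lin_on_comb[OF _ f]) auto
		finally show "coord B (f b) b = (\<Sum>c\<in>C. coord C b c * coord B (f c) b)"
			by (simp add: coord_lincomb[OF B(2)] B(3))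
	qed
	also have "... = (\<Sum>c\<in>C. \<Sum>b\<in>B. coord B (f c) b * coord C b c)"
		by (subst sum.swap) (simp add: mult.commute)
	also have "... = trace_on C f"
		unfolding trace_on_def
	proof (rule sum.cong[OF refl])
		fix c assume "c\<in>C"
		have "f c = (\<Sum>b\<in>B. coord B (f c) b *c b)" using coord_expand[OF B(2,1), of "f c"] B(3) by simp
		then have "coord C (f c) c = coord C (\<Sum>b\<in>B. coord B (f c) b *c b) c" by simp
		also have "... = (\<Sum>b\<in>B. coord B (f c) b * coord C b c)" by (simp add: coord_lincomb[OF C(2)] C(3))
		finally show "(\<Sum>b\<in>B. coord B (f c) b * coord C b c) = coord C (f c) c" by simp
	qed
	finally show ?thesis .
qed

definition tr :: "('g::fin_dim_lie_algebra => 'g) => complex" where "tr = trace_on lie_basis"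

lemma tr_basis: "finite B ==> cindep B ==> cspan B = UNIV ==> lin_on UNIV f ==> tr f = trace_on B f"
	unfolding tr_def by (rule trace_on_basis_indep) (use lie_basis in auto)

lemma tr_add: "tr (\<lambda>x. f x + g x) = tr f + tr g"
	unfolding tr_def trace_on_def by (simp add: coord_add[OF lie_basis(2)] lie_basis(3) sum.distrib)
lemma tr_diff: "tr (\<lambda>x. f x - g x) = tr f - tr g"
	unfolding tr_def trace_on_def by (simp add: coord_diff[OF lie_basis(2)] lie_basis(3) sum_subtractf)
lemma tr_scale: "tr (\<lambda>x. c *c f x) = c * tr f"
	unfolding tr_def trace_on_def by (simp add: coord_scale[OF lie_basis(2)] lie_basis(3) sum_distrib_left)
lemma tr_comm: "lin_on UNIV (f :: 'g => 'g::fin_dim_lie_algebra) ==> lin_on UNIV (g :: 'g => 'g) ==> tr (\<lambda>x. f (g x)) = tr (\<lambda>x. g (f x))"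
	using trace_comm[of lie_basis lie_basis f g] unfolding tr_def trace_on_def by (simp add: lie_basis)

text \<open>The trace is taken over the whole algebra even if the arguments lie in a subalgebra, so
  the restriction of this form to a Levi part or a Borel subalgebra is still invariant under that
  subalgebra.\<close>

definition killing :: "'g::fin_dim_lie_algebra => 'g => complex" where
	"killing x y = tr (\<lambda>z. bracket x (bracket y z))"

lemma killing_sym: "killing x y = killing y x"
	unfolding killing_def by (rule tr_comm) auto
lemma killing_add_left: "killing (x + y) z = killing x z + killing y z"
	unfolding killing_def by (simp add: bracket_add_left tr_add)
lemma killing_scale_left: "killing (c *c x) z = c * killing x z"
	unfolding killing_def by (simp add: bracket_scaleC_left tr_scale)
lemma killing_add_right: "killing x (y + z) = killing x y + killing x z"
	by (metis killing_sym killing_add_left)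
lemma killing_scale_right: "killing x (c *c z) = c * killing x z"
	by (metis killing_sym killing_scale_left)
lemma killing_0_left [simp]: "killing 0 x = 0" using killing_scale_left[of 0 0 x] by simp
lemma killing_0_right [simp]: "killing x 0 = 0" using killing_scale_right[of x 0 0] by simp
lemma killing_lin: "lin_on W (killing x)"
	by (simp add: lin_on_def killing_add_right killing_scale_right)
lemma killing_lin': "lin_on W (\<lambda>x. killing x y)"
	by (simp add: lin_on_def killing_add_left killing_scale_left)

lemma killing_invariant: "killing (bracket x y) z = killing x (bracket y z)"
proof -
	have "killing (bracket x y) z = tr (\<lambda>v. bracket x (bracket y (bracket z v))) - tr (\<lambda>v. bracket y (bracket x (bracket z v)))"
		unfolding killing_def by (simp add: bracket_bracket_left tr_diff)
	moreover have "killing x (bracket y z) = tr (\<lambda>v. bracket x (bracket y (bracket z v))) - tr (\<lambda>v. bracket x (bracket z (bracket y v)))"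
		unfolding killing_def by (simp add: bracket_bracket_left bracket_diff_right tr_diff)
	moreover have "tr (\<lambda>v. bracket y (bracket x (bracket z v))) = tr (\<lambda>v. bracket x (bracket z (bracket y v)))"
		by (rule tr_comm[of "bracket y" "\<lambda>v. bracket x (bracket z v)"]) auto
	ultimately show ?thesis by simp
qed

lemma killing_zero_span:
	assumes "\<And>x y. x\<in>A ==> y\<in>B ==> killing x y = 0" "x\<in>cspan A" "y\<in>cspan B"
	shows "killing x y = 0"
proof -
	have "killing x y = 0" if "x\<in>A" for x
		using lin_on_span[OF killing_lin[of UNIV x], of B "{0}" y] assms that
		by (simp add: complex_vector.subspace_0 csub_def)
	then show ?thesis
		using lin_on_span[OF killing_lin'[of UNIV y], of A "{0}" x] assms
		by (simp add: csub_def)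
qed

subsection \<open>Cartan's criterion\<close>

text \<open>On the span of a single element the eigenvalues of \<open>ad x\<close> are replaced by their complex
	conjugates; the resulting operator differs from \<open>ad x\<close> but still acts on \<open>m\<close> by inner derivations.\<close>

lemma cartan_criterion_nilpotent:
	fixes m :: "'g::fin_dim_lie_algebra set"
	assumes m: "subalgebra m" and zero: "\<And>x y. x\<in>m ==> y\<in>m ==> killing x y = 0"
		and x: "x\<in>bracket_set m m"
	shows "gen_eig x 0 = UNIV"
proof -
	note ms = subalg_csub[OF m]
	have xm: "x\<in>m" using x bracket_set_least[OF ms, of m m] subalg_bracket[OF m] by blast
	\<comment> \<open>A line is an abelian subalgebra; its weight basis is a basis of generalized
	  eigenvectors of \<open>ad x\<close> alone.\<close>
	define H where "H = cspan {x}"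
	have Hx: "\<exists>c. y = c *c x" if "y\<in>H" for y using that by (auto simp: H_def complex_vector.span_singleton)
	have br: "bracket y z = 0" if "y\<in>H" "z\<in>H" for y z
		using Hx[OF that(1)] Hx[OF that(2)] by (auto simp: bracket_scaleC_left bracket_scaleC_right bracket_self)
	have H: "subalgebra H" by (auto simp: subalgebra_def br) (simp_all add: H_def cspan_0)
	have "bracket_set H H = {0}"
		using bracket_set_least[of "{0}" H H] br csub_0[OF bracket_set_subspace[of H H]]
		by (auto simp: csub_def)
	then have "(bracket_set H ^^ 1) H = {0}" by simp
	then have "lie_nilpotent H" unfolding lie_nilpotent_def by blast
	then obtain B wt r where wb: "wb H UNIV B wt r"
		using wb_exists[OF H, of UNIV] by auto
	note B = weight_basis_span[OF wb]
	have xH: "x\<in>H" unfolding H_def by (rule cspan_base) simp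
	define S where "S v = (\<Sum>b\<in>B. (coord B v b * cnj (wt b x)) *c b)" for v
	have S_lin: "lin_on UNIV S"
		by (auto simp: lin_on_def S_def coord_add[OF B(2)] coord_scale[OF B(2)] B(3) algebra_simps
				scaleC_add_left sum.distrib scaleC_sum scaleC_scaleC)
	have S_eig: "S v = cnj c *c v" if v: "v\<in>gen_eig x c" for v c
	proof -
		have "S v = (\<Sum>b\<in>B. (coord B v b * cnj c) *c b)"
			unfolding S_def using weight_basis_coord[OF wb xH _ v]
			by (intro sum.cong refl) (auto simp: B(3))
		also have "... = cnj c *c (\<Sum>b\<in>B. coord B v b *c b)"
			by (simp add: scaleC_sum scaleC_scaleC mult.commute)
		finally show ?thesis using coord_expand[OF B(2,1), of v] B(3) by simp
	qed
	\<comment> \<open>On a component \<open>a\<close> with eigenvalue \<open>c\<close> the commutator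
	  of \<open>S\<close> with \<open>ad a\<close> is \<open>ad\<close> of \<open>cnj c\<close> times
	  \<open>a\<close>, because conjugation is additive on eigenvalues. So these commutators are inner
	  derivations by elements of \<open>m\<close>, which the Killing hypothesis can reach.\<close>
	have comm: "\<exists>a'\<in>m. \<forall>v. S (bracket a v) - bracket a (S v) = bracket a' v" if "a\<in>m" for a
	proof -
		have "a\<in>cspan (\<Union>c. m\<inter>gen_eig x c)"
			using single_decomposition[OF ms, of x] subalg_bracket[OF m xm] that by blast
		then show ?thesis
		proof (induction rule: cspan_induct)
			case zero
			show ?case using csub_0[OF ms] lin_on_0[OF _ S_lin] by (intro bexI[of _ 0]) auto
		next
			case (base a)
			then obtain c where a: "a\<in>m" "a\<in>gen_eig x c" by auto
			have "S (bracket a v) - bracket a (S v) = bracket (cnj c *c a) v" for v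
			proof -
				have "v\<in>cspan B" using B(3) by simp
				then show ?thesis
				proof (induction rule: cspan_induct)
					case zero
					then show ?case using lin_on_0[OF _ S_lin] by simp
				next
					case (base b)
					have b: "b\<in>gen_eig x (wt b x)" by (rule weight_basis_gen_eig[OF wb base xH])
					show ?case unfolding S_eig[OF b] S_eig[OF gen_eig_bracket[OF a(2) b]]
						by (simp add: bracket_scaleC_left bracket_scaleC_right scaleC_add_left)
				next
					case (add u v)
					then show ?case by (simp add: bracket_add_right lin_on_add[OF S_lin] algebra_simps)
				next
					case (scale k v)
					then show ?case
						by (simp add: bracket_scaleC_right lin_on_scale[OF S_lin] scaleC_diff_right[symmetric])
				qed
			qed
			then show ?case using csub_scale[OF ms a(1)] by blast
		next
			case (add a b)
			then obtain a' b' where "a'\<in>m" "b'\<in>m" "\<forall>v. S (bracket a v) - bracket a (S v) = bracket a' v"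
				"\<forall>v. S (bracket b v) - bracket b (S v) = bracket b' v" by blast
			then show ?case using csub_add[OF ms, of a' b']
				by (intro bexI[of _ "a' + b'"]) (auto simp: bracket_add_left lin_on_add[OF S_lin] algebra_simps)
		next
			case (scale k a)
			then obtain a' where "a'\<in>m" "\<forall>v. S (bracket a v) - bracket a (S v) = bracket a' v" by blast
			then show ?case using csub_scale[OF ms, of a' k]
				by (intro bexI[of _ "k *c a'"])
					(auto simp: bracket_scaleC_left lin_on_scale[OF S_lin] scaleC_diff_right[symmetric])
		qed
	qed
	have "tr (\<lambda>v. S (bracket x v)) = 0"
		using x unfolding bracket_set_def
	proof (induction rule: cspan_induct)
		case zero
		show ?case using lin_on_0[OF _ S_lin] tr_scale[of 0 "\<lambda>_. 0"] by simp
	next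
		case (base z)
		then obtain a b where ab: "a\<in>m" "b\<in>m" "z = bracket a b" by blast
		obtain a' where a': "a'\<in>m" "\<And>v. S (bracket a v) - bracket a (S v) = bracket a' v" using comm[OF ab(1)] by blast
		have lin: "lin_on UNIV (\<lambda>v. S (bracket b v))"
			using S_lin by (auto simp: lin_on_def bracket_add_right bracket_scaleC_right)
		have "tr (\<lambda>v. S (bracket z v)) = tr (\<lambda>v. S (bracket a (bracket b v))) - tr (\<lambda>v. S (bracket b (bracket a v)))"
			unfolding ab by (simp add: bracket_bracket_left lin_on_diff[OF _ S_lin] tr_diff)
		also have "tr (\<lambda>v. S (bracket b (bracket a v))) = tr (\<lambda>v. bracket a (S (bracket b v)))"
			by (rule tr_comm[OF lin]) auto
		also have "tr (\<lambda>v. S (bracket a (bracket b v))) - tr (\<lambda>v. bracket a (S (bracket b v))) = killing a' b"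
			unfolding killing_def a'(2)[symmetric] by (simp add: tr_diff)
		finally show ?case using zero[OF a'(1) ab(2)] by simp
	next
		case (add u v)
		then show ?case by (simp add: bracket_add_left lin_on_add[OF S_lin] tr_add)
	next
		case (scale k v)
		then show ?case by (simp add: bracket_scaleC_left lin_on_scale[OF S_lin] tr_scale)
	qed
	moreover have "tr (\<lambda>v. S (bracket x v)) = (\<Sum>b\<in>B. cnj (wt b x) * wt b x)"
	proof -
		have "lin_on UNIV (\<lambda>v. S (bracket x v))"
			using S_lin by (auto simp: lin_on_def bracket_add_right bracket_scaleC_right)
		then have "tr (\<lambda>v. S (bracket x v)) = trace_on B (\<lambda>v. S (bracket x v))" by (rule tr_basis[OF B])
		also have "... = (\<Sum>b\<in>B. cnj (wt b x) * wt b x)"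
			unfolding trace_on_def S_def
			by (intro sum.cong refl)
				(subst coord_lincomb_basis[OF B(2,1)], auto simp: wb_coord_ad(1)[OF wb _ xH] mult.commute)
		finally show ?thesis .
	qed
	\<comment> \<open>Conjugate eigenvalues were chosen for this point: a vanishing sum of squared
	  moduli forces every eigenvalue of \<open>ad x\<close> to be 0.\<close>
	ultimately have "(\<Sum>b\<in>B. cnj (wt b x) * wt b x) = 0" by simp
	then have "(\<Sum>b\<in>B. complex_of_real ((cmod (wt b x))\<^sup>2)) = 0"
		by (simp only: complex_norm_square mult.commute)
	then have "complex_of_real (\<Sum>b\<in>B. (cmod (wt b x))\<^sup>2) = 0" by (simp only: of_real_sum)
	then have "(\<Sum>b\<in>B. (cmod (wt b x))\<^sup>2) = 0" by (simp only: of_real_eq_0_iff)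
	then have "\<forall>b\<in>B. wt b x = 0" using B(1) by (simp add: sum_nonneg_eq_0_iff)
	then have "B\<subseteq>gen_eig x 0" using weight_basis_gen_eig[OF wb _ xH] by force
	then have "cspan B\<subseteq>gen_eig x 0" by (rule cspan_least) simp
	then show ?thesis using B(3) by auto
qed

text \<open>Modulo \<open>K\<close>, the \<open>k\<close>-th power of \<open>ad y\<close> sends
  \<open>x\<close> to \<open>c ^ k\<close> times \<open>x\<close>. Nilpotency puts such a multiple
  into \<open>K\<close>, but \<open>x\<close> itself is outside.\<close>

lemma nilpotent_character_zero:
	assumes "csub K" "bracket y x - c *c x\<in>K" "x \<notin> K" "x\<in>gen_eig y 0" "\<And>k. k\<in>K ==> bracket y k\<in>K"
	shows "c = 0"
proof (rule ccontr)
	assume c: "c\<noteq>0"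
	obtain n where n: "(adm y 0 ^^ n) x = 0" using assms(4) by (auto simp: gen_eig_def)
	have "(adm y 0 ^^ k) x - c ^ k *c x\<in>K" for k
	proof (induction k)
		case (Suc k)
		have "adm y 0 ((adm y 0 ^^ k) x) - c ^ Suc k *c x
			= bracket y ((adm y 0 ^^ k) x - c ^ k *c x) + c ^ k *c (bracket y x - c *c x)"
			unfolding bracket_diff_right bracket_scaleC_right
			by (simp add: adm_def scaleC_diff_right scaleC_scaleC mult.commute)
		also have "...\<in>K" using Suc assms by (intro csub_add csub_scale) auto
		finally show ?case by simp
	qed (use assms in \<open>auto simp: csub_0 scaleC_one\<close>)
	from this[of n] have "- inverse (c ^ n) *c (0 - c ^ n *c x)\<in>K" unfolding n by (rule csub_scale[OF assms(1)])
	then show False using c assms(3) by (simp add: scaleC_scaleC scaleC_one)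
qed

text \<open>All elements of \<open>d = [m, m]\<close> are ad-nilpotent. A solvable subalgebra
  \<open>K\<close> of \<open>d\<close> of maximal dimension must be \<open>d\<close>: Lie's theorem
  gives an eigenvector modulo \<open>K\<close>, its weight is 0 by nilpotency, and adjoining it to
  \<open>K\<close> gives a larger solvable subalgebra.\<close>

theorem cartan_criterion:
	fixes m :: "'g::fin_dim_lie_algebra set"
	assumes m: "subalgebra m" and zero: "\<And>x y. x\<in>m ==> y\<in>m ==> killing x y = 0"
	shows "lie_solvable m"
proof -
	define d where "d = bracket_set m m"
	note ms = subalg_csub[OF m]
	have dm: "d\<subseteq>m" unfolding d_def by (rule bracket_set_least[OF ms]) (use subalg_bracket[OF m] in auto)
	have d: "subalgebra d" unfolding subalgebra_def using dm by (auto simp: d_def intro: bracket_in_set)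
	note ds = subalg_csub[OF d]
	have nil: "z\<in>gen_eig y 0" if "y\<in>d" for y z
		using cartan_criterion_nilpotent[OF m zero] that unfolding d_def by auto
	define P where "P K \<longleftrightarrow> subalgebra K \<and> lie_solvable K \<and> K\<subseteq>d" for K
	have "P {0}" unfolding P_def subalgebra_def lie_solvable_iff using csub_0[OF ds]
		by (auto simp: csub_def intro!: exI[of _ 0])
	moreover have bd: "cdim K \<le> cdim (UNIV :: 'g set)" if "P K" for K :: "'g set"
	proof (cases "K = UNIV")
		case False
		then have "K \<subset> UNIV" by auto
		moreover have "csub K" using that by (simp add: P_def subalg_csub)
		ultimately show ?thesis using dim_less[OF fin_dim_lie, of K UNIV] by simp
	qed simp
	ultimately obtain K where K: "P K" and max: "\<And>K'. P K' ==> cdim K' \<le> cdim K"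
		using ex_has_greatest_nat[of P "{0}" cdim "Suc (cdim (UNIV :: 'g set))"] by (metis le_imp_less_Suc)
	have Ks: "csub K" and Kalg: "subalgebra K" and Ksol: "lie_solvable K" and Kd: "K\<subseteq>d" using K by (auto simp: P_def subalg_csub)
	have "K = d"
	proof (rule ccontr)
		assume "K\<noteq>d"
		then have "K \<subset> d" using Kd by auto
		have rep: "lie_rep K d bracket"
			by (rule lie_rep_ad[OF Kalg ds]) (use subalg_bracket[OF d] Kd in auto)
		have "\<exists>x\<in>d - K. \<exists>\<chi>. \<forall>y\<in>K. bracket y x - \<chi> y *c x\<in>K"
			by (rule lie_theorem[OF rep Ksol fin_dim_lie Ks \<open>K \<subset> d\<close>]) (rule subalg_bracket[OF Kalg])
		then obtain x \<chi> where x: "x\<in>d" "x \<notin> K" "\<And>y. y\<in>K ==> bracket y x - \<chi> y *c x\<in>K" by blast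
		have xK: "bracket y x\<in>K" if y: "y\<in>K" for y
		proof -
			have "\<chi> y = 0"
				by (rule nilpotent_character_zero[OF Ks x(3)[OF y] x(2) nil]) (use y Kd subalg_bracket[OF Kalg] in auto)
			then show ?thesis using x(3)[OF y] by simp
		qed
		define K' where "K' = cspan (insert x K)"
		have K'sub: "csub K'" by (simp add: K'_def)
		have K'e: "\<exists>c. \<exists>k\<in>K. y = k + c *c x" if yK: "y\<in>K'" for y
		proof -
			obtain c where "y - c *c x\<in>cspan K" using yK complex_vector.span_breakdown_eq[of y x K] unfolding K'_def by blast
			then show ?thesis using cspan_eq[OF Ks] by (intro exI[of _ c] bexI[of _ "y - c *c x"]) auto
		qed
		\<comment> \<open>The derived algebra of the extension by \<open>x\<close> stays inside
		  \<open>K\<close>; solvability of the extension follows at once.\<close>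
		have br: "bracket y z\<in>K" if yz: "y\<in>K'" "z\<in>K'" for y z
		proof -
			obtain c k c' k' where *: "k\<in>K" "k'\<in>K" "y = k + c *c x" "z = k' + c' *c x"
				using K'e[OF yz(1)] K'e[OF yz(2)] by blast
			have "bracket y z = bracket k k' + c' *c bracket k x - c *c bracket k' x"
				unfolding * using bracket_anti[of x k']
				by (simp add: bracket_add_left bracket_add_right bracket_scaleC_left bracket_scaleC_right bracket_self)
			also have "...\<in>K" using * xK subalg_bracket[OF Kalg] by (intro csub_add[OF Ks] csub_diff[OF Ks] csub_scale[OF Ks]) auto
			finally show ?thesis .
		qed
		have KK': "K\<subseteq>K'" unfolding K'_def using cspan_superset[of "insert x K"] by auto
		have "P K'" unfolding P_def
		proof (intro conjI)
			show "subalgebra K'" unfolding subalgebra_def using K'sub br KK' by auto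
			show "lie_solvable K'" by (rule lie_solvable_derived[OF Ksol bracket_set_least[OF Ks br]])
			show "K'\<subseteq>d" unfolding K'_def by (rule cspan_least) (use x Kd ds in auto)
		qed
		moreover have "K \<subset> K'" using KK' x(2) cspan_base[of x "insert x K"] by (auto simp: K'_def)
		then have "cdim K < cdim K'" by (intro dim_less) (auto simp: Ks K'sub)
		ultimately show False using max by force
	qed
	then show ?thesis using lie_solvable_derived[of d m] Ksol by (simp add: d_def)
qed

section \<open>Root space decomposition\<close>

lemma bracket_span:
	assumes "\<And>x y. x\<in>A ==> y\<in>B ==> bracket x y\<in>W" "csub W" "x\<in>cspan A" "y\<in>cspan (B::'g::lie_algebra set)"
	shows "bracket x y\<in>W"
proof -
	have "bracket x y\<in>W" if "x\<in>A" for x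
		using lin_on_span[of UNIV "bracket x" B W y] assms that by auto
	then show ?thesis using lin_on_span[of UNIV "\<lambda>x. bracket x y" A W x] assms by auto
qed

locale reductive_cartan =
	fixes H :: "'g::fin_dim_lie_algebra set"
	assumes red: "reductive (UNIV :: 'g set)" and cart: "cartan_subalgebra H"
begin

lemma H_subalgebra: "subalgebra H" and H_nilpotent: "lie_nilpotent H"
	and H_normalizer: "(\<And>y. y\<in>H ==> bracket x y\<in>H) ==> x\<in>H"
	using cart by (auto simp: cartan_subalgebra_def)

lemma H_subspace [simp]: "csub H" using H_subalgebra by (rule subalg_csub)

definition Z :: "'g set" where "Z = {x. \<forall>y. bracket x y = 0}"

lemma Z_subspace [simp]: "csub Z"
	by (rule csubI) (auto simp: Z_def bracket_add_left bracket_scaleC_left)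

lemma Z_H: "Z\<subseteq>H"
	using H_normalizer csub_0[OF H_subspace] by (auto simp: Z_def)

lemma killing_Z: "z\<in>Z ==> killing z x = 0"
	using tr_scale[of 0 "\<lambda>_. 0"] by (simp add: Z_def killing_def)

text \<open>The kernel of the Killing form is an ideal, solvable by Cartan's criterion, hence inside
  the radical, which is the centre of a reductive algebra.\<close>

lemma killing_radical:
	assumes "\<And>y. killing x y = 0" shows "x\<in>Z"
proof -
	define I where "I = {x::'g. \<forall>y. killing x y = 0}"
	have sub: "csub I" by (rule csubI) (auto simp: I_def killing_add_left killing_scale_left)
	have ideal: "bracket u v\<in>I" if "v\<in>I" for u v
	proof -
		have "killing (bracket u v) w = 0" for w
		proof -
			have "killing (bracket u v) w = - killing (bracket v u) w"
				using killing_scale_left[of "-1" "bracket v u" w] bracket_anti[of u v] by simp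
			then show ?thesis using that by (simp add: killing_invariant I_def)
		qed
		then show ?thesis by (simp add: I_def)
	qed
	have "subalgebra I" unfolding subalgebra_def using sub ideal by auto
	then have "lie_solvable I" by (rule cartan_criterion) (auto simp: I_def)
	moreover have "lie_ideal I UNIV" unfolding lie_ideal_def using sub ideal by auto
	ultimately have "I\<subseteq>radical UNIV"
		unfolding radical_def by (intro subsetI cspan_base) auto
	moreover have "radical UNIV = lie_center (UNIV :: 'g set)" using red by (simp add: reductive_def)
	moreover have "x\<in>I" using assms by (simp add: I_def)
	ultimately show ?thesis by (auto simp: lie_center_def Z_def)
qed

definition WB where "WB = (SOME t. wb H UNIV (fst t) (fst (snd t)) (snd (snd t)))"
definition B where "B = fst WB"
definition wt where "wt = fst (snd WB)"
definition rk where "rk = snd (snd WB)"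

lemma wb: "wb H UNIV B wt rk"
proof -
	obtain B' wt' r' where "wb H UNIV B' wt' (r' :: 'g => nat)"
		using wb_exists[OF H_subalgebra H_nilpotent, of UNIV] by auto
	then have "\<exists>t. wb H UNIV (fst t) (fst (snd t)) (snd (snd t) :: 'g => nat)"
		by (intro exI[of _ "(B', wt', r')"]) simp
	from someI_ex[OF this] show ?thesis unfolding B_def wt_def rk_def WB_def .
qed

lemmas Bfin = weight_basis_span(1)[OF wb] and Bind = weight_basis_span(2)[OF wb] and Bspan = weight_basis_span(3)[OF wb]

lemma wt_off: "b\<in>B ==> y \<notin> H ==> wt b y = 0"
	using wb by (simp add: wb_def)

lemma wt_dual: "b\<in>B ==> wt b\<in>dual_space H"
	unfolding dual_space_def
proof (intro CollectI conjI ballI allI impI)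
	fix x y assume "b\<in>B" "x\<in>H" "y\<in>H"
	then show "wt b (x + y) = wt b x + wt b y"
		using wb_coord_ad(1)[OF wb \<open>b\<in>B\<close>, symmetric] csub_add[OF H_subspace, of x y]
		by (simp add: bracket_add_left coord_add[OF Bind] Bspan)
next
	fix c x assume "b\<in>B" "x\<in>H"
	then show "wt b (c *c x) = c * wt b x"
		using wb_coord_ad(1)[OF wb \<open>b\<in>B\<close>, symmetric] csub_scale[OF H_subspace, of x c]
		by (simp add: bracket_scaleC_left coord_scale[OF Bind] Bspan)
qed (auto simp: wt_off)

lemma wt_commutator: "b\<in>B ==> x\<in>H ==> y\<in>H ==> wt b (bracket x y) = 0"
	using wb_coord_ad(1)[OF wb, of b "bracket x y", symmetric] subalg_bracket[OF H_subalgebra, of x y]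
		wb_coord_ad(2)[OF wb, of b]
	by (simp add: bracket_bracket_left coord_diff[OF Bind] Bspan)

text \<open>At this stage a generalized weight space; that \<open>H\<close> acts on it by scalars
  when \<open>s\<close> is nonzero is only obtained in \<open>root_eig\<close>, after the space is
  known to be a line.\<close>

definition rs :: "('g => complex) => 'g set" where "rs s = cspan {b\<in>B. wt b = s}"

lemma rs_subspace [simp]: "csub (rs s)" by (simp add: rs_def)

lemma wt_rs: "b\<in>B ==> b\<in>rs (wt b)" unfolding rs_def by (rule cspan_base) simp

lemma rs_gen_eig: "x\<in>rs s ==> y\<in>H ==> x\<in>gen_eig y (s y)"
	unfolding rs_def using cspan_least[OF _ gen_eig_subspace[of y "s y"], of "{b\<in>B. wt b = s}"]
		weight_basis_gen_eig[OF wb] by blast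

lemma rsI:
	assumes "\<And>y. y\<in>H ==> x\<in>gen_eig y (s y)" "\<And>y. y \<notin> H ==> s y = 0"
	shows "x\<in>rs s"
	unfolding rs_def
proof (rule coord_zero_in_span[OF Bind Bfin])
	fix b assume b: "b\<in>B - {b\<in>B. wt b = s}"
	then obtain y where y: "wt b y\<noteq>s y" by auto
	then have "y\<in>H" using b assms(2) wt_off by fastforce
	then show "coord B x b = 0" using weight_basis_coord[OF wb, of y x "s y" b] assms(1) b y by simp
qed (auto simp: Bspan)

lemma rs_nonzero_basis: "x\<in>rs s ==> x\<noteq>0 ==> \<exists>b\<in>B. wt b = s"
proof (rule ccontr)
	assume *: "x\<in>rs s" "x\<noteq>0" "\<not> (\<exists>b\<in>B. wt b = s)"
	then have "{b\<in>B. wt b = s} = {}" by auto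
	then have "rs s = {0}" unfolding rs_def by (simp only: complex_vector.span_empty)
	then show False using * by simp
qed

lemma rs_off: "x\<in>rs s ==> x\<noteq>0 ==> y \<notin> H ==> s y = 0"
	using rs_nonzero_basis wt_off by blast

lemma rs_dual: "x\<in>rs s ==> x\<noteq>0 ==> s\<in>dual_space H"
	using rs_nonzero_basis wt_dual by blast

lemma rs_bracket: "x\<in>rs s ==> z\<in>rs h ==> bracket x z\<in>rs (s + h)"
proof (cases "x = 0 \<or> z = 0")
	case False
	assume *: "x\<in>rs s" "z\<in>rs h"
	show ?thesis
	proof (rule rsI)
		fix y assume "y\<in>H"
		then show "bracket x z\<in>gen_eig y ((s + h) y)"
			using gen_eig_bracket[OF rs_gen_eig[OF *(1)] rs_gen_eig[OF *(2)]] by simp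
	qed (use * False rs_off[of x s] rs_off[of z h] in auto)
qed (auto simp: csub_0)

lemma rs_coord: "x\<in>rs s ==> b\<in>B ==> wt b\<noteq>s ==> coord B x b = 0"
	unfolding rs_def by (rule coord_span_subset[OF Bind]) auto

lemma rs_disjoint: "x\<in>rs s ==> x\<in>rs h ==> s\<noteq>h ==> x = 0"
proof -
	assume *: "x\<in>rs s" "x\<in>rs h" "s\<noteq>h"
	then have "coord B x b = 0" if "b\<in>B" for b using rs_coord[of x _ b] that by metis
	then show "x = 0" using coord_expand[OF Bind Bfin, of x] Bspan by simp
qed

text \<open>If \<open>H\<close> were smaller, Lie's theorem on the zero weight space modulo
  \<open>H\<close> would give a vector outside \<open>H\<close> that is an eigenvector modulo
  \<open>H\<close>. Its weight is 0, so it normalizes \<open>H\<close>, which a Cartan subalgebra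
  excludes.\<close>

lemma rs_0: "rs 0 = H"
proof
	show "H\<subseteq>rs 0" using nilpotent_ad[OF H_nilpotent] by (auto intro!: rsI)
	show "rs 0\<subseteq>H"
	proof (rule ccontr)
		assume "\<not> rs 0\<subseteq>H"
		then have "H \<subset> rs 0" using \<open>H\<subseteq>rs 0\<close> by auto
		have st: "bracket y w\<in>rs 0" if "y\<in>H" "w\<in>rs 0" for y w
			using rs_bracket[of y 0 w 0] that \<open>H\<subseteq>rs 0\<close> by auto
		have rep: "lie_rep H (rs 0) bracket" by (rule lie_rep_ad[OF H_subalgebra rs_subspace st])
		have "\<exists>x\<in>rs 0 - H. \<exists>\<chi>. \<forall>y\<in>H. bracket y x - \<chi> y *c x\<in>H"
			by (rule lie_theorem[OF rep nilpotent_solvable[OF H_nilpotent H_subalgebra] fin_dim_lie H_subspace \<open>H \<subset> rs 0\<close>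
					subalg_bracket[OF H_subalgebra]])
		then obtain x \<chi> where x: "x\<in>rs 0" "x \<notin> H" "\<And>y. y\<in>H ==> bracket y x - \<chi> y *c x\<in>H" by blast
		have "bracket x y\<in>H" if "y\<in>H" for y
		proof -
			have "\<chi> y = 0"
				by (rule nilpotent_character_zero[OF H_subspace x(3)[OF that] x(2)])
					(use rs_gen_eig[OF x(1) that] subalg_bracket[OF H_subalgebra that] in auto)
			then have "bracket y x\<in>H" using x(3)[OF that] by simp
			then show ?thesis using bracket_anti[of x y] csub_neg[OF H_subspace] by auto
		qed
		then show False using H_normalizer x(2) by blast
	qed
qed

text \<open>The product of the two adjoint maps shifts every weight by \<open>s + h\<close>, so its
  matrix in the weight basis has zero diagonal.\<close>

lemma killing_orthogonal:
	assumes "x\<in>rs s" "z\<in>rs h" "s + h\<noteq>0" shows "killing x z = 0"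
proof -
	have "killing x z = trace_on B (\<lambda>v. bracket x (bracket z v))"
		unfolding killing_def by (rule tr_basis[OF Bfin Bind Bspan]) simp
	also have "... = 0"
		unfolding trace_on_def
	proof (rule sum.neutral, rule ballI)
		fix b assume b: "b\<in>B"
		have "bracket x (bracket z b)\<in>rs (s + (h + wt b))"
			using assms wt_rs[OF b] by (intro rs_bracket)
		moreover have "wt b\<noteq>s + (h + wt b)" using assms(3) by (metis add.assoc add.left_neutral add_right_cancel)
		ultimately show "coord B (bracket x (bracket z b)) b = 0" using rs_coord b by blast
	qed
	finally show ?thesis .
qed

lemma killing_H: "t\<in>H ==> y\<in>H ==> killing t y = (\<Sum>b\<in>B. wt b t * wt b y)"
proof -
	assume *: "t\<in>H" "y\<in>H"
	have "killing t y = trace_on B (\<lambda>v. bracket t (bracket y v))"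
		unfolding killing_def by (rule tr_basis[OF Bfin Bind Bspan]) simp
	also have "... = (\<Sum>b\<in>B. wt b t * wt b y)"
		unfolding trace_on_def using wb_coord_ad(2)[OF wb] * by (intro sum.cong refl) auto
	finally show ?thesis .
qed

lemma killing_B_zero: "(\<And>b. b\<in>B ==> killing x b = 0) ==> killing x y = 0"
	using killing_zero_span[of "{x}" B x y] Bspan cspan_base[of x "{x}"] by auto

text \<open>Weights vanish on commutators of \<open>H\<close>, so these are Killing-orthogonal to
  \<open>H\<close> by the sum formula and to the other weight spaces by shifting. This weak form of
  commutativity is what the solvability arguments use.\<close>

lemma H_commutator_central: "x\<in>H ==> y\<in>H ==> bracket x y\<in>Z"
proof (rule killing_radical, rule killing_B_zero)
	fix b assume *: "x\<in>H" "y\<in>H" "b\<in>B"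
	have xy: "bracket x y\<in>H" using * subalg_bracket[OF H_subalgebra] by auto
	show "killing (bracket x y) b = 0"
	proof (cases "wt b = 0")
		case True
		then have "b\<in>H" using wt_rs[OF *(3)] rs_0 by auto
		then show ?thesis using killing_H[OF xy] wt_commutator * by simp
	next
		case False
		then show ?thesis using killing_orthogonal[of "bracket x y" 0 b "wt b"] xy rs_0 wt_rs[OF *(3)] by simp
	qed
qed

text \<open>Otherwise \<open>e\<close> would be orthogonal to the whole weight basis, hence central,
  hence of weight 0.\<close>

lemma killing_pairing:
	assumes "e\<in>rs s" "e\<noteq>0" "s\<noteq>0" shows "\<exists>f\<in>rs (- s). killing e f\<noteq>0"
proof (rule ccontr)
	assume *: "\<not> ?thesis"
	have "killing e b = 0" if b: "b\<in>B" for b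
	proof (cases "wt b = - s")
		case True then show ?thesis using * wt_rs[OF b] by auto
	next
		case False
		then have "s + wt b\<noteq>0" by (metis add.right_inverse add_left_cancel eq_neg_iff_add_eq_0)
		then show ?thesis using killing_orthogonal assms(1) wt_rs[OF b] by blast
	qed
	then have "e\<in>Z" using killing_B_zero by (intro killing_radical) blast
	then have "e\<in>rs 0" using Z_H rs_0 by auto
	then show False using rs_disjoint[OF assms(1)] assms(2,3) by blast
qed

lemma partial_trace:
	assumes C: "finite C" "cindep C" and e: "\<And>b. b\<in>C ==> bracket e b\<in>cspan C" and f: "\<And>b. b\<in>C ==> bracket f b\<in>cspan C"
	shows "(\<Sum>b\<in>C. coord C (bracket (bracket e f) b) b) = 0"
proof -
	have st: "bracket x v\<in>cspan C" if "\<And>b. b\<in>C ==> bracket x b\<in>cspan C" "v\<in>cspan C" for x v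
		by (rule lin_on_span[of UNIV "bracket x" C]) (use that in auto)
	have "(\<Sum>b\<in>C. coord C (bracket e (bracket f b)) b) = (\<Sum>b\<in>C. coord C (bracket f (bracket e b)) b)"
		by (rule trace_comm) (use C e f in auto)
	moreover have "coord C (bracket (bracket e f) b) b = coord C (bracket e (bracket f b)) b - coord C (bracket f (bracket e b)) b"
		if "b\<in>C" for b
		unfolding bracket_bracket_left by (rule coord_diff[OF C(2)]) (use st e f that in auto)
	ultimately show ?thesis by (simp add: sum_subtractf)
qed

lemma coord_sub: "C\<subseteq>B ==> x\<in>cspan C ==> coord C x = coord B x"
	using complex_vector.representation_extend[OF Bind, of x C] by simp

text \<open>The trace of a commutator on a space stable under both factors is 0, and on a sum of
  weight spaces it is the sum of the weights. All statements about strings of roots are derived from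
  this identity.\<close>

lemma string_trace:
	assumes "bracket e f\<in>H"
		and e: "\<And>b. b\<in>B ==> wt b\<in>A ==> bracket e b\<in>cspan {b\<in>B. wt b\<in>A}"
		and f: "\<And>b. b\<in>B ==> wt b\<in>A ==> bracket f b\<in>cspan {b\<in>B. wt b\<in>A}"
	shows "(\<Sum>b\<in>{b\<in>B. wt b\<in>A}. wt b (bracket e f)) = 0"
proof -
	let ?C = "{b\<in>B. wt b\<in>A}"
	have C: "finite ?C" "cindep ?C" using Bfin complex_vector.independent_mono[OF Bind] by auto
	have "(\<Sum>b\<in>?C. coord ?C (bracket (bracket e f) b) b) = 0"
		by (rule partial_trace[OF C]) (use e f in auto)
	moreover have "coord ?C (bracket (bracket e f) b) b = wt b (bracket e f)" if b: "b\<in>?C" for b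
	proof -
		have "bracket (bracket e f) b\<in>rs (0 + wt b)"
			using assms(1) rs_0 wt_rs[of b] b by (intro rs_bracket) auto
		also have "rs (0 + wt b)\<subseteq>cspan ?C" unfolding rs_def using b by (intro cspan_mono) auto
		finally have "coord ?C (bracket (bracket e f) b) b = coord B (bracket (bracket e f) b) b"
			by (subst coord_sub) auto
		then show ?thesis using wb_coord_ad(1)[OF wb _ assms(1)] b by simp
	qed
	ultimately show ?thesis by simp
qed

lemma rs_cspan: "s\<in>A ==> x\<in>rs s ==> x\<in>cspan {b\<in>B. wt b\<in>A}"
	unfolding rs_def using cspan_mono[of "{b\<in>B. wt b = s}" "{b\<in>B. wt b\<in>A}"] by auto

definition root :: "('g => complex) => bool" where "root s \<longleftrightarrow> s\<noteq>0 \<and> rs s\<noteq>{0}"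

abbreviation RS where "RS W \<equiv> (\<Union>a\<in>{a. root a \<and> rs a \<subseteq> W}. rs a)"

lemma rootI: "x\<in>rs s ==> x\<noteq>0 ==> s\<noteq>0 ==> root s" by (auto simp: root_def)

lemma rootE: assumes "root s" obtains x where "x\<in>rs s" "x\<noteq>0" "s\<noteq>0"
	using assms csub_0[OF rs_subspace[of s]] by (auto simp: root_def)

lemma root_neg: "root s ==> root (- s)"
proof -
	assume "root s"
	then obtain e where e: "e\<in>rs s" "e\<noteq>0" "s\<noteq>0" by (rule rootE)
	then obtain f where "f\<in>rs (- s)" "killing e f\<noteq>0" using killing_pairing by blast
	then show ?thesis using e(3) by (intro rootI[of f]) auto
qed

section \<open>Root strings, pairs of opposite root vectors and one-dimensional root spaces\<close>

definition shift :: "('g => complex) => ('g => complex) => int => 'g => complex" where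
	"shift h s k = (\<lambda>y. h y + of_int k * s y)"

lemma shift_add: "s + shift h s k = shift h s (k + 1)" "- s + shift h s k = shift h s (k - 1)"
	by (auto simp: shift_def fun_eq_iff algebra_simps)

text \<open>Taking \<open>e\<close> of least rank in its weight block makes it a genuine
  eigenvector. If \<open>s\<close> vanished on \<open>t = [e, f]\<close>, all weights of an
  \<open>s\<close>-string would agree on \<open>t\<close>, and the trace over the string would make
  each of them 0 there. Then \<open>t\<close> is orthogonal to \<open>H\<close>, although
  \<open>killing t y\<close> equals \<open>s y\<close> times the nonzero
  \<open>killing e f\<close>.\<close>

lemma sl2_aux:
	assumes "root s"
	obtains e f where "e\<in>rs s" "e\<noteq>0" "\<And>y. y\<in>H ==> bracket y e = s y *c e" "f\<in>rs (- s)"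
		"bracket e f\<in>H" "s (bracket e f)\<noteq>0"
proof -
	have a0: "s\<noteq>0" using assms by (simp add: root_def)
	obtain x where "x\<in>rs s" "x\<noteq>0" using assms by (rule rootE)
	then obtain b1 where "b1\<in>B \<and> wt b1 = s" using rs_nonzero_basis by blast
	then obtain e where e: "e\<in>B" "wt e = s" and least: "\<And>b. b\<in>B \<and> wt b = s ==> rk e \<le> rk b"
		using ex_has_least_nat[of "\<lambda>b. b\<in>B \<and> wt b = s" b1 rk] by blast
	have "e\<noteq>0" using e(1) Bind complex_vector.dependent_zero by blast
	have ee: "e\<in>rs s" using wt_rs[OF e(1)] e(2) by simp
	have eig: "bracket y e = s y *c e" if "y\<in>H" for y
	proof -
		have "bracket y e - wt e y *c e\<in>cspan {b'\<in>B. rk b' < rk e \<and> wt b' = wt e}"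
			using wb e(1) that unfolding wb_def by blast
		also have "{b'\<in>B. rk b' < rk e \<and> wt b' = wt e} = {}" using least e by force
		finally show ?thesis using e by simp
	qed
	obtain f where f: "f\<in>rs (- s)" "killing e f\<noteq>0" using killing_pairing[OF ee \<open>e\<noteq>0\<close> a0] by blast
	define t where "t = bracket e f"
	have tH: "t\<in>H" using rs_bracket[OF ee f(1)] rs_0 by (simp add: t_def)
	have kt: "killing t y = s y * killing e f" if "y\<in>H" for y
		unfolding t_def killing_sym[of _ y] killing_invariant[symmetric] eig[OF that] killing_scale_left ..
	have "s t\<noteq>0"
	proof
		assume at: "s t = 0"
		have "wt b t = 0" if b: "b\<in>B" for b
		proof -
			let ?A = "range (shift (wt b) s)"
			have "(\<Sum>b'\<in>{b'\<in>B. wt b'\<in>?A}. wt b' t) = 0"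
				unfolding t_def
			proof (rule string_trace)
				fix b' assume b': "b'\<in>B" "wt b'\<in>?A"
				then obtain k where k: "wt b' = shift (wt b) s k" by auto
				have "bracket e b'\<in>rs (s + wt b')" "bracket f b'\<in>rs (- s + wt b')"
					by (rule rs_bracket[OF ee wt_rs[OF b'(1)]], rule rs_bracket[OF f(1) wt_rs[OF b'(1)]])
				then show "bracket e b'\<in>cspan {b'\<in>B. wt b'\<in>?A}" "bracket f b'\<in>cspan {b'\<in>B. wt b'\<in>?A}"
					unfolding k shift_add by (auto intro: rs_cspan[rotated])
			qed (use tH in \<open>simp add: t_def\<close>)
			moreover have "wt b' t = wt b t" if "b'\<in>{b'\<in>B. wt b'\<in>?A}" for b'
				using that at by (auto simp: shift_def)
			ultimately have "of_nat (card {b'\<in>B. wt b'\<in>?A}) * wt b t = 0" by simp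
			moreover have "b\<in>{b'\<in>B. wt b'\<in>?A}"
				using b by (auto intro!: image_eqI[of _ _ 0] simp: shift_def)
			then have "card {b'\<in>B. wt b'\<in>?A}\<noteq>0" using Bfin by (subst card_0_eq) auto
			ultimately show ?thesis by simp
		qed
		then have "killing t y = 0" if "y\<in>H" for y using killing_H[OF tH that] by simp
		then have "s y = 0" if "y\<in>H" for y using kt[OF that] f(2) that by simp
		moreover have "s y = 0" if "y \<notin> H" for y using rs_off[OF ee \<open>e\<noteq>0\<close> that] .
		ultimately show False using a0 by (auto simp: fun_eq_iff)
	qed
	then show thesis using that[OF ee \<open>e\<noteq>0\<close> eig f(1)] tH unfolding t_def by blast
qed

text \<open>The trace of \<open>[e, f]\<close> on the span of \<open>e\<close>, \<open>H\<close> and the spaces of weight \<open>- k s\<close> vanishes,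
	which leaves room for just one basis vector of weight \<open>- s\<close>.\<close>

lemma root_space_dim_one:
	assumes "root s" shows "\<exists>b\<in>B. {b'\<in>B. wt b' = - s} = {b}"
proof -
	obtain e f where e: "e\<in>rs s" "e\<noteq>0" and eig: "\<And>y. y\<in>H ==> bracket y e = s y *c e" and f: "f\<in>rs (- s)"
		and tH: "bracket e f\<in>H" and at: "s (bracket e f)\<noteq>0" using sl2_aux[OF assms] by blast
	have a0: "s\<noteq>0" using assms by (simp add: root_def)
	define t where "t = bracket e f"
	have inj: "shift 0 s k = shift 0 s l \<longleftrightarrow> k = l" for k l
		using a0 by (auto simp: shift_def fun_eq_iff)
	define A where "A = (\<lambda>k. shift 0 s (- int k)) ` UNIV"
	define C0 where "C0 = {b\<in>B. wt b\<in>A}"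
	\<comment> \<open>Only the vector \<open>e\<close> is taken from weight \<open>s\<close>, which
	  keeps the span stable: brackets of \<open>e\<close> with \<open>H\<close> are multiples of
	  \<open>e\<close>.\<close>
	define C where "C = insert e C0"
	have eb: "coord B e b = 0" if "b\<in>C0" for b
	proof (rule rs_coord[OF e(1)])
		show "wt b\<noteq>s"
		proof
			assume "wt b = s"
			moreover obtain k where "wt b = shift 0 s (- int k)" using \<open>b\<in>C0\<close> by (auto simp: C0_def A_def)
			moreover have "shift 0 s 1 = s" by (simp add: shift_def)
			ultimately have "shift 0 s 1 = shift 0 s (- int k)" by simp
			then show False unfolding inj by simp
		qed
	qed (use that in \<open>auto simp: C0_def\<close>)
	have C0: "finite C0" "cindep C0" "C0\<subseteq>B" unfolding C0_def using Bfin complex_vector.independent_mono[OF Bind] by auto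
	have eC0: "e \<notin> cspan C0"
	proof
		assume "e\<in>cspan C0"
		then have "e = (\<Sum>b\<in>C0. coord C0 e b *c b)" using coord_expand[OF C0(2,1)] by simp
		also have "... = 0" using coord_sub[OF C0(3) \<open>e\<in>cspan C0\<close>] eb by simp
		finally show False using e(2) by simp
	qed
	have C: "finite C" "cindep C" unfolding C_def using C0 complex_vector.independent_insertI[OF eC0] by auto
	have rsA: "x\<in>cspan C" if "x\<in>rs (shift 0 s (- int k))" for x k
		using rs_cspan[of "shift 0 s (- int k)" A x] that cspan_mono[of C0 C] by (auto simp: A_def C_def C0_def)
	have eC: "e\<in>cspan C" unfolding C_def by (rule cspan_base) simp
	have HC: "x\<in>cspan C" if "x\<in>H" for x
		using rsA[of x 0] that rs_0 by (simp add: shift_def zero_fun_def)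
	have "(\<Sum>b\<in>C. coord C (bracket (bracket e f) b) b) = 0"
	proof (rule partial_trace[OF C])
		fix b assume b: "b\<in>C"
		show "bracket e b\<in>cspan C"
		proof (cases "b = e")
			case False
			then obtain k where b: "b\<in>B" "wt b = shift 0 s (- int k)" using b by (auto simp: C_def C0_def A_def)
			show ?thesis
			proof (cases k)
				case 0
				then have "b\<in>H" using wt_rs[OF b(1)] b(2) rs_0 by (simp add: shift_def zero_fun_def)
				then have "bracket e b = - s b *c e" using eig bracket_anti[of e b] by simp
				then show ?thesis using cspan_scale[OF eC, of "- s b"] by simp
			next
				case (Suc k')
				have "bracket e b\<in>rs (s + wt b)" by (rule rs_bracket[OF e(1) wt_rs[OF b(1)]])
				also have "s + wt b = shift 0 s (- int k')" unfolding b(2) shift_add Suc by simp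
				finally show ?thesis by (rule rsA)
			qed
		qed (simp add: bracket_self cspan_0)
		show "bracket f b\<in>cspan C"
		proof (cases "b = e")
			case True
			then show ?thesis using HC[OF tH] bracket_anti[of f e] cspan_neg by auto
		next
			case False
			then obtain k where b: "b\<in>B" "wt b = shift 0 s (- int k)" using b by (auto simp: C_def C0_def A_def)
			have "bracket f b\<in>rs (- s + wt b)" by (rule rs_bracket[OF f wt_rs[OF b(1)]])
			also have "- s + wt b = shift 0 s (- int (Suc k))" unfolding b(2) shift_add by (rule arg_cong[of _ _ "shift 0 s"]) simp
			finally show ?thesis by (rule rsA)
		qed
	qed
	moreover have "e \<notin> C0" using eC0 cspan_base by blast
	moreover have "coord C (bracket t e) e = s t"
		using eig[OF tH] coord_basis[OF C(2), of e e] by (simp add: t_def coord_scale[OF C(2) eC]) (simp add: C_def)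
	moreover have "coord C (bracket t b) b = wt b t" if b: "b\<in>C0" for b
	proof -
		have "bracket t b\<in>rs (0 + wt b)"
			using tH rs_0 wt_rs[of b] b by (intro rs_bracket) (auto simp: t_def C0_def)
		then have tb: "bracket t b\<in>cspan C0" using rs_cspan[of "wt b" A] b by (simp add: C0_def)
		have "coord C (bracket t b) = coord C0 (bracket t b)"
			by (rule complex_vector.representation_extend[OF C(2) tb]) (simp add: C_def subset_insertI)
		also have "... = coord B (bracket t b)" by (rule coord_sub[OF C0(3) tb])
		finally show ?thesis using wb_coord_ad(1)[OF wb _ tH] b by (simp add: C0_def t_def)
	qed
	ultimately have *: "s t + (\<Sum>b\<in>C0. wt b t) = 0"
		using C0(1) by (simp add: C_def t_def)
	define n where "n b = (THE k. wt b = shift 0 s (- int k))" for b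
	have n: "n b = k" if "wt b = shift 0 s (- int k)" for b k
		unfolding n_def by (rule the_equality) (use that inj in auto)
	have "wt b t = - of_nat (n b) * s t" if "b\<in>C0" for b
	proof -
		obtain k where "wt b = shift 0 s (- int k)" using \<open>b\<in>C0\<close> by (auto simp: C0_def A_def)
		then show ?thesis using n by (simp add: shift_def)
	qed
	then have "s t + (\<Sum>b\<in>C0. - of_nat (n b) * s t) = 0" using * by simp
	then have "s t * (1 - of_nat (\<Sum>b\<in>C0. n b)) = 0"
		by (simp add: sum_distrib_left sum_negf algebra_simps)
	\<comment> \<open>After division by \<open>s t\<close> the trace identity says that the
	  multiplicities of weights \<open>- k s\<close>, each counted \<open>k\<close> times, add up to 1.
	  Weight \<open>- s\<close> occurs, so it occurs once and uses up the sum.\<close>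
	then have "of_nat (\<Sum>b\<in>C0. n b) = (of_nat 1 :: complex)" using at by (simp add: t_def)
	then have sum1: "(\<Sum>b\<in>C0. n b) = 1" by (simp only: of_nat_eq_iff)
	obtain x where "x\<in>rs (- s)" "x\<noteq>0" using root_neg[OF assms] by (rule rootE)
	then obtain b0 where b0: "b0\<in>B" "wt b0 = - s" using rs_nonzero_basis by blast
	have sm: "- s = shift 0 s (- int 1)" by (auto simp: shift_def fun_eq_iff)
	have one: "b\<in>C0 \<and> n b = 1" if "b\<in>B" "wt b = - s" for b
		using that n[of b 1] sm unfolding C0_def A_def by (auto intro: range_eqI[of _ _ 1])
	have "b = b0" if "b\<in>B" "wt b = - s" for b
	proof (rule ccontr)
		assume "b\<noteq>b0"
		then have "(\<Sum>b\<in>{b, b0}. n b) = 2" using one[OF that] one[OF b0] by simp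
		moreover have "(\<Sum>b\<in>{b, b0}. n b) \<le> (\<Sum>b\<in>C0. n b)"
			by (rule sum_mono2) (use C0 one[OF that] one[OF b0] in auto)
		ultimately show False using sum1 by simp
	qed
	then show ?thesis using b0 by auto
qed

lemma root_span:
	assumes "root s" "x\<in>rs s" "x\<noteq>0" "z\<in>rs s" shows "\<exists>c. z = c *c x"
proof -
	obtain b where b: "b\<in>B" "{b'\<in>B. wt b' = s} = {b}"
		using root_space_dim_one[OF root_neg[OF assms(1)]] by auto
	then have "\<exists>c. v = c *c b" if "v\<in>rs s" for v
		using that by (auto simp: rs_def complex_vector.span_singleton)
	then obtain c d where c: "x = c *c b" "z = d *c b" using assms by metis
	then have "c\<noteq>0" using assms(3) by auto
	then show ?thesis using c by (intro exI[of _ "d / c"]) (simp add: scaleC_scaleC)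
qed

lemma root_eig:
	assumes "s\<noteq>0" "x\<in>rs s" "y\<in>H" shows "bracket y x = s y *c x"
proof (cases "x = 0")
	case False
	then have "root s" using rootI assms by blast
	then obtain e where e: "e\<in>rs s" "e\<noteq>0" "bracket y e = s y *c e" using sl2_aux assms(3) by metis
	obtain c where "x = c *c e" using root_span[OF \<open>root s\<close> e(1,2) assms(2)] by blast
	then show ?thesis by (simp add: bracket_scaleC_right e(3) scaleC_scaleC mult.commute)
qed simp

lemma rs_root_space:
	assumes "s\<noteq>0" "\<And>y. y \<notin> H ==> s y = 0" shows "rs s = root_space H s"
proof
	show "rs s\<subseteq>root_space H s" using root_eig[OF assms(1)] by (auto simp: root_space_def)
	show "root_space H s\<subseteq>rs s"
	proof
		fix x assume x: "x\<in>root_space H s"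
		show "x\<in>rs s"
		proof (rule rsI)
			fix y assume "y\<in>H"
			then have "(adm y (s y) ^^ 1) x = 0" using x by (simp add: root_space_def adm_def)
			then show "x\<in>gen_eig y (s y)" unfolding gen_eig_def by blast
		qed (rule assms(2))
	qed
qed

lemma sl2:
	assumes "root s" "e\<in>rs s" "e\<noteq>0" "f\<in>rs (- s)" "f\<noteq>0"
	shows "bracket e f\<in>H" "s (bracket e f)\<noteq>0"
proof -
	show "bracket e f\<in>H" using rs_bracket[OF assms(2,4)] rs_0 by simp
	obtain e' f' where *: "e'\<in>rs s" "f'\<in>rs (- s)" "bracket e' f'\<in>H" "s (bracket e' f')\<noteq>0"
		using sl2_aux[OF assms(1)] by metis
	obtain c d where "e' = c *c e" "f' = d *c f"
		using root_span[OF assms(1-3) *(1)] root_span[OF root_neg[OF assms(1)] assms(4,5) *(2)] by blast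
	then have "bracket e' f' = (c * d) *c bracket e f" by (simp add: bracket_scaleC_left bracket_scaleC_right scaleC_scaleC)
	moreover have "s\<in>dual_space H" using rs_dual assms by blast
	ultimately have "s (bracket e' f') = c * d * s (bracket e f)"
		using \<open>bracket e f\<in>H\<close> by (simp add: dual_space_def)
	then show "s (bracket e f)\<noteq>0" using *(4) by auto
qed

text \<open>If \<open>f\<close> killed \<open>[e, x]\<close>, the part of the string above
  \<open>h\<close> would be stable under \<open>e\<close> and \<open>f\<close>: the only exit
  downwards is from weight \<open>j + h\<close>, whose space is the line through
  \<open>[e, x]\<close>. The traces over this part and over the whole string vanish, hence also over
  the lower part, and the two conditions are incompatible.\<close>

lemma string_lemma:
	assumes g: "root j" "e\<in>rs j" "e\<noteq>0" "f\<in>rs (- j)" "f\<noteq>0"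
		and x: "x\<in>rs h" "bracket e x\<noteq>0" "j + h\<noteq>0"
	shows "bracket f (bracket e x)\<noteq>0"
proof
	assume zero: "bracket f (bracket e x) = 0"
	define t where "t = bracket e f"
	have tH: "t\<in>H" and gt: "j t\<noteq>0" using sl2[OF g] by (auto simp: t_def)
	have x0: "x\<noteq>0" using x(2) by auto
	have ex: "bracket e x\<in>rs (j + h)" using rs_bracket g(2) x(1) by blast
	have gb: "root (j + h)" by (rule rootI[OF ex x(2,3)])
	have inj: "shift h j k = shift h j l \<longleftrightarrow> k = l" for k l
		using g(1) by (auto simp: shift_def fun_eq_iff root_def)
	define C where "C A = {b\<in>B. wt b\<in>shift h j ` A}" for A
	have fin: "finite (C A)" for A using Bfin by (simp add: C_def)
	have br: "bracket e b\<in>rs (shift h j (k + 1))" "bracket f b\<in>rs (shift h j (k - 1))"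
		if "b\<in>B" "wt b = shift h j k" for b k
		using rs_bracket[OF g(2) wt_rs[OF that(1)]] rs_bracket[OF g(4) wt_rs[OF that(1)]]
		unfolding that(2) shift_add by auto
	have "(\<Sum>b\<in>C {1..}. wt b t) = 0"
		unfolding t_def C_def
	proof (rule string_trace)
		fix b assume b: "b\<in>B" "wt b\<in>shift h j ` {1..}"
		then obtain k where k: "k \<ge> 1" "wt b = shift h j k" by auto
		show "bracket e b\<in>cspan {b\<in>B. wt b\<in>shift h j ` {1..}}"
			by (rule rs_cspan[OF _ br(1)[OF b(1) k(2)]]) (use k in auto)
		show "bracket f b\<in>cspan {b\<in>B. wt b\<in>shift h j ` {1..}}"
		proof (cases "k = 1")
			case True
			then have "wt b = j + h" using k by (auto simp: shift_def fun_eq_iff)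
			then obtain c where "b = c *c bracket e x" using root_span[OF gb ex x(2), of b] wt_rs[OF b(1)] by auto
			then show ?thesis using zero by (simp add: bracket_scaleC_right cspan_0)
		next
			case False
			then show ?thesis using k by (intro rs_cspan[OF _ br(2)[OF b(1) k(2)]]) auto
		qed
	qed (use tH in \<open>simp add: t_def\<close>)
	moreover have "(\<Sum>b\<in>C UNIV. wt b t) = 0"
		unfolding t_def C_def
	proof (rule string_trace)
		fix b assume b: "b\<in>B" "wt b\<in>range (shift h j)"
		then obtain k where k: "wt b = shift h j k" by auto
		show "bracket e b\<in>cspan {b\<in>B. wt b\<in>range (shift h j)}" "bracket f b\<in>cspan {b\<in>B. wt b\<in>range (shift h j)}"
			using rs_cspan[OF _ br(1)[OF b(1) k]] rs_cspan[OF _ br(2)[OF b(1) k]] by auto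
	qed (use tH in \<open>simp add: t_def\<close>)
	moreover have "C UNIV = C {1..}\<union>C {..0}"
	proof -
		have "(UNIV :: int set) = {1..}\<union>{..0}" by auto
		then show ?thesis unfolding C_def by (auto simp: image_Un) 
	qed
	moreover have "C {1..}\<inter>C {..0} = {}" by (auto simp: C_def inj)
	ultimately have s1: "(\<Sum>b\<in>C {1..}. wt b t) = 0" and s0: "(\<Sum>b\<in>C {..0}. wt b t) = 0"
		using sum.union_disjoint[OF fin fin, of "{1..}" "{..0}" "\<lambda>b. wt b t"] by auto
	\<comment> \<open>Along the string the real part of \<open>wt b t / j t\<close> is
	  \<open>k - q\<close>. A zero sum over \<open>k \<ge> 1\<close> requires \<open>q \<ge> 1\<close>,
	  a zero sum over \<open>k \<le> 0\<close> requires \<open>q \<le> 0\<close>; both sums have at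
	  least one term.\<close>
	define q where "q = Re (- h t / j t)"
	have re: "Re (wt b t / j t) = of_int k - q" if "wt b = shift h j k" for b k
		unfolding that shift_def q_def using gt by (simp add: add_divide_distrib)
	have sre: "(\<Sum>b\<in>C A. Re (wt b t / j t)) = Re ((\<Sum>b\<in>C A. wt b t) / j t)" for A
		by (simp add: sum_divide_distrib)
	have "q \<ge> 1"
	proof (rule ccontr)
		assume q: "\<not> q \<ge> 1"
		obtain b where b: "b\<in>B" "wt b = j + h" using rs_nonzero_basis[OF ex x(2)] by blast
		then have "C {1..}\<noteq>{}" by (auto simp: C_def shift_def fun_eq_iff image_iff intro!: exI[of _ b] bexI[of _ 1])
		then have "(\<Sum>b\<in>C {1..}. Re (wt b t / j t)) > 0"
			using fin re q by (intro sum_pos) (auto simp: C_def)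
		then show False using sre[of "{1..}"] s1 by simp
	qed
	moreover have "q \<le> 0"
	proof (rule ccontr)
		assume q: "\<not> q \<le> 0"
		obtain b where b: "b\<in>B" "wt b = h" using rs_nonzero_basis[OF x(1) x0] by blast
		then have "C {..0}\<noteq>{}" by (auto simp: C_def shift_def fun_eq_iff image_iff intro!: exI[of _ b] bexI[of _ 0])
		then have "(\<Sum>b\<in>C {..0}. - Re (wt b t / j t)) > 0"
			using fin re q by (intro sum_pos) (auto simp: C_def)
		then show False using sre[of "{..0}"] s0 by (simp add: sum_negf)
	qed
	ultimately show False by simp
qed

end

section \<open>Weight projections and subspaces stable under the Cartan subalgebra\<close>

context reductive_cartan
begin

definition proj :: "('g => complex) => 'g => 'g" where
	"proj h x = (\<Sum>b\<in>{b\<in>B. wt b = h}. coord B x b *c b)"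

lemma proj_in_rs: "proj h x\<in>rs h"
	unfolding proj_def rs_def by (intro cspan_sum cspan_scale cspan_base)

lemma proj_add: "proj h (x + y) = proj h x + proj h y"
	by (simp add: proj_def coord_add[OF Bind] Bspan scaleC_add_left sum.distrib)

lemma proj_scale: "proj h (c *c x) = c *c proj h x"
	by (simp add: proj_def coord_scale[OF Bind] Bspan scaleC_scaleC scaleC_sum)

lemma proj_lin: "lin_on W (proj h)" by (simp add: lin_on_def proj_add proj_scale)

lemma proj_diff: "proj h (x - y) = proj h x - proj h y"
	by (rule lin_on_diff[OF _ proj_lin[of UNIV]]) auto

lemma proj_0 [simp]: "proj h 0 = 0" using proj_scale[of h 0 0] by simp

lemma proj_sum: "(\<Sum>h\<in>wt ` B. proj h x) = x"
proof -
	have "(\<Sum>h\<in>wt ` B. proj h x) = (\<Sum>b\<in>B. coord B x b *c b)"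
		unfolding proj_def by (rule sum.image_gen[OF Bfin, symmetric])
	then show ?thesis using coord_expand[OF Bind Bfin, of x] Bspan by simp
qed

lemma proj_rs: "x\<in>rs h ==> proj j x = (if j = h then x else 0)"
proof -
	assume x: "x\<in>rs h"
	have 0: "proj j x = 0" if "j\<noteq>h" for j
		unfolding proj_def using rs_coord[OF x] that by (intro sum.neutral) auto
	have "proj h x = x"
	proof (cases "x = 0")
		case False
		then have "h\<in>wt ` B" using rs_nonzero_basis[OF x] by auto
		have "x = (\<Sum>j\<in>wt ` B. proj j x)" by (simp add: proj_sum)
		also have "... = (\<Sum>j\<in>wt ` B. if j = h then proj h x else 0)" by (rule sum.cong) (auto simp: 0)
		also have "... = proj h x" using \<open>h\<in>wt ` B\<close> Bfin by simp
		finally show ?thesis by simp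
	qed simp
	then show ?thesis using 0 by simp
qed

lemma proj_all_zero: "(\<And>h. proj h x = 0) ==> x = 0"
	using proj_sum[of x] by simp

definition hstab :: "'g set => bool" where
	"hstab W \<longleftrightarrow> csub W \<and> (\<forall>y\<in>H. \<forall>w\<in>W. bracket y w\<in>W)"

text \<open>A weight basis of \<open>W\<close> consists of generalized weight vectors of the whole
  algebra. Hence weight components of elements of \<open>W\<close> stay in \<open>W\<close>, and
  root spaces are either inside \<open>W\<close> or meet it in 0.\<close>

lemma hstab_decomposition: "hstab W ==> W\<subseteq>cspan (\<Union>s. W\<inter>rs s)"
proof -
	assume W: "hstab W"
	then obtain C wtC r where wbC: "wb H W C wtC (r :: 'g => nat)"
		using wb_exists[OF H_subalgebra H_nilpotent, of W] by (auto simp: hstab_def)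
	have "C\<subseteq>(\<Union>s. W\<inter>rs s)"
	proof
		fix c assume c: "c\<in>C"
		have "c\<in>rs (wtC c)"
			by (rule rsI) (use weight_basis_gen_eig[OF wbC c] wbC c in \<open>auto simp: wb_def\<close>)
		moreover have "c\<in>W" using wbC c cspan_base[of c C] by (auto simp: wb_def)
		ultimately show "c\<in>(\<Union>s. W\<inter>rs s)" by auto
	qed
	then have "cspan C\<subseteq>cspan (\<Union>s. W\<inter>rs s)" by (rule cspan_mono)
	then show ?thesis using wbC by (simp add: wb_def)
qed

lemma proj_hstab: "hstab W ==> x\<in>W ==> proj h x\<in>W"
proof -
	assume W: "hstab W" "x\<in>W"
	then have "x\<in>cspan (\<Union>s. W\<inter>rs s)" using hstab_decomposition by blast
	then show ?thesis
		by (rule lin_on_span[OF proj_lin[of UNIV], rotated 4])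
			(use W in \<open>auto simp: proj_rs hstab_def csub_0\<close>)
qed

lemma hstab_root: "hstab W ==> root s ==> x\<in>W ==> x\<in>rs s ==> x\<noteq>0 ==> rs s\<subseteq>W"
	using root_span[of s x] csub_scale[of W] unfolding hstab_def by (metis subsetI)

lemma hstab_span: "hstab W ==> W\<subseteq>cspan ((W\<inter>H)\<union>(RS W))"
proof -
	assume W: "hstab W"
	have "(\<Union>s. W\<inter>rs s)\<subseteq>cspan ((W\<inter>H)\<union>(RS W))"
	proof clarify
		fix x s assume x: "x\<in>W" "x\<in>rs s"
		show "x\<in>cspan ((W\<inter>H)\<union>(RS W))"
		proof (cases "x = 0 \<or> s = 0")
			case True
			then show ?thesis using x rs_0 cspan_0 by (auto intro: cspan_base)
		next
			case False
			then have "root s" using rootI[OF x(2)] by auto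
			moreover have "rs s\<subseteq>W" using hstab_root[OF W \<open>root s\<close> x] False by auto
			ultimately show ?thesis using x(2) by (intro cspan_base) blast
		qed
	qed
	then show ?thesis using hstab_decomposition[OF W] cspan_least by (meson complex_vector.subspace_span order_trans)
qed

lemma hstab_UNIV: "hstab UNIV" by (simp add: hstab_def)

lemma hstab_subalgebra: "subalgebra W ==> H\<subseteq>W ==> hstab W"
	unfolding hstab_def using subalg_bracket subalg_csub by blast

text \<open>Connects the roots of the definitions, given by genuine weight vectors in
  \<open>L\<close>, with generalized weight spaces; since root spaces are lines, meeting
  \<open>W\<close> nontrivially means being contained in it.\<close>

lemma roots_in_iff: "hstab W ==> s\<in>roots_in H W \<longleftrightarrow> root s \<and> rs s\<subseteq>W"
proof
	assume W: "hstab W"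
	have W0: "0\<in>W" using W csub_0 by (auto simp: hstab_def)
	{
		assume a: "s\<in>roots_in H W"
		then have d: "s\<in>dual_space H" "s\<noteq>0" "root_space H s\<inter>W\<noteq>{0}" by (auto simp: roots_in_def zero_fun_def)
		have eq: "rs s = root_space H s" by (rule rs_root_space) (use d in \<open>auto simp: dual_space_def\<close>)
		have "0\<in>rs s\<inter>W" using W0 csub_0[OF rs_subspace] by auto
		then obtain x where "x\<in>rs s" "x\<in>W" "x\<noteq>0" using d(3) unfolding eq by blast
		then show "root s \<and> rs s\<subseteq>W" using rootI[of x s] d(2) hstab_root[OF W, of s x] by auto
	}
	{
		assume a: "root s \<and> rs s\<subseteq>W"
		then obtain x where x: "x\<in>rs s" "x\<noteq>0" "s\<noteq>0" using a rootE[of s] by metis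
		have d: "s\<in>dual_space H" using rs_dual x by blast
		have eq: "rs s = root_space H s" by (rule rs_root_space) (use x d in \<open>auto simp: dual_space_def\<close>)
		show "s\<in>roots_in H W" using d x a eq by (auto simp: roots_in_def zero_fun_def)
	}
qed

text \<open>A set of roots that is closed under nonzero brackets and contains no pair of opposite roots spans,
	together with \<open>H\<close>, a solvable subalgebra: the Killing form vanishes on the commutators.\<close>

lemma closed_roots_solvable:
	assumes T: "\<forall>s\<in>T. root s \<and> - s \<notin> T"
		and closed: "\<forall>s\<in>T. \<forall>h\<in>T. \<forall>x\<in>rs s. \<forall>y\<in>rs h. bracket x y\<noteq>0 \<longrightarrow> s + h\<in>T"
	shows "subalgebra (cspan (\<Union>s\<in>T. rs s))" "subalgebra (cspan (H\<union>(\<Union>s\<in>T. rs s)))"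
		"lie_solvable (cspan (H\<union>(\<Union>s\<in>T. rs s)))"
proof -
	let ?R = "\<Union>s\<in>T. rs s"
	have RR: "bracket x y\<in>cspan ?R" if xy: "x\<in>?R" "y\<in>?R" for x y
	proof (cases "bracket x y = 0")
		case False
		obtain s h where *: "s\<in>T" "h\<in>T" "x\<in>rs s" "y\<in>rs h" using xy by auto
		then have "s + h\<in>T" using closed False by blast
		then show ?thesis using rs_bracket[OF *(3,4)] by (intro cspan_base) auto
	qed (simp add: cspan_0)
	have HR: "bracket x y\<in>cspan ?R" if xy: "x\<in>H" "y\<in>?R" for x y
	proof -
		obtain s where "s\<in>T" "y\<in>rs s" using xy by auto
		then show ?thesis using rs_bracket[of x 0 y s] rs_0 xy(1) by (intro cspan_base) auto
	qed
	have RH: "bracket y x\<in>cspan ?R" if "x\<in>H" "y\<in>?R" for x y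
		using HR[OF that] bracket_anti[of y x] cspan_neg by auto
	show "subalgebra (cspan ?R)"
		unfolding subalgebra_def by (auto intro: bracket_span[OF RR])
	\<comment> \<open>The centre is added because commutators of \<open>H\<close> are only known to be
	  central. This space contains all commutators, and the Killing form vanishes on it since no two of
	  its roots add up to 0.\<close>
	let ?M = "cspan (Z\<union>?R)"
	have RM: "cspan ?R\<subseteq>?M" by (rule cspan_mono) auto
	have ZM: "z\<in>?M" if "z\<in>Z" for z using that by (intro cspan_base) auto
	have all: "bracket x y\<in>?M" if "x\<in>cspan (H\<union>?R)" "y\<in>cspan (H\<union>?R)" for x y
	proof (rule bracket_span[of "H\<union>?R" "H\<union>?R"])
		fix x y assume "x\<in>H\<union>?R" "y\<in>H\<union>?R"
		then show "bracket x y\<in>?M"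
			using H_commutator_central ZM RM RR HR RH by (metis (no_types, lifting) Un_iff subsetD)
	qed (use that in auto)
	have MH: "?M\<subseteq>cspan (H\<union>?R)" by (rule cspan_mono) (use Z_H in auto)
	show "subalgebra (cspan (H\<union>?R))"
		unfolding subalgebra_def using all MH by auto
	have "subalgebra ?M" unfolding subalgebra_def using all MH by auto
	moreover have "killing x y = 0" if "x\<in>?M" "y\<in>?M" for x y
	proof (rule killing_zero_span[OF _ that])
		fix x y assume xy: "x\<in>Z\<union>?R" "y\<in>Z\<union>?R"
		show "killing x y = 0"
		proof (cases "x\<in>Z \<or> y\<in>Z")
			case True
			then show ?thesis using killing_Z killing_sym by metis
		next
			case False
			then obtain s h where *: "s\<in>T" "h\<in>T" "x\<in>rs s" "y\<in>rs h" using xy by auto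
			then have "s + h\<noteq>0" using T by (auto simp: add_eq_0_iff)
			then show ?thesis using killing_orthogonal * by blast
		qed
	qed
	ultimately have "lie_solvable ?M" by (rule cartan_criterion)
	then show "lie_solvable (cspan (H\<union>?R))"
		by (rule lie_solvable_derived) (rule bracket_set_least, simp, rule all)
qed

end

section \<open>Borel subalgebras contain exactly one of two opposite root spaces\<close>

locale reductive_borel = reductive_cartan H for H :: "'g::fin_dim_lie_algebra set" +
	fixes bo :: "'g set"
	assumes borel: "borel_subalgebra bo" and H_bo: "H\<subseteq>bo"
begin

lemma bo_subalg: "subalgebra bo" and bo_solvable: "lie_solvable bo"
	and bo_maximal: "subalgebra b' ==> lie_solvable b' ==> bo\<subseteq>b' ==> b' = bo"
	using borel by (auto simp: borel_subalgebra_def)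

lemma bo_subspace [simp]: "csub bo" using bo_subalg by (rule subalg_csub)

lemma bo_hstab: "hstab bo" using hstab_subalgebra[OF bo_subalg H_bo] .

text \<open>With \<open>t = [e, f]\<close>, both \<open>e\<close> and \<open>f\<close> are multiples
  of their brackets with \<open>t\<close>, so all three persist in every term of the derived
  series.\<close>

lemma bo_not_both:
	assumes "root s" "rs s\<subseteq>bo" shows "\<not> rs (- s)\<subseteq>bo"
proof
	assume neg: "rs (- s)\<subseteq>bo"
	obtain e where e: "e\<in>rs s" "e\<noteq>0" "s\<noteq>0" using assms(1) by (rule rootE)
	obtain f where f: "f\<in>rs (- s)" "f\<noteq>0" using root_neg[OF assms(1)] by (rule rootE)
	define t where "t = bracket e f"
	have t: "t\<in>H" "s t\<noteq>0" using sl2[OF assms(1) e(1,2) f] by (auto simp: t_def)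
	have "e\<in>derived n bo \<and> f\<in>derived n bo" for n
	proof (induction n)
		case 0
		then show ?case using assms(2) neg e f by auto
	next
		case (Suc n)
		have tn: "t\<in>derived n bo"
		proof (cases n)
			case 0
			then show ?thesis using t H_bo by auto
		next
			case (Suc m)
			have "subalgebra (derived k bo)" for k
			proof (induction k)
				case (Suc k)
				have "bracket_set (derived k bo) (derived k bo)\<subseteq>derived k bo"
					by (rule bracket_set_least) (use Suc subalg_csub subalg_bracket in auto)
				then show ?case unfolding subalgebra_def derived_Suc by (auto intro: bracket_in_set)
			qed (simp add: bo_subalg)
			then show ?thesis using Suc.IH subalg_bracket unfolding t_def by blast
		qed
		have "bracket t e = s t *c e" by (rule root_eig[OF e(3,1) t(1)])
		moreover have "bracket t f = - s t *c f"
			using root_eig[of "- s" f t] e(3) f(1) t(1) by simp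
		moreover have "bracket t e\<in>derived (Suc n) bo" "bracket t f\<in>derived (Suc n) bo"
			unfolding derived_Suc using tn Suc by (auto intro: bracket_in_set)
		ultimately have "inverse (s t) *c (s t *c e)\<in>derived (Suc n) bo" "- inverse (s t) *c (- s t *c f)\<in>derived (Suc n) bo"
			unfolding derived_Suc by (metis bracket_set_subspace csub_scale)+
		moreover have "inverse (s t) *c (s t *c e) = e" "- inverse (s t) *c (- s t *c f) = f"
			using t(2) by (simp_all only: scaleC_scaleC) (simp_all add: scaleC_one)
		ultimately show ?case by metis
	qed
	moreover obtain n where "derived n bo = {0}" using bo_solvable by (auto simp: lie_solvable_iff)
	ultimately show False using e(2) by auto
qed

text \<open>The complement of a subalgebra under the Killing form is stable under that subalgebra
  and contains each root vector whose opposite root space is missing. Used for Borel subalgebras and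
  for Levi parts.\<close>

lemma killing_perp:
	assumes S: "subalgebra S"
	shows "csub {x. \<forall>y\<in>S. killing x y = 0}"
		and "y\<in>S ==> \<forall>z\<in>S. killing p z = 0 ==> \<forall>z\<in>S. killing (bracket y p) z = 0"
		and "H\<subseteq>S ==> e\<in>rs s ==> s\<noteq>0 ==> \<not> rs (- s)\<subseteq>S ==> \<forall>y\<in>S. killing e y = 0"
proof -
	show "csub {x. \<forall>y\<in>S. killing x y = 0}" by (rule csubI) (auto simp: killing_add_left killing_scale_left)
	show "\<forall>z\<in>S. killing (bracket y p) z = 0" if "y\<in>S" "\<forall>z\<in>S. killing p z = 0"
		using killing_scale_left[of "-1" "bracket p y"] bracket_anti[of y p] that subalg_bracket[OF S that(1)]
		by (simp add: killing_invariant)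
	show "\<forall>y\<in>S. killing e y = 0" if e: "H\<subseteq>S" "e\<in>rs s" "s\<noteq>0" "\<not> rs (- s)\<subseteq>S"
	proof
		fix y assume y: "y\<in>S"
		show "killing e y = 0"
		proof (rule killing_zero_span[of "{e}"])
			show "y\<in>cspan ((S\<inter>H)\<union>(RS S))"
				using hstab_span[OF hstab_subalgebra[OF S e(1)]] y by auto
			fix x y assume "x\<in>{e}" "y\<in>(S\<inter>H)\<union>(RS S)"
			then obtain h where "x = e" "y\<in>rs h" "h = 0 \<or> rs h\<subseteq>S" using rs_0 by auto
			then show "killing x y = 0" using killing_orthogonal[OF e(2), of y h] e(3,4) by (auto simp: add_eq_0_iff)
		qed (simp add: cspan_base)
	qed
qed

text \<open>If both root spaces are missing, the Killing complement \<open>P\<close> of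
  \<open>bo\<close> contains a vector outside \<open>bo\<close>. Lie's theorem for \<open>bo\<close>
  acting on \<open>bo + P\<close> modulo \<open>bo\<close> yields a weight vector \<open>x\<close>
  in \<open>P\<close>, of some weight \<open>h\<close>, that \<open>bo\<close> normalizes modulo
  \<open>bo\<close>. Adding \<open>h\<close> to the roots of \<open>bo\<close> gives a larger
  solvable subalgebra, against maximality.\<close>

lemma bo_either:
	assumes "root s" shows "rs s\<subseteq>bo \<or> rs (- s)\<subseteq>bo"
proof (rule ccontr)
	assume neither: "\<not> ?thesis"
	define P where "P = {x. \<forall>y\<in>bo. killing x y = 0}"
	note perp = killing_perp[OF bo_subalg]
	have Ps: "csub P" using perp(1) by (simp add: P_def)
	have Pst: "bracket y p\<in>P" if "y\<in>bo" "p\<in>P" for y p using perp(2)[OF that(1)] that(2) by (simp add: P_def)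
	have Ph: "hstab P" using Ps Pst H_bo by (auto simp: hstab_def)
	obtain e where e: "e\<in>rs s" "e\<noteq>0" "s\<noteq>0" using assms by (rule rootE)
	have "e\<in>P" using perp(3)[OF H_bo e(1,3)] neither by (simp add: P_def)
	define W where "W = cspan (bo\<union>P)"
	have W_e: "\<exists>u\<in>bo. \<exists>p\<in>P. x = u + p" if "x\<in>W" for x
		using that Ps unfolding W_def cspan_Un by (auto simp: cspan_eq)
	have Ws: "csub W" and boW: "bo\<subseteq>W" and PW: "P\<subseteq>W" unfolding W_def by (auto intro: cspan_base)
	have "bo \<subset> W"
	proof -
		have "e \<notin> bo" using hstab_root[OF bo_hstab assms _ e(1,2)] neither by auto
		then show ?thesis using \<open>e\<in>P\<close> PW boW by auto
	qed
	have Wst: "bracket y w\<in>W" if y: "y\<in>bo" and w: "w\<in>W" for y w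
	proof -
		obtain u p where "u\<in>bo" "p\<in>P" "w = u + p" using W_e[OF w] by blast
		then show ?thesis
			using subalg_bracket[OF bo_subalg y] Pst[OF y] boW PW Ws by (simp add: bracket_add_right csub_add subset_iff)
	qed
	have rep: "lie_rep bo W bracket" by (rule lie_rep_ad[OF bo_subalg Ws Wst])
	have "\<exists>w\<in>W - bo. \<exists>\<chi>. \<forall>x\<in>bo. bracket x w - \<chi> x *c w\<in>bo"
		by (rule lie_theorem[OF rep bo_solvable fin_dim_lie bo_subspace \<open>bo \<subset> W\<close> subalg_bracket[OF bo_subalg]])
	then obtain w \<chi> where w: "w\<in>W" "w \<notin> bo" "\<And>y. y\<in>bo ==> bracket y w - \<chi> y *c w\<in>bo" by blast
	have shift_bo: "bracket y v' - \<chi> y *c v'\<in>bo" if "bracket y v - \<chi> y *c v\<in>bo" "v - v'\<in>bo" "y\<in>bo" for y v v'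
	proof -
		have "bracket y v' - \<chi> y *c v' = (bracket y v - \<chi> y *c v) - (bracket y (v - v') - \<chi> y *c (v - v'))"
			by (simp add: bracket_diff_right scaleC_diff_right)
		also have "...\<in>bo"
			by (rule csub_diff[OF bo_subspace that(1)], rule csub_diff[OF bo_subspace])
				(use that subalg_bracket[OF bo_subalg] csub_scale[OF bo_subspace] in auto)
		finally show ?thesis .
	qed
	obtain u p where up: "u\<in>bo" "p\<in>P" "w = u + p" using W_e[OF w(1)] by blast
	have p: "p \<notin> bo" "\<And>y. y\<in>bo ==> bracket y p - \<chi> y *c p\<in>bo"
		using up w(2) csub_add[OF bo_subspace, of u p] shift_bo[OF w(3), of _ p] by auto
	have "\<exists>h. proj h p \<notin> bo"
	proof (rule ccontr)
		assume "\<nexists>h. proj h p \<notin> bo"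
		then have "(\<Sum>h\<in>wt ` B. proj h p)\<in>bo" by (intro csub_sum) auto
		then show False using p(1) by (simp add: proj_sum)
	qed
	then obtain h where h: "proj h p \<notin> bo" by blast
	have proj_br: "proj j (bracket y v) = bracket y (proj j v)" if y: "y\<in>H" for y v j
	proof -
		have "bracket y v = bracket y (\<Sum>h\<in>wt ` B. proj h v)" by (simp add: proj_sum)
		also have "... = (\<Sum>h\<in>wt ` B. bracket y (proj h v))" by (rule lin_on_sum[OF _ lin_on_bracket[of UNIV]]) auto
		finally have "proj j (bracket y v) = (\<Sum>h\<in>wt ` B. proj j (bracket y (proj h v)))"
			using lin_on_sum[OF _ proj_lin[of UNIV j]] by simp
		also have "... = (\<Sum>h\<in>wt ` B. if j = h then bracket y (proj j v) else 0)"
		proof (rule sum.cong[OF refl])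
			fix h
			have "bracket y (proj h v)\<in>rs h" using rs_bracket[of y 0 "proj h v" h] y rs_0 proj_in_rs by auto
			then show "proj j (bracket y (proj h v)) = (if j = h then bracket y (proj j v) else 0)"
				using proj_rs by simp
		qed
		also have "... = bracket y (proj j v)"
		proof (cases "j\<in>wt ` B")
			case False
			then have "proj j v = 0" using rs_nonzero_basis[OF proj_in_rs[of j v]] by auto
			then show ?thesis by (intro trans[OF sum.neutral]) auto
		qed (use Bfin in simp)
		finally show ?thesis .
	qed
	\<comment> \<open>On \<open>H\<close> the eigenvalue \<open>\<chi>\<close> is the weight of every
	  component of \<open>p\<close> that lies outside \<open>bo\<close>. There is thus only one such
	  component, and it can replace \<open>p\<close>.\<close>
	have ch: "\<chi> y = j y" if "proj j p \<notin> bo" "y\<in>H" for j y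
	proof (rule ccontr)
		assume ne: "\<chi> y\<noteq>j y"
		have "j\<noteq>0" using that(1) proj_in_rs[of j p] rs_0 H_bo by auto
		then have "bracket y (proj j p) = j y *c proj j p" using root_eig proj_in_rs that(2) by blast
		then have "proj j (bracket y p - \<chi> y *c p) = (j y - \<chi> y) *c proj j p"
			using proj_br[OF that(2)] by (simp add: proj_diff proj_scale scaleC_diff_left)
		then have "(j y - \<chi> y) *c proj j p\<in>bo" using proj_hstab[OF bo_hstab p(2)] that(2) H_bo by (metis subsetD)
		then have "inverse (j y - \<chi> y) *c ((j y - \<chi> y) *c proj j p)\<in>bo" by (rule csub_scale[OF bo_subspace])
		then show False using that(1) ne by (simp add: scaleC_scaleC scaleC_one)
	qed
	have other: "proj j p\<in>bo" if "j\<noteq>h" for j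
	proof (rule ccontr)
		assume g: "proj j p \<notin> bo"
		have "j y = h y" for y
		proof (cases "y\<in>H")
			case False
			have "proj j p\<noteq>0" "proj h p\<noteq>0" using g h csub_0[OF bo_subspace] by auto
			then show ?thesis using rs_off[OF proj_in_rs] False by metis
		qed (use ch[OF g] ch[OF h] in auto)
		then show False using that by auto
	qed
	define x where "x = proj h p"
	have x: "x\<in>P" "x\<in>rs h" "x \<notin> bo" "x\<noteq>0"
		using proj_hstab[OF Ph up(2)] proj_in_rs h csub_0[OF bo_subspace] unfolding x_def by auto
	have "p - x = (\<Sum>j\<in>wt ` B - {h}. proj j p)"
	proof -
		have "h\<in>wt ` B" using rs_nonzero_basis[OF x(2,4)] by auto
		then have "(\<Sum>j\<in>wt ` B. proj j p) = x + (\<Sum>j\<in>wt ` B - {h}. proj j p)"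
			unfolding x_def by (rule sum.remove[rotated]) (use Bfin in simp)
		then have "p = x + (\<Sum>j\<in>wt ` B - {h}. proj j p)" by (simp only: proj_sum)
		then show ?thesis by (metis add_diff_cancel_left')
	qed
	also have "...\<in>bo" using other by (intro csub_sum) auto
	finally have xb: "bracket y x - \<chi> y *c x\<in>bo" if "y\<in>bo" for y using shift_bo[OF p(2)] that by blast
	have b0: "h\<noteq>0" using x(2,3) rs_0 H_bo by auto
	have rb: "root h" by (rule rootI[OF x(2,4) b0])
	\<comment> \<open>\<open>x\<close> is orthogonal to \<open>bo\<close> but pairs nontrivially with
	  the opposite root space, which therefore is not in \<open>bo\<close>.\<close>
	have nb: "\<not> rs (- h)\<subseteq>bo"
		using killing_pairing[OF x(2,4) b0] x(1) by (auto simp: P_def)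
	define S where "S = {j. root j \<and> rs j\<subseteq>bo}"
	define T where "T = insert h S"
	have bS: "- h \<notin> S" "h \<notin> S" using nb x by (auto simp: S_def)
	have T: "root j \<and> - j \<notin> T" if "j\<in>T" for j
	proof -
		have "- h\<noteq>h" using b0 by (auto simp: fun_eq_iff)
		moreover have "- j \<notin> S" if "j\<in>S" using that bo_not_both by (auto simp: S_def)
		moreover have "- j\<noteq>h" if "j\<in>S" using that bS(1) by auto
		ultimately show ?thesis using that rb bS by (auto simp: T_def S_def)
	qed
	have in_S: "j + i\<in>S" if "z\<in>rs (j + i)" "z\<in>bo" "z\<noteq>0" "j\<in>T" "i\<in>T" for z j i
	proof -
		have "j + i\<noteq>0"
		proof
			assume "j + i = 0"
			then have "i = - j" by (simp add: add_eq_0_iff)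
			then show False using T[OF that(4)] that(5) by simp
		qed
		then have "root (j + i)" using rootI that by blast
		then show ?thesis using hstab_root[OF bo_hstab _ that(2,1,3)] by (simp add: S_def)
	qed
	\<comment> \<open>\<open>bracket y x\<close> differs from an element of \<open>bo\<close> by a
	  multiple of \<open>x\<close>. Its weight \<open>j + h\<close> is not \<open>h\<close>, so
	  projecting to that weight removes the multiple.\<close>
	have with_x: "j + h\<in>S" if g: "j\<in>S" "y\<in>rs j" "bracket y x\<noteq>0" for j y
	proof -
		have r: "bracket y x\<in>rs (j + h)" by (rule rs_bracket[OF g(2) x(2)])
		have "j\<noteq>0" using g(1) by (auto simp: S_def root_def)
		then have "j + h\<noteq>h" by simp
		then have "proj (j + h) (bracket y x - \<chi> y *c x) = bracket y x"
			using proj_rs[OF r, of "j + h"] proj_rs[OF x(2), of "j + h"] by (simp add: proj_diff proj_scale)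
		moreover have "y\<in>bo" using g by (auto simp: S_def)
		ultimately have "bracket y x\<in>bo" using proj_hstab[OF bo_hstab xb] by metis
		then show ?thesis by (intro in_S[OF r _ g(3)]) (use g in \<open>auto simp: T_def\<close>)
	qed
	have closed: "j + i\<in>T" if g: "j\<in>T" "i\<in>T" "y\<in>rs j" "z\<in>rs i" "bracket y z\<noteq>0" for j i y z
	proof -
		consider "j\<in>S" "i\<in>S" | "j\<in>S" "i = h" | "j = h" "i\<in>S" | "j = h" "i = h" using g by (auto simp: T_def)
		then show ?thesis
		proof cases
			case 1
			then have "bracket y z\<in>bo" using g subalg_bracket[OF bo_subalg] by (auto simp: S_def)
			then show ?thesis using in_S[OF rs_bracket[OF g(3,4)] _ g(5,1,2)] by (simp add: T_def)
		next
			case 2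
			obtain c where "z = c *c x" using root_span[OF rb x(2,4)] g(4) 2 by blast
			then have "bracket y x\<noteq>0" using g(5) by (auto simp: bracket_scaleC_right)
			then show ?thesis using with_x[OF 2(1) g(3)] 2 by (simp add: T_def)
		next
			case 3
			obtain c where "y = c *c x" using root_span[OF rb x(2,4)] g(3) 3 by blast
			then have "bracket z x\<noteq>0" using g(5) bracket_anti[of x z] by (auto simp: bracket_scaleC_left)
			then show ?thesis using with_x[OF 3(2) g(4)] 3 by (simp add: T_def add.commute)
		next
			case 4
			obtain c d where "y = c *c x" "z = d *c x" using root_span[OF rb x(2,4)] g(3,4) 4 by meson
			then show ?thesis using g(5) by (simp add: bracket_scaleC_left bracket_scaleC_right bracket_self)
		qed
	qed
	let ?c = "cspan (H\<union>(\<Union>j\<in>T. rs j))"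
	have "bo\<subseteq>?c"
		by (rule order_trans[OF hstab_span[OF bo_hstab]], rule cspan_mono) (auto simp: T_def S_def)
	moreover have "x\<in>?c" using x(2) by (intro cspan_base) (auto simp: T_def)
	moreover have "subalgebra ?c" "lie_solvable ?c"
		by (rule closed_roots_solvable; use T closed in blast)+
	ultimately show False using bo_maximal[of ?c] x(3) by simp
qed

definition opp :: "'g set" where "opp = cspan (\<Union>s\<in>{s. root s \<and> \<not> rs s\<subseteq>bo}. rs s)"

text \<open>Suppose a nonzero bracket \<open>[x, y]\<close> of root vectors outside
  \<open>bo\<close> fell into \<open>bo\<close>. A root vector \<open>f\<close> opposite to
  \<open>x\<close> lies in \<open>bo\<close>, and by the string lemma it returns
  \<open>[x, y]\<close> to a nonzero vector of the root space of \<open>y\<close>, which would then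
  be in \<open>bo\<close>.\<close>

lemma opposite_borel:
	"subalgebra opp" "lie_solvable (cspan (H\<union>(\<Union>s\<in>{s. root s \<and> \<not> rs s\<subseteq>bo}. rs s)))"
	"subalgebra (cspan (H\<union>(\<Union>s\<in>{s. root s \<and> \<not> rs s\<subseteq>bo}. rs s)))"
proof -
	let ?T = "{s. root s \<and> \<not> rs s\<subseteq>bo}"
	have T: "root s \<and> - s \<notin> ?T" if "s\<in>?T" for s using bo_either[of s] that by auto
	have closed: "s + h\<in>?T" if ab: "s\<in>?T" "h\<in>?T" "x\<in>rs s" "y\<in>rs h" "bracket x y\<noteq>0" for s h x y
	proof -
		have ne: "s + h\<noteq>0"
		proof
			assume "s + h = 0"
			then have "h = - s" by (simp add: add_eq_0_iff)
			then show False using T[OF ab(1)] ab(2) by simp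
		qed
		have r: "bracket x y\<in>rs (s + h)" by (rule rs_bracket[OF ab(3,4)])
		have "root (s + h)" by (rule rootI[OF r ab(5) ne])
		moreover have "\<not> rs (s + h)\<subseteq>bo"
		proof
			assume sub: "rs (s + h)\<subseteq>bo"
			have ra: "root s" "rs (- s)\<subseteq>bo" "root h" "\<not> rs h\<subseteq>bo" using ab bo_either by auto
			obtain f where f: "f\<in>rs (- s)" "f\<noteq>0" using root_neg[OF ra(1)] by (rule rootE)
			have "x\<noteq>0" using ab(5) by auto
			then have nz: "bracket f (bracket x y)\<noteq>0" using string_lemma[OF ra(1) ab(3) _ f ab(4,5) ne] by auto
			have "bracket f (bracket x y)\<in>bo"
				by (rule subalg_bracket[OF bo_subalg]) (use f ra r sub in auto)
			moreover have "bracket f (bracket x y)\<in>rs h" using rs_bracket[OF f(1) r] by simp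
			ultimately show False using hstab_root[OF bo_hstab ra(3)] nz ra(4) by blast
		qed
		ultimately show ?thesis by simp
	qed
	show "subalgebra opp" "lie_solvable (cspan (H\<union>(\<Union>s\<in>?T. rs s)))" "subalgebra (cspan (H\<union>(\<Union>s\<in>?T. rs s)))"
		unfolding opp_def by (rule closed_roots_solvable; use T closed in blast)+
qed

end

section \<open>Parabolic subalgebras: Levi roots and the triangular decomposition\<close>

locale reductive_parabolic = reductive_borel H bo for H bo :: "'g::fin_dim_lie_algebra set" +
	fixes P L :: "'g set"
	assumes P: "subalgebra P" and bo_P: "bo\<subseteq>P" and levi: "levi_part H P L"
begin

definition N :: "'g set" where "N = parabolic_nilradical P"

lemma L_subalg: "subalgebra L" and L_reductive: "radical L = lie_center L" and H_L: "H\<subseteq>L"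
	and L_N: "L\<inter>N = {0}" and P_eq: "P = {x + y | x y. x\<in>L \<and> y\<in>N}"
	using levi unfolding levi_part_def reductive_def N_def by auto

lemma L_subspace [simp]: "csub L" and P_subspace [simp]: "csub P"
	using L_subalg P by (auto intro: subalg_csub)

lemma nilradical_stable: "x\<in>P ==> y\<in>nilradical P ==> bracket x y\<in>nilradical P"
	unfolding nilradical_def
	by (rule lin_on_span[OF lin_on_bracket[of UNIV], of "\<Union> {I. lie_ideal I P \<and> lie_nilpotent I}"])
		(auto simp: lie_ideal_def intro!: cspan_base)

lemma N_subspace [simp]: "csub N"
	unfolding N_def parabolic_nilradical_def by (intro csub_Int) (auto simp: nilradical_def)

lemma L_P: "L\<subseteq>P"
proof
	fix x assume "x\<in>L"
	then have "x + 0\<in>{x + y | x y. x\<in>L \<and> y\<in>N}" using csub_0[OF N_subspace] by blast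
	then show "x\<in>P" by (subst P_eq) simp
qed

lemma N_stable: "x\<in>P ==> y\<in>N ==> bracket x y\<in>N"
	unfolding N_def parabolic_nilradical_def using nilradical_stable by (auto intro: bracket_in_set)

lemma H_P: "H\<subseteq>P" using H_bo bo_P by auto

lemma hstab_N: "hstab N" and hstab_L: "hstab L" and hstab_P: "hstab P"
	using N_stable H_P hstab_subalgebra[OF L_subalg H_L] hstab_subalgebra[OF P H_P] by (auto simp: hstab_def)

text \<open>A root vector of \<open>P\<close> is split along \<open>L\<close> and \<open>N\<close>;
  the components of the right weight lie in the same summands, one of them is nonzero, and the root
  space is a line.\<close>

lemma root_P_cases: "root s ==> rs s\<subseteq>P ==> rs s\<subseteq>L \<or> rs s\<subseteq>N"
proof -
	assume a: "root s" "rs s\<subseteq>P"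
	obtain x where x: "x\<in>rs s" "x\<noteq>0" using a(1) by (rule rootE)
	have "x\<in>{x + y | x y. x\<in>L \<and> y\<in>N}" using a(2) x(1) P_eq by blast
	then obtain l n where ln: "x = l + n" "l\<in>L" "n\<in>N" by blast
	have "x = proj s l + proj s n" using proj_rs[OF x(1), of s] by (simp add: ln(1) proj_add)
	then have "proj s l\<noteq>0 \<or> proj s n\<noteq>0" using x(2) by auto
	then show ?thesis
		using hstab_root[OF hstab_L a(1) proj_hstab[OF hstab_L ln(2)] proj_in_rs]
			hstab_root[OF hstab_N a(1) proj_hstab[OF hstab_N ln(3)] proj_in_rs] by blast
qed

text \<open>If the opposite root space is missing, the root vector \<open>e\<close> lies in the
  kernel \<open>J\<close> of the Killing form restricted to \<open>L\<close>. By Cartan's criterion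
  \<open>J\<close> is a solvable ideal of \<open>L\<close>, hence central by reductivity of
  \<open>L\<close>; but \<open>H\<close> acts on \<open>e\<close> by the nonzero weight
  \<open>s\<close>.\<close>

lemma L_symmetric:
	assumes a: "root s" "rs s\<subseteq>L" shows "rs (- s)\<subseteq>L"
proof (rule ccontr)
	assume no: "\<not> ?thesis"
	define J where "J = {x\<in>L. \<forall>y\<in>L. killing x y = 0}"
	note perp = killing_perp[OF L_subalg]
	have Js: "csub J"
		by (rule csubI) (auto simp: J_def killing_add_left killing_scale_left csub_0 csub_add csub_scale)
	have Jst: "bracket y p\<in>J" if "y\<in>L" "p\<in>J" for y p
		using perp(2)[OF that(1)] that subalg_bracket[OF L_subalg] by (simp add: J_def)
	have "subalgebra J" unfolding subalgebra_def using Js Jst by (auto simp: J_def)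
	then have "lie_solvable J" by (rule cartan_criterion) (auto simp: J_def)
	moreover have "lie_ideal J L" unfolding lie_ideal_def using Js Jst by (auto simp: J_def)
	ultimately have "J\<subseteq>radical L" unfolding radical_def by (intro subsetI cspan_base) auto
	then have central: "bracket x y = 0" if "x\<in>J" "y\<in>L" for x y
		using that L_reductive by (auto simp: lie_center_def)
	obtain e where e: "e\<in>rs s" "e\<noteq>0" "s\<noteq>0" using a(1) by (rule rootE)
	have "\<forall>y\<in>L. killing e y = 0" by (rule perp(3)[OF H_L e(1,3) no])
	then have "e\<in>J" using a(2) e(1) by (auto simp: J_def)
	have "s y = 0" for y
	proof (cases "y\<in>H")
		case True
		then have "bracket e y = 0" using central[OF \<open>e\<in>J\<close>] H_L by auto
		then have "s y *c e = 0" using root_eig[OF e(3,1) True] bracket_anti[of y e] by simp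
		then show ?thesis using e(2) by simp
	qed (use rs_off[OF e(1,2)] in auto)
	then show False using e(3) by (auto simp: fun_eq_iff)
qed

text \<open>Since the Borel subalgebra contains one of the two root spaces, that of \<open>s\<close>
  is in \<open>P\<close>; it is not in \<open>L\<close>, because the roots of \<open>L\<close> are
  symmetric.\<close>

lemma root_not_P:
	assumes "root s" "\<not> rs (- s)\<subseteq>P" shows "rs s\<subseteq>N"
	using bo_either bo_P root_P_cases L_symmetric L_P assms by fastforce

text \<open>\<open>N\<close> is an ideal of \<open>P\<close>, so \<open>[e, f]\<close> would lie in
  both \<open>N\<close> and \<open>H\<close>, hence in the zero intersection of \<open>N\<close> and
  \<open>L\<close>; but \<open>s\<close> does not vanish on it.\<close>

lemma root_N_opposite:
	assumes "root s" "rs s\<subseteq>N" shows "\<not> rs (- s)\<subseteq>P"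
proof
	assume neg: "rs (- s)\<subseteq>P"
	obtain e where e: "e\<in>rs s" "e\<noteq>0" using assms(1) by (rule rootE)
	obtain f where f: "f\<in>rs (- s)" "f\<noteq>0" using root_neg[OF assms(1)] by (rule rootE)
	have t: "bracket e f\<in>H" "s (bracket e f)\<noteq>0" using sl2[OF assms(1) e f] by auto
	have "bracket f e\<in>N" using N_stable neg f e assms(2) by auto
	then have "bracket e f\<in>N" using bracket_anti[of e f] csub_neg[OF N_subspace] by auto
	then have "bracket e f = 0" using t(1) H_L L_N by auto
	then have "s 0\<noteq>0" using t(2) by simp
	moreover have "s (0 *c 0) = 0 * s 0" using rs_dual[OF e] csub_0[OF H_subspace] unfolding dual_space_def by blast
	ultimately show False by simp
qed

definition NM :: "'g set" where "NM = opposite_nilradical H P"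

lemma NM_eq: "NM = cspan (\<Union>s\<in>{s. root s \<and> rs s\<subseteq>N}. rs (- s))"
proof -
	have "root_space H (\<lambda>x. - s x) = rs (- s)" if ra: "root s" for s
	proof -
		obtain e where e: "e\<in>rs (- s)" "e\<noteq>0" "- s\<noteq>0" using root_neg[OF ra] by (rule rootE)
		have "rs (- s) = root_space H (- s)" by (rule rs_root_space[OF e(3)]) (use rs_off[OF e(1,2)] in auto)
		then show ?thesis by (simp add: fun_Compl_def)
	qed
	then have "(\<Union>s\<in>roots_in H N. root_space H (\<lambda>x. - s x)) = (\<Union>s\<in>{s. root s \<and> rs s\<subseteq>N}. rs (- s))"
		using roots_in_iff[OF hstab_N] by auto
	then show ?thesis unfolding NM_def opposite_nilradical_def N_def[symmetric] by simp
qed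

lemma NM_subspace [simp]: "csub NM" by (simp add: NM_eq)

lemma NM_rs: "root s ==> rs s\<subseteq>N ==> rs (- s)\<subseteq>NM"
	unfolding NM_eq by (auto intro!: cspan_base)

lemma P_plus_NM: "\<exists>p\<in>P. \<exists>n\<in>NM. x = p + n"
proof -
	have "(UNIV\<inter>H)\<union>(RS UNIV)\<subseteq>P\<union>NM"
	proof -
		have "rs s\<subseteq>P\<union>NM" if "root s" for s
			using root_not_P[OF root_neg[OF that]] NM_rs[OF root_neg[OF that]] by auto
		then show ?thesis using H_P by auto
	qed
	then have "x\<in>cspan (P\<union>NM)"
		using hstab_span[OF hstab_UNIV] cspan_mono by blast
	then show ?thesis unfolding cspan_Un by (auto simp: cspan_eq)
qed

text \<open>A nonzero weight component of a common element has a weight opposite to a root of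
  \<open>N\<close>, and by stability it would put that whole root space into
  \<open>P\<close>.\<close>

lemma NM_P: "NM\<inter>P = {0}"
proof -
	have "x = 0" if x: "x\<in>NM" "x\<in>P" for x
	proof (rule proj_all_zero, rule ccontr)
		fix h assume nz: "proj h x\<noteq>0"
		have "\<exists>s. root s \<and> rs s\<subseteq>N \<and> h = - s"
		proof (rule ccontr)
			assume no: "\<not> ?thesis"
			have "proj h x\<in>{0}"
				using x(1) unfolding NM_eq
				by (rule lin_on_span[OF proj_lin[of UNIV], rotated 4]) (use no in \<open>auto simp: proj_rs csub_def\<close>)
			then show False using nz by simp
		qed
		then obtain s where a: "root s" "rs s\<subseteq>N" "h = - s" by blast
		have "rs h\<subseteq>P" using hstab_root[OF hstab_P _ proj_hstab[OF hstab_P x(2)] proj_in_rs nz] root_neg[OF a(1)] a(3) by auto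
		then show False using root_N_opposite a by auto
	qed
	then show ?thesis using csub_0[OF NM_subspace] csub_0[OF P_subspace] by auto
qed

text \<open>If a bracket of root vectors from \<open>L\<close> and \<open>NM\<close> landed in
  \<open>P\<close>, a root vector of \<open>L\<close> opposite to the first one would carry it back,
  nonzero by the string lemma, to the root space of the second, which would then be in
  \<open>P\<close>.\<close>

lemma NM_L_stable: "x\<in>L ==> z\<in>NM ==> bracket x z\<in>NM"
proof -
	assume xz: "x\<in>L" "z\<in>NM"
	have "x\<in>cspan ((L\<inter>H)\<union>(RS L))" using hstab_span[OF hstab_L] xz(1) by auto
	moreover have "z\<in>cspan (\<Union>s\<in>{s. root s \<and> rs s\<subseteq>N}. rs (- s))" using xz(2) NM_eq by simp
	ultimately show ?thesis
	proof (rule bracket_span[rotated 2])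
		fix x z assume "x\<in>(L\<inter>H)\<union>(RS L)" "z\<in>(\<Union>s\<in>{s. root s \<and> rs s\<subseteq>N}. rs (- s))"
		then obtain s where a: "root s" "rs s\<subseteq>N" "z\<in>rs (- s)" and
			x: "x\<in>H \<or> (\<exists>j. root j \<and> rs j\<subseteq>L \<and> x\<in>rs j)" by auto
		from x show "bracket x z\<in>NM"
		proof
			assume "x\<in>H"
			then show ?thesis using rs_bracket[of x 0 z "- s"] rs_0 a NM_rs by auto
		next
			assume "\<exists>j. root j \<and> rs j\<subseteq>L \<and> x\<in>rs j"
			then obtain j where g: "root j" "rs j\<subseteq>L" "x\<in>rs j" by blast
			show ?thesis
			proof (cases "bracket x z = 0")
				case False
				have x0: "x\<noteq>0" using False by auto
				have r: "bracket x z\<in>rs (j + - s)" by (rule rs_bracket[OF g(3) a(3)])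
				have ne: "j + - s\<noteq>0"
				proof
					assume "j + - s = 0"
					then have "j = s" by simp
					then show False using g a(2) x0 L_N by auto
				qed
				have rt: "root (j + - s)" by (rule rootI[OF r False ne])
				have "\<not> rs (j + - s)\<subseteq>P"
				proof
					assume inP: "rs (j + - s)\<subseteq>P"
					obtain f where f: "f\<in>rs (- j)" "f\<noteq>0" using root_neg[OF g(1)] by (rule rootE)
					have nz: "bracket f (bracket x z)\<noteq>0" by (rule string_lemma[OF g(1,3) x0 f a(3) False ne])
					have "f\<in>P" using L_symmetric[OF g(1,2)] f(1) L_P by auto
					then have "bracket f (bracket x z)\<in>P" using subalg_bracket[OF P] r inP by auto
					moreover have "bracket f (bracket x z)\<in>rs (- s)" using rs_bracket[OF f(1) r] by simp
					ultimately have "rs (- s)\<subseteq>P" using hstab_root[OF hstab_P root_neg[OF a(1)]] nz by blast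
					then show False using root_N_opposite a by auto
				qed
				then have "rs (- (j + - s))\<subseteq>N" using root_not_P[OF root_neg[OF rt]] by simp
				then have "rs (j + - s)\<subseteq>NM" using NM_rs[OF root_neg[OF rt]] by simp
				then show ?thesis using r by auto
			qed (simp add: csub_0)
		qed
	qed simp
qed

end

section \<open>Highest weight modules\<close>

definition stable :: "'x set => ('x => 'w => 'w) => 'w::complex_vector set => bool" where
	"stable L a U \<longleftrightarrow> csub U \<and> (\<forall>x\<in>L. \<forall>u\<in>U. a x u\<in>U)"

lemma minimal_stable_subspace:
	assumes "fin_dim W" "stable L a W" "W\<noteq>{0}"
	obtains U where "U\<subseteq>W" "stable L a U" "U\<noteq>{0}"
		"\<And>U'. stable L a U' ==> U'\<subseteq>U ==> U' = {0} \<or> U' = U"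
proof -
	let ?P = "\<lambda>U. U\<subseteq>W \<and> stable L a U \<and> U\<noteq>{0}"
	obtain U where U: "?P U" and min: "\<And>U'. ?P U' ==> cdim U \<le> cdim U'"
		using ex_has_least_nat[of ?P W cdim] assms by blast
	have "U' = {0} \<or> U' = U" if U': "stable L a U'" "U'\<subseteq>U" for U'
	proof (rule ccontr)
		assume *: "\<not> ?thesis"
		then have "cdim U' < cdim U"
			using U U' by (intro dim_less fin_dim_mono[OF assms(1)]) (auto simp: stable_def)
		moreover have "?P U'" using * U U' by auto
		ultimately show False using min[of U'] by simp
	qed
	then show thesis using that U by blast
qed

lemma maximal_proper_stable_subspace:
	assumes "fin_dim W" "csub W" "W\<noteq>{0}" "\<And>x. x\<in>L ==> a x 0 = 0"
	obtains U where "U \<subset> W" "stable L a U"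
		"\<And>U'. stable L a U' ==> U \<subset> U' ==> U'\<subseteq>W ==> U' = W"
proof -
	let ?P = "\<lambda>U. U \<subset> W \<and> stable L a U"
	have "?P {0}" using assms csub_0[OF assms(2)] by (auto simp: stable_def)
	moreover have "cdim U < Suc (cdim W)" if "?P U" for U
		using dim_less[OF assms(1) _ assms(2), of U] that by (auto simp: stable_def)
	ultimately obtain U where U: "?P U" and max: "\<And>U'. ?P U' ==> cdim U' \<le> cdim U"
		using ex_has_greatest_nat[of ?P "{0}" cdim "Suc (cdim W)"] by blast
	have "U' = W" if U': "stable L a U'" "U \<subset> U'" "U'\<subseteq>W" for U'
	proof (rule ccontr)
		assume "U'\<noteq>W"
		then have "?P U'" using U' by auto
		moreover have "cdim U < cdim U'"
			using U U' by (intro dim_less fin_dim_mono[OF assms(1)]) (auto simp: stable_def)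
		ultimately show False using max[of U'] by simp
	qed
	then show thesis using that U by blast
qed

text \<open>Closure is imposed only under \<open>M\<close>, the lowering part, so that modulo proper
  subspaces containing the images of \<open>M\<close> every pair is a multiple of
  \<open>(v, v')\<close>. Closure under the rest of the algebra is derived from the highest weight
  condition.\<close>

inductive_set gen_pairs ::
	"'x set => ('x => 'v::complex_vector => 'v) => ('x => 'w::complex_vector => 'w) => 'v => 'w => ('v \<times> 'w) set"
	for M a a' v v' where
	base: "(v, v')\<in>gen_pairs M a a' v v'"
| add: "(x, x')\<in>gen_pairs M a a' v v' ==> (y, y')\<in>gen_pairs M a a' v v' ==>
		(x + y, x' + y')\<in>gen_pairs M a a' v v'"
| scale: "(x, x')\<in>gen_pairs M a a' v v' ==> (c *c x, c *c x')\<in>gen_pairs M a a' v v'"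
| act: "(x, x')\<in>gen_pairs M a a' v v' ==> f\<in>M ==> (a f x, a' f x')\<in>gen_pairs M a a' v v'"

text \<open>The submodule of \<open>W \<times> W'\<close> generated by \<open>(v, v')\<close> is the graph of an isomorphism. It contains no
	pair \<open>(0, v')\<close>, because all of its elements are multiples of \<open>(v, v')\<close> modulo \<open>U \<times> U'\<close>.\<close>

lemma highest_weight_isomorphism:
	fixes a :: "'x::lie_algebra => 'v::complex_vector => 'v" and a' :: "'x => 'w::complex_vector => 'w"
	assumes "lie_rep L W a" "lie_rep L W' a'"
		and irr: "\<And>U. stable L a U ==> U\<subseteq>W ==> U = {0} \<or> U = W"
			"\<And>U. stable L a' U ==> U\<subseteq>W' ==> U = {0} \<or> U = W'"
		and v: "v\<in>W" "v\<noteq>0" "v'\<in>W'" "v'\<noteq>0"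
		and dec: "bl\<subseteq>L" "M\<subseteq>L" "\<And>x. x\<in>L ==> \<exists>y\<in>bl. \<exists>f\<in>M. x = y + f"
		and hw: "\<And>y. y\<in>bl ==> a y v = \<chi> y *c v" "\<And>y. y\<in>bl ==> a' y v' = \<chi> y *c v'"
		and U: "csub U" "U \<subset> W" "\<And>f w. f\<in>M ==> w\<in>W ==> a f w\<in>U"
			"csub U'" "U' \<subset> W'" "\<And>f w. f\<in>M ==> w\<in>W' ==> a' f w\<in>U'"
	shows "\<exists>\<phi>. bij_betw \<phi> W W' \<and> lin_on W \<phi> \<and> (\<forall>x\<in>L. \<forall>w\<in>W. \<phi> (a x w) = a' x (\<phi> w))"
proof -
	interpret A: lie_rep L W a by fact
	interpret A': lie_rep L W' a' by fact
	let ?G = "gen_pairs M a a' v v'"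
	have GW: "x\<in>W \<and> x'\<in>W'" if "(x, x')\<in>?G" for x x'
		using that
		by (induction rule: gen_pairs.induct)
			(use v dec A.W A'.W A.closed A'.closed in \<open>auto intro: csub_add csub_scale\<close>)
	have mod: "\<exists>c. x - c *c v\<in>U \<and> x' - c *c v'\<in>U'" if "(x, x')\<in>?G" for x x'
		using that
	proof (induction rule: gen_pairs.induct)
		case base
		show ?case by (intro exI[of _ 1]) (simp add: scaleC_one csub_0 U)
	next
		case (add x x' y y')
		then obtain c d where "x - c *c v\<in>U" "x' - c *c v'\<in>U'" "y - d *c v\<in>U" "y' - d *c v'\<in>U'" by blast
		then have "(x - c *c v) + (y - d *c v)\<in>U" "(x' - c *c v') + (y' - d *c v')\<in>U'"
			using U(1,4) by (auto intro: csub_add)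
		then show ?case by (intro exI[of _ "c + d"]) (simp add: scaleC_add_left algebra_simps)
	next
		case (scale x x' k)
		then obtain c where "x - c *c v\<in>U" "x' - c *c v'\<in>U'" by blast
		then have "k *c (x - c *c v)\<in>U" "k *c (x' - c *c v')\<in>U'" using U(1,4) by (auto intro: csub_scale)
		then show ?case by (intro exI[of _ "k * c"]) (simp add: scaleC_diff_right)
	next
		case (act x x' f)
		then show ?case using U(3)[of f x] U(6)[of f x'] GW by (intro exI[of _ 0]) auto
	qed
	have Gsum: "(0, 0)\<in>?G" using gen_pairs.scale[OF gen_pairs.base, where c = 0] by simp
	\<comment> \<open>An operator \<open>y\<close> of \<open>bl\<close> is moved to the right through
	  the lowering operators. Its commutator with \<open>f\<close> splits again into a part in
	  \<open>bl\<close> and a part in \<open>M\<close>, and on the generator \<open>y\<close> acts by a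
	  scalar that is the same for both modules.\<close>
	have bl: "(a y x, a' y x')\<in>?G" if "(x, x')\<in>?G" "y\<in>bl" for x x' y
		using that
	proof (induction arbitrary: y rule: gen_pairs.induct)
		case base
		then show ?case using hw gen_pairs.scale[OF gen_pairs.base] by metis
	next
		case (add x x' z z')
		have y: "y\<in>L" using add dec by auto
		show ?case
			using gen_pairs.add[OF add.IH(1)[OF add.prems] add.IH(2)[OF add.prems]]
				lin_on_add[OF A.lin[OF y], of x z] lin_on_add[OF A'.lin[OF y], of x' z'] GW[OF add.hyps(1)] GW[OF add.hyps(2)] by simp
	next
		case (scale x x' c)
		have y: "y\<in>L" using scale dec by auto
		show ?case
			using gen_pairs.scale[OF scale.IH[OF scale.prems], where c = c]
				lin_on_scale[OF A.lin[OF y], of x c] lin_on_scale[OF A'.lin[OF y], of x' c] GW[OF scale.hyps] by simp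
	next
		case (act x x' f)
		have y: "y\<in>L" and f: "f\<in>L" using act dec by auto
		have x: "x\<in>W" "x'\<in>W'" using GW[OF act.hyps(1)] by auto
		obtain z g where zg: "z\<in>bl" "g\<in>M" "bracket y f = z + g"
			using dec(3)[OF subalg_bracket[OF A.L y f]] by blast
		have zL: "z\<in>L" "g\<in>L" using zg dec by auto
		have "a y (a f x) = a f (a y x) + (a z x + a g x)"
			using A.comm[OF y f x(1)] lin_on_add[OF A.lin_left[OF x(1)] zL] zg(3) by (simp add: algebra_simps)
		moreover have "a' y (a' f x') = a' f (a' y x') + (a' z x' + a' g x')"
			using A'.comm[OF y f x(2)] lin_on_add[OF A'.lin_left[OF x(2)] zL] zg(3) by (simp add: algebra_simps)
		moreover have "(a f (a y x), a' f (a' y x'))\<in>?G" by (rule gen_pairs.act[OF act.IH[OF act.prems] act.hyps(2)])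
		moreover have "(a z x, a' z x')\<in>?G" by (rule act.IH[OF zg(1)])
		moreover have "(a g x, a' g x')\<in>?G" by (rule gen_pairs.act[OF act.hyps(1) zg(2)])
		ultimately show ?case by (simp add: gen_pairs.add)
	qed
	have stab: "(a x u, a' x u')\<in>?G" if "(u, u')\<in>?G" "x\<in>L" for x u u'
	proof -
		obtain y f where yf: "y\<in>bl" "f\<in>M" "x = y + f" using dec(3) \<open>x\<in>L\<close> by blast
		have "y\<in>L" "f\<in>L" using yf dec by auto
		then have "a x u = a y u + a f u" "a' x u' = a' y u' + a' f u'"
			using lin_on_add[OF A.lin_left] lin_on_add[OF A'.lin_left] GW[OF that(1)] yf(3) by blast+
		then show ?thesis using gen_pairs.add[OF bl[OF that(1) yf(1)] gen_pairs.act[OF that(1) yf(2)]] by simp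
	qed
	have dom: "{x. \<exists>x'. (x, x')\<in>?G} = W"
	proof -
		have "stable L a {x. \<exists>x'. (x, x')\<in>?G}"
			unfolding stable_def
			by (auto intro!: csubI intro: Gsum gen_pairs.add gen_pairs.scale stab)
		moreover have "v\<in>{x. \<exists>x'. (x, x')\<in>?G}" by (auto intro: gen_pairs.base)
		ultimately show ?thesis using irr(1)[of "{x. \<exists>x'. (x, x')\<in>?G}"] GW v by blast
	qed
	have ran: "{x'. \<exists>x. (x, x')\<in>?G} = W'"
	proof -
		have "stable L a' {x'. \<exists>x. (x, x')\<in>?G}"
			unfolding stable_def
			by (auto intro!: csubI intro: Gsum gen_pairs.add gen_pairs.scale stab)
		moreover have "v'\<in>{x'. \<exists>x. (x, x')\<in>?G}" by (auto intro: gen_pairs.base)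
		ultimately show ?thesis using irr(2)[of "{x'. \<exists>x. (x, x')\<in>?G}"] GW v by blast
	qed
	have vU: "v \<notin> U"
	proof
		assume "v\<in>U"
		have "x\<in>U" if xW: "x\<in>W" for x
		proof -
			obtain c where "x - c *c v\<in>U" using xW dom mod by blast
			then have "(x - c *c v) + c *c v\<in>U" using \<open>v\<in>U\<close> U(1) by (intro csub_add csub_scale)
			then show ?thesis by simp
		qed
		then show False using U(2) by auto
	qed
	have vU': "v' \<notin> U'"
	proof
		assume "v'\<in>U'"
		have "x\<in>U'" if xW: "x\<in>W'" for x
		proof -
			obtain c where "x - c *c v'\<in>U'" using xW ran mod by blast
			then have "(x - c *c v') + c *c v'\<in>U'" using \<open>v'\<in>U'\<close> U(4) by (intro csub_add csub_scale)
			then show ?thesis by simp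
		qed
		then show False using U(5) by auto
	qed
	have scal0: "c = 0" if "csub S" "0 - c *c z\<in>S" "z \<notin> S" for c and S :: "'b::complex_vector set" and z
	proof (rule ccontr)
		assume "c\<noteq>0"
		have "- inverse c *c (0 - c *c z)\<in>S" by (rule csub_scale[OF that(1,2)])
		then show False using that(3) \<open>c\<noteq>0\<close> by (simp add: scaleC_scaleC scaleC_one)
	qed
	have f1: "x' = 0" if "(0, x')\<in>?G" for x'
	proof -
		let ?K = "{x'. (0, x')\<in>?G}"
		have st: "stable L a' ?K"
			unfolding stable_def
		proof (intro conjI csubI ballI)
			fix x u assume "x\<in>L" "u\<in>?K"
			then show "a' x u\<in>?K" using stab[of 0 u x] lin_on_0[OF A.W A.lin] by simp
		qed (use Gsum gen_pairs.add[where x = 0 and y = 0] gen_pairs.scale[where x = 0] in auto)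
		have "v' \<notin> ?K"
		proof
			assume "v'\<in>?K"
			then obtain c where "0 - c *c v\<in>U" "v' - c *c v'\<in>U'" using mod by blast
			then show False using scal0[OF U(1) _ vU] vU' by force
		qed
		then show ?thesis using irr(2)[OF st] GW that v by blast
	qed
	have f2: "x = 0" if "(x, 0)\<in>?G" for x
	proof -
		let ?K = "{x. (x, 0)\<in>?G}"
		have st: "stable L a ?K"
			unfolding stable_def
		proof (intro conjI csubI ballI)
			fix x u assume "x\<in>L" "u\<in>?K"
			then show "a x u\<in>?K" using stab[of u 0 x] lin_on_0[OF A'.W A'.lin] by simp
		qed (use Gsum gen_pairs.add[where x' = 0 and y' = 0] gen_pairs.scale[where x' = 0] in auto)
		have "v \<notin> ?K"
		proof
			assume "v\<in>?K"
			then obtain c where "v - c *c v\<in>U" "0 - c *c v'\<in>U'" using mod by blast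
			then show False using scal0[OF U(4) _ vU'] vU by force
		qed
		then show ?thesis using irr(1)[OF st] GW that v by blast
	qed
	have neg: "(- x, - x')\<in>?G" if "(x, x')\<in>?G" for x x' using gen_pairs.scale[OF that, where c = "-1"] by simp
	have u1: "x' = y'" if "(x, x')\<in>?G" "(x, y')\<in>?G" for x x' y'
		using f1[of "x' + - y'"] gen_pairs.add[OF that(1) neg[OF that(2)]] by simp
	have u2: "x = y" if "(x, x')\<in>?G" "(y, x')\<in>?G" for x x' y
		using f2[of "x + - y"] gen_pairs.add[OF that(1) neg[OF that(2)]] by simp
	define \<phi> where "\<phi> x = (THE x'. (x, x')\<in>?G)" for x
	have phiI: "\<phi> x = x'" if "(x, x')\<in>?G" for x x'
		unfolding \<phi>_def using that u1 by blast
	have phi: "(x, \<phi> x)\<in>?G" if "x\<in>W" for x using that dom phiI by blast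
	have "bij_betw \<phi> W W'"
		unfolding bij_betw_def
	proof
		show "inj_on \<phi> W" by (rule inj_onI) (metis phi u2)
		show "\<phi> ` W = W'" using phi GW ran phiI by force
	qed
	moreover have "lin_on W \<phi>"
		unfolding lin_on_def using phi phiI gen_pairs.add gen_pairs.scale by metis
	moreover have "\<forall>x\<in>L. \<forall>w\<in>W. \<phi> (a x w) = a' x (\<phi> w)" using phi phiI stab by metis
	ultimately show ?thesis by blast
qed

section \<open>Existence of highest weight vectors and uniqueness of highest weight modules\<close>

context reductive_borel
begin

definition is_hw :: "'g set => ('g => complex) => ('g => 'w::complex_vector => 'w) => 'w => bool" where
	"is_hw l \<mu> a v \<longleftrightarrow> v\<noteq>0 \<and> (\<forall>x\<in>H. a x v = \<mu> x *c v) \<and>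
		 (\<forall>h\<in>roots_in H (bo\<inter>l). \<forall>x\<in>root_space H h\<inter>l. a x v = 0)"

lemma bl_subalgebra: "subalgebra l ==> subalgebra (bo\<inter>l)"
	using bo_subalg unfolding subalgebra_def by (auto intro: csub_Int)

text \<open>Lie's theorem for the solvable algebra \<open>bo \<inter> l\<close> gives a common
  eigenvector. Positive root vectors kill it: up to a nonzero factor they are commutators with
  elements of \<open>H\<close>, and commutators act by 0 on a common eigenvector.\<close>

lemma hw_vector_exists:
	assumes l: "subalgebra l" "H\<subseteq>l" and rep: "lie_rep l W a" and Wf: "fin_dim W" "W\<noteq>{0}"
	shows "\<exists>v\<in>W. \<exists>\<mu>\<in>dual_space H. is_hw l \<mu> a v"
proof -
	interpret lie_rep l W a by fact
	have rep': "lie_rep (bo\<inter>l) W a" by (rule lie_rep_subalgebra[OF rep bl_subalgebra[OF l(1)]]) auto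
	have sol: "lie_solvable (bo\<inter>l)"
		by (rule lie_solvable_mono[OF bo_solvable]) (use subalg_csub[OF bl_subalgebra[OF l(1)]] in auto)
	have a0: "a x 0 = 0" if "x\<in>l" for x using lin_on_0[OF W lin[OF that]] .
	have "\<exists>w\<in>W - {0}. \<exists>\<chi>. \<forall>x\<in>bo\<inter>l. a x w - \<chi> x *c w\<in>{0}"
		by (rule lie_theorem[OF rep' sol Wf(1)]) (use Wf(2) csub_0[OF W] a0 in \<open>auto simp: csub_def\<close>)
	then obtain v \<chi> where v: "v\<in>W" "v\<noteq>0" "\<And>x. x\<in>bo\<inter>l ==> a x v = \<chi> x *c v" by auto
	define \<mu> where "\<mu> x = (if x\<in>H then \<chi> x else 0)" for x
	have Hl: "x\<in>bo\<inter>l" if "x\<in>H" for x using that l H_bo by auto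
	have add: "\<chi> (x + y) = \<chi> x + \<chi> y" if "x\<in>bo\<inter>l" "y\<in>bo\<inter>l" for x y
	proof -
		have "x + y\<in>bo\<inter>l" using csub_add[OF subalg_csub[OF bl_subalgebra[OF l(1)]] that] .
		then have "\<chi> (x + y) *c v = (\<chi> x + \<chi> y) *c v"
			using v(3) that lin_on_add[OF lin_left[OF v(1)], of x y] by (simp add: scaleC_add_left)
		then show ?thesis using v(2) by simp
	qed
	have scale: "\<chi> (c *c x) = c * \<chi> x" if "x\<in>bo\<inter>l" for x c
	proof -
		have "c *c x\<in>bo\<inter>l" using csub_scale[OF subalg_csub[OF bl_subalgebra[OF l(1)]] that] .
		then have "\<chi> (c *c x) *c v = (c * \<chi> x) *c v"
			using v(3) that lin_on_scale[OF lin_left[OF v(1)], of x c] by (simp add: scaleC_scaleC)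
		then show ?thesis using v(2) by simp
	qed
	have "\<mu>\<in>dual_space H"
		using add scale Hl csub_add[OF H_subspace] csub_scale[OF H_subspace] by (auto simp: dual_space_def \<mu>_def)
	moreover have "is_hw l \<mu> a v"
		unfolding is_hw_def
	proof (intro conjI ballI)
		fix h x assume b: "h\<in>roots_in H (bo\<inter>l)" and x: "x\<in>root_space H h\<inter>l"
		have hs: "hstab (bo\<inter>l)" by (rule hstab_subalgebra[OF bl_subalgebra[OF l(1)]]) (use l H_bo in auto)
		have rb: "root h" "rs h\<subseteq>bo\<inter>l" using roots_in_iff[OF hs] b by auto
		have bd: "h\<in>dual_space H" "h\<noteq>0" using b by (auto simp: roots_in_def zero_fun_def)
		have "rs h = root_space H h" by (rule rs_root_space) (use bd in \<open>auto simp: dual_space_def\<close>)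
		then have xr: "x\<in>rs h" using x by auto
		obtain y where y: "y\<in>H" "h y\<noteq>0" using bd by (auto simp: dual_space_def fun_eq_iff) metis
		have br: "bracket y x = h y *c x" using root_eig[OF bd(2) xr y(1)] .
		have xb: "x\<in>bo\<inter>l" using xr rb by auto
		have "h y *c a x v = a (bracket y x) v" unfolding br using lin_on_scale[OF lin_left[OF v(1)], of x "h y"] xb by simp
		also have "... = a y (a x v) - a x (a y v)" by (rule comm) (use Hl[OF y(1)] xb v in auto)
		also have "... = 0"
			using v(3)[OF xb] v(3)[OF Hl[OF y(1)]] lin_on_scale[OF lin, of y v] lin_on_scale[OF lin, of x v] Hl[OF y(1)] xb v(1)
			by (simp add: scaleC_scaleC mult.commute)
		finally show "a x v = 0" using y(2) by simp
	qed (use v Hl in \<open>auto simp: \<mu>_def\<close>)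
	ultimately show ?thesis using v(1) by blast
qed

definition hpart :: "'g => 'g" where "hpart = proj 0"

lemma hpart_add: "hpart (x + y) = hpart x + hpart y" and hpart_scale: "hpart (c *c x) = c *c hpart x"
	and hpart_H: "hpart x\<in>H" and hpart_rs: "x\<in>rs s ==> hpart x = (if s = 0 then x else 0)"
	using proj_in_rs[of 0] rs_0 by (auto simp: hpart_def proj_add proj_scale proj_rs)

text \<open>The highest weight condition is given on \<open>H\<close> and on root vectors only.
  These span \<open>bo \<inter> l\<close>, so the whole algebra acts on \<open>v\<close> by the
  scalar attached to the zero-weight component.\<close>

lemma is_hw_character:
	assumes l: "subalgebra l" "H\<subseteq>l" and rep: "lie_rep l W a" and v: "v\<in>W" "is_hw l \<mu> a v" "\<mu>\<in>dual_space H"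
		and x: "x\<in>bo\<inter>l"
	shows "a x v = \<mu> (hpart x) *c v"
proof -
	interpret lie_rep l W a by fact
	have hs: "hstab (bo\<inter>l)" by (rule hstab_subalgebra[OF bl_subalgebra[OF l(1)]]) (use l H_bo in auto)
	have ls: "csub (bo\<inter>l)" using hs by (simp add: hstab_def)
	have "x\<in>cspan ((bo\<inter>l\<inter>H)\<union>(\<Union>s\<in>{s. root s \<and> rs s\<subseteq>bo\<inter>l}. rs s))" (is "x\<in>cspan ?S")
		using hstab_span[OF hs] x by blast
	then have "x\<in>bo\<inter>l \<and> a x v = \<mu> (hpart x) *c v"
	proof (induction rule: cspan_induct)
		case zero
		have "\<mu> 0 = 0" using v(3) csub_0[OF H_subspace] unfolding dual_space_def
			by (metis (mono_tags, lifting) complex_vector.scale_zero_left mem_Collect_eq mult_zero_left)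
		moreover have "hpart 0 = 0" using hpart_scale[of 0 0] by simp
		ultimately show ?case using csub_0[OF ls] lin_on_0[OF subalg_csub[OF L] lin_left[OF v(1)]] by simp
	next
		case (base x)
		show ?case
		proof (cases "x\<in>H")
			case True
			then have "hpart x = x" using hpart_rs[of x 0] rs_0 by simp
			then show ?thesis using True v(2) l H_bo by (auto simp: is_hw_def)
		next
			case False
			then obtain s where a: "root s" "rs s\<subseteq>bo\<inter>l" "x\<in>rs s" using base by auto
			have "s\<in>roots_in H (bo\<inter>l)" using roots_in_iff[OF hs] a by auto
			moreover have "x\<in>root_space H s"
				using root_eig[OF _ a(3)] a(1) by (auto simp: root_space_def root_def)
			ultimately have "a x v = 0" using v(2) a by (auto simp: is_hw_def)
			moreover have "hpart x = 0" using hpart_rs[OF a(3)] a(1) by (auto simp: root_def)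
			moreover have "\<mu> 0 = 0" using v(3) csub_0[OF H_subspace] unfolding dual_space_def
				by (metis (mono_tags, lifting) complex_vector.scale_zero_left mem_Collect_eq mult_zero_left)
			ultimately show ?thesis using a by auto
		qed
	next
		case (add x y)
		have "hpart x\<in>H" "hpart y\<in>H" using hpart_H by auto
		then have "\<mu> (hpart x + hpart y) = \<mu> (hpart x) + \<mu> (hpart y)" using v(3) by (auto simp: dual_space_def)
		then show ?case using add csub_add[OF ls] lin_on_add[OF lin_left[OF v(1)], of x y]
			by (simp add: hpart_add scaleC_add_left del: Int_iff) auto
	next
		case (scale c x)
		have "hpart x\<in>H" using hpart_H by auto
		then have "\<mu> (c *c hpart x) = c * \<mu> (hpart x)" using v(3) by (auto simp: dual_space_def)
		then show ?case using scale csub_scale[OF ls] lin_on_scale[OF lin_left[OF v(1)], of x c]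
			by (simp add: hpart_scale scaleC_scaleC del: Int_iff) auto
	qed
	then show ?thesis by simp
qed

text \<open>\<open>U\<close> is a maximal proper subspace stable under the opposite Borel subalgebra
  of \<open>l\<close>. By Lie's theorem the quotient by \<open>U\<close> is a line, on which root
  vectors act by 0, being multiples of commutators with \<open>H\<close>.\<close>

lemma opposite_nilpotent_action:
	assumes l: "subalgebra l" "H\<subseteq>l" and rep: "lie_rep l W a" and Wf: "fin_dim W" "W\<noteq>{0}"
	obtains U where "csub U" "U \<subset> W"
		"\<And>f w. f\<in>cspan (\<Union>s\<in>{s. root s \<and> rs s\<subseteq>l \<and> \<not> rs s\<subseteq>bo}. rs s) ==> w\<in>W ==> a f w\<in>U"
proof -
	interpret lie_rep l W a by fact
	define c where "c = l\<inter>cspan (H\<union>(\<Union>s\<in>{s. root s \<and> \<not> rs s\<subseteq>bo}. rs s))"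
	have ls: "csub l" using l(1) by (rule subalg_csub)
	have c: "subalgebra c" using l(1) opposite_borel(3)
		unfolding c_def subalgebra_def by (auto intro: csub_Int)
	have csol: "lie_solvable c"
		by (rule lie_solvable_mono[OF opposite_borel(2)]) (use subalg_csub[OF c] in \<open>auto simp: c_def\<close>)
	have cl: "c\<subseteq>l" by (simp add: c_def)
	have Hc: "H\<subseteq>c" using l by (auto simp: c_def intro: cspan_base)
	have rep': "lie_rep c W a" by (rule lie_rep_subalgebra[OF rep c cl])
	obtain U where U: "U \<subset> W" "stable c a U"
		and max: "\<And>U'. stable c a U' ==> U \<subset> U' ==> U'\<subseteq>W ==> U' = W"
		using maximal_proper_stable_subspace[OF Wf(1) W Wf(2), of c a] lin_on_0[OF W lin] cl by blast
	have Us: "csub U" and Ust: "\<And>x u. x\<in>c ==> u\<in>U ==> a x u\<in>U" using U by (auto simp: stable_def)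
	obtain w \<chi> where w: "w\<in>W" "w \<notin> U" "\<And>x. x\<in>c ==> a x w - \<chi> x *c w\<in>U"
		using lie_theorem[OF rep' csol Wf(1) Us U(1) Ust] by blast
	define U' where "U' = cspan (insert w U)"
	have U'e: "\<exists>k. u - k *c w\<in>U" if "u\<in>U'" for u
		using that complex_vector.span_breakdown_eq[of u w U] cspan_eq[OF Us] by (auto simp: U'_def)
	have UU': "U\<subseteq>U'" "w\<in>U'" unfolding U'_def by (auto intro: cspan_base)
	have U'W: "U'\<subseteq>W" unfolding U'_def by (rule cspan_least) (use w U W in auto)
	have U's: "csub U'" by (simp add: U'_def)
	have wst: "a x w\<in>U'" if "x\<in>c" for x
		using csub_add[OF U's, of "a x w - \<chi> x *c w" "\<chi> x *c w"] w(3)[OF that] UU' csub_scale[OF U's] by auto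
	have "stable c a U'"
		unfolding stable_def
	proof (intro conjI ballI U's)
		fix x u assume x: "x\<in>c" "u\<in>U'"
		then have xl: "x\<in>l" using cl by auto
		show "a x u\<in>U'"
			by (rule lin_on_span[OF lin[OF xl] W, of "insert w U"])
				(use w U wst[OF x(1)] Ust[OF x(1)] UU' U's x in \<open>auto simp: U'_def[symmetric]\<close>)
	qed
	\<comment> \<open>By maximality \<open>w\<close> and \<open>U\<close> span everything, so the
	  quotient is one-dimensional and only the action on \<open>w\<close> remains to be
	  controlled.\<close>
	then have UW: "U' = W" using max UU' w(2) U'W by blast
	have kill: "a x u\<in>U" if x: "root s" "rs s\<subseteq>l" "\<not> rs s\<subseteq>bo" "x\<in>rs s" "u\<in>W" for x u s
	proof -
		have xc: "x\<in>c" unfolding c_def using x by (auto intro!: cspan_base)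
		have xl: "x\<in>l" using xc cl by auto
		have a0: "s\<noteq>0" using x(1) by (simp add: root_def)
		have xw: "a x w\<in>U"
		proof (cases "x = 0")
			case True
			then show ?thesis using lin_on_0[OF ls lin_left[OF w(1)]] csub_0[OF Us] by simp
		next
			case False
			then obtain y where y: "y\<in>H" "s y\<noteq>0" using a0 rs_off[OF x(4)] by (auto simp: fun_eq_iff)
			have yc: "y\<in>c" "y\<in>l" using y Hc cl by auto
			define u1 where "u1 = a x w - \<chi> x *c w"
			define u2 where "u2 = a y w - \<chi> y *c w"
			have u: "u1\<in>U" "u2\<in>U" using w(3) xc yc by (auto simp: u1_def u2_def)
			then have uW: "u1\<in>W" "u2\<in>W" using U by auto
			have e1: "a x w = \<chi> x *c w + u1" and e2: "a y w = \<chi> y *c w + u2" by (simp_all add: u1_def u2_def)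
			have "s y *c a x w = a (bracket y x) w"
				using root_eig[OF a0 x(4) y(1)] lin_on_scale[OF lin_left[OF w(1)] xl] by simp
			also have "... = a y (a x w) - a x (a y w)" by (rule comm[OF yc(2) xl w(1)])
			also have "a y (a x w) = \<chi> x *c a y w + a y u1"
				unfolding e1 using lin_on_add[OF lin[OF yc(2)] csub_scale[OF W w(1)] uW(1)] lin_on_scale[OF lin[OF yc(2)] w(1)] by simp
			also have "a x (a y w) = \<chi> y *c a x w + a x u2"
				unfolding e2 using lin_on_add[OF lin[OF xl] csub_scale[OF W w(1)] uW(2)] lin_on_scale[OF lin[OF xl] w(1)] by simp
			also have "\<chi> x *c a y w + a y u1 - (\<chi> y *c a x w + a x u2) = \<chi> x *c u2 + a y u1 - (\<chi> y *c u1 + a x u2)"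
				unfolding e1 e2 by (simp add: scaleC_add_right scaleC_scaleC mult.commute)
			also have "...\<in>U" using u Ust xc yc Us by (intro csub_diff csub_add csub_scale) auto
			finally have "inverse (s y) *c (s y *c a x w)\<in>U" by (rule csub_scale[OF Us])
			then show ?thesis using y(2) by (simp add: scaleC_scaleC scaleC_one)
		qed
		show ?thesis
			by (rule lin_on_span[OF lin[OF xl] W, of "insert w U"])
				(use w U xw Ust xc Us x(5) UW in \<open>auto simp: U'_def\<close>)
	qed
	have "a f u\<in>U" if f: "f\<in>cspan (\<Union>s\<in>{s. root s \<and> rs s\<subseteq>l \<and> \<not> rs s\<subseteq>bo}. rs s)" and u: "u\<in>W" for f u
		by (rule lin_on_span[OF lin_left[OF u] ls _ _ Us f]) (use kill u in auto)
	then show thesis using that Us U(1) by blast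
qed

theorem highest_weight_unique:
	fixes a :: "'g => 'v::complex_vector => 'v" and a' :: "'g => 'w::complex_vector => 'w"
	assumes l: "subalgebra l" "H\<subseteq>l" and rep: "lie_rep l W a" "lie_rep l W' a'" and fin: "fin_dim W" "fin_dim W'"
		and irr: "\<And>U. stable l a U ==> U\<subseteq>W ==> U = {0} \<or> U = W"
			"\<And>U. stable l a' U ==> U\<subseteq>W' ==> U = {0} \<or> U = W'"
		and v: "v\<in>W" "is_hw l \<mu> a v" "v'\<in>W'" "is_hw l \<mu> a' v'" "\<mu>\<in>dual_space H"
	shows "\<exists>\<phi>. bij_betw \<phi> W W' \<and> lin_on W \<phi> \<and> (\<forall>x\<in>l. \<forall>w\<in>W. \<phi> (a x w) = a' x (\<phi> w))"
proof -
	let ?M = "cspan (\<Union>s\<in>{s. root s \<and> rs s\<subseteq>l \<and> \<not> rs s\<subseteq>bo}. rs s)"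
	have v0: "v\<noteq>0" "v'\<noteq>0" using v by (auto simp: is_hw_def)
	have W0: "W\<noteq>{0}" "W'\<noteq>{0}" using v v0 by auto
	have ls: "csub l" using l(1) by (rule subalg_csub)
	obtain U where U: "csub U" "U \<subset> W" "\<And>f w. f\<in>?M ==> w\<in>W ==> a f w\<in>U"
		by (rule opposite_nilpotent_action[OF l rep(1) fin(1) W0(1)]) blast
	obtain U' where U': "csub U'" "U' \<subset> W'" "\<And>f w. f\<in>?M ==> w\<in>W' ==> a' f w\<in>U'"
		by (rule opposite_nilpotent_action[OF l rep(2) fin(2) W0(2)]) blast
	have M: "?M\<subseteq>l" by (rule cspan_least) (use ls in auto)
	have dec: "\<exists>y\<in>bo\<inter>l. \<exists>f\<in>?M. x = y + f" if "x\<in>l" for x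
	proof -
		have bls: "csub (bo\<inter>l)" using subalg_csub[OF bl_subalgebra[OF l(1)]] .
		have hs: "hstab l" by (rule hstab_subalgebra[OF l])
		have "(l\<inter>H)\<union>(RS l)\<subseteq>(bo\<inter>l)\<union>?M"
			using H_bo by (auto intro: cspan_base)
		then have "x\<in>cspan ((bo\<inter>l)\<union>?M)" using hstab_span[OF hs] that cspan_mono by blast
		then show ?thesis using bls by (auto simp: cspan_Un cspan_eq)
	qed
	show ?thesis
		by (rule highest_weight_isomorphism[where bl = "bo\<inter>l" and M = ?M and U = U and U' = U' and \<chi> = "\<lambda>x. \<mu> (hpart x)" and v = v and v' = v'])
			(use rep irr v v0 M dec U U' is_hw_character[OF l rep(1) v(1,2,5)] is_hw_character[OF l rep(2) v(3,4,5)] in auto)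
qed

end

section \<open>Module records and their linear models\<close>

lemma complex_ring_simps [simp]:
	"carrier complex_ring = UNIV" "monoid.mult complex_ring = (*)" "one complex_ring = 1" "zero complex_ring = 0" "add complex_ring = (+)"
	by (simp_all add: complex_ring_def)

lemma complex_ring_cring: "cring complex_ring"
proof (rule cringI)
	show "abelian_group complex_ring"
		by (rule abelian_groupI) (auto intro!: exI[of _ "- x" for x] simp: algebra_simps)
	show "comm_monoid complex_ring"
		by (rule comm_monoidI) (auto simp: algebra_simps)
qed (auto simp: algebra_simps)

text \<open>A linear model identifies a module record with a subspace \<open>W\<close> of a type of vectors.\<close>

definition lin_model :: "(complex, 'v, 'm) module_scheme => 'w::complex_vector set => ('v => 'w) => bool" where
	"lin_model M W \<phi> \<longleftrightarrow> csub W \<and> bij_betw \<phi> (carrier M) W \<and>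
		 (\<forall>x\<in>carrier M. \<forall>y\<in>carrier M. x \<oplus>\<^bsub>M\<^esub> y\<in>carrier M \<and> \<phi> (x \<oplus>\<^bsub>M\<^esub> y) = \<phi> x + \<phi> y) \<and>
		 (\<forall>c. \<forall>x\<in>carrier M. c \<odot>\<^bsub>M\<^esub> x\<in>carrier M \<and> \<phi> (c \<odot>\<^bsub>M\<^esub> x) = c *c \<phi> x) \<and>
		 \<zero>\<^bsub>M\<^esub>\<in>carrier M \<and> \<phi> \<zero>\<^bsub>M\<^esub> = 0"

locale lmodel =
	fixes M :: "(complex, 'v, 'm) module_scheme" (structure) and W :: "'w::complex_vector set" and \<phi> :: "'v => 'w"
	assumes lm: "lin_model M W \<phi>"
begin

lemma Ws [simp]: "csub W" using lm by (simp add: lin_model_def)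
lemma bij: "bij_betw \<phi> (carrier M) W" using lm by (simp add: lin_model_def)
lemma phi_W [simp]: "x\<in>carrier M ==> \<phi> x\<in>W" using bij by (auto simp: bij_betw_def)
lemma phi_inj: "x\<in>carrier M ==> y\<in>carrier M ==> \<phi> x = \<phi> y ==> x = y"
	using bij by (auto simp: bij_betw_def inj_on_def)
lemma phi_surj: "w\<in>W ==> \<exists>x\<in>carrier M. \<phi> x = w" using bij by (auto simp: bij_betw_def)
lemma add_c [simp]: "x\<in>carrier M ==> y\<in>carrier M ==> x \<oplus> y\<in>carrier M"
	and phi_add [simp]: "x\<in>carrier M ==> y\<in>carrier M ==> \<phi> (x \<oplus> y) = \<phi> x + \<phi> y"
	and smult_c [simp]: "x\<in>carrier M ==> c \<odot> x\<in>carrier M"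
	and phi_smult [simp]: "x\<in>carrier M ==> \<phi> (c \<odot> x) = c *c \<phi> x"
	and zero_c [simp]: "\<zero>\<in>carrier M" and phi_zero [simp]: "\<phi> \<zero> = 0"
	using lm unfolding lin_model_def by auto

lemma abelian_group_M: "abelian_group M"
proof (rule abelian_groupI)
	fix x assume x: "x\<in>carrier M"
	have "- 1 \<odot> x \<oplus> x = \<zero>" by (rule phi_inj) (use x in auto)
	then show "\<exists>y\<in>carrier M. y \<oplus> x = \<zero>" using x by (intro bexI[of _ "- 1 \<odot> x"]) auto
qed (auto intro!: phi_inj)

lemma module_M: "Module.module complex_ring M"
	by (rule moduleI) (auto intro!: phi_inj complex_ring_cring abelian_group_M simp: scaleC_add_left scaleC_add_right scaleC_scaleC scaleC_one)

lemma minus_c [simp]: "x\<in>carrier M ==> y\<in>carrier M ==> x \<ominus> y\<in>carrier M"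
	by (simp add: abelian_group.minus_closed abelian_group_M)

lemma phi_minus [simp]:
	assumes "x\<in>carrier M" "y\<in>carrier M" shows "\<phi> (x \<ominus> y) = \<phi> x - \<phi> y"
proof -
	interpret abelian_group M by (rule abelian_group_M)
	have "\<phi> (x \<ominus> y \<oplus> y) = \<phi> (x \<ominus> y) + \<phi> y" using assms by (intro phi_add) auto
	moreover have "x \<ominus> y \<oplus> y = x" using assms by (simp add: minus_eq a_assoc l_neg)
	ultimately show ?thesis by (simp add: algebra_simps)
qed

lemma finsum_c: "finite A ==> (\<And>a. a\<in>A ==> g a\<in>carrier M) ==> finsum M g A\<in>carrier M"
proof -
	interpret abelian_group M by (rule abelian_group_M)
	show "(\<And>a. a\<in>A ==> g a\<in>carrier M) ==> ?thesis" by (rule finsum_closed) auto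
qed

lemma phi_finsum: "finite A ==> (\<And>a. a\<in>A ==> g a\<in>carrier M) ==> \<phi> (finsum M g A) = (\<Sum>a\<in>A. \<phi> (g a))"
proof -
	interpret abelian_group M by (rule abelian_group_M)
	assume "finite A" "\<And>a. a\<in>A ==> g a\<in>carrier M"
	then show ?thesis
	proof (induction A)
		case (insert a A)
		then show ?case by (subst finsum_insert) (auto intro!: phi_add finsum_c)
	qed simp
qed

lemma submodule_iff:
	"submodule U complex_ring M \<longleftrightarrow> U\<subseteq>carrier M \<and> csub (\<phi> ` U)"
proof -
	interpret abelian_group M by (rule abelian_group_M)
	show ?thesis
	proof
		assume U: "submodule U complex_ring M"
		have sub: "U\<subseteq>carrier M" and zero: "\<zero>\<in>U" and add: "\<And>x y. x\<in>U ==> y\<in>U ==> x \<oplus> y\<in>U"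
			and smult: "\<And>c x. x\<in>U ==> c \<odot> x\<in>U"
			using U subgroup.subset[OF submodule.axioms(1)[OF U]] subgroup.one_closed[OF submodule.axioms(1)[OF U]]
				subgroup.m_closed[OF submodule.axioms(1)[OF U]] submodule.smult_closed[OF U] by auto
		have "csub (\<phi> ` U)"
		proof (rule csubI)
			show "0\<in>\<phi> ` U" using zero phi_zero by force
		next
			fix x y assume "x\<in>\<phi> ` U" "y\<in>\<phi> ` U"
			then obtain u v where "u\<in>U" "v\<in>U" "x = \<phi> u" "y = \<phi> v" by auto
			then show "x + y\<in>\<phi> ` U" using add[of u v] sub phi_add[of u v] by (metis imageI subsetD)
		next
			fix c x assume "x\<in>\<phi> ` U"
			then obtain u where "u\<in>U" "x = \<phi> u" by auto
			then show "c *c x\<in>\<phi> ` U" using smult[of u c] sub phi_smult[of u c] by (metis imageI subsetD)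
		qed
		then show "U\<subseteq>carrier M \<and> csub (\<phi> ` U)" using sub by simp
	next
		assume U: "U\<subseteq>carrier M \<and> csub (\<phi> ` U)"
		have backU: "x\<in>U" if "x\<in>carrier M" "\<phi> x\<in>\<phi> ` U" for x
			using that U phi_inj by (metis imageE subsetD)
		show "submodule U complex_ring M"
		proof (rule submodule.intro)
			show "subgroup U (add_monoid M)"
			proof (rule subgroup.intro)
				show "U\<subseteq>carrier (add_monoid M)" using U by auto
				show "x \<otimes>\<^bsub>add_monoid M\<^esub> y\<in>U" if "x\<in>U" "y\<in>U" for x y
				proof -
					have "x\<in>carrier M" "y\<in>carrier M" using that U by auto
					then show ?thesis
						using backU[of "x \<oplus> y"] csub_add[of "\<phi> ` U" "\<phi> x" "\<phi> y"] that U by simp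
				qed
				show "\<one>\<^bsub>add_monoid M\<^esub>\<in>U" using backU[of \<zero>] U csub_0[of "\<phi> ` U"] by auto
				show "inv\<^bsub>add_monoid M\<^esub> x\<in>U" if "x\<in>U" for x
				proof -
					have x: "x\<in>carrier M" using that U by auto
					have "\<phi> (\<ominus> x) = - \<phi> x" using phi_minus[of \<zero> x] x by (simp add: minus_eq)
					then have "\<ominus> x\<in>U" using backU[of "\<ominus> x"] x that U csub_neg[of "\<phi> ` U" "\<phi> x"] by auto
					then show ?thesis by (simp add: a_inv_def)
				qed
			qed
			show "submodule_axioms U complex_ring M"
			proof (rule submodule_axioms.intro)
				fix c x assume "x\<in>U"
				then have "x\<in>carrier M" "\<phi> (c \<odot> x)\<in>\<phi> ` U" using U csub_scale[of "\<phi> ` U" "\<phi> x" c] by auto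
				then show "c \<odot> x\<in>U" using backU[of "c \<odot> x"] by simp
			qed
		qed
	qed
qed

lemma vspan_image:
	assumes "S\<subseteq>carrier M" shows "vspan M S = {x\<in>carrier M. \<phi> x\<in>cspan (\<phi> ` S)}"
proof
	have im: "\<phi> ` {x\<in>carrier M. \<phi> x\<in>cspan (\<phi> ` S)} = cspan (\<phi> ` S)"
		using phi_surj cspan_least[of "\<phi> ` S" W] assms by force
	have "submodule {x\<in>carrier M. \<phi> x\<in>cspan (\<phi> ` S)} complex_ring M"
		unfolding submodule_iff im by auto
	then show "vspan M S\<subseteq>{x\<in>carrier M. \<phi> x\<in>cspan (\<phi> ` S)}"
		unfolding vspan_def using assms by (intro Inter_lower) (auto intro: cspan_base)
	show "{x\<in>carrier M. \<phi> x\<in>cspan (\<phi> ` S)}\<subseteq>vspan M S"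
		unfolding vspan_def
	proof (intro Inter_greatest subsetI)
		fix U x assume U: "U\<in>{W. submodule W complex_ring M \<and> S\<subseteq>W}" and x: "x\<in>{x\<in>carrier M. \<phi> x\<in>cspan (\<phi> ` S)}"
		then have "cspan (\<phi> ` S)\<subseteq>\<phi> ` U" by (intro cspan_least) (auto simp: submodule_iff)
		then obtain u where "u\<in>U" "\<phi> x = \<phi> u" using x by auto
		then show "x\<in>U" using phi_inj[of x u] x U by (auto simp: submodule_iff)
	qed
qed

text \<open>\<open>vdim\<close> is an infimum over finite spanning sets, and the infimum of the
  empty set is infinity.\<close>

lemma vdim_finite_iff: "vdim M\<noteq>\<infinity> \<longleftrightarrow> fin_dim W"
proof
	assume "vdim M\<noteq>\<infinity>"
	then have "{enat (card S) | S. finite S \<and> S\<subseteq>carrier M \<and> vspan M S = carrier M}\<noteq>{}"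
		unfolding vdim_def by (metis Inf_empty top_enat_def)
	then obtain S where S: "finite S" "S\<subseteq>carrier M" "vspan M S = carrier M" by auto
	then have "W\<subseteq>cspan (\<phi> ` S)" using phi_surj vspan_image[OF S(2)] by force
	then show "fin_dim W" unfolding fin_dim_def using S(1) by blast
next
	assume "fin_dim W"
	then obtain B where B: "finite B" "cspan B = W" using fin_dim_basis Ws by metis
	have "\<forall>b\<in>B. \<exists>x\<in>carrier M. \<phi> x = b" using phi_surj B(2) cspan_base by blast
	then obtain g where g: "\<And>b. b\<in>B ==> g b\<in>carrier M \<and> \<phi> (g b) = b" by metis
	have "\<phi> ` g ` B = B" using g by force
	moreover have "g ` B\<subseteq>carrier M" using g by auto
	ultimately have "vspan M (g ` B) = carrier M" using vspan_image[of "g ` B"] phi_W unfolding B(2)[symmetric] by auto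
	then have "enat (card (g ` B))\<in>{enat (card S) | S. finite S \<and> S\<subseteq>carrier M \<and> vspan M S = carrier M}"
		using B(1) g by blast
	then have "vdim M \<le> enat (card (g ` B))" unfolding vdim_def by (rule Inf_lower)
	then show "vdim M\<noteq>\<infinity>" by (metis enat_ord_simps(5) enat.distinct(1) )
qed

definition inv_model :: "'w => 'v" where "inv_model w = (THE x. x\<in>carrier M \<and> \<phi> x = w)"

lemma inv_model: "w\<in>W ==> inv_model w\<in>carrier M" "w\<in>W ==> \<phi> (inv_model w) = w"
proof -
	assume "w\<in>W"
	then have "\<exists>!x. x\<in>carrier M \<and> \<phi> x = w" using phi_surj phi_inj by blast
	from theI'[OF this] show "inv_model w\<in>carrier M" "\<phi> (inv_model w) = w" unfolding inv_model_def by auto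
qed

lemma inv_phi: "x\<in>carrier M ==> inv_model (\<phi> x) = x"
	using inv_model[of "\<phi> x"] phi_inj by simp

end

definition model_act :: "('x, 'v) lie_module => ('v => 'w::complex_vector) => 'x => 'w => 'w" where
	"model_act M \<phi> x w = \<phi> (act M x (lmodel.inv_model M \<phi> w))"

lemma model_act_phi: "lin_model M W \<phi> ==> v\<in>carrier M ==> model_act M \<phi> x (\<phi> v) = \<phi> (act M x v)"
	by (simp add: model_act_def lmodel.inv_phi lmodel_def)

lemma module_lie_rep:
	assumes "is_lie_module L M" "lin_model M W \<phi>" "subalgebra L"
	shows "lie_rep L W (model_act M \<phi>)"
proof -
	interpret lmodel M W \<phi> by (rule lmodel.intro) fact
	note a = model_act_phi[OF assms(2)]
	have c: "x\<in>L ==> v\<in>carrier M ==> act M x v\<in>carrier M" for x v using assms(1) by (simp add: is_lie_module_def)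
	show ?thesis
	proof (rule lie_rep.intro)
		show "model_act M \<phi> x w\<in>W" if "x\<in>L" "w\<in>W" for x w
			using phi_surj[OF that(2)] a c that(1) by auto
		show "lin_on W (model_act M \<phi> x)" if x: "x\<in>L" for x
			unfolding lin_on_def
		proof (intro conjI ballI allI)
			fix u w assume "u\<in>W" "w\<in>W"
			then obtain u' w' where "u'\<in>carrier M" "w'\<in>carrier M" "u = \<phi> u'" "w = \<phi> w'" using phi_surj by metis
			then show "model_act M \<phi> x (u + w) = model_act M \<phi> x u + model_act M \<phi> x w"
				using a[of "u' \<oplus>\<^bsub>M\<^esub> w'" x] a[of u' x] a[of w' x] c[OF x] assms(1) x by (simp add: is_lie_module_def)
		next
			fix k u assume "u\<in>W"
			then obtain u' where "u'\<in>carrier M" "u = \<phi> u'" using phi_surj by metis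
			then show "model_act M \<phi> x (k *c u) = k *c model_act M \<phi> x u"
				using a[of "k \<odot>\<^bsub>M\<^esub> u'" x] a[of u' x] c[OF x] assms(1) x by (simp add: is_lie_module_def)
		qed
		show "lin_on L (\<lambda>x. model_act M \<phi> x w)" if w: "w\<in>W" for w
		proof -
			obtain w' where w': "w'\<in>carrier M" "w = \<phi> w'" using phi_surj w by metis
			show ?thesis unfolding lin_on_def w'(2) a[OF w'(1)] using assms(1) w'(1) c by (simp add: is_lie_module_def)
		qed
		show "model_act M \<phi> (bracket x y) w = model_act M \<phi> x (model_act M \<phi> y w) - model_act M \<phi> y (model_act M \<phi> x w)"
			if xyw: "x\<in>L" "y\<in>L" "w\<in>W" for x y w
		proof -
			obtain w' where w': "w'\<in>carrier M" "w = \<phi> w'" using phi_surj xyw(3) by metis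
			show ?thesis using assms(1) w' a c xyw(1,2) by (simp add: is_lie_module_def)
		qed
	qed (use assms in auto)
qed

lemma lie_rep_is_lie_module:
	assumes "lie_rep L W a" "lin_model M W \<phi>"
		and c: "\<And>x v. x\<in>L ==> v\<in>carrier M ==> act M x v\<in>carrier M \<and> \<phi> (act M x v) = a x (\<phi> v)"
	shows "is_lie_module L M"
proof -
	interpret lmodel M W \<phi> by (rule lmodel.intro) fact
	interpret lie_rep L W a by fact
	have br: "bracket x y\<in>L" if "x\<in>L" "y\<in>L" for x y using subalg_bracket[OF L that] .
	have ad: "x + y\<in>L" "k *c x\<in>L" if "x\<in>L" "y\<in>L" for x y k
		using that csub_add csub_scale subalg_csub[OF L] by auto
	show ?thesis
		unfolding is_lie_module_def
		by (intro conjI ballI allI module_M)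
			(auto intro!: phi_inj simp: c br ad lin_on_add[OF lin] lin_on_scale[OF lin] lin_on_add[OF lin_left] lin_on_scale[OF lin_left] comm)
qed

text \<open>Realizes the quotient of \<open>F\<close> by \<open>K\<close> inside the type of
  \<open>F\<close>: the map sends a basis of \<open>K\<close> to 0 and fixes the added basis
  vectors, so that its image is a complement of \<open>K\<close>.\<close>

lemma quotient_section:
	fixes F K :: "'a::complex_vector set"
	assumes "csub F" "csub K" "K\<subseteq>F"
	obtains \<pi> where "lin_on UNIV \<pi>" "\<And>x. x\<in>F ==> \<pi> x\<in>F" "\<And>x. x\<in>F ==> x - \<pi> x\<in>K" "\<And>x. x\<in>K ==> \<pi> x = 0"
proof -
	interpret vp: vector_space_pair "scaleC :: complex => 'a => 'a" "scaleC :: complex => 'a => 'a" by unfold_locales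
	obtain B0 where B0: "B0\<subseteq>K" "cindep B0" "K\<subseteq>cspan B0"
		using complex_vector.basis_exists[of K] by metis
	obtain B where B: "B0\<subseteq>B" "cindep B" "cspan B = F"
		using basis_extend[OF B0(2) _ assms(1)] B0(1) assms(3) by (metis order_trans)
	obtain g where g: "Vector_Spaces.linear scaleC scaleC g" "\<And>x. x\<in>B ==> g x = (if x\<in>B0 then 0 else x)"
		using vp.linear_independent_extend[OF B(2), of "\<lambda>x. if x\<in>B0 then 0 else x"] by auto
	have lin: "lin_on UNIV g" using g(1) unfolding Vector_Spaces.linear_iff lin_on_def by simp
	show thesis
	proof (rule that[OF lin])
		show "g x\<in>F" if "x\<in>F" for x
			by (rule lin_on_span[OF lin, of B])
				(use that B g(2) assms(1) cspan_base[of _ B] in \<open>auto simp: csub_0\<close>)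
		show "x - g x\<in>K" if "x\<in>F" for x
		proof (rule lin_on_span[of UNIV "\<lambda>x. x - g x" B])
			show "lin_on UNIV (\<lambda>x. x - g x)"
				using lin by (auto simp: lin_on_def scaleC_diff_right)
		qed (use that B B0 g(2) assms in \<open>auto simp: csub_0\<close>)
		show "g x = 0" if "x\<in>K" for x
		proof -
			have "g x\<in>{0}"
				by (rule lin_on_span[OF lin, of B0]) (use that B0 B(1) g(2) in \<open>auto simp: csub_def\<close>)
			then show ?thesis by simp
		qed
	qed
qed

text \<open>The carrier of a module record may live in any type. Formal combinations of its elements
  form a vector space, and modulo the kernel of evaluation this is a copy of the module.\<close>

lemma lin_model_exists:
	fixes M :: "(complex, 'v, 'm) module_scheme" (structure)
	assumes "Module.module complex_ring M"
	shows "\<exists>(W :: ('v \<Rightarrow>\<^sub>0 complex) set) \<phi>. lin_model M W \<phi>"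
proof -
	interpret Module.module complex_ring M by fact
	define ev where "ev p = finsum M (\<lambda>x. lookup p x \<odot> x) (keys p)" for p :: "'v \<Rightarrow>\<^sub>0 complex"
	define F where "F = {p :: 'v \<Rightarrow>\<^sub>0 complex. keys p\<subseteq>carrier M}"
	have sm: "c \<odot> x\<in>carrier M" if "x\<in>carrier M" for c x using that smult_closed by simp
	have ev_eq: "ev p = finsum M (\<lambda>x. lookup p x \<odot> x) S" if "finite S" "keys p\<subseteq>S" "S\<subseteq>carrier M" for p S
		unfolding ev_def
	proof (rule add.finprod_mono_neutral_cong_left[OF that(1,2)])
		fix x assume "x\<in>S - keys p"
		then show "lookup p x \<odot> x = \<zero>" using that smult_l_null[of x] by (auto simp: in_keys_iff)
	qed (use that sm in auto)
	have ev_c: "ev p\<in>carrier M" if "p\<in>F" for p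
		unfolding ev_def using that sm by (auto simp: F_def intro!: finsum_closed)
	have ev_add: "ev (p + q) = ev p \<oplus> ev q" if "p\<in>F" "q\<in>F" for p q
	proof -
		let ?S = "keys p\<union>keys q"
		have S: "finite ?S" "?S\<subseteq>carrier M" using that by (auto simp: F_def)
		have "ev (p + q) = finsum M (\<lambda>x. lookup (p + q) x \<odot> x) ?S"
			by (rule ev_eq) (use S keys_add[of p q] in auto)
		also have "... = finsum M (\<lambda>x. lookup p x \<odot> x \<oplus> lookup q x \<odot> x) ?S"
		proof (rule add.finprod_cong')
			fix x assume "x\<in>?S"
			then show "lookup (p + q) x \<odot> x = lookup p x \<odot> x \<oplus> lookup q x \<odot> x"
				using S smult_l_distr[of "lookup p x" "lookup q x" x] by (auto simp: lookup_add)
		qed (use S sm in auto)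
		also have "... = finsum M (\<lambda>x. lookup p x \<odot> x) ?S \<oplus> finsum M (\<lambda>x. lookup q x \<odot> x) ?S"
			by (rule finsum_addf) (use S sm in auto)
		also have "... = ev p \<oplus> ev q" using ev_eq[of ?S p] ev_eq[of ?S q] S by simp
		finally show ?thesis .
	qed
	have ev_single: "ev (Poly_Mapping.single x c) = c \<odot> x" if "x\<in>carrier M" for x c
		using ev_eq[of "{x}" "Poly_Mapping.single x c"] that sm by simp
	have ev_scale: "ev (c *c p) = c \<odot> ev p" if "p\<in>F" for c p
	proof -
		have S: "finite (keys p)" "keys p\<subseteq>carrier M" using that by (auto simp: F_def)
		have "ev (c *c p) = finsum M (\<lambda>x. lookup (c *c p) x \<odot> x) (keys p)"
			by (rule ev_eq) (use S in \<open>auto simp: in_keys_iff\<close>)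
		also have "... = finsum M (\<lambda>x. c \<odot> (lookup p x \<odot> x)) (keys p)"
			by (rule add.finprod_cong') (use S sm smult_assoc1 in auto)
		also have "... = c \<odot> ev p"
			unfolding ev_def by (rule finsum_smult_ldistr[symmetric]) (use S sm in auto)
		finally show ?thesis .
	qed
	have Fs: "csub F"
	proof (rule csubI)
		fix x y assume "x\<in>F" "y\<in>F"
		then show "x + y\<in>F" using keys_add[of x y] by (auto simp: F_def)
	qed (auto simp: F_def in_keys_iff)
	have sF: "Poly_Mapping.single x c\<in>F" if "x\<in>carrier M" for x c using that by (simp add: F_def)
	define K where "K = {p\<in>F. ev p = \<zero>}"
	have "ev 0 = \<zero>" by (simp add: ev_def)
	then have Ks: "csub K"
		by (intro csubI) (use Fs ev_add ev_scale in \<open>auto simp: K_def csub_0 csub_add csub_scale smult_r_null\<close>)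
	have mem_K: "p - q\<in>K \<longleftrightarrow> ev p = ev q" if "p\<in>F" "q\<in>F" for p q
	proof -
		have "p - q\<in>F" using that csub_diff[OF Fs] by auto
		then have "ev p = ev (p - q) \<oplus> ev q" using ev_add[of "p - q" q] that by simp
		then show ?thesis using ev_c[OF \<open>p - q\<in>F\<close>] ev_c[OF that(2)] \<open>p - q\<in>F\<close>
			by (auto simp: K_def)
	qed
	\<comment> \<open>\<open>K\<close> is the kernel of evaluation, so the values of
	  \<open>\<pi>\<close> are in bijection with the elements of the module.\<close>
	obtain \<pi> where pi: "lin_on UNIV \<pi>" "\<And>x. x\<in>F ==> \<pi> x\<in>F" "\<And>x. x\<in>F ==> x - \<pi> x\<in>K" "\<And>x. x\<in>K ==> \<pi> x = 0"
		using quotient_section[OF Fs Ks] by (auto simp: K_def)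
	have pi_eq: "\<pi> p = \<pi> q \<longleftrightarrow> ev p = ev q" if "p\<in>F" "q\<in>F" for p q
	proof
		assume "ev p = ev q"
		then have "\<pi> (p - q) = 0" using pi(4) mem_K[OF that] by simp
		then show "\<pi> p = \<pi> q" using lin_on_diff[OF _ pi(1)] by simp
	next
		assume "\<pi> p = \<pi> q"
		then have "(p - \<pi> p) - (q - \<pi> q) = p - q" by simp
		then show "ev p = ev q" using mem_K[OF that] csub_diff[OF Ks pi(3)[OF that(1)] pi(3)[OF that(2)]] by simp
	qed
	define \<phi> where "\<phi> x = \<pi> (Poly_Mapping.single x 1)" for x
	have pi_F: "\<pi> p = \<phi> (ev p)" if "p\<in>F" for p
		unfolding \<phi>_def using pi_eq[OF that sF[OF ev_c[OF that]]] ev_single[OF ev_c[OF that], of 1] ev_c[OF that] smult_one by simp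
	have "lin_model M (\<phi> ` carrier M) \<phi>"
		unfolding lin_model_def
	proof (intro conjI ballI allI)
		have im: "\<phi> ` carrier M = \<pi> ` F"
			using pi_F ev_c sF by (auto simp: \<phi>_def image_iff)
		show "csub (\<phi> ` carrier M)" unfolding im by (rule csub_image[OF Fs lin_on_mono[OF pi(1)]]) simp
		show "bij_betw \<phi> (carrier M) (\<phi> ` carrier M)"
			unfolding bij_betw_def
		proof
			show "inj_on \<phi> (carrier M)"
			proof (rule inj_onI)
				fix x y assume "x\<in>carrier M" "y\<in>carrier M" "\<phi> x = \<phi> y"
				then show "x = y" using pi_eq[OF sF sF, of x y 1 1] ev_single[of x 1] ev_single[of y 1] smult_one by (simp add: \<phi>_def)
			qed
		qed simp
		fix x y assume "x\<in>carrier M" "y\<in>carrier M"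
		then show "\<phi> (x \<oplus> y) = \<phi> x + \<phi> y"
			using pi_F[of "Poly_Mapping.single x 1 + Poly_Mapping.single y 1"] ev_add[OF sF sF, of x y 1 1]
				ev_single[of x 1] ev_single[of y 1] csub_add[OF Fs sF sF, of x y 1 1] lin_on_add[OF pi(1)] smult_one by (simp add: \<phi>_def)
	next
		fix c x assume "x\<in>carrier M"
		then show "\<phi> (c \<odot> x) = c *c \<phi> x"
			using pi_F[of "c *c Poly_Mapping.single x 1"] ev_scale[OF sF, of x c 1] ev_single[of x 1]
				csub_scale[OF Fs sF, of x c 1] lin_on_scale[OF pi(1)] smult_one by (simp add: \<phi>_def)
	next
		show "\<phi> \<zero> = 0" using pi_F[of 0] \<open>ev 0 = \<zero>\<close> csub_0[OF Fs] lin_on_0[OF _ pi(1)] by simp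
	qed (use sm in auto)
	then show ?thesis by blast
qed

lemma lin_model_comp:
	assumes "lin_model M W \<phi>" "lin_on W \<psi>" "inj_on \<psi> W"
	shows "lin_model M (\<psi> ` W) (\<psi> \<circ> \<phi>)"
proof -
	interpret lmodel M W \<phi> by (rule lmodel.intro) fact
	have "csub (\<psi> ` W)" by (rule csub_image[OF Ws assms(2)])
	moreover have "bij_betw (\<psi> \<circ> \<phi>) (carrier M) (\<psi> ` W)"
		by (rule bij_betw_trans[OF bij]) (use assms(3) in \<open>simp add: bij_betw_def\<close>)
	ultimately show ?thesis
		unfolding lin_model_def using lin_on_0[OF Ws assms(2)] by (auto simp: lin_on_add[OF assms(2)] lin_on_scale[OF assms(2)])
qed

text \<open>Models of simple modules are chosen among modules on functions from \<open>nat\<close>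
  to \<open>complex\<close>, so finite-dimensional spaces are moved there by coordinates, padded
  with zeros.\<close>

lemma fin_dim_coordinates:
	fixes W :: "'w::complex_vector set"
	assumes "fin_dim W" "csub W"
	obtains \<psi> :: "'w => nat => complex" where "lin_on W \<psi>" "inj_on \<psi> W" "fin_dim (\<psi> ` W)"
proof -
	obtain B where B: "finite B" "cindep B" "cspan B = W" using fin_dim_basis[OF assms] .
	obtain e where e: "bij_betw e {..<card B} B"
		using ex_bij_betw_nat_finite[OF B(1)] by (auto simp: atLeast0LessThan)
	define \<psi> where "\<psi> w = (\<lambda>i. if i < card B then coord B w (e i) else 0)" for w
	have lin: "lin_on W \<psi>"
		unfolding lin_on_def \<psi>_def B(3)[symmetric] by (auto simp: fun_eq_iff coord_add[OF B(2)] coord_scale[OF B(2)])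
	moreover have "inj_on \<psi> W"
	proof (rule inj_onI)
		fix x y assume xy: "x\<in>W" "y\<in>W" "\<psi> x = \<psi> y"
		have "coord B x b = coord B y b" if bB: "b\<in>B" for b
		proof -
			obtain i where "i\<in>{..<card B}" "b = e i" using e bB unfolding bij_betw_def by blast
			then have "i < card B" "e i = b" by auto
			then show ?thesis using fun_cong[OF xy(3), of i] by (simp add: \<psi>_def)
		qed
		then have "(\<Sum>b\<in>B. coord B x b *c b) = (\<Sum>b\<in>B. coord B y b *c b)" by simp
		then show "x = y" using coord_expand[OF B(2,1)] xy B(3) by simp
	qed
	moreover have "fin_dim (\<psi> ` W)"
		unfolding fin_dim_def
	proof (intro exI[of _ "\<psi> ` B"] conjI subsetI)
		fix y assume "y\<in>\<psi> ` W"
		then obtain x where x: "x\<in>W" "y = \<psi> x" by auto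
		show "y\<in>cspan (\<psi> ` B)" unfolding x(2)
		proof (rule lin_on_span[OF lin assms(2), of B])
			fix s assume "s\<in>B"
			then show "\<psi> s\<in>cspan (\<psi> ` B)" by (intro cspan_base imageI)
		qed (use B x cspan_superset[of B] in auto)
	qed (use B in simp)
	ultimately show thesis using that by blast
qed

lemma finite_lin_model_exists:
	assumes "Module.module complex_ring M" "vdim M\<noteq>\<infinity>"
	obtains W :: "(nat => complex) set" and \<phi> where "lin_model M W \<phi>" "fin_dim W"
	using lin_model_exists lmodel.vdim_finite_iff lmodel_def lin_model_def fin_dim_coordinates lin_model_comp assms by metis

text \<open>The way back from a representation on a subspace to a module record.\<close>

definition tl_module :: "'w::complex_vector set => ('x => 'w => 'w) => ('x, 'w) lie_module" where
	"tl_module W a = \<lparr>carrier = W, monoid.mult = undefined, one = undefined, zero = 0, add = (+), module.smult = scaleC, act = a\<rparr>"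

lemma tl_module_simps [simp]:
	"carrier (tl_module W a) = W" "zero (tl_module W a) = 0" "add (tl_module W a) = (+)"
	"module.smult (tl_module W a) = scaleC" "act (tl_module W a) = a"
	by (simp_all add: tl_module_def)

lemma lin_model_tl: "csub W ==> lin_model (tl_module W a) W (\<lambda>x. x)"
	by (auto simp: lin_model_def csub_add csub_scale csub_0 bij_betw_def)

lemma is_lie_module_tl: "lie_rep L W a ==> is_lie_module L (tl_module W a)"
	by (rule lie_rep_is_lie_module[OF _ lin_model_tl]) (auto simp: lie_rep_def)

section \<open>Free vector spaces, free algebras and their quotients\<close>

lemma lin_modelI:
	assumes "inj_on \<phi> (carrier M)"
		"\<And>x y. x\<in>carrier M ==> y\<in>carrier M ==> x \<oplus>\<^bsub>M\<^esub> y\<in>carrier M \<and> \<phi> (x \<oplus>\<^bsub>M\<^esub> y) = \<phi> x + \<phi> y"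
		"\<And>c x. x\<in>carrier M ==> c \<odot>\<^bsub>M\<^esub> x\<in>carrier M \<and> \<phi> (c \<odot>\<^bsub>M\<^esub> x) = c *c \<phi> x"
		"\<zero>\<^bsub>M\<^esub>\<in>carrier M" "\<phi> \<zero>\<^bsub>M\<^esub> = 0"
	shows "lin_model M (\<phi> ` carrier M) \<phi>"
proof -
	have "csub (\<phi> ` carrier M)"
	proof (rule csubI)
		show "0\<in>\<phi> ` carrier M" using assms(4,5) by (metis imageI)
		show "x + y\<in>\<phi> ` carrier M" if "x\<in>\<phi> ` carrier M" "y\<in>\<phi> ` carrier M" for x y
			using that assms(2) by (auto simp: image_iff) metis
		show "c *c x\<in>\<phi> ` carrier M" if "x\<in>\<phi> ` carrier M" for c x
			using that assms(3) by (auto simp: image_iff) metis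
	qed
	then show ?thesis unfolding lin_model_def using assms by (auto simp: bij_betw_def)
qed

section \<open>Cosets and quotient spaces\<close>

definition cs :: "'a::ab_group_add set => 'a => 'a set" where "cs K x = (\<lambda>k. k + x) ` K"

lemma cs_a_r_coset: "add R = (+) ==> a_r_coset R K x = cs K x"
	unfolding a_r_coset_def' cs_def by auto

lemma cs_rcosets: "add R = (+) ==> a_rcosets\<^bsub>R\<^esub> K = cs K ` carrier R"
	unfolding A_RCOSETS_def' by (auto simp: cs_a_r_coset)

lemma cs_self: "csub K ==> x\<in>cs K x" unfolding cs_def using csub_0 by force

lemma cs_eq_iff: assumes "csub K" shows "cs K x = cs K y \<longleftrightarrow> x - y\<in>K"
proof
	assume "cs K x = cs K y"
	then have "x\<in>cs K y" using cs_self[OF assms, of x] by simp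
	then show "x - y\<in>K" by (auto simp: cs_def)
next
	assume xy: "x - y\<in>K"
	have "k + x\<in>cs K y" if "k\<in>K" for k
		using csub_add[OF assms that xy] unfolding cs_def by (auto intro!: image_eqI[of _ _ "k + (x - y)"])
	moreover have "k + y\<in>cs K x" if "k\<in>K" for k
		using csub_diff[OF assms that xy] unfolding cs_def by (auto intro!: image_eqI[of _ _ "k - (x - y)"])
	ultimately show "cs K x = cs K y" by (auto simp: cs_def)
qed

lemma cs_zero: "csub K ==> cs K 0 = K" by (auto simp: cs_def)

lemma cs_set_add: assumes "csub K" "add R = (+)" shows "set_add R (cs K x) (cs K y) = cs K (x + y)"
proof -
	have "(k + x) + (l + y)\<in>cs K (x + y)" if "k\<in>K" "l\<in>K" for k l
		using csub_add[OF assms(1) that] unfolding cs_def by (auto intro!: image_eqI[of _ _ "k + l"])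
	then have "(\<Union>a\<in>cs K x. \<Union>b\<in>cs K y. {a + b})\<subseteq>cs K (x + y)"
		by (auto simp: cs_def[of K x] cs_def[of K y])
	moreover have "cs K (x + y)\<subseteq>(\<Union>a\<in>cs K x. \<Union>b\<in>cs K y. {a + b})"
	proof
		fix z assume "z\<in>cs K (x + y)"
		then obtain k where k: "k\<in>K" "z = (k + x) + y" by (auto simp: cs_def add.assoc)
		have "k + x\<in>cs K x" using k(1) by (auto simp: cs_def)
		then show "z\<in>(\<Union>a\<in>cs K x. \<Union>b\<in>cs K y. {a + b})" using cs_self[OF assms(1), of y] k(2) by blast
	qed
	ultimately show ?thesis unfolding set_add_def' assms(2) by blast
qed

lemma cs_union:
	assumes "csub K" "\<And>z. z\<in>K ==> f (z + x) - f x\<in>K"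
	shows "(\<Union>v\<in>cs K x. cs K (f v)) = cs K (f x)"
proof -
	have "cs K (f v) = cs K (f x)" if "v\<in>cs K x" for v
		unfolding cs_eq_iff[OF assms(1)] using that assms(2) by (auto simp: cs_def)
	then show ?thesis using cs_self[OF assms(1), of x] by blast
qed

text \<open>All elements of a coset have the same image under a section \<open>\<pi>\<close> that
  kills the subspace; this common value represents the coset in the model.\<close>

definition quot_map :: "('a => 'b) => 'a set => 'b" where "quot_map \<pi> C = the_elem (\<pi> ` C)"

locale quotient_space =
	fixes F K :: "'a::complex_vector set" and \<pi> :: "'a => 'a"
	assumes F: "csub F" and K: "csub K" and KF: "K\<subseteq>F" and pi_lin: "lin_on UNIV \<pi>"
		and pi_F: "x\<in>F ==> \<pi> x\<in>F" and pi_mod: "x\<in>F ==> x - \<pi> x\<in>K" and pi_K: "x\<in>K ==> \<pi> x = 0"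
begin

lemma pi_add [simp]: "\<pi> (x + y) = \<pi> x + \<pi> y" and pi_scale [simp]: "\<pi> (c *c x) = c *c \<pi> x"
	using pi_lin by (auto simp: lin_on_def)
lemma pi_diff [simp]: "\<pi> (x - y) = \<pi> x - \<pi> y" using lin_on_diff[OF _ pi_lin] by auto
lemma pi_0 [simp]: "\<pi> 0 = 0" using lin_on_0[OF _ pi_lin] by auto

lemma pi_eq_iff: "x\<in>F ==> y\<in>F ==> \<pi> x = \<pi> y \<longleftrightarrow> x - y\<in>K"
proof
	assume *: "x\<in>F" "y\<in>F" "\<pi> x = \<pi> y"
	have "(x - \<pi> x) - (y - \<pi> y)\<in>K" by (rule csub_diff[OF K pi_mod[OF *(1)] pi_mod[OF *(2)]])
	then show "x - y\<in>K" using *(3) by simp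
next
	assume "x - y\<in>K" then show "\<pi> x = \<pi> y" using pi_K[of "x - y"] by simp
qed

lemma pi_image: "csub (\<pi> ` F)" by (rule csub_image[OF F lin_on_mono[OF pi_lin]]) simp

lemma quot_map_cs [simp]: "quot_map \<pi> (cs K x) = \<pi> x"
proof -
	have "\<pi> ` cs K x = {\<pi> x}" using cs_self[OF K, of x] pi_K by (auto simp: cs_def image_iff)
	then show ?thesis by (simp add: quot_map_def)
qed

lemma quotient_lin_model:
	assumes "carrier Q = cs K ` F" "zero Q = K" "add Q = set_add R" "add R = (+)"
		"\<And>c x. x\<in>F ==> module.smult Q c (cs K x) = cs K (c *c x)"
	shows "lin_model Q (\<pi> ` F) (quot_map \<pi>)"
proof -
	have "lin_model Q (quot_map \<pi> ` carrier Q) (quot_map \<pi>)"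
	proof (rule lin_modelI)
		show "inj_on (quot_map \<pi>) (carrier Q)"
		proof (rule inj_onI)
			fix A B assume "A\<in>carrier Q" "B\<in>carrier Q" "quot_map \<pi> A = quot_map \<pi> B"
			then obtain x y where "x\<in>F" "y\<in>F" "A = cs K x" "B = cs K y" "\<pi> x = \<pi> y" by (auto simp: assms(1))
			then show "A = B" using cs_eq_iff[OF K] pi_eq_iff by simp
		qed
		show "\<zero>\<^bsub>Q\<^esub>\<in>carrier Q" unfolding assms(1,2) using cs_zero[OF K] csub_0[OF F] by (metis imageI)
		show "quot_map \<pi> \<zero>\<^bsub>Q\<^esub> = 0" unfolding assms(2) using quot_map_cs[of 0] cs_zero[OF K] by simp
	qed (use csub_add[OF F] csub_scale[OF F] in \<open>auto simp: assms cs_set_add[OF K assms(4)]\<close>)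
	moreover have "quot_map \<pi> ` carrier Q = \<pi> ` F" by (auto simp: assms(1) image_image)
	ultimately show ?thesis by simp
qed

text \<open>The module laws are required only modulo \<open>K\<close>. This is the case for
  operators on free algebras and free vector spaces, where letters and pairs are formal.\<close>

lemma quotient_rep:
	fixes a :: "'x::lie_algebra => 'a => 'a"
	assumes L: "subalgebra L" and lin: "\<And>x. x\<in>L ==> lin_on F (a x)"
		and aF: "\<And>x f. x\<in>L ==> f\<in>F ==> a x f\<in>F" and aK: "\<And>x f. x\<in>L ==> f\<in>K ==> a x f\<in>K"
		and add: "\<And>x y f. x\<in>L ==> y\<in>L ==> f\<in>F ==> a (x + y) f - (a x f + a y f)\<in>K"
		and scale: "\<And>c x f. x\<in>L ==> f\<in>F ==> a (c *c x) f - c *c a x f\<in>K"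
		and comm: "\<And>x y f. x\<in>L ==> y\<in>L ==> f\<in>F ==> a (bracket x y) f - (a x (a y f) - a y (a x f))\<in>K"
	shows "lie_rep L (\<pi> ` F) (\<lambda>x f. \<pi> (a x f))"
		and "\<And>x f. x\<in>L ==> f\<in>F ==> \<pi> (a x (\<pi> f)) = \<pi> (a x f)"
proof -
	show eq: "\<pi> (a x (\<pi> f)) = \<pi> (a x f)" if "x\<in>L" "f\<in>F" for x f
	proof -
		have "a x (f - \<pi> f) = a x f - a x (\<pi> f)" using lin_on_diff[OF F lin[OF that(1)]] that(2) pi_F by auto
		then have "\<pi> (a x f) - \<pi> (a x (\<pi> f)) = 0" using pi_K[OF aK[OF that(1) pi_mod[OF that(2)]]] by simp
		then show ?thesis by simp
	qed
	have Ls: "csub L" using L by (rule subalg_csub)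
	show "lie_rep L (\<pi> ` F) (\<lambda>x f. \<pi> (a x f))"
	proof (rule lie_rep.intro[OF L pi_image])
		show "\<pi> (a x w)\<in>\<pi> ` F" if "x\<in>L" "w\<in>\<pi> ` F" for x w using that aF pi_F by auto
		show "lin_on (\<pi> ` F) (\<lambda>f. \<pi> (a x f))" if "x\<in>L" for x
			unfolding lin_on_def using pi_F lin_on_add[OF lin[OF that]] lin_on_scale[OF lin[OF that]] by auto
		show "lin_on L (\<lambda>x. \<pi> (a x w))" if w: "w\<in>\<pi> ` F" for w
			unfolding lin_on_def
		proof (intro conjI ballI allI)
			have wF: "w\<in>F" using w pi_F by auto
			show "\<pi> (a (x + y) w) = \<pi> (a x w) + \<pi> (a y w)" if "x\<in>L" "y\<in>L" for x y
				using pi_K[OF add[OF that wF]] by simp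
			show "\<pi> (a (c *c x) w) = c *c \<pi> (a x w)" if "x\<in>L" for c x
				using pi_K[OF scale[OF that wF]] by simp
		qed
		show "\<pi> (a (bracket x y) w) = \<pi> (a x (\<pi> (a y w))) - \<pi> (a y (\<pi> (a x w)))" if "x\<in>L" "y\<in>L" "w\<in>\<pi> ` F" for x y w
		proof -
			have wF: "w\<in>F" using that pi_F by auto
			show ?thesis using pi_K[OF comm[OF that(1,2) wF]] eq aF that(1,2) wF by simp
		qed
	qed
qed

end

lemma quotient_space_exists:
	assumes "csub F" "csub K" "K\<subseteq>F" obtains \<pi> where "quotient_space F K \<pi>"
proof -
	obtain \<pi> where "lin_on UNIV \<pi>" "\<And>x. x\<in>F ==> \<pi> x\<in>F" "\<And>x. x\<in>F ==> x - \<pi> x\<in>K" "\<And>x. x\<in>K ==> \<pi> x = 0"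
		using quotient_section[OF assms] by blast
	then have "quotient_space F K \<pi>" using assms by unfold_locales
	then show thesis by (rule that)
qed

lemma quot_cs:
	assumes "csub F" "csub K" "K\<subseteq>F" "carrier V = F" "zero V = 0" "add V = (+)" "module.smult V = scaleC"
	shows "carrier (quotient_module V K) = cs K ` F" "zero (quotient_module V K) = K" "add (quotient_module V K) = set_add V"
		"module.smult (quotient_module V K) c (cs K x) = cs K (c *c x)"
		"(\<And>z. z\<in>K ==> act V y (z + x) - act V y x\<in>K) ==> act (quotient_module V K) y (cs K x) = cs K (act V y x)"
proof -
	have "(\<Union>v\<in>cs K x. cs K (c *c v)) = cs K (c *c x)"
		by (rule cs_union[OF assms(2)]) (simp add: scaleC_add_right csub_scale assms(2))
	then show "module.smult (quotient_module V K) c (cs K x) = cs K (c *c x)"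
		by (simp add: quotient_module_def cs_a_r_coset[OF assms(6)] assms(7))
	assume "\<And>z. z\<in>K ==> act V y (z + x) - act V y x\<in>K"
	then have "(\<Union>v\<in>cs K x. cs K (act V y v)) = cs K (act V y x)" by (rule cs_union[OF assms(2)])
	then show "act (quotient_module V K) y (cs K x) = cs K (act V y x)"
		by (simp add: quotient_module_def cs_a_r_coset[OF assms(6)])
qed (simp_all add: quotient_module_def cs_rcosets[OF assms(6)] assms(4))

abbreviation sg :: "'a => ('a \<Rightarrow>\<^sub>0 complex)" where "sg x \<equiv> Poly_Mapping.single x 1"

lemma single_scaleC: "Poly_Mapping.single x c = c *c sg x"
	by (rule poly_mapping_eqI) (simp add: lookup_single when_def)

lemma pm_expand: "p = (\<Sum>k\<in>keys p. lookup p k *c sg k)" for p :: "'a \<Rightarrow>\<^sub>0 complex"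
proof (rule poly_mapping_eqI)
	fix k
	have "lookup (\<Sum>k\<in>keys p. lookup p k *c sg k) k
		= (\<Sum>l\<in>keys p. if l = k then lookup p l else 0)"
		unfolding lookup_sum by (rule sum.cong) (auto simp: lookup_single when_def)
	then show "lookup p k = lookup (\<Sum>k\<in>keys p. lookup p k *c sg k) k"
		by (simp add: in_keys_iff)
qed

lemma keys_subspace [simp]: "csub {p :: 'a \<Rightarrow>\<^sub>0 complex. keys p\<subseteq>X}"
proof (rule csubI)
	fix p q :: "'a \<Rightarrow>\<^sub>0 complex" assume "p\<in>{p. keys p\<subseteq>X}" "q\<in>{p. keys p\<subseteq>X}"
	then show "p + q\<in>{p. keys p\<subseteq>X}" using keys_add[of p q] by auto
qed (auto simp: in_keys_iff)

lemma keys_span: "{p :: 'a \<Rightarrow>\<^sub>0 complex. keys p\<subseteq>X} = cspan (sg ` X)"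
proof
	show "cspan (sg ` X)\<subseteq>{p :: 'a \<Rightarrow>\<^sub>0 complex. keys p\<subseteq>X}"
		by (rule cspan_least) auto
	show "{p :: 'a \<Rightarrow>\<^sub>0 complex. keys p\<subseteq>X}\<subseteq>cspan (sg ` X)"
	proof clarify
		fix p :: "'a \<Rightarrow>\<^sub>0 complex" assume "keys p\<subseteq>X"
		then have "(\<Sum>k\<in>keys p. lookup p k *c sg k)\<in>cspan (sg ` X)"
			by (intro cspan_sum cspan_scale cspan_base) auto
		then show "p\<in>cspan (sg ` X)" using pm_expand[of p] by simp
	qed
qed

definition lext :: "('a => 'b::complex_vector) => ('a \<Rightarrow>\<^sub>0 complex) => 'b" where
	"lext f p = (\<Sum>k\<in>keys p. lookup p k *c f k)"

lemma lin_ext_lext: "lin_ext f = lext f"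
	by (rule ext) (simp add: lin_ext_def lext_def)

lemma lext_superset: "finite S ==> keys p\<subseteq>S ==> lext f p = (\<Sum>k\<in>S. lookup p k *c f k)"
	unfolding lext_def by (rule sum.mono_neutral_left) (auto simp: in_keys_iff)

lemma lext_add: "lext f (p + q) = lext f p + lext f q"
proof -
	let ?S = "keys p\<union>keys q"
	show ?thesis
		using lext_superset[of ?S "p + q" f] lext_superset[of ?S p f] lext_superset[of ?S q f] keys_add[of p q]
		by (simp add: lookup_add scaleC_add_left sum.distrib)
qed

lemma lext_scale: "lext f (c *c p) = c *c lext f p"
proof -
	have "keys (c *c p)\<subseteq>keys p" by (auto simp: in_keys_iff)
	then show ?thesis
		using lext_superset[of "keys p" "c *c p" f]
		by (simp add: lext_def[of f p] scaleC_sum scaleC_scaleC)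
qed

lemma lext_lin [simp]: "lin_on W (lext f)" by (simp add: lin_on_def lext_add lext_scale)

lemma lext_diff: "lext f (p - q) = lext f p - lext f q" using lin_on_diff[of UNIV "lext f"] by simp
lemma lext_0 [simp]: "lext f 0 = 0" using lin_on_0[of UNIV "lext f"] by simp

lemma lext_sg [simp]: "lext f (sg x) = f x" by (simp add: lext_def scaleC_one)

subsection \<open>The free algebra\<close>

definition word :: "'a list => 'a free_algebra" where "word u = sg (FWord u)"

lemma word_mult: "word u * word v = word (u @ v)"
	by (simp add: word_def mult_single plus_fword_def)
lemma word_Nil: "word [] = 1" by (simp add: word_def flip: zero_fword_def)
lemma gen_word: "gen x = word [x]" by (simp add: gen_def word_def)
lemma const_mult: "const c * p = c *c p" "p * const c = c *c p"
proof -
	show "const c * p = c *c p"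
		using mult_map_scale_conv_mult[of c p] by (simp add: const_def scaleC_poly_mapping_def fun_eq_iff)
			(metis scaleC_complex_def ext)
	have "p * const c = lext (\<lambda>k. c *c sg k) p"
	proof -
		have "p * const c = (\<Sum>k\<in>keys p. lookup p k *c sg k) * const c" using pm_expand[of p] by simp
		also have "... = (\<Sum>k\<in>keys p. lookup p k *c c *c sg k)"
			unfolding sum_distrib_right
		proof (rule sum.cong[OF refl])
			fix k
			have "(lookup p k *c sg k) * const c = Poly_Mapping.single k (lookup p k * c)"
				unfolding single_scaleC[of k "lookup p k", symmetric] by (simp add: const_def mult_single)
			then show "(lookup p k *c sg k) * const c = lookup p k *c c *c sg k"
				unfolding single_scaleC[of k "lookup p k * c"] scaleC_scaleC .
		qed
		finally show ?thesis by (simp add: lext_def)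
	qed
	also have "... = c *c p"
		using pm_expand[of p] unfolding lext_def
		by (metis (no_types, lifting) complex_vector.scale_left_commute scaleC_sum sum.cong)
	finally show "p * const c = c *c p" .
qed

lemma const_word: "const c = c *c word []"
	using const_mult(1)[of c 1] by (simp add: word_Nil)

lemma scaleC_mult_left: "(c *c p) * q = c *c (p * q)" for p q :: "'a free_algebra"
	by (simp add: mult.assoc flip: const_mult(1))
lemma scaleC_mult_right: "p * (c *c q) = c *c (p * q)" for p q :: "'a free_algebra"
	by (metis const_mult mult.assoc)

lemma lin_on_mult_left [simp]: "lin_on W (\<lambda>q. p * q)" for p :: "'a free_algebra"
	by (simp add: lin_on_def distrib_left scaleC_mult_right)
lemma lin_on_mult_right [simp]: "lin_on W (\<lambda>q. q * p)" for p :: "'a free_algebra"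
	by (simp add: lin_on_def distrib_right scaleC_mult_left)

definition words :: "'a set => 'a free_algebra set" where "words X = word ` {u. set u\<subseteq>X}"

lemma free_ring_simps [simp]: "add (free_ring X) = (+)" "zero (free_ring X) = 0" "one (free_ring X) = 1" "monoid.mult (free_ring X) = (*)"
	by (simp_all add: free_ring_def)

lemma free_ring_carrier: "carrier (free_ring X) = cspan (words X)"
proof -
	have "carrier (free_ring X) = {p. keys p\<subseteq>{w. set (letters w)\<subseteq>X}}" by (auto simp: free_ring_def)
	also have "... = cspan (sg ` {w. set (letters w)\<subseteq>X})" by (rule keys_span)
	also have "sg ` {w. set (letters w)\<subseteq>X} = words X"
		unfolding words_def word_def image_image[symmetric, of sg FWord]
		by (rule arg_cong[of _ _ "image sg"]) (auto simp: image_iff, metis fword.collapse)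
	finally show ?thesis .
qed

lemma word_carrier: "set u\<subseteq>X ==> word u\<in>cspan (words X)"
	by (rule cspan_base) (auto simp: words_def)

lemma words_mult: assumes "p\<in>cspan (words X)" "q\<in>cspan (words X)" shows "p * q\<in>cspan (words X)"
proof -
	have "word u * q\<in>cspan (words X)" if u: "set u\<subseteq>X" for u
	proof (rule lin_on_span[of UNIV _ "words X", OF _ _ _ _ _ assms(2)])
		fix s assume "s\<in>words X"
		then obtain v where "set v\<subseteq>X" "s = word v" by (auto simp: words_def)
		then show "word u * s\<in>cspan (words X)" using u by (simp add: word_mult word_carrier)
	qed auto
	then show ?thesis
		by (intro lin_on_span[of UNIV "\<lambda>p. p * q" "words X", OF _ _ _ _ _ assms(1)]) (auto simp: words_def)
qed

lemma free_ring_ring: "ring (free_ring X)"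
proof (rule ringI)
	note c = free_ring_carrier[of X]
	show "abelian_group (free_ring X)"
	proof (rule abelian_groupI)
		fix x assume "x\<in>carrier (free_ring X)"
		then show "\<exists>y\<in>carrier (free_ring X). y \<oplus>\<^bsub>free_ring X\<^esub> x = \<zero>\<^bsub>free_ring X\<^esub>"
			by (intro bexI[of _ "- x"]) (auto simp: c cspan_neg)
	qed (auto simp: c algebra_simps cspan_add cspan_0)
	show "Group.monoid (free_ring X)"
		by (rule monoidI) (use word_carrier[of "[]" X] in \<open>auto simp: c words_mult mult.assoc word_Nil\<close>)
qed (auto simp: algebra_simps)

lemma cspan_image_add: "x\<in>cspan A ==> y\<in>cspan A ==> x + y\<in>cspan A" by (rule cspan_add)

text \<open>Words span the free ring and concatenate, so the span of the generators multiplied by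
  words on both sides is already a two-sided ideal. Conversely, an ideal is a subspace because
  constants belong to the ring.\<close>

lemma genideal_free_ring:
	assumes S: "S\<subseteq>carrier (free_ring X)"
	shows "genideal (free_ring X) S = cspan {word u * g * word v | u g v. g\<in>S \<and> set u\<subseteq>X \<and> set v\<subseteq>X}" (is "_ = cspan ?G")
proof
	have GF: "cspan ?G\<subseteq>cspan (words X)"
		by (rule cspan_least) (use S in \<open>auto simp: free_ring_carrier intro!: words_mult word_carrier\<close>)
	have left: "x * a\<in>cspan ?G" if "a\<in>cspan ?G" "x\<in>cspan (words X)" for a x
	proof -
		have "word t * a\<in>cspan ?G" if t: "set t\<subseteq>X" for t
		proof (rule lin_on_span[of UNIV _ ?G, OF _ _ _ _ _ \<open>a\<in>cspan ?G\<close>])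
			fix s assume "s\<in>?G"
			then obtain u g v where *: "s = word u * g * word v" "g\<in>S" "set u\<subseteq>X" "set v\<subseteq>X" by blast
			then have "word t * s = word (t @ u) * g * word v" by (simp add: mult.assoc flip: word_mult)
			then show "word t * s\<in>cspan ?G" using * t by (intro cspan_base) (auto, force)
		qed auto
		then show ?thesis
			by (intro lin_on_span[of UNIV "\<lambda>p. p * a" "words X", OF _ _ _ _ _ that(2)]) (auto simp: words_def)
	qed
	have right: "a * x\<in>cspan ?G" if "a\<in>cspan ?G" "x\<in>cspan (words X)" for a x
	proof -
		have "a * word t\<in>cspan ?G" if t: "set t\<subseteq>X" for t
		proof (rule lin_on_span[of UNIV "\<lambda>a. a * word t" ?G, OF _ _ _ _ _ \<open>a\<in>cspan ?G\<close>])
			fix s assume "s\<in>?G"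
			then obtain u g v where *: "s = word u * g * word v" "g\<in>S" "set u\<subseteq>X" "set v\<subseteq>X" by blast
			then have "s * word t = word u * g * word (v @ t)" by (simp add: mult.assoc flip: word_mult)
			then show "s * word t\<in>cspan ?G" using * t by (intro cspan_base) (auto, force)
		qed auto
		then show ?thesis
			by (intro lin_on_span[of UNIV "\<lambda>p. a * p" "words X", OF _ _ _ _ _ that(2)]) (auto simp: words_def)
	qed
	have "ideal (cspan ?G) (free_ring X)"
	proof (rule idealI[OF free_ring_ring])
		interpret R: ring "free_ring X" by (rule free_ring_ring)
		show "subgroup (cspan ?G) (add_monoid (free_ring X))"
		proof (rule subgroup.intro)
			fix x assume x: "x\<in>cspan ?G"
			then have "x\<in>carrier (free_ring X)" using GF by (auto simp: free_ring_carrier)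
			moreover have "- x\<in>carrier (free_ring X)" using calculation by (simp add: free_ring_carrier cspan_neg)
			ultimately have "\<ominus>\<^bsub>free_ring X\<^esub> x = - x" by (intro R.minus_equality) auto
			then show "inv\<^bsub>add_monoid (free_ring X)\<^esub> x\<in>cspan ?G"
				using x cspan_neg by (simp add: a_inv_def)
		qed (use GF in \<open>auto simp: free_ring_carrier cspan_0 intro: cspan_image_add\<close>)
	qed (use left right in \<open>auto simp: free_ring_carrier\<close>)
	moreover have "S\<subseteq>cspan ?G"
	proof
		fix g assume "g\<in>S"
		then have "word [] * g * word []\<in>?G" by force
		then show "g\<in>cspan ?G" using cspan_base[of "word [] * g * word []" ?G] by (simp add: word_Nil)
	qed
	ultimately show "genideal (free_ring X) S\<subseteq>cspan ?G" unfolding genideal_def by auto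
	show "cspan ?G\<subseteq>genideal (free_ring X) S"
		unfolding genideal_def
	proof (intro Inter_greatest)
		fix I assume "I\<in>{I. ideal I (free_ring X) \<and> S\<subseteq>I}"
		then have I: "ideal I (free_ring X)" and SI: "S\<subseteq>I" by auto
		interpret I: ideal I "free_ring X" by (rule I)
		have "csub I"
		proof (rule csubI)
			show "0\<in>I" using additive_subgroup.zero_closed[OF I.additive_subgroup_axioms] by simp
			show "x + y\<in>I" if "x\<in>I" "y\<in>I" for x y
				using additive_subgroup.a_closed[OF I.additive_subgroup_axioms that] by simp
			show "c *c x\<in>I" if "x\<in>I" for c x
			proof -
				have "const c\<in>carrier (free_ring X)"
					using cspan_scale[OF word_carrier[of "[]" X], of c] by (simp add: free_ring_carrier const_word)
				then show ?thesis using I.I_l_closed[OF that, of "const c"] by (simp add: const_mult)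
			qed
		qed
		moreover have "?G\<subseteq>I"
			using SI I.I_l_closed I.I_r_closed by (auto simp: free_ring_carrier word_carrier)
		ultimately show "cspan ?G\<subseteq>I" by (intro cspan_least)
	qed
qed

section \<open>Symmetric algebras and tensor products of modules\<close>

lemma derivation_word: "derivation f (word u) = (\<Sum>k<length u. word (u[k := f (u ! k)]))"
	by (simp add: derivation_def lin_ext_lext word_def)

lemma derivation_lin [simp]: "lin_on W (derivation f)"
	by (simp add: derivation_def lin_ext_lext)

lemma derivation_0: "derivation f 0 = 0" by (simp add: derivation_def lin_ext_lext)
lemma derivation_add: "derivation f (p + q) = derivation f p + derivation f q"
	using lin_on_add[OF derivation_lin[of UNIV f]] by simp
lemma derivation_diff: "derivation f (p - q) = derivation f p - derivation f q"
	using lin_on_diff[OF _ derivation_lin[of UNIV f]] by simp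
lemma derivation_scale: "derivation f (c *c p) = c *c derivation f p"
	using lin_on_scale[OF derivation_lin[of UNIV f]] by simp

lemma derivation_Nil: "derivation f (word []) = 0" by (simp add: derivation_word)

lemma derivation_Cons: "derivation f (word (x # u)) = word (f x # u) + word [x] * derivation f (word u)"
	by (simp add: derivation_word sum.lessThan_Suc_shift sum_distrib_left word_mult del: sum.lessThan_Suc)

lemma derivation_word_mult: "derivation f (word (u @ v)) = derivation f (word u) * word v + word u * derivation f (word v)"
proof (induction u)
	case Nil
	then show ?case using derivation_Nil[of f] by (simp add: word_Nil)
next
	case (Cons x u)
	have "derivation f (word ((x # u) @ v)) = word (f x # u @ v) + word [x] * derivation f (word (u @ v))"
		by (simp add: derivation_Cons)
	also have "... = word (f x # u) * word v + word [x] * (derivation f (word u) * word v + word u * derivation f (word v))"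
		by (simp add: Cons word_mult)
	also have "... = derivation f (word (x # u)) * word v + word (x # u) * derivation f (word v)"
		by (simp add: derivation_Cons distrib_left distrib_right mult.assoc[symmetric] word_mult)
	finally show ?case .
qed

lemma in_words_UNIV: "p\<in>cspan (words UNIV)" for p :: "'a free_algebra"
	using free_ring_carrier[of UNIV] by (auto simp: free_ring_def)

lemma derivation_mult: "derivation f (p * q) = derivation f p * q + p * derivation f q"
proof -
	have 1: "derivation f (word u * q) = derivation f (word u) * q + word u * derivation f q" for u
		using in_words_UNIV[of q] derivation_0[of f]
		by (induction rule: cspan_induct)
			(auto simp: words_def word_mult derivation_word_mult distrib_left derivation_add scaleC_mult_right derivation_scale scaleC_add_right algebra_simps)
	show ?thesis
		using in_words_UNIV[of p] 1 derivation_0[of f]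
		by (induction rule: cspan_induct)
			(auto simp: words_def distrib_right derivation_add scaleC_mult_left derivation_scale scaleC_add_right algebra_simps)
qed

lemma derivation_words:
	assumes "\<And>x. x\<in>X ==> f x\<in>X" "p\<in>cspan (words X)" shows "derivation f p\<in>cspan (words X)"
proof (rule lin_on_span[of UNIV "derivation f" "words X"])
	fix s assume "s\<in>words X"
	then obtain u where u: "set u\<subseteq>X" "s = word u" by (auto simp: words_def)
	have "set (u[k := f (u ! k)])\<subseteq>X" if "k < length u" for k
		using set_update_subset_insert[of u k "f (u ! k)"] u that assms(1)[of "u ! k"] nth_mem[of k u] by blast
	then show "derivation f s\<in>cspan (words X)"
		unfolding u(2) derivation_word by (intro cspan_sum word_carrier) auto
qed (use assms in auto)

section \<open>The symmetric algebra of a module\<close>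

locale lie_mod =
	fixes L :: "'x::lie_algebra set" and M :: "('x, 'v) lie_module" (structure)
	assumes M: "is_lie_module L M" and L: "subalgebra L"
begin

lemma Ls: "csub L" using L by (rule subalg_csub)
lemma mod: "Module.module complex_ring M" using M by (simp add: is_lie_module_def)

lemma add_c [simp]: "x\<in>carrier M ==> y\<in>carrier M ==> x \<oplus> y\<in>carrier M"
	and smult_c [simp]: "x\<in>carrier M ==> c \<odot> x\<in>carrier M"
	and zero_c [simp]: "\<zero>\<in>carrier M"
	and minus_c [simp]: "x\<in>carrier M ==> y\<in>carrier M ==> x \<ominus> y\<in>carrier M"
	and minus_add [simp]: "x\<in>carrier M ==> y\<in>carrier M ==> (x \<ominus> y) \<oplus> y = x"
	and smult_0 [simp]: "x\<in>carrier M ==> 0 \<odot> x = \<zero>"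
proof -
	interpret Module.module complex_ring M by (rule mod)
	show "x\<in>carrier M ==> y\<in>carrier M ==> x \<oplus> y\<in>carrier M" "x\<in>carrier M ==> c \<odot> x\<in>carrier M"
		"\<zero>\<in>carrier M" "x\<in>carrier M ==> y\<in>carrier M ==> x \<ominus> y\<in>carrier M"
		"x\<in>carrier M ==> 0 \<odot> x = \<zero>"
		using smult_closed[of c x] smult_l_null[of x] by auto
	show "x\<in>carrier M ==> y\<in>carrier M ==> (x \<ominus> y) \<oplus> y = x"
		by (simp add: M.minus_eq M.a_assoc M.l_neg)
qed

lemma act_c [simp]: "x\<in>L ==> v\<in>carrier M ==> act M x v\<in>carrier M"
	and act_add [simp]: "x\<in>L ==> v\<in>carrier M ==> w\<in>carrier M ==> act M x (v \<oplus> w) = act M x v \<oplus> act M x w"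
	and act_smult [simp]: "x\<in>L ==> v\<in>carrier M ==> act M x (c \<odot> v) = c \<odot> act M x v"
	and act_left_add: "x\<in>L ==> y\<in>L ==> v\<in>carrier M ==> act M (x + y) v = act M x v \<oplus> act M y v"
	and act_left_scale: "x\<in>L ==> v\<in>carrier M ==> act M (c *c x) v = c \<odot> act M x v"
	and act_bracket: "x\<in>L ==> y\<in>L ==> v\<in>carrier M ==> act M (bracket x y) v = act M x (act M y v) \<ominus> act M y (act M x v)"
	using M by (simp_all add: is_lie_module_def)

lemma L_closed [simp]: "x\<in>L ==> y\<in>L ==> x + y\<in>L" "x\<in>L ==> c *c x\<in>L" "x\<in>L ==> y\<in>L ==> bracket x y\<in>L"
	using csub_add[OF Ls] csub_scale[OF Ls] subalg_bracket[OF L] by auto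

abbreviation SX where "SX \<equiv> carrier M"
abbreviation SF where "SF \<equiv> cspan (words (carrier M))"
definition SR where "SR = linear_rels M\<union>{gen x * gen y - gen y * gen x | x y. x\<in>carrier M \<and> y\<in>carrier M}"
definition SI where "SI = sym_ideal M"

lemma SR_carrier: "SR\<subseteq>carrier (free_ring SX)"
	unfolding free_ring_carrier SR_def linear_rels_def
	by (auto simp: gen_word word_mult const_mult intro!: cspan_diff cspan_scale word_carrier)

lemma SI_span: "SI = cspan {word u * g * word v | u g v. g\<in>SR \<and> set u\<subseteq>SX \<and> set v\<subseteq>SX}"
	unfolding SI_def sym_ideal_def SR_def[symmetric] by (rule genideal_free_ring[OF SR_carrier])

lemma SI_ideal: "ideal SI (free_ring SX)"
proof -
	interpret ring "free_ring SX" by (rule free_ring_ring)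
	show ?thesis unfolding SI_def sym_ideal_def SR_def[symmetric] by (rule genideal_ideal[OF SR_carrier])
qed

lemma SI_subspace [simp]: "csub SI" by (simp add: SI_span)

lemma SI_SF: "SI\<subseteq>SF" unfolding SI_span
	by (rule cspan_least) (use SR_carrier in \<open>auto simp: free_ring_carrier intro!: words_mult word_carrier\<close>)

lemma SI_left: "a\<in>SI ==> p\<in>SF ==> p * a\<in>SI" and SI_right: "a\<in>SI ==> p\<in>SF ==> a * p\<in>SI"
	using ideal.I_l_closed[OF SI_ideal, of a p] ideal.I_r_closed[OF SI_ideal, of a p] by (auto simp: free_ring_carrier)

lemma SR_SI: "SR\<subseteq>SI"
proof
	fix g assume "g\<in>SR"
	then have "word [] * g * word []\<in>SI" unfolding SI_span by (intro cspan_base) force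
	then show "g\<in>SI" by (simp add: word_Nil)
qed

lemma SR_add: "x\<in>SX ==> y\<in>SX ==> word [x \<oplus> y] - word [x] - word [y]\<in>SI"
	and SR_scale: "x\<in>SX ==> word [c \<odot> x] - c *c word [x]\<in>SI"
	and SR_comm: "x\<in>SX ==> y\<in>SX ==> word [x, y] - word [y, x]\<in>SI"
proof -
	show "x\<in>SX ==> y\<in>SX ==> word [x \<oplus> y] - word [x] - word [y]\<in>SI"
		by (rule subsetD[OF SR_SI]) (auto simp: SR_def linear_rels_def gen_word)
	show "x\<in>SX ==> word [c \<odot> x] - c *c word [x]\<in>SI"
		by (rule subsetD[OF SR_SI]) (auto simp: SR_def linear_rels_def gen_word const_mult)
	have "word [x, y] - word [y, x] = gen x * gen y - gen y * gen x" by (simp add: gen_word word_mult)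
	then show "x\<in>SX ==> y\<in>SX ==> word [x, y] - word [y, x]\<in>SI"
		by (intro subsetD[OF SR_SI]) (auto simp: SR_def)
qed

text \<open>A derivation turns each defining relation into a sum of relations of the same kind, and
  the product rule extends this to the ideal.\<close>

lemma derivation_SI: "x\<in>L ==> p\<in>SI ==> derivation (act M x) p\<in>SI"
proof -
	assume x: "x\<in>L" and p: "p\<in>SI"
	let ?D = "derivation (act M x)"
	have Dw: "?D (word u)\<in>SF" if "set u\<subseteq>SX" for u
		by (rule derivation_words) (use x that word_carrier in auto)
	have DR: "?D g\<in>SI" if "g\<in>SR" for g
	proof -
		consider (a) y z where "g = gen (y \<oplus> z) - gen y - gen z" "y\<in>SX" "z\<in>SX" |
			(s) c y where "g = gen (c \<odot> y) - const c * gen y" "y\<in>SX" |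
			(c) y z where "g = gen y * gen z - gen z * gen y" "y\<in>SX" "z\<in>SX"
			using \<open>g\<in>SR\<close> unfolding SR_def linear_rels_def by blast
		then show ?thesis
		proof cases
			case a
			then show ?thesis using SR_add[of "act M x y" "act M x z"] x
				by (simp add: gen_word derivation_diff derivation_Cons derivation_Nil)
		next
			case s
			then show ?thesis using SR_scale[of "act M x y" c] x
				by (simp add: gen_word const_mult derivation_diff derivation_scale derivation_Cons derivation_Nil)
		next
			case c
			have "?D g = (word [act M x y, z] - word [z, act M x y]) + (word [y, act M x z] - word [act M x z, y])"
				by (simp add: c gen_word word_mult derivation_diff derivation_Cons derivation_Nil)
			also have "...\<in>SI" using SR_comm c x by (intro csub_add) auto
			finally show ?thesis .
		qed
	qed
	show "?D p\<in>SI"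
	proof (rule lin_on_span[of UNIV ?D _ SI, OF _ _ _ _ _ p[unfolded SI_span]])
		fix s assume "s\<in>{word u * g * word v | u g v. g\<in>SR \<and> set u\<subseteq>SX \<and> set v\<subseteq>SX}"
		then obtain u g v where s: "s = word u * g * word v" "g\<in>SR" "set u\<subseteq>SX" "set v\<subseteq>SX" by blast
		have g: "g\<in>SI" using s SR_SI by auto
		have "?D s = ?D (word u) * g * word v + word u * ?D g * word v + word u * g * ?D (word v)"
			by (simp add: s(1) derivation_mult distrib_left distrib_right mult.assoc algebra_simps)
		also have "...\<in>SI"
		proof (intro csub_add SI_subspace)
			show "?D (word u) * g * word v\<in>SI" using SI_right[OF SI_left[OF g Dw[OF s(3)]]] word_carrier[OF s(4)] by auto
			show "word u * ?D g * word v\<in>SI" using SI_right[OF SI_left[OF DR[OF s(2)]]] word_carrier[OF s(3)] word_carrier[OF s(4)] by auto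
			show "word u * g * ?D (word v)\<in>SI" using SI_right[OF SI_left[OF g]] word_carrier[OF s(3)] Dw[OF s(4)] by auto
		qed
		finally show "?D s\<in>SI" .
	qed auto
qed

lemma mod_SI_cons:
	assumes "p\<in>SI" "a\<in>SX" shows "word [a] * p\<in>SI"
	by (rule SI_left[OF assms(1)]) (use assms(2) word_carrier[of "[a]" SX] in auto)

text \<open>A word keeps \<open>act M (x + y) a\<close> as one letter, and splitting it into two
  costs an element of the ideal. Hence the laws hold only modulo \<open>SI\<close>; the proof is by
  induction on words with the product rule.\<close>

lemma derivation_laws:
	assumes x: "x\<in>L" and y: "y\<in>L" and p: "p\<in>SF"
	shows "derivation (act M (x + y)) p - (derivation (act M x) p + derivation (act M y) p)\<in>SI"
		"derivation (act M (c *c x)) p - c *c derivation (act M x) p\<in>SI"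
		"derivation (act M (bracket x y)) p -
			(derivation (act M x) (derivation (act M y) p) - derivation (act M y) (derivation (act M x) p))\<in>SI"
proof -
	let ?D = "\<lambda>x. derivation (act M x)"
	have ext: "T p\<in>SI" if "\<And>u. set u\<subseteq>SX ==> T (word u)\<in>SI" "lin_on UNIV T" for T
		by (rule lin_on_span[OF that(2) _ _ _ _ p]) (use that(1) in \<open>auto simp: words_def\<close>)
	have right: "q * word u\<in>SI" if "q\<in>SI" "set u\<subseteq>SX" for q u using SI_right[OF that(1)] that(2) word_carrier by auto
	show "?D (x + y) p - (?D x p + ?D y p)\<in>SI"
	proof (rule ext)
		fix u assume "set u\<subseteq>SX"
		then show "?D (x + y) (word u) - (?D x (word u) + ?D y (word u))\<in>SI"
		proof (induction u)
			case (Cons a u)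
			have "?D (x + y) (word (a # u)) - (?D x (word (a # u)) + ?D y (word (a # u)))
				= (word [act M x a \<oplus> act M y a] - word [act M x a] - word [act M y a]) * word u
					+ word [a] * (?D (x + y) (word u) - (?D x (word u) + ?D y (word u)))"
				using Cons.prems x y
				by (simp add: derivation_Cons act_left_add left_diff_distrib right_diff_distrib distrib_left word_mult algebra_simps)
			also have "...\<in>SI"
				using Cons x y by (intro csub_add SI_subspace right SR_add mod_SI_cons) auto
			finally show ?case .
		qed (simp add: derivation_Nil csub_0)
	qed (auto simp: lin_on_def derivation_add derivation_scale scaleC_add_right scaleC_diff_right)
	show "?D (c *c x) p - c *c ?D x p\<in>SI"
	proof (rule ext)
		fix u assume "set u\<subseteq>SX"
		then show "?D (c *c x) (word u) - c *c ?D x (word u)\<in>SI"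
		proof (induction u)
			case (Cons a u)
			have "?D (c *c x) (word (a # u)) - c *c ?D x (word (a # u))
				= (word [c \<odot> act M x a] - c *c word [act M x a]) * word u
					+ word [a] * (?D (c *c x) (word u) - c *c ?D x (word u))"
				using Cons.prems x
				by (simp add: derivation_Cons act_left_scale left_diff_distrib right_diff_distrib word_mult scaleC_mult_left scaleC_mult_right
						scaleC_add_right algebra_simps)
			also have "...\<in>SI"
				using Cons x by (intro csub_add SI_subspace right SR_scale mod_SI_cons) auto
			finally show ?case .
		qed (simp add: derivation_Nil csub_0)
	qed (auto simp: lin_on_def derivation_add derivation_scale scaleC_add_right scaleC_diff_right mult.commute)
	show "?D (bracket x y) p - (?D x (?D y p) - ?D y (?D x p))\<in>SI"
	proof (rule ext)
		fix u assume "set u\<subseteq>SX"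
		then show "?D (bracket x y) (word u) - (?D x (?D y (word u)) - ?D y (?D x (word u)))\<in>SI"
		proof (induction u)
			case (Cons a u)
			have a: "a\<in>SX" using Cons.prems by auto
			have w: "word (b # u) = word [b] * word u" for b by (simp add: word_mult)
			have D1: "?D z (word [b]) = word [act M z b]" for z b by (simp add: derivation_Cons derivation_Nil)
			let ?p = "act M x (act M y a)" and ?q = "act M y (act M x a)"
			have "?D (bracket x y) (word (a # u)) - (?D x (?D y (word (a # u))) - ?D y (?D x (word (a # u))))
				= (word [?p \<ominus> ?q] - word [?p] + word [?q]) * word u
					+ word [a] * (?D (bracket x y) (word u) - (?D x (?D y (word u)) - ?D y (?D x (word u))))"
				using a x y
				by (simp add: w derivation_mult derivation_add D1 act_bracket left_diff_distrib right_diff_distrib distrib_left distrib_right algebra_simps)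
			also have "...\<in>SI"
			proof -
				have "word [(?p \<ominus> ?q) \<oplus> ?q] - word [?p \<ominus> ?q] - word [?q]\<in>SI" using a x y by (intro SR_add) auto
				then have "- (word [(?p \<ominus> ?q) \<oplus> ?q] - word [?p \<ominus> ?q] - word [?q])\<in>SI" by (rule csub_neg[OF SI_subspace])
				moreover have "(?p \<ominus> ?q) \<oplus> ?q = ?p" using a x y by simp
				ultimately have "word [?p \<ominus> ?q] - word [?p] + word [?q]\<in>SI" by (simp add: algebra_simps)
				from csub_add[OF SI_subspace right[OF this] mod_SI_cons[OF Cons.IH a]] Cons.prems show ?thesis by auto
			qed
			finally show ?case .
		qed (simp add: derivation_Nil csub_0 lin_on_0[OF _ derivation_lin[of UNIV]])
	qed (auto simp: lin_on_def derivation_add derivation_scale scaleC_add_right scaleC_diff_right)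
qed

lemma sym_cs:
	shows "carrier (sym_module M) = cs SI ` SF" "zero (sym_module M) = SI" "add (sym_module M) = set_add (free_ring SX)"
		and sym_smult: "p\<in>SF ==> module.smult (sym_module M) c (cs SI p) = cs SI (c *c p)"
		and sym_act: "x\<in>L ==> act (sym_module M) x (cs SI p) = cs SI (derivation (act M x) p)"
proof -
	have plus: "add (free_ring SX) = (+)" by simp
	show "carrier (sym_module M) = cs SI ` SF" "zero (sym_module M) = SI" "add (sym_module M) = set_add (free_ring SX)"
		by (simp_all add: sym_module_def Let_def FactRing_def cs_rcosets[OF plus] free_ring_carrier SI_def[symmetric])
	assume "x\<in>L"
	then have "(\<Union>p\<in>cs SI p. cs SI (derivation (act M x) p)) = cs SI (derivation (act M x) p)"
		by (intro cs_union) (auto simp: derivation_add derivation_SI)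
	then show "act (sym_module M) x (cs SI p) = cs SI (derivation (act M x) p)"
		by (simp add: sym_module_def Let_def SI_def[symmetric] cs_a_r_coset[OF plus])
next
	assume p: "p\<in>SF"
	have plus: "add (free_ring SX) = (+)" by simp
	have "const c\<in>carrier (free_ring SX)"
		using cspan_scale[OF word_carrier[of "[]" SX], of c] by (simp add: free_ring_carrier const_word)
	then have "rcoset_mult (free_ring SX) SI (cs SI (const c)) (cs SI p) = cs SI (c *c p)"
		using ideal.rcoset_mult_add[OF SI_ideal, of "const c" p] p
		by (simp add: free_ring_carrier cs_a_r_coset[OF plus] const_mult)
	then show "module.smult (sym_module M) c (cs SI p) = cs SI (c *c p)"
		by (simp add: sym_module_def Let_def SI_def[symmetric] FactRing_def cs_a_r_coset[OF plus])
qed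

lemma sym_is_lie_module: "is_lie_module L (sym_module M)"
proof -
	obtain \<pi> where "quotient_space SF SI \<pi>"
		by (rule quotient_space_exists[OF _ SI_subspace SI_SF]) auto
	then interpret quotient_space SF SI \<pi> .
	have rep: "lie_rep L (\<pi> ` SF) (\<lambda>x f. \<pi> (derivation (act M x) f))"
		and eq: "\<And>x f. x\<in>L ==> f\<in>SF ==> \<pi> (derivation (act M x) (\<pi> f)) = \<pi> (derivation (act M x) f)"
		using quotient_rep[OF L, of "\<lambda>x. derivation (act M x)"] derivation_laws derivation_SI derivation_words[of SX "act M _"]
		by auto
	have model: "lin_model (sym_module M) (\<pi> ` SF) (quot_map \<pi>)"
		by (rule quotient_lin_model[where R = "free_ring SX"]) (auto simp: sym_cs sym_smult)
	show ?thesis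
		by (rule lie_rep_is_lie_module[OF rep model])
			(auto simp: sym_cs sym_act eq intro!: imageI derivation_words)
qed

definition homog :: "nat => 'v free_algebra set" where "homog k = cspan {word u | u. set u\<subseteq>SX \<and> length u = k}"

lemma homog_SF: "homog k\<subseteq>SF"
	unfolding homog_def by (rule cspan_mono) (auto simp: words_def)

lemma homog_subspace [simp]: "csub (homog k)" by (simp add: homog_def)

lemma word_homog: "set u\<subseteq>SX ==> word u\<in>homog (length u)"
	unfolding homog_def by (rule cspan_base) auto

definition deg_part :: "nat => 'v free_algebra => 'v free_algebra" where
	"deg_part k = lext (\<lambda>w. if length (letters w) = k then sg w else 0)"

lemma deg_part_lin [simp]: "lin_on W (deg_part k)" by (simp add: deg_part_def)

lemma deg_part_add: "deg_part k (p + q) = deg_part k p + deg_part k q" by (simp add: deg_part_def lext_add)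
lemma deg_part_scale: "deg_part k (c *c p) = c *c deg_part k p" by (simp add: deg_part_def lext_scale)

lemma deg_part_word: "deg_part k (word u) = (if length u = k then word u else 0)"
	by (simp add: deg_part_def word_def)

lemma deg_part_homog: "p\<in>homog n ==> deg_part k p = (if n = k then p else 0)"
	unfolding homog_def
proof (induction rule: cspan_induct)
	case zero
	then show ?case using lin_on_0[of UNIV "deg_part k"] by simp
qed (auto simp: deg_part_word deg_part_add deg_part_scale)

lemma homog_sandwich: "g\<in>homog d ==> set u\<subseteq>SX ==> set v\<subseteq>SX ==> word u * g * word v\<in>homog (length u + d + length v)"
	unfolding homog_def[of d]
proof (induction rule: cspan_induct)
	case (base x)
	then obtain w where "x = word w" "set w\<subseteq>SX" "length w = d" by auto
	then show ?case using word_homog[of "u @ w @ v"] base by (simp add: word_mult add.assoc)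
qed (auto simp: csub_0 distrib_left distrib_right scaleC_mult_left scaleC_mult_right csub_add csub_scale)

lemma SR_homog: "g\<in>SR ==> \<exists>d. g\<in>homog d"
proof -
	assume "g\<in>SR"
	then consider (a) y z where "g = gen (y \<oplus> z) - gen y - gen z" "y\<in>SX" "z\<in>SX" |
		(s) c y where "g = gen (c \<odot> y) - const c * gen y" "y\<in>SX" |
		(c) y z where "g = gen y * gen z - gen z * gen y" "y\<in>SX" "z\<in>SX"
		unfolding SR_def linear_rels_def by blast
	then show ?thesis
	proof cases
		case a
		then have "g\<in>homog 1" using word_homog[of "[y \<oplus> z]"] word_homog[of "[y]"] word_homog[of "[z]"]
			by (simp add: gen_word csub_diff)
		then show ?thesis ..
	next
		case s
		then have "g\<in>homog 1" using word_homog[of "[c \<odot> y]"] word_homog[of "[y]"]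
			by (simp add: gen_word const_mult csub_diff csub_scale)
		then show ?thesis ..
	next
		case c
		then have "g\<in>homog 2" using word_homog[of "[y, z]"] word_homog[of "[z, y]"]
			by (simp add: gen_word word_mult csub_diff numeral_2_eq_2)
		then show ?thesis ..
	qed
qed

text \<open>The defining relations are homogeneous, so the grading of words descends to the
  symmetric algebra.\<close>

lemma deg_part_SI: "p\<in>SI ==> deg_part k p\<in>SI"
proof -
	assume p: "p\<in>SI"
	show ?thesis
	proof (rule lin_on_span[of UNIV "deg_part k" _ SI, OF _ _ _ _ _ p[unfolded SI_span]])
		fix s assume s: "s\<in>{word u * g * word v | u g v. g\<in>SR \<and> set u\<subseteq>SX \<and> set v\<subseteq>SX}"
		then obtain n where "s\<in>homog n" using SR_homog homog_sandwich by blast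
		moreover have "s\<in>SI" unfolding SI_span by (rule cspan_base[OF s])
		ultimately show "deg_part k s\<in>SI" by (simp add: deg_part_homog csub_0)
	qed auto
qed

lemma derivation_homog: "x\<in>L ==> p\<in>homog k ==> derivation (act M x) p\<in>homog k"
proof -
	assume x: "x\<in>L" and p: "p\<in>homog k"
	show ?thesis
	proof (rule lin_on_span[of UNIV _ _ "homog k", OF _ _ _ _ _ p[unfolded homog_def]])
		fix s assume "s\<in>{word u | u. set u\<subseteq>SX \<and> length u = k}"
		then obtain u where u: "s = word u" "set u\<subseteq>SX" "length u = k" by blast
		have "set (u[i := act M x (u ! i)])\<subseteq>SX" if "i < length u" for i
			using set_update_subset_insert[of u i "act M x (u ! i)"] u that x nth_mem[of i u] by fastforce
		then show "derivation (act M x) s\<in>homog k"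
			unfolding u(1) derivation_word using word_homog u(3) by (intro csub_sum homog_subspace) (metis length_list_update lessThan_iff)
	qed auto
qed

text \<open>A linear functional extends to a multiplicative evaluation of words that respects all
  relations. It will show that powers of a nonzero vector do not vanish in the symmetric
  algebra.\<close>

lemma eval_SI:
	fixes f :: "'v => complex"
	assumes f: "\<And>x y. x\<in>SX ==> y\<in>SX ==> f (x \<oplus> y) = f x + f y" "\<And>c x. x\<in>SX ==> f (c \<odot> x) = c * f x"
		and p: "p\<in>SI"
	shows "lext (\<lambda>w. prod_list (map f (letters w))) p = 0"
proof -
	let ?e = "lext (\<lambda>w. prod_list (map f (letters w)))"
	have w: "?e (word u) = prod_list (map f u)" for u by (simp add: word_def)
	have m1: "?e (word u * q) = ?e (word u) * ?e q" for u q
		using in_words_UNIV[of q]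
		by (induction rule: cspan_induct)
			(auto simp: words_def word_mult w distrib_left lext_add scaleC_mult_right lext_scale)
	have m: "?e (p * q) = ?e p * ?e q" for p q
		using in_words_UNIV[of p]
		by (induction rule: cspan_induct)
			(auto simp: words_def m1 distrib_right lext_add scaleC_mult_left lext_scale)
	have "?e g = 0" if "g\<in>SR" for g
		using that unfolding SR_def linear_rels_def
		by (auto simp: gen_word const_mult lext_diff lext_scale w f m)
	then have "?e p\<in>{0}"
		by (intro lin_on_span[of UNIV ?e _ "{0}", OF _ _ _ _ _ p[unfolded SI_span]])
			(auto simp: m csub_def)
	then show ?thesis by simp
qed

end

lemma free_module_tl: "free_module X a = tl_module {p. keys p\<subseteq>X} a"
proof -
	have "pm_scale = (scaleC :: complex => ('a \<Rightarrow>\<^sub>0 complex) => _)" by (intro ext) simp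
	then show ?thesis by (simp add: free_module_def tl_module_def)
qed

lemma vspan_tl: "csub F ==> S\<subseteq>F ==> vspan (tl_module F a) S = cspan S"
	using lmodel.vspan_image[of "tl_module F a" F "\<lambda>x. x" S] lin_model_tl[of F a] cspan_least[of S F]
	by (auto simp: lmodel_def)

text \<open>Applies to maps such as inserting a vector as a letter or as a tensor factor, which are
  linear only modulo relations. The induction runs over the linear model, where the span of
  \<open>B\<close> is available.\<close>

lemma span_modulo:
	fixes h :: "'v => 'z::complex_vector"
	assumes m: "lin_model M W \<phi>" and B: "B\<subseteq>carrier M" "vspan M B = carrier M"
		and h: "\<And>x y. x\<in>carrier M ==> y\<in>carrier M ==> h (x \<oplus>\<^bsub>M\<^esub> y) - h x - h y\<in>K"
			"\<And>c x. x\<in>carrier M ==> h (c \<odot>\<^bsub>M\<^esub> x) - c *c h x\<in>K"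
		and x: "x\<in>carrier M"
	shows "h x\<in>cspan (h ` B\<union>K)"
proof -
	interpret lmodel M W \<phi> by (rule lmodel.intro) fact
	let ?S = "cspan (h ` B\<union>K)"
	have KS: "k\<in>?S" if "k\<in>K" for k using that by (intro cspan_base) auto
	have "\<phi> x\<in>cspan (\<phi> ` B)" using vspan_image[OF B(1)] B(2) x by auto
	then have "\<exists>y\<in>carrier M. \<phi> y = \<phi> x \<and> h y\<in>?S"
	proof (induction rule: cspan_induct)
		case zero
		have "h (0 \<odot>\<^bsub>M\<^esub> \<zero>\<^bsub>M\<^esub>) - 0 *c h \<zero>\<^bsub>M\<^esub>\<in>?S" by (rule KS[OF h(2)]) simp
		then show ?case by (intro bexI[of _ "0 \<odot>\<^bsub>M\<^esub> \<zero>\<^bsub>M\<^esub>"]) auto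
	next
		case (base w)
		then obtain b where "b\<in>B" "w = \<phi> b" by auto
		then show ?case using B(1) by (intro bexI[of _ b]) (auto intro: cspan_base)
	next
		case (add u w)
		then obtain a b where ab: "a\<in>carrier M" "\<phi> a = u" "h a\<in>?S" "b\<in>carrier M" "\<phi> b = w" "h b\<in>?S" by blast
		have "(h (a \<oplus>\<^bsub>M\<^esub> b) - h a - h b) + (h a + h b)\<in>?S"
			using KS[OF h(1)[OF ab(1,4)]] ab(3,6) by (intro cspan_add)
		then show ?case using ab by (intro bexI[of _ "a \<oplus>\<^bsub>M\<^esub> b"]) auto
	next
		case (scale c w)
		then obtain a where a: "a\<in>carrier M" "\<phi> a = w" "h a\<in>?S" by blast
		have "(h (c \<odot>\<^bsub>M\<^esub> a) - c *c h a) + c *c h a\<in>?S"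
			using KS[OF h(2)[OF a(1)]] a(3) by (intro cspan_add cspan_scale)
		then show ?case using a by (intro bexI[of _ "c \<odot>\<^bsub>M\<^esub> a"]) auto
	qed
	then show ?thesis using phi_inj x by metis
qed

lemma linear_functional_exists:
	fixes W :: "'w::complex_vector set"
	assumes "csub W" "w\<in>W" "w\<noteq>0"
	obtains f :: "'w => complex" where "lin_on W f" "f w = 1"
proof -
	have "cindep {w}" using assms(3) by simp
	then obtain B where B: "{w}\<subseteq>B" "cindep B" "cspan B = W" using basis_extend[of "{w}" W] assms by auto
	have "lin_on W (\<lambda>x. coord B x w)" using coord_add[OF B(2)] coord_scale[OF B(2)] B(3) by (auto simp: lin_on_def)
	then show thesis using that[of "\<lambda>x. coord B x w"] coord_basis[OF B(2), of w w] B(1) by auto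
qed

section \<open>Tensor products of modules\<close>

locale tensor_pair = V: lie_mod L V + W: lie_mod L W
	for L :: "'x::lie_algebra set" and V :: "('x, 'v) lie_module" and W :: "('x, 'w) lie_module"
begin

definition TF where "TF = {p :: 'v \<times> 'w \<Rightarrow>\<^sub>0 complex. keys p\<subseteq>carrier V \<times> carrier W}"
definition TK where "TK = cspan (bilinear_rels V W)"
definition ta where "ta x = lext (\<lambda>(v, w). sg (act V x v, w) + sg (v, act W x w))"

lemma TF_subspace [simp]: "csub TF" by (simp add: TF_def)
lemma TK_subspace [simp]: "csub TK" by (simp add: TK_def)
lemma TF_span: "TF = cspan (sg ` (carrier V \<times> carrier W))" unfolding TF_def by (rule keys_span)
lemma sg_TF: "v\<in>carrier V ==> w\<in>carrier W ==> sg (v, w)\<in>TF" by (simp add: TF_def)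

lemma rel_TF: "bilinear_rels V W\<subseteq>TF"
proof -
	have s: "Poly_Mapping.single (v, w) c\<in>TF" if "v\<in>carrier V" "w\<in>carrier W" for v w c
		using that unfolding TF_def by (auto split: if_splits)
	show ?thesis unfolding bilinear_rels_def by (auto intro!: csub_diff s)
qed

lemma TK_TF: "TK\<subseteq>TF" unfolding TK_def by (rule cspan_least[OF rel_TF]) simp

lemma rel1: "a\<in>carrier V ==> b\<in>carrier V ==> w\<in>carrier W ==> sg (a \<oplus>\<^bsub>V\<^esub> b, w) - sg (a, w) - sg (b, w)\<in>TK"
	and rel2: "a\<in>carrier V ==> v\<in>carrier W ==> w\<in>carrier W ==> sg (a, v \<oplus>\<^bsub>W\<^esub> w) - sg (a, v) - sg (a, w)\<in>TK"
	and rel3: "a\<in>carrier V ==> w\<in>carrier W ==> sg (c \<odot>\<^bsub>V\<^esub> a, w) - c *c sg (a, w)\<in>TK"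
	and rel4: "a\<in>carrier V ==> w\<in>carrier W ==> sg (a, c \<odot>\<^bsub>W\<^esub> w) - c *c sg (a, w)\<in>TK"
	unfolding TK_def bilinear_rels_def single_scaleC[of _ c, symmetric]
	by (rule cspan_base, blast)+

lemma TK_induct:
	assumes T: "lin_on UNIV T" and U: "csub U" and p: "p\<in>TK"
		and "\<And>a b w. a\<in>carrier V ==> b\<in>carrier V ==> w\<in>carrier W ==> T (sg (a \<oplus>\<^bsub>V\<^esub> b, w)) - T (sg (a, w)) - T (sg (b, w))\<in>U"
		"\<And>a v w. a\<in>carrier V ==> v\<in>carrier W ==> w\<in>carrier W ==> T (sg (a, v \<oplus>\<^bsub>W\<^esub> w)) - T (sg (a, v)) - T (sg (a, w))\<in>U"
		"\<And>c a w. a\<in>carrier V ==> w\<in>carrier W ==> T (sg (c \<odot>\<^bsub>V\<^esub> a, w)) - c *c T (sg (a, w))\<in>U"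
		"\<And>c a w. a\<in>carrier V ==> w\<in>carrier W ==> T (sg (a, c \<odot>\<^bsub>W\<^esub> w)) - c *c T (sg (a, w))\<in>U"
	shows "T p\<in>U"
proof (rule lin_on_span[OF T _ _ _ U p[unfolded TK_def]])
	have d: "T (x - y) = T x - T y" and s: "T (c *c x) = c *c T x" for x y c
		using lin_on_diff[OF _ T] lin_on_scale[OF T] by auto
	fix q assume "q\<in>bilinear_rels V W"
	then consider (1) a b w where "q = sg (a \<oplus>\<^bsub>V\<^esub> b, w) - sg (a, w) - sg (b, w)" "a\<in>carrier V" "b\<in>carrier V" "w\<in>carrier W"
		| (2) a v w where "q = sg (a, v \<oplus>\<^bsub>W\<^esub> w) - sg (a, v) - sg (a, w)" "a\<in>carrier V" "v\<in>carrier W" "w\<in>carrier W"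
		| (3) c a w where "q = sg (c \<odot>\<^bsub>V\<^esub> a, w) - Poly_Mapping.single (a, w) c" "a\<in>carrier V" "w\<in>carrier W"
		| (4) c a w where "q = sg (a, c \<odot>\<^bsub>W\<^esub> w) - Poly_Mapping.single (a, w) c" "a\<in>carrier V" "w\<in>carrier W"
		unfolding bilinear_rels_def by blast
	then show "T q\<in>U"
	proof cases
		case 1
		then show ?thesis using assms(4) by (simp add: d)
	next
		case 2
		then show ?thesis using assms(5) by (simp add: d)
	next
		case 3
		then show ?thesis using assms(6) by (simp only: d s single_scaleC[of _ c])
	next
		case 4
		then show ?thesis using assms(7) by (simp only: d s single_scaleC[of _ c])
	qed
qed auto

lemma ta_sg: "ta x (sg (v, w)) = sg (act V x v, w) + sg (v, act W x w)" by (simp add: ta_def)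
lemma ta_lin [simp]: "lin_on U (ta x)" by (simp add: ta_def)
lemma ta_add: "ta x (p + q) = ta x p + ta x q" by (simp add: ta_def lext_add)
lemma ta_scale: "ta x (c *c p) = c *c ta x p" by (simp add: ta_def lext_scale)

lemma ta_TF: "x\<in>L ==> p\<in>TF ==> ta x p\<in>TF"
	by (rule lin_on_span[OF ta_lin[of UNIV], of "sg ` (carrier V \<times> carrier W)"])
		(auto simp: TF_span[symmetric] ta_sg intro!: csub_add sg_TF)

lemma ta_TK: assumes x: "x\<in>L" and p: "p\<in>TK" shows "ta x p\<in>TK"
proof (rule TK_induct[OF ta_lin TK_subspace p])
	fix a b w assume *: "a\<in>carrier V" "b\<in>carrier V" "w\<in>carrier W"
	have "ta x (sg (a \<oplus>\<^bsub>V\<^esub> b, w)) - ta x (sg (a, w)) - ta x (sg (b, w)) =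
		(sg (act V x a \<oplus>\<^bsub>V\<^esub> act V x b, w) - sg (act V x a, w) - sg (act V x b, w)) +
		(sg (a \<oplus>\<^bsub>V\<^esub> b, act W x w) - sg (a, act W x w) - sg (b, act W x w))"
		using * x by (simp add: ta_sg algebra_simps)
	also have "...\<in>TK" using * x by (intro csub_add TK_subspace rel1) auto
	finally show "ta x (sg (a \<oplus>\<^bsub>V\<^esub> b, w)) - ta x (sg (a, w)) - ta x (sg (b, w))\<in>TK" .
next
	fix a v w assume *: "a\<in>carrier V" "v\<in>carrier W" "w\<in>carrier W"
	have "ta x (sg (a, v \<oplus>\<^bsub>W\<^esub> w)) - ta x (sg (a, v)) - ta x (sg (a, w)) =
		(sg (act V x a, v \<oplus>\<^bsub>W\<^esub> w) - sg (act V x a, v) - sg (act V x a, w)) +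
		(sg (a, act W x v \<oplus>\<^bsub>W\<^esub> act W x w) - sg (a, act W x v) - sg (a, act W x w))"
		using * x by (simp add: ta_sg algebra_simps)
	also have "...\<in>TK" using * x by (intro csub_add TK_subspace rel2) auto
	finally show "ta x (sg (a, v \<oplus>\<^bsub>W\<^esub> w)) - ta x (sg (a, v)) - ta x (sg (a, w))\<in>TK" .
next
	fix c a w assume *: "a\<in>carrier V" "w\<in>carrier W"
	have "ta x (sg (c \<odot>\<^bsub>V\<^esub> a, w)) - c *c ta x (sg (a, w)) =
		(sg (c \<odot>\<^bsub>V\<^esub> act V x a, w) - c *c sg (act V x a, w)) + (sg (c \<odot>\<^bsub>V\<^esub> a, act W x w) - c *c sg (a, act W x w))"
		using * x by (simp add: ta_sg scaleC_add_right algebra_simps)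
	also have "...\<in>TK" using * x by (intro csub_add TK_subspace rel3) auto
	finally show "ta x (sg (c \<odot>\<^bsub>V\<^esub> a, w)) - c *c ta x (sg (a, w))\<in>TK" .
	have "ta x (sg (a, c \<odot>\<^bsub>W\<^esub> w)) - c *c ta x (sg (a, w)) =
		(sg (act V x a, c \<odot>\<^bsub>W\<^esub> w) - c *c sg (act V x a, w)) + (sg (a, c \<odot>\<^bsub>W\<^esub> act W x w) - c *c sg (a, act W x w))"
		using * x by (simp add: ta_sg scaleC_add_right algebra_simps)
	also have "...\<in>TK" using * x by (intro csub_add TK_subspace rel4) auto
	finally show "ta x (sg (a, c \<odot>\<^bsub>W\<^esub> w)) - c *c ta x (sg (a, w))\<in>TK" .
qed

lemma ta_laws:
	assumes x: "x\<in>L" and y: "y\<in>L" and p: "p\<in>TF"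
	shows "ta (x + y) p - (ta x p + ta y p)\<in>TK" "ta (c *c x) p - c *c ta x p\<in>TK"
		"ta (bracket x y) p - (ta x (ta y p) - ta y (ta x p))\<in>TK"
proof -
	have ext: "T p\<in>TK" if "\<And>v w. v\<in>carrier V ==> w\<in>carrier W ==> T (sg (v, w))\<in>TK" "lin_on UNIV T" for T
		by (rule lin_on_span[OF that(2) _ _ _ _ p[unfolded TF_span]]) (use that(1) in auto)
	show "ta (x + y) p - (ta x p + ta y p)\<in>TK"
	proof (rule ext)
		fix v w assume *: "v\<in>carrier V" "w\<in>carrier W"
		have "ta (x + y) (sg (v, w)) - (ta x (sg (v, w)) + ta y (sg (v, w))) =
			(sg (act V x v \<oplus>\<^bsub>V\<^esub> act V y v, w) - sg (act V x v, w) - sg (act V y v, w)) +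
			(sg (v, act W x w \<oplus>\<^bsub>W\<^esub> act W y w) - sg (v, act W x w) - sg (v, act W y w))"
			using * x y by (simp add: ta_sg V.act_left_add W.act_left_add algebra_simps)
		also have "...\<in>TK" using * x y by (intro csub_add TK_subspace rel1 rel2) auto
		finally show "ta (x + y) (sg (v, w)) - (ta x (sg (v, w)) + ta y (sg (v, w)))\<in>TK" .
	qed (auto simp: lin_on_def ta_add ta_scale scaleC_add_right scaleC_diff_right)
	show "ta (c *c x) p - c *c ta x p\<in>TK"
	proof (rule ext)
		fix v w assume *: "v\<in>carrier V" "w\<in>carrier W"
		have "ta (c *c x) (sg (v, w)) - c *c ta x (sg (v, w)) =
			(sg (c \<odot>\<^bsub>V\<^esub> act V x v, w) - c *c sg (act V x v, w)) + (sg (v, c \<odot>\<^bsub>W\<^esub> act W x w) - c *c sg (v, act W x w))"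
			using * x by (simp add: ta_sg V.act_left_scale W.act_left_scale scaleC_add_right algebra_simps)
		also have "...\<in>TK" using * x by (intro csub_add TK_subspace rel3 rel4) auto
		finally show "ta (c *c x) (sg (v, w)) - c *c ta x (sg (v, w))\<in>TK" .
	qed (auto simp: lin_on_def ta_add ta_scale scaleC_add_right scaleC_diff_right mult.commute)
	show "ta (bracket x y) p - (ta x (ta y p) - ta y (ta x p))\<in>TK"
	proof (rule ext)
		fix v w assume *: "v\<in>carrier V" "w\<in>carrier W"
		have m1: "sg (a \<ominus>\<^bsub>V\<^esub> b, w) - sg (a, w) + sg (b, w)\<in>TK" if "a\<in>carrier V" "b\<in>carrier V" for a b
			using csub_neg[OF TK_subspace rel1[of "a \<ominus>\<^bsub>V\<^esub> b" b w]] that * by (simp add: algebra_simps)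
		have m2: "sg (v, a \<ominus>\<^bsub>W\<^esub> b) - sg (v, a) + sg (v, b)\<in>TK" if "a\<in>carrier W" "b\<in>carrier W" for a b
			using csub_neg[OF TK_subspace rel2[of v "a \<ominus>\<^bsub>W\<^esub> b" b]] that * by (simp add: algebra_simps)
		have "ta (bracket x y) (sg (v, w)) - (ta x (ta y (sg (v, w))) - ta y (ta x (sg (v, w)))) =
			(sg (act V x (act V y v) \<ominus>\<^bsub>V\<^esub> act V y (act V x v), w) - sg (act V x (act V y v), w) + sg (act V y (act V x v), w)) +
			(sg (v, act W x (act W y w) \<ominus>\<^bsub>W\<^esub> act W y (act W x w)) - sg (v, act W x (act W y w)) + sg (v, act W y (act W x w)))"
			using * x y by (simp add: ta_sg ta_add V.act_bracket W.act_bracket algebra_simps)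
		also have "...\<in>TK" using m1 m2 * x y by (intro csub_add[OF TK_subspace m1 m2]) auto
		finally show "ta (bracket x y) (sg (v, w)) - (ta x (ta y (sg (v, w))) - ta y (ta x (sg (v, w))))\<in>TK" .
	qed (auto simp: lin_on_def ta_add ta_scale scaleC_add_right scaleC_diff_right)
qed

lemma tensor_eq: "tensor_module V W = quotient_module (tl_module TF ta) TK"
proof -
	have "(\<lambda>x. lin_ext (\<lambda>(v, w). Poly_Mapping.single (act V x v, w) 1 + Poly_Mapping.single (v, act W x w) 1)) = ta"
		by (rule ext) (simp add: ta_def lin_ext_lext)
	then show ?thesis
		unfolding tensor_module_def Let_def free_module_tl TF_def[symmetric] using vspan_tl[OF TF_subspace rel_TF, of ta]
		by (simp add: TK_def)
qed

lemma tensor_cs: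
	shows "carrier (tensor_module V W) = cs TK ` TF" "zero (tensor_module V W) = TK"
		"add (tensor_module V W) = set_add (tl_module TF ta)"
		"module.smult (tensor_module V W) c (cs TK p) = cs TK (c *c p)"
		and tensor_act: "x\<in>L ==> act (tensor_module V W) x (cs TK p) = cs TK (ta x p)"
	unfolding tensor_eq using quot_cs[OF TF_subspace TK_subspace TK_TF, of "tl_module TF ta"]
	by (auto simp: ta_add ta_TK)

end

lemma (in tensor_pair) tensor_model:
	assumes "quotient_space TF TK \<pi>"
	shows "lin_model (tensor_module V W) (\<pi> ` TF) (quot_map \<pi>)"
		and "lie_rep L (\<pi> ` TF) (\<lambda>x f. \<pi> (ta x f))"
		and "\<And>x f. x\<in>L ==> f\<in>TF ==> \<pi> (ta x (\<pi> f)) = \<pi> (ta x f)"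
proof -
	interpret Q: quotient_space TF TK \<pi> by fact
	show "lin_model (tensor_module V W) (\<pi> ` TF) (quot_map \<pi>)"
		by (rule Q.quotient_lin_model[where R = "tl_module TF ta"]) (auto simp: tensor_cs)
	show "lie_rep L (\<pi> ` TF) (\<lambda>x f. \<pi> (ta x f))"
		and "\<And>x f. x\<in>L ==> f\<in>TF ==> \<pi> (ta x (\<pi> f)) = \<pi> (ta x f)"
		using Q.quotient_rep[OF V.L, of ta] ta_laws ta_TK ta_TF by auto
qed

section \<open>The grading of the tensor product with a symmetric algebra\<close>

locale gr_tensor = V: lie_mod L V + M: lie_mod L M
	for L :: "'x::lie_algebra set" and V :: "('x, 'v) lie_module" and M :: "('x, 'w) lie_module"
begin

sublocale T: tensor_pair L V "sym_module M"
	unfolding tensor_pair_def using V.lie_mod_axioms M.sym_is_lie_module M.L by (simp add: lie_mod_def)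

definition piece :: "nat => ('v \<times> 'w free_algebra set \<Rightarrow>\<^sub>0 complex) set" where
	"piece k = cspan (sg ` (carrier V \<times> cs M.SI ` M.homog k))"

lemma piece_subspace [simp]: "csub (piece k)" by (simp add: piece_def)

lemma sym_carrier: "p\<in>M.SF ==> cs M.SI p\<in>carrier (sym_module M)" by (simp add: M.sym_cs)

lemma piece_TF: "piece k\<subseteq>T.TF"
	unfolding piece_def T.TF_span using subsetD[OF M.homog_SF] by (intro cspan_mono image_mono) (auto intro!: sym_carrier)

lemma piece_stable: "x\<in>L ==> p\<in>piece k ==> T.ta x p\<in>piece k"
proof -
	assume x: "x\<in>L" and p: "p\<in>piece k"
	show ?thesis
	proof (rule lin_on_span[OF T.ta_lin[of UNIV] _ _ _ _ p[unfolded piece_def]])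
		fix s assume "s\<in>sg ` (carrier V \<times> cs M.SI ` M.homog k)"
		then obtain v q where s: "s = sg (v, cs M.SI q)" "v\<in>carrier V" "q\<in>M.homog k" by auto
		have "T.ta x s = sg (act V x v, cs M.SI q) + sg (v, cs M.SI (derivation (act M x) q))"
			using x by (simp add: s T.ta_sg M.sym_act)
		also have "...\<in>piece k"
			unfolding piece_def using s x M.derivation_homog[OF x s(3)]
			by (intro cspan_add cspan_base imageI) auto
		finally show "T.ta x s\<in>piece k" .
	qed auto
qed

text \<open>The projection of the symmetric algebra to degree \<open>k\<close>. Since the ideal is
  homogeneous, all representatives of a coset contribute the same coset to the union.\<close>

definition XD :: "nat => 'w free_algebra set => 'w free_algebra set" where
	"XD k C = (\<Union>p\<in>C. cs M.SI (M.deg_part k p))"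

lemma XD_cs: "XD k (cs M.SI p) = cs M.SI (M.deg_part k p)"
	unfolding XD_def by (rule cs_union[OF M.SI_subspace]) (simp add: M.deg_part_add M.deg_part_SI)

lemma deg_part_SF: "p\<in>M.SF ==> M.deg_part k p\<in>M.SF"
proof (rule lin_on_span[of UNIV "M.deg_part k" "words (carrier M)"])
	fix s assume "s\<in>words (carrier M)"
	then obtain u where "s = word u" "set u\<subseteq>carrier M" by (auto simp: words_def)
	then show "M.deg_part k s\<in>M.SF" by (simp add: M.deg_part_word cspan_0 word_carrier)
qed auto

definition td :: "nat => ('v \<times> 'w free_algebra set \<Rightarrow>\<^sub>0 complex) => ('v \<times> 'w free_algebra set \<Rightarrow>\<^sub>0 complex)" where
	"td k = lext (\<lambda>(v, C). sg (v, XD k C))"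

lemma td_sg: "td k (sg (v, C)) = sg (v, XD k C)" by (simp add: td_def)
lemma td_lin [simp]: "lin_on U (td k)" by (simp add: td_def)

lemma td_TK: assumes p: "p\<in>T.TK" shows "td k p\<in>T.TK"
proof (rule T.TK_induct[OF td_lin T.TK_subspace p])
	have c: "XD k C\<in>carrier (sym_module M)" if "C\<in>carrier (sym_module M)" for C
		using that by (auto simp: M.sym_cs XD_cs intro!: imageI deg_part_SF)
	show "td k (sg (a \<oplus>\<^bsub>V\<^esub> b, w)) - td k (sg (a, w)) - td k (sg (b, w))\<in>T.TK"
		if "a\<in>carrier V" "b\<in>carrier V" "w\<in>carrier (sym_module M)" for a b w
		using T.rel1[OF that(1,2) c[OF that(3)]] by (simp add: td_sg)
	show "td k (sg (c \<odot>\<^bsub>V\<^esub> a, w)) - c *c td k (sg (a, w))\<in>T.TK"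
		if "a\<in>carrier V" "w\<in>carrier (sym_module M)" for c' c a w
		using T.rel3[OF that(1) c[OF that(2)]] by (simp add: td_sg)
	show "td k (sg (a, v \<oplus>\<^bsub>sym_module M\<^esub> w)) - td k (sg (a, v)) - td k (sg (a, w))\<in>T.TK"
		if vw: "a\<in>carrier V" "v\<in>carrier (sym_module M)" "w\<in>carrier (sym_module M)" for a v w
	proof -
		obtain p q where pq: "v = cs M.SI p" "w = cs M.SI q" "p\<in>M.SF" "q\<in>M.SF" using vw by (auto simp: M.sym_cs)
		have plus: "add (free_ring (carrier M)) = (+)" by simp
		have "XD k (v \<oplus>\<^bsub>sym_module M\<^esub> w) = XD k v \<oplus>\<^bsub>sym_module M\<^esub> XD k w"
			by (simp add: pq M.sym_cs cs_set_add[OF M.SI_subspace plus] XD_cs M.deg_part_add)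
		then show ?thesis using T.rel2[OF vw(1) c[OF vw(2)] c[OF vw(3)]] by (simp add: td_sg)
	qed
	show "td k (sg (a, c' \<odot>\<^bsub>sym_module M\<^esub> w)) - c' *c td k (sg (a, w))\<in>T.TK"
		if vw: "a\<in>carrier V" "w\<in>carrier (sym_module M)" for c' a w
	proof -
		obtain p where p: "w = cs M.SI p" "p\<in>M.SF" using vw by (auto simp: M.sym_cs)
		have "XD k (c' \<odot>\<^bsub>sym_module M\<^esub> w) = c' \<odot>\<^bsub>sym_module M\<^esub> XD k w"
			using p(2) deg_part_SF by (simp add: p(1) M.sym_smult XD_cs M.deg_part_scale)
		then show ?thesis using T.rel4[OF vw(1) c[OF vw(2)]] by (simp add: td_sg)
	qed
qed

lemma sg_zero: "v\<in>carrier V ==> sg (v, cs M.SI 0)\<in>T.TK"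
proof -
	assume v: "v\<in>carrier V"
	have 0: "cs M.SI 0\<in>carrier (sym_module M)" by (rule sym_carrier) (simp add: cspan_0)
	have "module.smult (sym_module M) 0 (cs M.SI 0) = cs M.SI 0" by (subst M.sym_smult) (auto simp: cspan_0)
	then show ?thesis using T.rel4[OF v 0, of 0] by simp
qed

lemma td_piece: "p\<in>piece j ==> td k p - (if j = k then p else 0)\<in>T.TK"
proof (rule lin_on_span[of UNIV "\<lambda>p. td k p - (if j = k then p else 0)" "sg ` (carrier V \<times> cs M.SI ` M.homog j)"])
	fix s assume "s\<in>sg ` (carrier V \<times> cs M.SI ` M.homog j)"
	then obtain v q where s: "s = sg (v, cs M.SI q)" "v\<in>carrier V" "q\<in>M.homog j" by auto
	then show "td k s - (if j = k then s else 0)\<in>T.TK"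
		using sg_zero[OF s(2)] by (simp add: td_sg XD_cs M.deg_part_homog csub_0)
next
	show "lin_on UNIV (\<lambda>p. td k p - (if j = k then p else 0))"
		using td_lin[of UNIV k] by (auto simp: lin_on_def scaleC_diff_right)
qed (auto simp: piece_def)

text \<open>The relations are included, so that membership depends only on the class in the tensor
  product.\<close>

definition upto :: "nat => ('v \<times> 'w free_algebra set \<Rightarrow>\<^sub>0 complex) set" where
	"upto n = cspan ((\<Union>j\<le>n. piece j)\<union>T.TK)"

lemma upto_subspace [simp]: "csub (upto n)" by (simp add: upto_def)
lemma upto_mono: "n \<le> m ==> upto n\<subseteq>upto m"
	unfolding upto_def by (rule cspan_mono) (auto intro: order_trans)
lemma TK_upto: "T.TK\<subseteq>upto n" unfolding upto_def by (auto intro: cspan_base)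

lemma upto_exhaust: "p\<in>T.TF ==> \<exists>n. p\<in>upto n"
proof -
	have sg: "\<exists>n. sg (v, cs M.SI q)\<in>upto n" if v: "v\<in>carrier V" and q: "q\<in>M.SF" for v q
	proof -
		have "q\<in>M.SF \<and> (\<exists>n. sg (v, cs M.SI q)\<in>upto n)"
			using q
		proof (induction rule: cspan_induct)
			case zero
			show ?case using sg_zero[OF v] TK_upto[of 0] cspan_0 by auto
		next
			case (base s)
			then obtain u where u: "s = word u" "set u\<subseteq>carrier M" by (auto simp: words_def)
			have "sg (v, cs M.SI s)\<in>piece (length u)"
				unfolding piece_def u(1) using v M.word_homog[OF u(2)] by (intro cspan_base) auto
			then have "sg (v, cs M.SI s)\<in>upto (length u)" unfolding upto_def by (intro cspan_base) auto
			then show ?case using u word_carrier by auto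
		next
			case (add s t)
			then obtain n m where nm: "sg (v, cs M.SI s)\<in>upto n" "sg (v, cs M.SI t)\<in>upto m" "s\<in>M.SF" "t\<in>M.SF" by blast
			have plus: "add (free_ring (carrier M)) = (+)" by simp
			have "cs M.SI s \<oplus>\<^bsub>sym_module M\<^esub> cs M.SI t = cs M.SI (s + t)"
				by (simp add: M.sym_cs cs_set_add[OF M.SI_subspace plus])
			then have "sg (v, cs M.SI (s + t)) - sg (v, cs M.SI s) - sg (v, cs M.SI t)\<in>upto (max n m)"
				using T.rel2[OF v sym_carrier[OF nm(3)] sym_carrier[OF nm(4)]] TK_upto by auto
			moreover have "sg (v, cs M.SI s)\<in>upto (max n m)" "sg (v, cs M.SI t)\<in>upto (max n m)"
				using nm upto_mono[of n "max n m"] upto_mono[of m "max n m"] by auto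
			ultimately have "(sg (v, cs M.SI (s + t)) - sg (v, cs M.SI s) - sg (v, cs M.SI t)) + (sg (v, cs M.SI s) + sg (v, cs M.SI t))\<in>upto (max n m)"
				by (intro csub_add upto_subspace)
			then have "sg (v, cs M.SI (s + t))\<in>upto (max n m)" by simp
			then show ?case using cspan_add[OF nm(3,4)] by blast
		next
			case (scale c s)
			then obtain n where n: "sg (v, cs M.SI s)\<in>upto n" "s\<in>M.SF" by blast
			have "sg (v, cs M.SI (c *c s)) - c *c sg (v, cs M.SI s)\<in>upto n"
				using T.rel4[OF v sym_carrier[OF n(2)], of c] M.sym_smult[OF n(2)] TK_upto by auto
			then have "(sg (v, cs M.SI (c *c s)) - c *c sg (v, cs M.SI s)) + c *c sg (v, cs M.SI s)\<in>upto n"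
				using n by (intro csub_add csub_scale upto_subspace)
			then have "sg (v, cs M.SI (c *c s))\<in>upto n" by simp
			then show ?case using cspan_scale[OF n(2)] by blast
		qed
		then show ?thesis by simp
	qed
	assume "p\<in>T.TF"
	then show ?thesis
		unfolding T.TF_span
	proof (induction rule: cspan_induct)
		case zero
		show ?case using csub_0[OF upto_subspace] by blast
	next
		case (base x)
		then show ?case using sg by (auto simp: M.sym_cs)
	next
		case (add x y)
		then obtain n m where "x\<in>upto n" "y\<in>upto m" by blast
		then have "x\<in>upto (max n m)" "y\<in>upto (max n m)" using upto_mono[of n "max n m"] upto_mono[of m "max n m"] by auto
		then show ?case using csub_add[OF upto_subspace] by blast
	next
		case (scale c x)
		then show ?case using csub_scale[OF upto_subspace] by blast
	qed
qed

text \<open>The degree projection fixes \<open>piece k\<close> and kills all lower pieces, both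
  modulo the relations. Different degrees are thus independent in the tensor product.\<close>

lemma piece_upto: "p\<in>piece k ==> p\<in>upto n ==> n < k ==> p\<in>T.TK"
proof -
	assume p: "p\<in>piece k" "p\<in>upto n" "n < k"
	have "td k p\<in>T.TK"
	proof (rule lin_on_span[OF td_lin[of UNIV] _ _ _ _ p(2)[unfolded upto_def]])
		fix s assume "s\<in>(\<Union>j\<le>n. piece j)\<union>T.TK"
		then show "td k s\<in>T.TK" using td_TK td_piece[of s _ k] p(3) by fastforce
	qed auto
	moreover have "td k p - p\<in>T.TK" using td_piece[OF p(1), of k] by simp
	ultimately have "td k p - (td k p - p)\<in>T.TK" by (rule csub_diff[OF T.TK_subspace])
	then show ?thesis by simp
qed

text \<open>Choose functionals with value 1 at \<open>v\<close> and at \<open>x\<close>. The first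
  one times the multiplicative extension of the second respects the relations of the tensor product
  and is 1 on \<open>v\<close> tensored with the \<open>k\<close>-th power of
  \<open>x\<close>.\<close>

lemma piece_nonzero:
	assumes "lin_model V W1 \<phi>1" "lin_model M W2 \<phi>2" "v\<in>carrier V" "v\<noteq>\<zero>\<^bsub>V\<^esub>" "x\<in>carrier M" "x\<noteq>\<zero>\<^bsub>M\<^esub>"
	shows "\<not> piece k\<subseteq>T.TK"
proof
	assume sub: "piece k\<subseteq>T.TK"
	interpret V': lmodel V W1 \<phi>1 by (rule lmodel.intro) fact
	interpret M': lmodel M W2 \<phi>2 by (rule lmodel.intro) fact
	have "\<phi>1 v\<noteq>0" "\<phi>2 x\<noteq>0" using assms V'.phi_inj[of v "\<zero>\<^bsub>V\<^esub>"] M'.phi_inj[of x "\<zero>\<^bsub>M\<^esub>"] by auto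
	then obtain f1 f2 where f1: "lin_on W1 f1" "f1 (\<phi>1 v) = (1::complex)" and f2: "lin_on W2 f2" "f2 (\<phi>2 x) = (1::complex)"
		using linear_functional_exists[OF V'.Ws V'.phi_W[OF assms(3)]] linear_functional_exists[OF M'.Ws M'.phi_W[OF assms(5)]] by metis
	define g where "g y = f1 (\<phi>1 y)" for y
	define h where "h y = f2 (\<phi>2 y)" for y
	have g: "g (a \<oplus>\<^bsub>V\<^esub> b) = g a + g b" "g (c \<odot>\<^bsub>V\<^esub> a) = c * g a" if "a\<in>carrier V" "b\<in>carrier V" for a b c
		using that by (simp_all add: g_def lin_on_add[OF f1(1)] lin_on_scale[OF f1(1)])
	have h: "h (a \<oplus>\<^bsub>M\<^esub> b) = h a + h b" "h (c \<odot>\<^bsub>M\<^esub> a) = c * h a" if "a\<in>carrier M" "b\<in>carrier M" for a b c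
		using that by (simp_all add: h_def lin_on_add[OF f2(1)] lin_on_scale[OF f2(1)])
	define e where "e = lext (\<lambda>w. prod_list (map h (letters w)))"
	have eSI: "e p = 0" if "p\<in>M.SI" for p unfolding e_def by (rule M.eval_SI[OF _ _ that]) (use h in auto)
	have e_add: "e (p + q) = e p + e q" "e (c *c p) = c * e p" for p q c by (simp_all add: e_def lext_add lext_scale)
	define E where "E C = the_elem (e ` C)" for C
	have E: "E (cs M.SI p) = e p" for p
	proof -
		have "e ` cs M.SI p = {e p}" using cs_self[OF M.SI_subspace, of p] eSI by (auto simp: cs_def e_add image_iff)
		then show ?thesis by (simp add: E_def)
	qed
	have plus: "add (free_ring (carrier M)) = (+)" by simp
	define T where "T = lext (\<lambda>(v, C). g v * E C)"
	have Tsg: "T (sg (a, C)) = g a * E C" for a C by (simp add: T_def)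
	have TK0: "T p\<in>{0}" if p: "p\<in>T.TK" for p
	proof (rule T.TK_induct[OF _ _ p])
		show "T (sg (a, v \<oplus>\<^bsub>sym_module M\<^esub> w)) - T (sg (a, v)) - T (sg (a, w))\<in>{0}"
			if vw: "a\<in>carrier V" "v\<in>carrier (sym_module M)" "w\<in>carrier (sym_module M)" for a v w
		proof -
			obtain p q where pq: "v = cs M.SI p" "w = cs M.SI q" using vw by (auto simp: M.sym_cs)
			show ?thesis by (simp add: Tsg pq M.sym_cs cs_set_add[OF M.SI_subspace plus] E e_add algebra_simps)
		qed
		show "T (sg (a, c \<odot>\<^bsub>sym_module M\<^esub> w)) - c *c T (sg (a, w))\<in>{0}"
			if vw: "a\<in>carrier V" "w\<in>carrier (sym_module M)" for c a w
		proof -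
			obtain p where p: "w = cs M.SI p" "p\<in>M.SF" using vw by (auto simp: M.sym_cs)
			show ?thesis using p(2) by (simp add: Tsg p(1) M.sym_smult E e_add algebra_simps)
		qed
	qed (auto simp: Tsg g algebra_simps T_def csub_def)
	let ?u = "replicate k x"
	have "set ?u\<subseteq>carrier M" using assms(5) by auto
	then have "word ?u\<in>M.homog k" using M.word_homog[of ?u] by simp
	then have "sg (v, cs M.SI (word ?u))\<in>piece k"
		unfolding piece_def using assms(3) by (intro cspan_base) auto
	then have "T (sg (v, cs M.SI (word ?u))) = 0" using sub TK0 by auto
	moreover have "e (word ?u) = 1" by (simp add: e_def word_def h_def f2(2))
	ultimately show False by (simp add: Tsg E g_def f1(2))
qed

text \<open>Modulo the relations, words of length \<open>k\<close> in a finite generating set and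
  finitely many first factors suffice.\<close>

lemma piece_finite:
	assumes "lin_model V W1 \<phi>1" "lin_model M W2 \<phi>2"
		and BV: "finite BV" "BV\<subseteq>carrier V" "vspan V BV = carrier V"
		and BM: "finite BM" "BM\<subseteq>carrier M" "vspan M BM = carrier M"
	shows "\<exists>S. finite S \<and> piece k\<subseteq>cspan (S\<union>T.TK)"
proof -
	let ?W = "\<lambda>k. word ` {u. set u\<subseteq>BM \<and> length u = k}"
	have one: "word [x]\<in>cspan (?W 1\<union>M.SI)" if x: "x\<in>carrier M" for x
	proof -
		have "word [x]\<in>cspan ((\<lambda>x. word [x]) ` BM\<union>M.SI)"
			by (rule span_modulo[OF assms(2) BM(2,3) M.SR_add M.SR_scale x])
		moreover have "(\<lambda>x. word [x]) ` BM\<subseteq>?W 1" by (auto intro!: imageI)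
		ultimately show ?thesis using cspan_mono[of "(\<lambda>x. word [x]) ` BM\<union>M.SI" "?W 1\<union>M.SI"] by blast
	qed
	have WSF: "?W j\<subseteq>M.SF" for j using BM(2) by (auto intro!: word_carrier)
	have prod: "p * q\<in>cspan (?W (Suc j)\<union>M.SI)" if "p\<in>cspan (?W 1\<union>M.SI)" "q\<in>cspan (?W j\<union>M.SI)" for p q j
	proof -
		have "s * q\<in>cspan (?W (Suc j)\<union>M.SI)" if s: "s\<in>?W 1\<union>M.SI" for s
		proof (rule lin_on_span[of UNIV "\<lambda>q. s * q", OF _ _ _ _ _ \<open>q\<in>cspan (?W j\<union>M.SI)\<close>])
			fix t assume t: "t\<in>?W j\<union>M.SI"
			have inSF: "s\<in>M.SF" "t\<in>M.SF" using s t WSF[of 1] WSF[of j] M.SI_SF by auto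
			show "s * t\<in>cspan (?W (Suc j)\<union>M.SI)"
			proof (cases "s\<in>M.SI \<or> t\<in>M.SI")
				case True
				then have "s * t\<in>M.SI" using M.SI_left M.SI_right inSF by auto
				then show ?thesis by (intro cspan_base) auto
			next
				case False
				then obtain u v where "s = word u" "t = word v" "set u\<subseteq>BM" "set v\<subseteq>BM" "length u = 1" "length v = j" using s t by auto
				then have "s * t = word (u @ v)" "set (u @ v)\<subseteq>BM" "length (u @ v) = Suc j" by (auto simp: word_mult)
				then have "s * t\<in>?W (Suc j)" by blast
				then show ?thesis by (intro cspan_base) auto
			qed
		qed auto
		then show ?thesis
			by (intro lin_on_span[of UNIV "\<lambda>p. p * q", OF _ _ _ _ _ that(1)]) auto
	qed
	have words_k: "word u\<in>cspan (?W (length u)\<union>M.SI)" if "set u\<subseteq>carrier M" for u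
		using that
	proof (induction u)
		case Nil
		then show ?case by (intro cspan_base) auto
	next
		case (Cons x u)
		then have "word [x] * word u\<in>cspan (?W (Suc (length u))\<union>M.SI)" by (intro prod one) auto
		then show ?case by (simp add: word_mult)
	qed
	have homog_k: "p\<in>cspan (?W k\<union>M.SI)" if "p\<in>M.homog k" for p
		using that unfolding M.homog_def
		by (rule rev_subsetD, intro cspan_least) (use words_k in auto)
	define S where "S = sg ` (BV \<times> cs M.SI ` ?W k)"
	have "finite {u. set u\<subseteq>BM \<and> length u = k}" by (rule finite_lists_length_eq[OF BM(1)])
	then have "finite S" using BV(1) by (simp add: S_def)
	moreover have "sg (v, cs M.SI p)\<in>cspan (S\<union>T.TK)" if v: "v\<in>carrier V" and p: "p\<in>M.homog k" for v p
	proof -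
		have wbase: "sg (v, cs M.SI w)\<in>cspan (S\<union>T.TK)" if w: "w\<in>?W k" for w
		proof -
			have wc: "cs M.SI w\<in>carrier (sym_module M)" using w WSF by (intro sym_carrier) auto
			have "sg (v, cs M.SI w)\<in>cspan ((\<lambda>v. sg (v, cs M.SI w)) ` BV\<union>T.TK)"
				by (rule span_modulo[OF assms(1) BV(2,3) T.rel1 T.rel3 v]) (use wc in auto)
			moreover have "(\<lambda>v. sg (v, cs M.SI w)) ` BV\<union>T.TK\<subseteq>S\<union>T.TK" using w by (auto simp: S_def)
			ultimately show ?thesis using cspan_mono by blast
		qed
		have "p\<in>M.SF \<and> sg (v, cs M.SI p)\<in>cspan (S\<union>T.TK)"
			using homog_k[OF p]
		proof (induction rule: cspan_induct)
			case zero
			show ?case using sg_zero[OF v] by (auto simp: cspan_0 intro: cspan_base)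
		next
			case (base x)
			show ?case
			proof (cases "x\<in>M.SI")
				case True
				then have "cs M.SI x = cs M.SI 0" using cs_eq_iff[OF M.SI_subspace, of x 0] by simp
				then show ?thesis using sg_zero[OF v] True M.SI_SF by (auto intro: cspan_base)
			next
				case False
				then show ?thesis using base wbase WSF[of k] by auto
			qed
		next
			case (add x y)
			have plus: "add (free_ring (carrier M)) = (+)" by simp
			have "cs M.SI x \<oplus>\<^bsub>sym_module M\<^esub> cs M.SI y = cs M.SI (x + y)"
				by (simp add: M.sym_cs cs_set_add[OF M.SI_subspace plus])
			then have "sg (v, cs M.SI (x + y)) - sg (v, cs M.SI x) - sg (v, cs M.SI y)\<in>cspan (S\<union>T.TK)"
				using T.rel2[OF v sym_carrier sym_carrier, of x y] add by (auto intro: cspan_base)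
			then have "(sg (v, cs M.SI (x + y)) - sg (v, cs M.SI x) - sg (v, cs M.SI y)) + (sg (v, cs M.SI x) + sg (v, cs M.SI y))\<in>cspan (S\<union>T.TK)"
				using add by (intro cspan_add) auto
			then show ?case using add cspan_add by auto
		next
			case (scale c x)
			have "sg (v, cs M.SI (c *c x)) - c *c sg (v, cs M.SI x)\<in>cspan (S\<union>T.TK)"
				using T.rel4[OF v sym_carrier, of x c] scale M.sym_smult[of x c] by (auto intro: cspan_base)
			then have "(sg (v, cs M.SI (c *c x)) - c *c sg (v, cs M.SI x)) + c *c sg (v, cs M.SI x)\<in>cspan (S\<union>T.TK)"
				using scale by (intro cspan_add cspan_scale) auto
			then show ?case using scale cspan_scale by auto
		qed
		then show ?thesis by simp
	qed
	then have "piece k\<subseteq>cspan (S\<union>T.TK)" unfolding piece_def by (intro cspan_least) auto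
	ultimately show ?thesis by blast
qed

end

section \<open>Multiplicities and the branching problem\<close>

lemma vdim_attained:
	assumes "vdim M\<noteq>\<infinity>"
	obtains S where "finite S" "S\<subseteq>carrier M" "vspan M S = carrier M" "vdim M = enat (card S)"
proof -
	let ?A = "{enat (card S) | S. finite S \<and> S\<subseteq>carrier M \<and> vspan M S = carrier M}"
	have "?A\<noteq>{}" using assms unfolding vdim_def by (metis Inf_empty top_enat_def)
	then have "Inf ?A\<in>?A" unfolding Inf_enat_def by (auto intro: LeastI)
	then show thesis using that unfolding vdim_def by auto
qed

lemma lie_submodule_iff:
	assumes "lin_model M W \<phi>"
	shows "lie_submodule L U M \<longleftrightarrow> U\<subseteq>carrier M \<and> csub (\<phi> ` U) \<and> (\<forall>x\<in>L. \<forall>u\<in>U. act M x u\<in>U)"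
	unfolding lie_submodule_def using lmodel.submodule_iff[of M W \<phi> U] assms by (auto simp: lmodel_def)

context reductive_borel
begin

definition irr_hw :: "'g set => ('g => complex) => ('g => 'w::complex_vector => 'w) => 'w set => bool" where
	"irr_hw l \<mu> a W \<longleftrightarrow> lie_rep l W a \<and> fin_dim W \<and> (\<forall>U. stable l a U \<longrightarrow> U\<subseteq>W \<longrightarrow> U = {0} \<or> U = W) \<and>
		 (\<exists>v\<in>W. is_hw l \<mu> a v)"

lemma irr_hw_model:
	assumes ihw: "irreducible_highest_weight H bo l \<mu> M" and m: "lin_model M W \<phi>" and l: "subalgebra l" "H\<subseteq>l"
	shows "irr_hw l \<mu> (model_act M \<phi>) W"
proof -
	interpret lmodel M W \<phi> by (rule lmodel.intro) fact
	note a = model_act_phi[OF m]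
	have mod: "is_lie_module l M" and fin: "vdim M\<noteq>\<infinity>" and irr: "irreducible_module l M"
		using ihw by (auto simp: irreducible_highest_weight_def)
	have ac: "act M x v\<in>carrier M" if "x\<in>l" "v\<in>carrier M" for x v using mod that by (simp add: is_lie_module_def)
	obtain v where v: "v\<in>carrier M" "v\<noteq>\<zero>\<^bsub>M\<^esub>" "\<And>x. x\<in>H ==> act M x v = \<mu> x \<odot>\<^bsub>M\<^esub> v"
		"\<And>\<beta> x. \<beta>\<in>roots_in H (bo\<inter>l) ==> x\<in>root_space H \<beta>\<inter>l ==> act M x v = \<zero>\<^bsub>M\<^esub>"
		using ihw unfolding irreducible_highest_weight_def by blast
	have "\<phi> v\<noteq>0" using phi_inj[OF v(1) zero_c] v(2) by auto
	then have "is_hw l \<mu> (model_act M \<phi>) (\<phi> v)"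
		unfolding is_hw_def using v by (auto simp: a)
	moreover have "U = {0} \<or> U = W" if U: "stable l (model_act M \<phi>) U" "U\<subseteq>W" for U
	proof -
		let ?U = "{x\<in>carrier M. \<phi> x\<in>U}"
		have im: "\<phi> ` ?U = U"
		proof
			show "U\<subseteq>\<phi> ` ?U"
			proof
				fix u assume u: "u\<in>U"
				then obtain x where "x\<in>carrier M" "\<phi> x = u" using phi_surj U(2) by blast
				then show "u\<in>\<phi> ` ?U" using u by auto
			qed
		qed auto
		have "act M x u\<in>?U" if xu: "x\<in>l" "u\<in>?U" for x u
		proof -
			have "model_act M \<phi> x (\<phi> u)\<in>U" using U(1) xu by (auto simp: stable_def)
			then show ?thesis using xu ac a[of u x] by simp
		qed
		then have "lie_submodule l ?U M"
			unfolding lie_submodule_iff[OF m] im using U(1) by (auto simp: stable_def)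
		then have "?U = {\<zero>\<^bsub>M\<^esub>} \<or> ?U = carrier M" using irr by (auto simp: irreducible_module_def)
		then show ?thesis
		proof
			assume "?U = {\<zero>\<^bsub>M\<^esub>}"
			then have "U = \<phi> ` {\<zero>\<^bsub>M\<^esub>}" using im by simp
			then show ?thesis by simp
		next
			assume "?U = carrier M"
			then have "U = \<phi> ` carrier M" using im by simp
			then show ?thesis using bij by (simp add: bij_betw_def)
		qed
	qed
	ultimately show ?thesis
		unfolding irr_hw_def using module_lie_rep[OF mod m l(1)] vdim_finite_iff fin phi_W[OF v(1)] by blast
qed

lemma irr_hw_tl: assumes "irr_hw l \<mu> a W" shows "irreducible_highest_weight H bo l \<mu> (tl_module W a)"
proof -
	have rep: "lie_rep l W a" and fin: "fin_dim W"
		and irr: "\<And>U. stable l a U ==> U\<subseteq>W ==> U = {0} \<or> U = W"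
		using assms by (auto simp: irr_hw_def)
	obtain v where v: "v\<in>W" "is_hw l \<mu> a v" using assms by (auto simp: irr_hw_def)
	interpret lie_rep l W a by fact
	note m = lin_model_tl[OF W, of a]
	have "irreducible_module l (tl_module W a)"
		unfolding irreducible_module_def lie_submodule_iff[OF m]
		using irr v by (auto simp: stable_def is_hw_def)
	moreover have "vdim (tl_module W a)\<noteq>\<infinity>"
		using lmodel.vdim_finite_iff[of "tl_module W a" W "\<lambda>x. x"] m fin by (simp add: lmodel_def)
	ultimately show ?thesis
		unfolding irreducible_highest_weight_def using is_lie_module_tl[OF rep] v by (auto simp: is_hw_def)
qed

text \<open>The choice in \<open>irr_module\<close> ranges over one fixed type. Coordinates
  transport a module on any type to that type, which shows that the choice is meaningful.\<close>

lemma irr_module_ihw: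
	assumes "irreducible_highest_weight H bo l \<mu> M" "subalgebra l" "H\<subseteq>l"
	shows "irreducible_highest_weight H bo l \<mu> (irr_module H bo l \<mu>)"
proof -
	have "Module.module complex_ring M" "vdim M\<noteq>\<infinity>"
		using assms by (auto simp: irreducible_highest_weight_def is_lie_module_def)
	then obtain W :: "(nat => complex) set" and \<phi> where "lin_model M W \<phi>" "fin_dim W"
		by (rule finite_lin_model_exists)
	then have "\<exists>V :: ('g, nat => complex) lie_module. irreducible_highest_weight H bo l \<mu> V"
		using irr_hw_tl[OF irr_hw_model[OF assms(1) _ assms(2,3)]] by blast
	then show ?thesis unfolding irr_module_def by (rule someI_ex)
qed

text \<open>Uniqueness of highest weight modules identifies the chosen model with a simple submodule
  found anywhere else; this is how such a submodule contributes to a multiplicity.\<close>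

lemma irr_module_embedding:
	assumes E: "irr_hw l \<mu> a E" and \<mu>: "\<mu>\<in>dual_space H" and l: "subalgebra l" "H\<subseteq>l"
	defines "I \<equiv> irr_module H bo l \<mu>"
	shows "irreducible_highest_weight H bo l \<mu> I"
		"\<exists>\<phi>. bij_betw \<phi> (carrier I) E \<and> (\<forall>x\<in>carrier I. \<forall>y\<in>carrier I. \<phi> (x \<oplus>\<^bsub>I\<^esub> y) = \<phi> x + \<phi> y) \<and>
			(\<forall>c. \<forall>x\<in>carrier I. \<phi> (c \<odot>\<^bsub>I\<^esub> x) = c *c \<phi> x) \<and> (\<forall>x\<in>l. \<forall>v\<in>carrier I. \<phi> (act I x v) = a x (\<phi> v))"
proof -
	show ihw: "irreducible_highest_weight H bo l \<mu> I"
		unfolding I_def by (rule irr_module_ihw[OF irr_hw_tl[OF E] l])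
	then have mod: "is_lie_module l I" and "Module.module complex_ring I" "vdim I\<noteq>\<infinity>"
		by (auto simp: irreducible_highest_weight_def is_lie_module_def)
	then obtain W :: "(nat => complex) set" and \<psi> where m: "lin_model I W \<psi>" "fin_dim W"
		using finite_lin_model_exists[of I] by metis
	interpret lmodel I W \<psi> by (rule lmodel.intro) fact
	have W': "irr_hw l \<mu> (model_act I \<psi>) W" by (rule irr_hw_model[OF ihw m(1) l])
	obtain v w where vw: "v\<in>W" "is_hw l \<mu> (model_act I \<psi>) v" "w\<in>E" "is_hw l \<mu> a w"
		using E W' unfolding irr_hw_def by blast
	have "\<exists>\<phi>. bij_betw \<phi> W E \<and> lin_on W \<phi> \<and> (\<forall>x\<in>l. \<forall>w\<in>W. \<phi> (model_act I \<psi> x w) = a x (\<phi> w))"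
		by (rule highest_weight_unique[OF l _ _ _ _ _ _ vw \<mu>]) (use E W' in \<open>auto simp: irr_hw_def\<close>)
	then obtain \<phi> where phi: "bij_betw \<phi> W E" "lin_on W \<phi>" "\<forall>x\<in>l. \<forall>w\<in>W. \<phi> (model_act I \<psi> x w) = a x (\<phi> w)" by blast
	have ac: "act I x v\<in>carrier I" if "x\<in>l" "v\<in>carrier I" for x v using mod that by (simp add: is_lie_module_def)
	have "bij_betw (\<phi> \<circ> \<psi>) (carrier I) E" by (rule bij_betw_trans[OF bij phi(1)])
	moreover have "\<phi> (\<psi> (act I x v)) = a x (\<phi> (\<psi> v))" if "x\<in>l" "v\<in>carrier I" for x v
		using bspec[OF bspec[OF phi(3) that(1)] phi_W[OF that(2)]] model_act_phi[OF m(1) that(2), of x] by simp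
	ultimately show "\<exists>\<phi>. bij_betw \<phi> (carrier I) E \<and> (\<forall>x\<in>carrier I. \<forall>y\<in>carrier I. \<phi> (x \<oplus>\<^bsub>I\<^esub> y) = \<phi> x + \<phi> y) \<and>
			(\<forall>c. \<forall>x\<in>carrier I. \<phi> (c \<odot>\<^bsub>I\<^esub> x) = c *c \<phi> x) \<and> (\<forall>x\<in>l. \<forall>v\<in>carrier I. \<phi> (act I x v) = a x (\<phi> v))"
		by (intro exI[of _ "\<phi> \<circ> \<psi>"]) (auto simp: lin_on_add[OF phi(2)] lin_on_scale[OF phi(2)])
qed

end

text \<open>Homomorphisms in \<open>hom_module\<close> are undefined outside the carrier. Extending
  by 0 makes them vectors of a function space, which is their linear model.\<close>

definition hom_map :: "('x, 'v) lie_module => ('w => 'z::complex_vector) => ('v => 'w) => 'v => 'z" where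
	"hom_map I \<phi> f = (\<lambda>v. if v\<in>carrier I then \<phi> (f v) else 0)"

lemma hom_lin_model:
	assumes I: "is_lie_module L I" and T: "is_lie_module L T" and L: "subalgebra L" and m: "lin_model T W \<phi>"
	shows "lin_model (hom_module L I T) (hom_map I \<phi> ` carrier (hom_module L I T)) (hom_map I \<phi>)"
proof (rule lin_modelI)
	interpret I: lie_mod L I using I L by (rule lie_mod.intro)
	interpret T: lie_mod L T using T L by (rule lie_mod.intro)
	interpret m: lmodel T W \<phi> by (rule lmodel.intro) fact
	have mem: "f v\<in>carrier T" if "f\<in>carrier (hom_module L I T)" "v\<in>carrier I" for f v
		using that by (auto simp: hom_module_def)
	show "inj_on (hom_map I \<phi>) (carrier (hom_module L I T))"
	proof (rule inj_onI)
		fix f g assume fg: "f\<in>carrier (hom_module L I T)" "g\<in>carrier (hom_module L I T)" "hom_map I \<phi> f = hom_map I \<phi> g"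
		have "f v = g v" if v: "v\<in>carrier I" for v
			using m.phi_inj[OF mem[OF fg(1) v] mem[OF fg(2) v]] fun_cong[OF fg(3), of v] v by (simp add: hom_map_def)
		then show "f = g" using fg(1,2) by (intro PiE_ext[of f "carrier I" "\<lambda>_. carrier T" g]) (auto simp: hom_module_def)
	qed
	fix f g assume f: "f\<in>carrier (hom_module L I T)" and g: "g\<in>carrier (hom_module L I T)"
	have ac4: "(a \<oplus>\<^bsub>T\<^esub> b) \<oplus>\<^bsub>T\<^esub> (c \<oplus>\<^bsub>T\<^esub> d) = (a \<oplus>\<^bsub>T\<^esub> c) \<oplus>\<^bsub>T\<^esub> (b \<oplus>\<^bsub>T\<^esub> d)"
		if "a\<in>carrier T" "b\<in>carrier T" "c\<in>carrier T" "d\<in>carrier T" for a b c d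
		by (rule m.phi_inj) (use that in auto)
	have dist: "k \<odot>\<^bsub>T\<^esub> (a \<oplus>\<^bsub>T\<^esub> b) = k \<odot>\<^bsub>T\<^esub> a \<oplus>\<^bsub>T\<^esub> k \<odot>\<^bsub>T\<^esub> b" "j \<odot>\<^bsub>T\<^esub> (k \<odot>\<^bsub>T\<^esub> a) = k \<odot>\<^bsub>T\<^esub> (j \<odot>\<^bsub>T\<^esub> a)"
		if "a\<in>carrier T" "b\<in>carrier T" for a b k j
		by (rule m.phi_inj; use that in \<open>simp add: scaleC_add_right scaleC_scaleC mult.commute\<close>)+
	note dist2 = dist(2)[OF _ T.zero_c]
	show "f \<oplus>\<^bsub>hom_module L I T\<^esub> g\<in>carrier (hom_module L I T) \<and>
		hom_map I \<phi> (f \<oplus>\<^bsub>hom_module L I T\<^esub> g) = hom_map I \<phi> f + hom_map I \<phi> g"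
	proof
		show "f \<oplus>\<^bsub>hom_module L I T\<^esub> g\<in>carrier (hom_module L I T)"
			using f g mem[OF f] mem[OF g] by (simp add: hom_module_def ac4 dist)
		show "hom_map I \<phi> (f \<oplus>\<^bsub>hom_module L I T\<^esub> g) = hom_map I \<phi> f + hom_map I \<phi> g"
			using mem[OF f] mem[OF g] by (auto simp: hom_map_def fun_eq_iff hom_module_def)
	qed
	show "c \<odot>\<^bsub>hom_module L I T\<^esub> f\<in>carrier (hom_module L I T) \<and>
		hom_map I \<phi> (c \<odot>\<^bsub>hom_module L I T\<^esub> f) = c *c hom_map I \<phi> f" for c
	proof
		show "c \<odot>\<^bsub>hom_module L I T\<^esub> f\<in>carrier (hom_module L I T)"
			using f mem[OF f] by (simp add: hom_module_def dist dist2)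
		show "hom_map I \<phi> (c \<odot>\<^bsub>hom_module L I T\<^esub> f) = c *c hom_map I \<phi> f"
			using mem[OF f] by (auto simp: hom_map_def fun_eq_iff hom_module_def)
	qed
next
	interpret I: lie_mod L I using I L by (rule lie_mod.intro)
	interpret T: lie_mod L T using T L by (rule lie_mod.intro)
	interpret m: lmodel T W \<phi> by (rule lmodel.intro) fact
	have z: "\<zero>\<^bsub>T\<^esub> \<oplus>\<^bsub>T\<^esub> \<zero>\<^bsub>T\<^esub> = \<zero>\<^bsub>T\<^esub>" "c \<odot>\<^bsub>T\<^esub> \<zero>\<^bsub>T\<^esub> = \<zero>\<^bsub>T\<^esub>" for c by (rule m.phi_inj; simp)+
	have z2: "act T x \<zero>\<^bsub>T\<^esub> = \<zero>\<^bsub>T\<^esub>" if "x\<in>L" for x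
		using T.act_smult[OF that T.zero_c, of 0] that by simp
	show "\<zero>\<^bsub>hom_module L I T\<^esub>\<in>carrier (hom_module L I T)" by (simp add: hom_module_def z z2)
	show "hom_map I \<phi> \<zero>\<^bsub>hom_module L I T\<^esub> = 0" by (auto simp: hom_map_def fun_eq_iff hom_module_def)
qed

lemma (in gr_tensor) upto_finite:
	assumes "finite A" "A\<subseteq>T.TF" obtains n where "A\<subseteq>upto n"
proof -
	have "\<exists>n. A\<subseteq>upto n"
		using assms
	proof (induction A)
		case (insert a A)
		then obtain n m where "A\<subseteq>upto n" "a\<in>upto m" using upto_exhaust by blast
		then have "insert a A\<subseteq>upto (max n m)" using upto_mono[of n "max n m"] upto_mono[of m "max n m"] by auto
		then show ?case ..
	qed simp
	then show thesis using that by blast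
qed

section \<open>Infinitely many graded pieces contradict a finite branching problem\<close>

context reductive_borel
begin

text \<open>The case distinction of \<open>branching_mult\<close> with an arbitrary target module,
  so that the argument about graded pieces can be made for general \<open>V\<close> and
  \<open>M\<close>.\<close>

definition mult_of :: "'g set => ('g, 't) lie_module => ('g => complex) => enat" where
	"mult_of l T \<mu> = (if \<exists>V :: ('g, nat => complex) lie_module. irreducible_highest_weight H bo l \<mu> V
		 then vdim (hom_module l (irr_module H bo l \<mu>) T) else 0)"

text \<open>Each graded piece is nonzero and finite-dimensional, so it contains a simple submodule,
  which is the image of a chosen model. If finitely many weights occur, one of them serves
  infinitely many degrees; but a finite-dimensional space of homomorphisms from a finite-dimensional
  module has its values in bounded degree.\<close>

lemma infinite_branching:
	fixes V :: "('g, 'v) lie_module" and M :: "('g, 'w) lie_module"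
	assumes l: "subalgebra l" "H\<subseteq>l" and V: "is_lie_module l V" "vdim V\<noteq>\<infinity>" "carrier V\<noteq>{\<zero>\<^bsub>V\<^esub>}"
		and M: "is_lie_module l M" "vdim M\<noteq>\<infinity>" "carrier M\<noteq>{\<zero>\<^bsub>M\<^esub>}"
		and fin: "finite {\<mu>\<in>dual_space H. mult_of l (tensor_module V (sym_module M)) \<mu>\<noteq>0}"
			"\<And>\<mu>. \<mu>\<in>dual_space H ==> mult_of l (tensor_module V (sym_module M)) \<mu>\<noteq>\<infinity>"
	shows False
proof -
	interpret gr_tensor l V M
		unfolding gr_tensor_def lie_mod_def using V M l by simp
	let ?T = "tensor_module V (sym_module M)"
	obtain \<pi> where q: "quotient_space T.TF T.TK \<pi>"
		using quotient_space_exists[OF T.TF_subspace T.TK_subspace T.TK_TF] by blast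
	interpret Q: quotient_space T.TF T.TK \<pi> by (rule q)
	note TM = T.tensor_model[OF q]
	interpret m: lmodel ?T "\<pi> ` T.TF" "quot_map \<pi>" by (rule lmodel.intro[OF TM(1)])
	let ?a = "\<lambda>x f. \<pi> (T.ta x f)"
	have Tact: "act ?T x C\<in>carrier ?T \<and> quot_map \<pi> (act ?T x C) = ?a x (quot_map \<pi> C)"
		if xC: "x\<in>l" "C\<in>carrier ?T" for x C
	proof -
		obtain f where f: "f\<in>T.TF" "C = cs T.TK f" using xC(2) by (auto simp: T.tensor_cs)
		then show ?thesis using xC T.ta_TF TM(3)[OF xC(1) f(1)] by (auto simp: T.tensor_act T.tensor_cs(1))
	qed
	have Tmod: "is_lie_module l ?T" by (rule lie_rep_is_lie_module[OF TM(2,1) Tact])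
	interpret R: lie_rep l "\<pi> ` T.TF" ?a by (rule TM(2))
	obtain BV where BV: "finite BV" "BV\<subseteq>carrier V" "vspan V BV = carrier V" using vdim_attained[OF V(2)] by metis
	obtain BM where BM: "finite BM" "BM\<subseteq>carrier M" "vspan M BM = carrier M" using vdim_attained[OF M(2)] by metis
	obtain W1 :: "('v \<Rightarrow>\<^sub>0 complex) set" and \<phi>1 where m1: "lin_model V W1 \<phi>1" using lin_model_exists[OF V.mod] by blast
	obtain W2 :: "('w \<Rightarrow>\<^sub>0 complex) set" and \<phi>2 where m2: "lin_model M W2 \<phi>2" using lin_model_exists[OF M.mod] by blast
	obtain v0 x0 where nz: "v0\<in>carrier V" "v0\<noteq>\<zero>\<^bsub>V\<^esub>" "x0\<in>carrier M" "x0\<noteq>\<zero>\<^bsub>M\<^esub>"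
		using V(3) M(3) V.zero_c M.zero_c by blast
	have I_mod: "is_lie_module l (irr_module H bo l \<mu>)" if "irreducible_highest_weight H bo l \<mu> (irr_module H bo l \<mu>)" for \<mu>
		using that by (simp add: irreducible_highest_weight_def)
	\<comment> \<open>The simple submodule is a minimal nonzero stable subspace of the piece. Its
	  highest weight vector comes from Lie's theorem and determines the weight.\<close>
	have step: "\<exists>\<mu>\<in>dual_space H. irreducible_highest_weight H bo l \<mu> (irr_module H bo l \<mu>) \<and>
		 (\<exists>f\<in>carrier (hom_module l (irr_module H bo l \<mu>) ?T). \<exists>v\<in>carrier (irr_module H bo l \<mu>).
			 quot_map \<pi> (f v)\<noteq>0 \<and> quot_map \<pi> (f v)\<in>\<pi> ` piece k)" for k
	proof -
		let ?E = "\<pi> ` piece k"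
		have Es: "csub ?E" by (rule csub_image[OF piece_subspace lin_on_mono[OF Q.pi_lin]]) simp
		have Est: "stable l ?a ?E"
			unfolding stable_def
		proof (intro conjI Es ballI)
			fix x u assume x: "x\<in>l" and "u\<in>?E"
			then obtain p where p: "p\<in>piece k" "u = \<pi> p" by auto
			then show "?a x u\<in>?E" using TM(3)[OF x, of p] piece_TF piece_stable[OF x p(1)] by auto
		qed
		obtain p where p: "p\<in>piece k" "p \<notin> T.TK" using piece_nonzero[OF m1 m2 nz] by blast
		have "p\<in>T.TF" using p piece_TF by auto
		then have "\<pi> p\<noteq>0" using Q.pi_eq_iff[of p 0] csub_0[OF T.TF_subspace] p(2) by auto
		then have E0: "?E\<noteq>{0}" using p(1) by blast
		obtain S where S: "finite S" "piece k\<subseteq>cspan (S\<union>T.TK)" using piece_finite[OF m1 m2 BV BM] by blast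
		have "?E\<subseteq>cspan (\<pi> ` S)"
		proof clarify
			fix p assume "p\<in>piece k"
			then have "p\<in>cspan (S\<union>T.TK)" using S by auto
			then show "\<pi> p\<in>cspan (\<pi> ` S)"
				by (rule lin_on_span[OF Q.pi_lin, rotated -1])
					(auto simp: Q.pi_K cspan_0 intro: cspan_base)
		qed
		then have Ef: "fin_dim ?E" unfolding fin_dim_def using S(1) by blast
		obtain F where F: "F\<subseteq>?E" "stable l ?a F" "F\<noteq>{0}"
			and min: "\<And>U'. stable l ?a U' ==> U'\<subseteq>F ==> U' = {0} \<or> U' = F"
			using minimal_stable_subspace[OF Ef Est E0] by blast
		have FT: "F\<subseteq>\<pi> ` T.TF" using F(1) piece_TF[of k] by blast
		have Fs: "csub F" using F(2) by (simp add: stable_def)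
		have repF: "lie_rep l F ?a"
			using F(2) FT Fs R.comm lin_on_mono[OF R.lin FT] R.lin_left l(1)
			by unfold_locales (auto simp: stable_def)
		obtain w \<mu> where w: "w\<in>F" "\<mu>\<in>dual_space H" "is_hw l \<mu> ?a w"
			using hw_vector_exists[OF l repF fin_dim_mono[OF Ef F(1)] F(3)] by blast
		have irr: "irr_hw l \<mu> ?a F" unfolding irr_hw_def using repF fin_dim_mono[OF Ef F(1)] min w by blast
		let ?I = "irr_module H bo l \<mu>"
		obtain \<phi> where phi: "bij_betw \<phi> (carrier ?I) F" "\<forall>x\<in>carrier ?I. \<forall>y\<in>carrier ?I. \<phi> (x \<oplus>\<^bsub>?I\<^esub> y) = \<phi> x + \<phi> y"
			"\<forall>c. \<forall>x\<in>carrier ?I. \<phi> (c \<odot>\<^bsub>?I\<^esub> x) = c *c \<phi> x" "\<forall>x\<in>l. \<forall>v\<in>carrier ?I. \<phi> (act ?I x v) = ?a x (\<phi> v)"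
			using irr_module_embedding(2)[OF irr w(2) l] by blast
		have ihw: "irreducible_highest_weight H bo l \<mu> ?I" by (rule irr_module_embedding(1)[OF irr w(2) l])
		interpret I: lie_mod l ?I by (rule lie_mod.intro[OF I_mod[OF ihw] l(1)])
		have phiF: "\<phi> v\<in>F" if "v\<in>carrier ?I" for v using phi(1) that by (auto simp: bij_betw_def)
		define f where "f = (\<lambda>v\<in>carrier ?I. m.inv_model (\<phi> v))"
		have fv: "f v\<in>carrier ?T" "quot_map \<pi> (f v) = \<phi> v" if "v\<in>carrier ?I" for v
			using m.inv_model[of "\<phi> v"] phiF[OF that] FT that by (auto simp: f_def)
		have "f\<in>carrier (hom_module l ?I ?T)"
			unfolding hom_module_def
		proof (simp, intro conjI ballI allI)
			show "f\<in>carrier ?I \<rightarrow>\<^sub>E carrier ?T" using fv by (auto simp: f_def)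
			fix v assume v: "v\<in>carrier ?I"
			show "f (v \<oplus>\<^bsub>?I\<^esub> u) = f v \<oplus>\<^bsub>?T\<^esub> f u" if "u\<in>carrier ?I" for u
				by (rule m.phi_inj) (use v that fv phi in auto)
			show "f (c \<odot>\<^bsub>?I\<^esub> v) = c \<odot>\<^bsub>?T\<^esub> f v" for c
				by (rule m.phi_inj) (use v fv phi in auto)
			show "f (act ?I x v) = act ?T x (f v)" if "x\<in>l" for x
				by (rule m.phi_inj) (use v that fv phi Tact in auto)
		qed
		moreover obtain v where "v\<in>carrier ?I" "\<phi> v = w" "v\<in>carrier ?I" using phi(1) w(1) by (auto simp: bij_betw_def)
		ultimately have "f\<in>carrier (hom_module l ?I ?T)" "v\<in>carrier ?I" "quot_map \<pi> (f v)\<noteq>0" "quot_map \<pi> (f v)\<in>?E"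
			using w(1,3) fv F(1) by (auto simp: is_hw_def)
		then show ?thesis using w(2) ihw by blast
	qed
	then obtain \<mu> where mu: "\<And>k. \<mu> k\<in>dual_space H"
		"\<And>k. irreducible_highest_weight H bo l (\<mu> k) (irr_module H bo l (\<mu> k))"
		"\<And>k. \<exists>f\<in>carrier (hom_module l (irr_module H bo l (\<mu> k)) ?T). \<exists>v\<in>carrier (irr_module H bo l (\<mu> k)).
			 quot_map \<pi> (f v)\<noteq>0 \<and> quot_map \<pi> (f v)\<in>\<pi> ` piece k"
		by metis
	have mult: "mult_of l ?T (\<mu> k) = vdim (hom_module l (irr_module H bo l (\<mu> k)) ?T)" for k
		using mu(2)[of k] unfolding mult_of_def by auto
	\<comment> \<open>Finitely many homomorphisms span, and finitely many vectors generate the source,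
	  so all values arise from finitely many classes, which lie in some \<open>upto n\<close>.
	  Multiplicity 0 means that the spanning set is empty and all homomorphisms vanish.\<close>
	have bound: "\<exists>n. \<forall>f\<in>carrier (hom_module l (irr_module H bo l (\<mu> k)) ?T). \<forall>v\<in>carrier (irr_module H bo l (\<mu> k)).
			quot_map \<pi> (f v)\<in>\<pi> ` upto n \<and> (mult_of l ?T (\<mu> k) = 0 \<longrightarrow> quot_map \<pi> (f v) = 0)" for k
	proof -
		let ?I = "irr_module H bo l (\<mu> k)" let ?H = "hom_module l ?I ?T"
		note mI = I_mod[OF mu(2)[of k]]
		interpret I: lie_mod l ?I by (rule lie_mod.intro[OF mI l(1)])
		interpret h: lmodel ?H "hom_map ?I (quot_map \<pi>) ` carrier ?H" "hom_map ?I (quot_map \<pi>)"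
			by (rule lmodel.intro[OF hom_lin_model[OF mI Tmod l(1) TM(1)]])
		obtain S where S: "finite S" "S\<subseteq>carrier ?H" "vspan ?H S = carrier ?H" "vdim ?H = enat (card S)"
			using vdim_attained[of ?H] fin(2)[OF mu(1)[of k]] mult by metis
		obtain BI where BI: "finite BI" "BI\<subseteq>carrier ?I" "vspan ?I BI = carrier ?I"
			using vdim_attained[of ?I] mu(2)[of k] unfolding irreducible_highest_weight_def by metis
		obtain WI :: "((nat => complex) \<Rightarrow>\<^sub>0 complex) set" and \<phi>I where mI': "lin_model ?I WI \<phi>I" using lin_model_exists[OF I.mod] by blast
		have Hc: "s v\<in>carrier ?T" if "s\<in>carrier ?H" "v\<in>carrier ?I" for s v using that by (auto simp: hom_module_def)
		define A where "A = (\<lambda>(s, b). SOME p. p\<in>T.TF \<and> \<pi> p = quot_map \<pi> (s b)) ` (S \<times> BI)"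
		have Ap: "\<exists>p\<in>A. p\<in>T.TF \<and> \<pi> p = quot_map \<pi> (s b)" if "s\<in>S" "b\<in>BI" for s b
		proof -
			have "quot_map \<pi> (s b)\<in>\<pi> ` T.TF" using m.phi_W[OF Hc[of s b]] that S(2) BI(2) by auto
			then have "\<exists>p. p\<in>T.TF \<and> \<pi> p = quot_map \<pi> (s b)" by (auto simp: image_iff)
			then have "(SOME p. p\<in>T.TF \<and> \<pi> p = quot_map \<pi> (s b))\<in>T.TF \<and> \<pi> (SOME p. p\<in>T.TF \<and> \<pi> p = quot_map \<pi> (s b)) = quot_map \<pi> (s b)"
				by (rule someI_ex)
			moreover have "(SOME p. p\<in>T.TF \<and> \<pi> p = quot_map \<pi> (s b))\<in>A" unfolding A_def using that by force
			ultimately show ?thesis by blast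
		qed
		have "finite (A\<inter>T.TF)" unfolding A_def using S(1) BI(1) by auto
		then obtain n where n: "A\<inter>T.TF\<subseteq>upto n" using upto_finite[of "A\<inter>T.TF"] by blast
		have Us: "csub (\<pi> ` upto n)" by (rule csub_image[OF upto_subspace lin_on_mono[OF Q.pi_lin]]) simp
		have s_in: "quot_map \<pi> (s v)\<in>\<pi> ` upto n" if s: "s\<in>S" and v: "v\<in>carrier ?I" for s v
		proof -
			have "quot_map \<pi> (s v)\<in>cspan ((\<lambda>v. quot_map \<pi> (s v)) ` BI\<union>{0})"
			proof (rule span_modulo[OF mI' BI(2,3) _ _ v])
				have sH: "s\<in>carrier ?H" using s S by auto
				show "quot_map \<pi> (s (x \<oplus>\<^bsub>?I\<^esub> y)) - quot_map \<pi> (s x) - quot_map \<pi> (s y)\<in>{0}" if "x\<in>carrier ?I" "y\<in>carrier ?I" for x y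
					using that sH Hc[OF sH] by (simp add: hom_module_def)
				show "quot_map \<pi> (s (c \<odot>\<^bsub>?I\<^esub> x)) - c *c quot_map \<pi> (s x)\<in>{0}" if "x\<in>carrier ?I" for c x
					using that sH Hc[OF sH] by (simp add: hom_module_def)
			qed
			moreover have "quot_map \<pi> (s b)\<in>\<pi> ` upto n" if "b\<in>BI" for b
				using Ap[OF s that] n by (metis IntI imageI subsetD)
			moreover have "cspan ((\<lambda>v. quot_map \<pi> (s v)) ` BI\<union>{0})\<subseteq>\<pi> ` upto n"
				using calculation(2) csub_0[OF Us] by (intro cspan_least Us) auto
			ultimately show ?thesis by blast
		qed
		have main: "quot_map \<pi> (f v)\<in>U" if f: "f\<in>carrier ?H" and v: "v\<in>carrier ?I"
			and U: "csub U" "\<And>s. s\<in>S ==> quot_map \<pi> (s v)\<in>U" for f v U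
		proof -
			have "hom_map ?I (quot_map \<pi>) f\<in>cspan (hom_map ?I (quot_map \<pi>) ` S)"
				using h.vspan_image[OF S(2)] S(3) f by auto
			then have "hom_map ?I (quot_map \<pi>) f v\<in>U"
				by (rule lin_on_span[of UNIV "\<lambda>F. F v", rotated -1])
					(use U v in \<open>auto simp: lin_on_def hom_map_def\<close>)
			then show ?thesis using v by (simp add: hom_map_def)
		qed
		show ?thesis
		proof (intro exI[of _ n] ballI conjI impI)
			fix f v assume fv: "f\<in>carrier ?H" "v\<in>carrier ?I"
			show "quot_map \<pi> (f v)\<in>\<pi> ` upto n" using main[OF fv Us] s_in fv(2) by blast
			assume "mult_of l ?T (\<mu> k) = 0"
			then have "S = {}" using S(1,4) mult[of k] by (simp add: zero_enat_def)
			then have "quot_map \<pi> (f v)\<in>{0}" using main[OF fv, of "{0}"] by (simp add: csub_def)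
			then show "quot_map \<pi> (f v) = 0" by simp
		qed
	qed
	have m0: "mult_of l ?T (\<mu> k)\<noteq>0" for k using bound[of k] mu(3)[of k] by blast
	\<comment> \<open>All \<open>\<mu> k\<close> belong to the finite set of weights with nonzero
	  multiplicity, so one value is taken infinitely often and in particular for some \<open>k\<close>
	  beyond the degree bound of that weight.\<close>
	have "finite (range \<mu>)" by (rule finite_subset[OF _ fin(1)]) (use m0 mu(1) in auto)
	then obtain k0 where k0: "infinite {k. \<mu> k = \<mu> k0}"
		using pigeonhole_infinite[of UNIV \<mu>] by auto
	obtain n where n: "\<forall>f\<in>carrier (hom_module l (irr_module H bo l (\<mu> k0)) ?T). \<forall>v\<in>carrier (irr_module H bo l (\<mu> k0)).
			quot_map \<pi> (f v)\<in>\<pi> ` upto n" using bound[of k0] by blast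
	obtain k where k: "\<mu> k = \<mu> k0" "n < k" using k0 unfolding infinite_nat_iff_unbounded by blast
	obtain f v where fv: "f\<in>carrier (hom_module l (irr_module H bo l (\<mu> k0)) ?T)" "v\<in>carrier (irr_module H bo l (\<mu> k0))"
		"quot_map \<pi> (f v)\<noteq>0" "quot_map \<pi> (f v)\<in>\<pi> ` piece k" using mu(3)[of k] unfolding k(1) by blast
	obtain p q where pq: "p\<in>piece k" "quot_map \<pi> (f v) = \<pi> p" "q\<in>upto n" "quot_map \<pi> (f v) = \<pi> q"
		using fv(4) n fv(1,2) by blast
	have "upto n\<subseteq>T.TF" unfolding upto_def by (rule cspan_least) (use piece_TF T.TK_TF in auto)
	then have "p - q\<in>T.TK" using Q.pi_eq_iff[of p q] pq piece_TF by auto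
	then have "(p - q) + q\<in>upto n" using TK_upto pq(3) by (intro csub_add upto_subspace) auto
	then have "p\<in>T.TK" using piece_upto[OF pq(1) _ k(2)] by simp
	then show False using fv(3) pq(2) Q.pi_K by simp
qed

end

section \<open>Pullbacks of modules and comparison of dimensions\<close>

lemma lin_model_pullback: "lin_model M W \<phi> ==> lin_model (pullback i M) W \<phi>"
	by (simp add: lin_model_def pullback_def)

lemma pullback_simps [simp]: "carrier (pullback i M) = carrier M" "act (pullback i M) x = act M (i x)" "zero (pullback i M) = zero M"
	"add (pullback i M) = add M" "module.smult (pullback i M) = module.smult M"
	by (simp_all add: pullback_def)

lemma lie_rep_pullback:
	assumes i: "lie_hom i" "i ` K\<subseteq>L" and K: "subalgebra K" and rep: "lie_rep L W a"
	shows "lie_rep K W (\<lambda>x. a (i x))"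
proof -
	interpret lie_rep L W a by fact
	have "x\<in>K ==> i x\<in>L" for x using i by auto
	then show ?thesis
		using i(1) K W closed lin comm lin_left by unfold_locales (auto simp: lie_hom_def lin_on_def)
qed

lemma pullback_is_lie_module:
	fixes M :: "('x::lie_algebra, 'v) lie_module"
	assumes i: "lie_hom i" "i ` K\<subseteq>L" and K: "subalgebra K" and L: "subalgebra L" and M: "is_lie_module L M"
	shows "is_lie_module K (pullback i M)"
proof -
	have "Module.module complex_ring M" using M by (simp add: is_lie_module_def)
	then obtain W :: "('v \<Rightarrow>\<^sub>0 complex) set" and \<phi> where m: "lin_model M W \<phi>" using lin_model_exists by blast
	show ?thesis
	proof (rule lie_rep_is_lie_module[OF lie_rep_pullback[OF i K module_lie_rep[OF M m L]] lin_model_pullback[OF m]])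
		fix x v assume "x\<in>K" "v\<in>carrier (pullback i M)"
		then show "act (pullback i M) x v\<in>carrier (pullback i M) \<and> \<phi> (act (pullback i M) x v) = model_act M \<phi> (i x) (\<phi> v)"
			using i(2) M by (auto simp: model_act_phi[OF m] is_lie_module_def)
	qed
qed

lemma vdim_pullback:
	fixes M :: "('x, 'v) lie_module"
	assumes "Module.module complex_ring M" "vdim M\<noteq>\<infinity>" shows "vdim (pullback i M)\<noteq>\<infinity>"
proof -
	obtain W :: "('v \<Rightarrow>\<^sub>0 complex) set" and \<phi> where m: "lin_model M W \<phi>" using lin_model_exists[OF assms(1)] by blast
	then show ?thesis
		using lmodel.vdim_finite_iff[of M W \<phi>] lmodel.vdim_finite_iff[of "pullback i M" W \<phi>]
			lin_model_pullback[OF m, of i] assms(2) by (simp add: lmodel_def)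
qed

lemma dim_image_le:
	fixes T :: "'a::complex_vector => 'b::complex_vector"
	assumes "csub W" "fin_dim W" "lin_on W T" shows "cdim (T ` W) \<le> cdim W"
proof -
	obtain B where B: "finite B" "cindep B" "cspan B = W" using fin_dim_basis[OF assms(2,1)] .
	have "T ` W\<subseteq>cspan (T ` B)"
	proof clarify
		fix w assume "w\<in>W"
		moreover have "B\<subseteq>W" using B(3) cspan_superset[of B] by simp
		moreover have "T s\<in>cspan (T ` B)" if "s\<in>B" for s using that by (intro cspan_base imageI)
		ultimately show "T w\<in>cspan (T ` B)"
			using lin_on_span[OF assms(3,1), of B "cspan (T ` B)" w] B(3) complex_vector.subspace_span by metis
	qed
	then have "cdim (T ` W) \<le> card (T ` B)" using B(1) by (intro complex_vector.dim_le_card) auto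
	also have "... \<le> card B" using B(1) by (rule card_image_le)
	also have "card B = cdim W" using complex_vector.dim_span_eq_card_independent[OF B(2)] B(3) by simp
	finally show ?thesis .
qed

lemma dim_inj_le:
	fixes T :: "'a::complex_vector => 'b::complex_vector"
	assumes W: "csub W" and T: "lin_on W T" "inj_on T W" and T': "csub (T ` W)" "fin_dim (T ` W)"
	shows "cdim W \<le> cdim (T ` W)"
proof -
	have "lin_on (T ` W) (inv_into W T)"
		unfolding lin_on_def
	proof (intro conjI ballI allI)
		fix x y assume "x\<in>T ` W" "y\<in>T ` W"
		then obtain u v where uv: "u\<in>W" "v\<in>W" "x = T u" "y = T v" by auto
		then have "x + y = T (u + v)" "u + v\<in>W" using lin_on_add[OF T(1)] csub_add[OF W] by auto
		then show "inv_into W T (x + y) = inv_into W T x + inv_into W T y" using uv T(2) by simp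
	next
		fix c x assume "x\<in>T ` W"
		then obtain u where u: "u\<in>W" "x = T u" by auto
		then have "c *c x = T (c *c u)" "c *c u\<in>W" using lin_on_scale[OF T(1)] csub_scale[OF W] by auto
		then show "inv_into W T (c *c x) = c *c inv_into W T x" using u T(2) by simp
	qed
	from dim_image_le[OF T' this] show ?thesis using T(2) by simp
qed

section \<open>A finite branching problem makes the algebra the sum of the subalgebra and
  \<open>p\<close>\<close>

locale branching_pair =
	g: reductive_parabolic h b p l + k: reductive_parabolic hbar bbar pbar lbar
	for h b p l :: "'g::fin_dim_lie_algebra set" and hbar bbar pbar lbar :: "'k::fin_dim_lie_algebra set" +
	fixes i :: "'k => 'g"
	assumes i_hom: "lie_hom i" and i_inj: "inj i" and i_lbar: "i ` lbar = l\<inter>range i" and pbar: "pbar = i -` p"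
begin

lemma i_add: "i (x + y) = i x + i y" and i_scale: "i (c *c x) = c *c i x" and i_bracket: "i (bracket x y) = bracket (i x) (i y)"
	using i_hom by (auto simp: lie_hom_def)
lemma i_lin: "lin_on W i" by (simp add: lin_on_def i_add i_scale)
lemma i_diff: "i (x - y) = i x - i y" using lin_on_diff[OF _ i_lin[of UNIV]] by simp

text \<open>If \<open>N\<close> were proper, its quotient in \<open>g.NM\<close> would be a nonzero
  finite-dimensional module of \<open>lbar\<close>, and the symmetric algebra of it would produce
  infinitely many contributions for the given \<open>lam\<close>.\<close>

lemma finite_branching_whole:
	fixes V :: "('g, 'v) lie_module"
	assumes N: "lie_submodule lbar N (pullback i (adjoint_module g.NM))"
		and fin: "finite_branching i hbar bbar lbar B h b p l N"
		and lam: "lam\<in>dual_space h" "dominant_integral B h b l lam" and V: "irreducible_highest_weight h b l lam V"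
	shows "N = g.NM"
proof (rule ccontr)
	assume neq: "N\<noteq>g.NM"
	let ?a = "\<lambda>x. bracket (i x)"
	let ?R = "tl_module g.NM ?a :: ('k, 'g) lie_module"
	have R: "pullback i (adjoint_module g.NM) = ?R" by (simp add: pullback_def adjoint_module_def tl_module_def)
	note m = lin_model_tl[OF g.NM_subspace, of ?a]
	have Ns: "csub N" and NNM: "N\<subseteq>g.NM" and Nst: "\<And>x u. x\<in>lbar ==> u\<in>N ==> bracket (i x) u\<in>N"
		using N unfolding R lie_submodule_iff[OF m] by auto
	have il: "i x\<in>l" if "x\<in>lbar" for x using i_lbar that by auto
	obtain \<pi> where q: "quotient_space g.NM N \<pi>" using quotient_space_exists[OF g.NM_subspace Ns NNM] by blast
	interpret q: quotient_space g.NM N \<pi> by (rule q)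
	let ?Q = "quotient_module ?R N"
	note Qcs = quot_cs[OF g.NM_subspace Ns NNM, of ?R, simplified]
	have act: "act ?Q x (cs N v) = cs N (bracket (i x) v)" if "x\<in>lbar" "v\<in>g.NM" for x v
		using Qcs(5)[of x v] Nst[OF that(1)] by (simp add: bracket_add_right)
	have mQ: "lin_model ?Q (\<pi> ` g.NM) (quot_map \<pi>)"
		by (rule q.quotient_lin_model[where R = ?R]) (auto simp: Qcs)
	have rep: "lie_rep lbar (\<pi> ` g.NM) (\<lambda>x f. \<pi> (?a x f))"
		and rep': "\<And>x f. x\<in>lbar ==> f\<in>g.NM ==> \<pi> (?a x (\<pi> f)) = \<pi> (?a x f)"
		using q.quotient_rep[OF k.L_subalg, of ?a] g.NM_L_stable[OF il] Nst csub_0[OF Ns]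
		by (auto simp: lin_on_def bracket_add_right bracket_add_left bracket_scaleC_left bracket_scaleC_right i_add i_scale i_bracket bracket_bracket_left)
	have Qmod: "is_lie_module lbar ?Q"
	proof (rule lie_rep_is_lie_module[OF rep mQ])
		fix x v assume x: "x\<in>lbar" and "v\<in>carrier ?Q"
		then obtain f where "f\<in>g.NM" "v = cs N f" by (auto simp: Qcs)
		then show "act ?Q x v\<in>carrier ?Q \<and> quot_map \<pi> (act ?Q x v) = \<pi> (?a x (quot_map \<pi> v))"
			using x act rep' g.NM_L_stable[OF il] by (auto simp: Qcs(1))
	qed
	have Qfin: "vdim ?Q\<noteq>\<infinity>" using lmodel.vdim_finite_iff[of ?Q "\<pi> ` g.NM" "quot_map \<pi>"] mQ by (simp add: lmodel_def)
	obtain x where x: "x\<in>g.NM" "x \<notin> N" using neq NNM by blast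
	then have "cs N x\<noteq>N" using cs_self[OF Ns, of x] by auto
	then have Q0: "carrier ?Q\<noteq>{\<zero>\<^bsub>?Q\<^esub>}" using x(1) by (auto simp: Qcs)
	let ?I = "irr_module h b l lam"
	have I: "irreducible_highest_weight h b l lam ?I" by (rule g.irr_module_ihw[OF V g.L_subalg g.H_L])
	then have Imod: "is_lie_module l ?I" and Ifin: "vdim ?I\<noteq>\<infinity>" and I0: "carrier ?I\<noteq>{\<zero>\<^bsub>?I\<^esub>}"
		by (auto simp: irreducible_highest_weight_def irreducible_module_def)
	have "i ` lbar\<subseteq>l" using il by auto
	then have I': "is_lie_module lbar (pullback i ?I)" by (rule pullback_is_lie_module[OF i_hom _ k.L_subalg g.L_subalg Imod])
	have "vdim (pullback i ?I)\<noteq>\<infinity>" using Imod Ifin by (intro vdim_pullback) (auto simp: is_lie_module_def)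
	moreover have "branching_mult i hbar bbar lbar h b p l N \<mu> lam = k.mult_of lbar (tensor_module (pullback i ?I) (sym_module ?Q)) \<mu>" for \<mu>
		unfolding branching_mult_def k.mult_of_def R[symmetric] unfolding g.NM_def by (rule refl)
	ultimately show False
		using k.infinite_branching[OF k.L_subalg k.H_L I' _ _ Qmod Qfin Q0] I0 fin lam
		unfolding finite_branching_def by auto
qed

text \<open>\<open>q\<close> is the projection to \<open>g.NM\<close> along \<open>p\<close>. Its
  composite with \<open>i\<close> maps \<open>k.NM\<close> into a space of no larger dimension and
  is injective, hence onto, so every element of \<open>g.NM\<close> is in the range of
  \<open>i\<close> up to \<open>p\<close>.\<close>

lemma range_plus_parabolic:
	assumes iso: "lie_isomorphic lbar (pullback i (adjoint_module g.NM)) (adjoint_module k.NM)"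
	shows "\<exists>z. \<exists>y\<in>p. x = i z + y"
proof -
	obtain f where f: "bij_betw f g.NM k.NM" "lin_on g.NM f"
		using iso unfolding lie_isomorphic_def by (auto simp: adjoint_module_def lin_on_def)
	have "\<exists>n. n\<in>g.NM \<and> x - n\<in>p" for x using g.P_plus_NM[of x] by force
	then obtain q where q: "\<And>x. q x\<in>g.NM \<and> x - q x\<in>p" by metis
	have q_eq: "q x = n" if "n\<in>g.NM" "x - n\<in>p" for x n
	proof -
		have "q x - n\<in>g.NM" using csub_diff[OF g.NM_subspace] q that(1) by blast
		moreover have "(x - n) - (x - q x)\<in>p" using csub_diff[OF g.P_subspace that(2)] q by blast
		ultimately have "q x - n\<in>g.NM\<inter>p" by simp
		then show ?thesis using g.NM_P by simp
	qed
	have q_lin: "lin_on UNIV q"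
		unfolding lin_on_def
	proof (intro conjI ballI allI)
		fix x y :: 'g
		have "(x - q x) + (y - q y)\<in>p" using q csub_add[OF g.P_subspace] by blast
		then show "q (x + y) = q x + q y" using q csub_add[OF g.NM_subspace] by (intro q_eq) (auto simp: algebra_simps)
	next
		fix c and x :: 'g
		have "c *c (x - q x)\<in>p" using q csub_scale[OF g.P_subspace] by blast
		then show "q (c *c x) = c *c q x" using q csub_scale[OF g.NM_subspace]
			by (intro q_eq) (auto simp: scaleC_diff_right)
	qed
	let ?T = "\<lambda>y. q (i y)"
	have T: "lin_on k.NM ?T" using q_lin by (simp add: lin_on_def i_add i_scale)
	\<comment> \<open>Equal projections mean that \<open>i (x - y)\<close> lies in \<open>p\<close>, so
	  \<open>x - y\<close> lies in \<open>pbar\<close>, which meets \<open>k.NM\<close> only in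
	  0.\<close>
	have inj: "inj_on ?T k.NM"
	proof (rule inj_onI)
		fix x y assume xy: "x\<in>k.NM" "y\<in>k.NM" "?T x = ?T y"
		have "(i x - q (i x)) - (i y - q (i y))\<in>p" using csub_diff[OF g.P_subspace] q by blast
		then have "x - y\<in>pbar" using xy(3) by (simp add: pbar i_diff)
		then have "x - y\<in>k.NM\<inter>pbar" using csub_diff[OF k.NM_subspace xy(1,2)] by simp
		then show "x = y" using k.NM_P by simp
	qed
	have Ts: "csub (?T ` k.NM)" by (rule csub_image[OF k.NM_subspace T])
	have "cdim g.NM \<le> cdim k.NM"
		using dim_inj_le[OF g.NM_subspace f(2)] f(1) by (auto simp: bij_betw_def)
	also have "... \<le> cdim (?T ` k.NM)" by (rule dim_inj_le[OF k.NM_subspace T inj Ts]) simp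
	finally have "\<not> ?T ` k.NM \<subset> g.NM" using dim_less[OF _ Ts g.NM_subspace] by fastforce
	then have surj: "?T ` k.NM = g.NM" using q by blast
	obtain y n where yn: "y\<in>p" "n\<in>g.NM" "x = y + n" using g.P_plus_NM[of x] by blast
	obtain z where z: "n = q (i z)" using surj yn(2) by blast
	have "y - (i z - n)\<in>p" using csub_diff[OF g.P_subspace yn(1)] q z by blast
	moreover have "x = i z + (y - (i z - n))" using yn(3) by simp
	ultimately show ?thesis by blast
qed

end

section \<open>The diamond lemma for enveloping algebras\<close>

lemma unsorted_descent: "\<not> sorted w ==> \<exists>A i j C. w = A @ i # j # C \<and> j < (i::nat)"
proof (induction w)
	case (Cons x w)
	show ?case
	proof (cases "sorted w")
		case True
		then obtain y t where "w = y # t" "y < x" using Cons.prems by (cases w) auto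
		then show ?thesis by (intro exI[of _ "[]"]) auto
	next
		case False
		then obtain A i j C where "w = A @ i # j # C" "j < i" using Cons.IH by blast
		then show ?thesis by (intro exI[of _ "x # A"]) auto
	qed
qed simp

lemma lenlex_swap: "j < i ==> (A @ j # i # C, A @ i # j # C)\<in>lenlex (less_than)"
	unfolding lenlex_conv lex_conv by (auto intro!: exI[of _ A])

lemma lenlex_shorter: "length u < length w ==> (u, w)\<in>lenlex (less_than)"
	by (simp add: lenlex_conv)

text \<open>The order compares lengths before it compares lexicographically: exchanging a descent
  lowers a word lexicographically, and replacing the pair by one letter of the bracket shortens
  it.\<close>

lemma sorting_induct [consumes 1, case_names sorted swap]:
	assumes "set w\<subseteq>J" and sorted: "\<And>w. set w\<subseteq>J ==> sorted w ==> P w"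
		and swap: "\<And>A i j C. set (A @ i # j # C)\<subseteq>J ==> j < i ==> P (A @ j # i # C) ==>
			(\<And>k. k\<in>J ==> P (A @ k # C)) ==> P (A @ i # j # C)"
	shows "P (w :: nat list)"
proof -
	have "wf (lenlex (less_than))" by (intro wf_lenlex wf_less_than)
	then show ?thesis
		using assms(1)
	proof (induction w rule: wf_induct_rule)
		case (less w)
		show ?case
		proof (cases "sorted w")
			case True
			then show ?thesis using sorted less.prems by blast
		next
			case False
			then obtain A i j C where w: "w = A @ i # j # C" "j < i" using unsorted_descent by blast
			show ?thesis
				unfolding w(1)
			proof (rule swap)
				show "P (A @ j # i # C)" by (rule less.IH) (use w less.prems lenlex_swap in auto)
				show "P (A @ k # C)" if "k\<in>J" for k by (rule less.IH) (use w less.prems lenlex_shorter that in auto)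
			qed (use w less.prems in auto)
		qed
	qed
qed

locale adapted_basis =
	fixes e :: "nat => 'g::lie_algebra" and n :: nat and co :: "'g => nat => complex"
	assumes co_add: "co (x + y) k = co x k + co y k" and co_scale: "co (c *c x) k = c * co x k"
		and expand: "x = (\<Sum>k<n. co x k *c e k)" and co_e: "j < n ==> k < n ==> co (e j) k = (if j = k then 1 else 0)"
begin

lemma co_lin: "lin_on UNIV (\<lambda>x. co x k)" by (simp add: lin_on_def co_add co_scale)

end

locale pbw = adapted_basis e n co
	for e :: "nat => 'g::lie_algebra" and n :: nat and co :: "'g => nat => complex" +
	fixes Nf :: "nat list => 'z::complex_vector"
begin

definition descent :: "nat list => nat list \<times> nat \<times> nat \<times> nat list" where
	"descent w = (SOME (A, i, j, C). w = A @ i # j # C \<and> j < i)"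

lemma descent: "\<not> sorted w ==> descent w = (A, i, j, C) ==> w = A @ i # j # C \<and> j < i"
proof -
	assume w: "\<not> sorted w" "descent w = (A, i, j, C)"
	have "\<exists>d. case d of (A, i, j, C) => w = A @ i # j # C \<and> j < i" using unsorted_descent[OF w(1)] by auto
	from someI_ex[OF this] show ?thesis using w(2) by (simp add: descent_def)
qed

text \<open>The candidate for a linear map on the enveloping algebra with prescribed values
  \<open>Nf\<close> on sorted words. Each unsorted word is rewritten at one arbitrarily selected
  descent; that the selection is immaterial is the content of the diamond lemma.\<close>

function L :: "nat list => 'z" where
	"L w = (if sorted w then Nf w else
		 (case descent w of (A, i, j, C) =>
				L (A @ j # i # C) + (\<Sum>k<n. co (bracket (e i) (e j)) k *c L (A @ k # C))))"
	by auto
termination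
proof (relation "lenlex (less_than)", goal_cases)
	case 1
	show ?case by (intro wf_lenlex wf_less_than)
next
	case 2
	then show ?case by (auto dest!: descent[OF _ sym] intro: lenlex_swap)
next
	case 3
	then show ?case by (auto dest!: descent[OF _ sym] intro!: lenlex_shorter)
qed

declare L.simps [simp del]

definition LL :: "nat list => 'g => nat list => 'z" where
	"LL A x C = (\<Sum>k<n. co x k *c L (A @ k # C))"

lemma LL_add: "LL A (x + y) C = LL A x C + LL A y C"
	by (simp add: LL_def co_add scaleC_add_left sum.distrib)
lemma LL_scale: "LL A (c *c x) C = c *c LL A x C"
	by (simp add: LL_def co_scale scaleC_sum scaleC_scaleC)
lemma LL_neg: "LL A (- x) C = - LL A x C" using LL_scale[of A "-1" x C] by simp
lemma LL_0: "LL A 0 C = 0" using LL_scale[of A 0 0 C] by simp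

text \<open>The commutation rule at an arbitrary place and for an arbitrary pair of letters, not
  only at the descent that \<open>L\<close> selects.\<close>

definition R where "R A i j C \<longleftrightarrow> L (A @ i # j # C) = L (A @ j # i # C) + LL A (bracket (e i) (e j)) C"

lemma R_sym: "R A i j C ==> R A j i C"
	unfolding R_def using bracket_anti[of "e i" "e j"] by (simp add: LL_neg)

lemma R_refl: "R A i i C" by (simp add: R_def bracket_self LL_0)

lemma R_bracket:
	assumes "\<And>k. R A i k C"
	shows "(\<Sum>k<n. co x k *c L (A @ i # k # C)) = (\<Sum>k<n. co x k *c L (A @ k # i # C)) + LL A (bracket (e i) x) C"
proof -
	have "lin_on UNIV (\<lambda>x. LL A (bracket (e i) x) C)"
		by (simp add: lin_on_def bracket_add_right bracket_scaleC_right LL_add LL_scale)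
	then have "LL A (bracket (e i) (\<Sum>k<n. co x k *c e k)) C = (\<Sum>k<n. co x k *c LL A (bracket (e i) (e k)) C)"
		using lin_on_comb[of UNIV "\<lambda>x. LL A (bracket (e i) x) C" "{..<n}" e "co x"] by simp
	then have "LL A (bracket (e i) x) C = (\<Sum>k<n. co x k *c LL A (bracket (e i) (e k)) C)" by (simp flip: expand)
	then show ?thesis using assms by (simp add: R_def scaleC_add_right sum.distrib)
qed

text \<open>Rewriting at the other place as well brings both sides to the same expansion; the terms
  with brackets at both places agree by exchanging the two sums.\<close>

lemma disjoint_descents:
	assumes "R (A @ j # i # B) i' j' C" "R A i j (B @ j' # i' # C)"
		"\<And>k. R (A @ k # B) i' j' C" "\<And>k. R A i j (B @ k # C)"
	shows "L (A @ j # i # B @ i' # j' # C) + LL A (bracket (e i) (e j)) (B @ i' # j' # C) =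
		L (A @ i # j # B @ j' # i' # C) + LL (A @ i # j # B) (bracket (e i') (e j')) C"
proof -
	let ?x = "bracket (e i) (e j)" let ?y = "bracket (e i') (e j')"
	have 1: "LL A ?x (B @ i' # j' # C) = LL A ?x (B @ j' # i' # C) + (\<Sum>k<n. co ?x k *c LL (A @ k # B) ?y C)"
		using assms(3) by (simp add: LL_def[of A ?x] R_def scaleC_add_right sum.distrib)
	have 2: "LL (A @ i # j # B) ?y C = LL (A @ j # i # B) ?y C + (\<Sum>k<n. co ?y k *c LL A ?x (B @ k # C))"
		using assms(4) by (simp add: LL_def[of "_ @ _" ?y] R_def scaleC_add_right sum.distrib)
	have 3: "(\<Sum>k<n. co ?x k *c LL (A @ k # B) ?y C) = (\<Sum>k<n. co ?y k *c LL A ?x (B @ k # C))"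
		by (simp add: LL_def scaleC_sum scaleC_scaleC mult.commute) (rule sum.swap)
	show ?thesis using assms(1,2) 1 2 3 by (simp add: R_def)
qed

text \<open>Both resolutions are carried on until the three letters are reversed. The terms with one
  bracket are then reordered by \<open>sh\<close>, which leaves double brackets that cancel by the
  Jacobi identity.\<close>

lemma overlapping_descents:
	assumes 1: "R (A @ [j]) i k C" "R A j k (i # C)" "R A i k (j # C)" "R (A @ [k]) i j C"
		and sh: "\<And>r s. R A r s C"
	shows "L (A @ j # i # k # C) + LL A (bracket (e i) (e j)) (k # C) =
		L (A @ i # k # j # C) + LL (A @ [i]) (bracket (e j) (e k)) C"
proof -
	let ?ij = "bracket (e i) (e j)" let ?ik = "bracket (e i) (e k)" let ?jk = "bracket (e j) (e k)"
	have a: "L (A @ j # i # k # C) = L (A @ k # j # i # C) + LL A ?jk (i # C) + LL (A @ [j]) ?ik C"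
		using 1(1,2) by (simp add: R_def)
	have b: "L (A @ i # k # j # C) = L (A @ k # j # i # C) + LL (A @ [k]) ?ij C + LL A ?ik (j # C)"
		using 1(3,4) by (simp add: R_def)
	have c: "LL (A @ [r]) x C = LL A x (r # C) + LL A (bracket (e r) x) C" for r x
		using R_bracket[OF sh] by (simp add: LL_def[of "A @ [r]"] LL_def[of A x])
	have "bracket (e j) ?ik - bracket (e k) ?ij - bracket (e i) ?jk = 0"
		using jacobi[of "e i" "e j" "e k"] bracket_anti[of "e k" "e i"] by (simp add: bracket_minus_right algebra_simps)
	then have "bracket (e j) ?ik = bracket (e k) ?ij + bracket (e i) ?jk" by (simp add: algebra_simps)
	then have "LL A (bracket (e j) ?ik) C = LL A (bracket (e k) ?ij) C + LL A (bracket (e i) ?jk) C" by (simp add: LL_add)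
	then show ?thesis by (simp add: a b c)
qed

text \<open>Disjoint descents can be resolved in either order; for overlapping ones this is the Jacobi identity.\<close>

lemma descents_agree:
	assumes len: "\<And>A r s C. length A + 2 + length C < length w ==> R A r s C"
		and lex: "\<And>A i j C. j < i ==> (A @ i # j # C, w)\<in>lenlex (less_than) ==> R A i j C"
		and w: "w = A @ i # j # C" "j < i" "w = A' @ i' # j' # C'" "j' < i'" "length A < length A'"
	shows "L (A @ j # i # C) + LL A (bracket (e i) (e j)) C = L (A' @ j' # i' # C') + LL A' (bracket (e i') (e j')) C'"
proof (cases "length A' = Suc (length A)")
	case True
	have "take (length A') w = A @ [i]" "drop (length A') w = j # C"
		using True w(1) by auto
	then have "A' = A @ [i]" "i' = j" "C = j' # C'" using w(3) by auto
	note eq = this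
	have w': "w = A @ i # j # j' # C'" using w(1) eq by simp
	show ?thesis
		unfolding eq
	proof (simp, rule overlapping_descents)
		have lt: "j' < j" "j < i" using w eq by auto
		show "R (A @ [j]) i j' C'" by (rule lex) (use lt w' lenlex_swap[of j i A "j' # C'"] in auto)
		show "R A i j' (j # C')" by (rule lex) (use lt w' lenlex_swap[of j' j "A @ [i]" C'] in auto)
		have l2: "(A @ j # j' # i # C', A @ j # i # j' # C')\<in>lenlex less_than"
			using lenlex_swap[of j' i "A @ [j]" C'] lt by simp
		have l3: "(A @ j # i # j' # C', w)\<in>lenlex less_than" using lenlex_swap[of j i A "j' # C'"] lt w' by simp
		have l4: "(A @ j' # i # j # C', A @ i # j' # j # C')\<in>lenlex less_than"
			using lenlex_swap[of j' i A "j # C'"] lt by simp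
		have l5: "(A @ i # j' # j # C', w)\<in>lenlex less_than" using lenlex_swap[of j' j "A @ [i]" C'] lt w' by simp
		have tr: "trans (lenlex less_than)" by (rule lenlex_transI) simp
		show "R A j j' (i # C')" by (rule lex[OF lt(1) transD[OF tr l2 l3]])
		show "R (A @ [j']) i j C'" by (rule lex) (use lt transD[OF tr l4 l5] in auto)
		show "R A r s C'" for r s by (rule len) (simp add: w')
	qed
next
	case False
	define B where "B = drop (length A + 2) A'"
	have l: "length A + 2 \<le> length A'" using False w(5) by simp
	have "take (length A + 2) w = A @ [i, j]" unfolding w(1) by simp
	then have "take (length A + 2) A' = A @ [i, j]" using l unfolding w(3) by simp
	then have A': "A' = A @ i # j # B"
		using append_take_drop_id[of "length A + 2" A'] unfolding B_def by (metis append.assoc append_Cons append_Nil)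
	then have C: "C = B @ i' # j' # C'" using w(1,3) by simp
	have w': "w = A @ i # j # B @ i' # j' # C'" using w(1) C by simp
	show ?thesis
		unfolding A' C
	proof (simp, rule disjoint_descents)
		show "R (A @ j # i # B) i' j' C'" by (rule lex) (use w w' lenlex_swap[of j i A "B @ i' # j' # C'"] in auto)
		show "R A i j (B @ j' # i' # C')" by (rule lex) (use w w' lenlex_swap[of j' i' "A @ i # j # B" C'] in auto)
	qed (rule len; simp add: w')+
qed

text \<open>Induction on the whole word. The rule at the selected descent is the defining equation
  of \<open>L\<close>, any other descent gives the same value, and the rule for ascending pairs
  follows from antisymmetry of the bracket.\<close>

lemma R: "R A i j C"
proof -
	have wf: "wf (lenlex (less_than))" by (intro wf_lenlex wf_less_than)
	have desc: "j < i ==> R A i j C" for A C i j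
	proof (induction "A @ i # j # C" arbitrary: A i j C rule: wf_induct_rule[OF wf])
		case less: (1 A i j C)
		let ?w = "A @ i # j # C"
		have lex: "R A' i' j' C'" if "j' < i'" "(A' @ i' # j' # C', ?w)\<in>lenlex (less_than)" for A' i' j' C'
			using less.hyps(1)[OF that(2,1)] .
		\<comment> \<open>For strictly shorter words the rule is available for every pair of letters,
		  descending or not; the Jacobi argument needs it in this generality.\<close>
		have len: "R A' r s C'" if l: "length A' + 2 + length C' < length ?w" for A' r s C'
		proof -
			consider "r = s" | "s < r" | "r < s" by linarith
			then show ?thesis
				using lex[of s r A' C'] lex[of r s A' C'] lenlex_shorter[of _ ?w] R_sym[of A' s r C'] l R_refl by cases auto
		qed
		have ns: "\<not> sorted ?w" using less.prems by (simp add: sorted_append)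
		obtain A' i' j' C' where d: "descent ?w = (A', i', j', C')" by (cases "descent ?w")
		have w': "?w = A' @ i' # j' # C'" "j' < i'" using descent[OF ns d] by auto
		have L: "L ?w = L (A' @ j' # i' # C') + LL A' (bracket (e i') (e j')) C'"
			by (subst L.simps) (simp add: ns d LL_def)
		consider "length A < length A'" | "length A' < length A" | "length A = length A'" by linarith
		then have "L (A @ j # i # C) + LL A (bracket (e i) (e j)) C = L (A' @ j' # i' # C') + LL A' (bracket (e i') (e j')) C'"
		proof cases
			case 1
			show ?thesis by (rule descents_agree[OF len lex refl less.prems w' 1])
		next
			case 2
			show ?thesis by (rule sym, rule descents_agree[OF len lex w' refl less.prems 2])
		next
			case 3
			then show ?thesis using w'(1) by simp
		qed
		then show ?case using L by (simp add: R_def)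
	qed
	consider "i = j" | "j < i" | "i < j" by linarith
	then show ?thesis using desc R_refl R_sym by cases auto
qed

lemma L_sorted: "sorted w ==> L w = Nf w" by (simp add: L.simps)

lemma L_swap: "L (A @ i # j # C) = L (A @ j # i # C) + (\<Sum>k<n. co (bracket (e i) (e j)) k *c L (A @ k # C))"
	using R unfolding R_def LL_def .

end

lemma sum_apply: "(\<Sum>k\<in>A. f k) x = (\<Sum>k\<in>A. f k x)"
	by (induction A rule: infinite_finite_induct) auto

lemma sum_rotate: "(\<Sum>i\<in>A. \<Sum>j\<in>B. \<Sum>k\<in>C. f i j k) = (\<Sum>k\<in>C. \<Sum>i\<in>A. \<Sum>j\<in>B. f i j k)"
proof -
	have "(\<Sum>i\<in>A. \<Sum>j\<in>B. \<Sum>k\<in>C. f i j k) = (\<Sum>i\<in>A. \<Sum>k\<in>C. \<Sum>j\<in>B. f i j k)"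
		by (rule sum.cong[OF refl]) (rule sum.swap)
	also have "... = (\<Sum>k\<in>C. \<Sum>i\<in>A. \<Sum>j\<in>B. f i j k)" by (rule sum.swap)
	finally show ?thesis .
qed

section \<open>From words in basis indices to words in elements of the Lie algebra\<close>

context adapted_basis
begin

text \<open>The generators of the enveloping algebra are all elements of the Lie algebra, so
  functions on index words are extended multilinearly through coordinates.\<close>

primrec mext :: "(nat list => 'z::complex_vector) => 'g list => 'z" where
	"mext F [] = F []"
| "mext F (x # xs) = (\<Sum>k<n. co x k *c mext (\<lambda>w. F (k # w)) xs)"

lemma mext_F_add: "mext (\<lambda>w. F w + G w) xs = mext F xs + mext G xs"
	by (induction xs arbitrary: F G) (simp_all add: scaleC_add_right sum.distrib)

lemma mext_F_scale: "mext (\<lambda>w. c *c F w) xs = c *c mext F xs"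
	by (induction xs arbitrary: F) (simp_all add: scaleC_sum scaleC_scaleC mult.commute)

lemma mext_F_zero: "mext (\<lambda>w. 0) xs = 0"
	by (induction xs) simp_all

lemma mext_F_sum: "mext (\<lambda>w. \<Sum>k\<in>A. c k *c F k w) xs = (\<Sum>k\<in>A. c k *c mext (F k) xs)"
	by (induction A rule: infinite_finite_induct) (simp_all add: mext_F_zero mext_F_add mext_F_scale)

lemma mext_add: "mext F (u @ (x + y) # t) = mext F (u @ x # t) + mext F (u @ y # t)"
	by (induction u arbitrary: F) (simp_all add: co_add scaleC_add_left scaleC_add_right sum.distrib)

lemma mext_scale: "mext F (u @ (c *c x) # t) = c *c mext F (u @ x # t)"
	by (induction u arbitrary: F) (simp_all add: co_scale scaleC_sum scaleC_scaleC mult.commute)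

lemma mext_e: "set w\<subseteq>{..<n} ==> mext F (map e w) = F w"
proof (induction w arbitrary: F)
	case (Cons j w)
	have "mext F (map e (j # w)) = (\<Sum>k<n. co (e j) k *c F (k # w))" using Cons by simp
	also have "... = (\<Sum>k<n. if k = j then F (j # w) else 0)"
		by (rule sum.cong) (use Cons.prems in \<open>auto simp: co_e scaleC_one\<close>)
	also have "... = F (j # w)" using Cons.prems by simp
	finally show ?case .
qed simp

lemma co_bracket: "co (bracket x y) k = (\<Sum>i<n. \<Sum>j<n. co x i * co y j * co (bracket (e i) (e j)) k)"
proof -
	have 1: "co (bracket (\<Sum>i<n. co x i *c e i) y) k = (\<Sum>i<n. co x i *c co (bracket (e i) y) k)"
		by (rule lin_on_comb[of UNIV "\<lambda>x. co (bracket x y) k"])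
			(auto simp: lin_on_def bracket_add_left bracket_scaleC_left co_add co_scale)
	have 2: "co (bracket z (\<Sum>j<n. co y j *c e j)) k = (\<Sum>j<n. co y j *c co (bracket z (e j)) k)" for z
		by (rule lin_on_comb[of UNIV "\<lambda>x. co (bracket z x) k"])
			(auto simp: lin_on_def bracket_add_right bracket_scaleC_right co_add co_scale)
	show ?thesis using 1 2 by (simp add: sum_distrib_left mult.assoc flip: expand)
qed

text \<open>By bilinearity, the commutation rule for basis letters implies it for arbitrary
  neighbouring letters; \<open>co_bracket\<close> collects the structure constants.\<close>

lemma mext_bracket:
	assumes "\<And>A i j C. F (A @ i # j # C) = F (A @ j # i # C) + (\<Sum>k<n. co (bracket (e i) (e j)) k *c F (A @ k # C))"
	shows "mext F (u @ x # y # t) = mext F (u @ y # x # t) + mext F (u @ bracket x y # t)"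
	using assms
proof (induction u arbitrary: F)
	case Nil
	let ?G = "\<lambda>i j. mext (\<lambda>w. F (i # j # w)) t" and ?H = "\<lambda>k. mext (\<lambda>w. F (k # w)) t"
	have G: "?G i j = ?G j i + (\<Sum>k<n. co (bracket (e i) (e j)) k *c ?H k)" for i j
		using Nil[of "[]" i j] by (simp add: mext_F_add mext_F_sum)
	have "mext F (x # y # t) = (\<Sum>i<n. \<Sum>j<n. (co x i * co y j) *c ?G i j)"
		by (simp add: scaleC_sum scaleC_scaleC)
	also have "... = (\<Sum>i<n. \<Sum>j<n. (co x i * co y j) *c (?G j i + (\<Sum>k<n. co (bracket (e i) (e j)) k *c ?H k)))"
		by (intro sum.cong refl arg_cong[of _ _ "scaleC _"] G)
	also have "... = (\<Sum>i<n. \<Sum>j<n. (co x i * co y j) *c ?G j i) +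
		(\<Sum>i<n. \<Sum>j<n. \<Sum>k<n. (co x i * co y j * co (bracket (e i) (e j)) k) *c ?H k)"
		by (simp add: scaleC_sum scaleC_scaleC scaleC_add_right sum.distrib)
	also have "(\<Sum>i<n. \<Sum>j<n. (co x i * co y j) *c ?G j i) = (\<Sum>j<n. \<Sum>i<n. (co y j * co x i) *c ?G j i)"
		by (subst sum.swap) (simp only: mult.commute)
	also have "... = mext F (y # x # t)" by (simp add: scaleC_sum scaleC_scaleC)
	also have "(\<Sum>i<n. \<Sum>j<n. \<Sum>k<n. (co x i * co y j * co (bracket (e i) (e j)) k) *c mext (\<lambda>w. F (k # w)) t) =
		(\<Sum>k<n. \<Sum>i<n. \<Sum>j<n. (co x i * co y j * co (bracket (e i) (e j)) k) *c mext (\<lambda>w. F (k # w)) t)"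
		by (rule sum_rotate)
	also have "... = mext F (bracket x y # t)"
		by (simp add: co_bracket[of x y] complex_vector.scale_sum_left)
	finally show ?case by simp
next
	case (Cons z u)
	have "mext (\<lambda>w. F (k # w)) (u @ x # y # t) = mext (\<lambda>w. F (k # w)) (u @ y # x # t) + mext (\<lambda>w. F (k # w)) (u @ bracket x y # t)" for k
	proof (rule Cons.IH)
		fix A i j C
		show "F (k # A @ i # j # C) = F (k # A @ j # i # C) + (\<Sum>l<n. co (bracket (e i) (e j)) l *c F (k # A @ l # C))"
			using Cons.prems[of "k # A" i j C] by simp
	qed
	then show ?case by (simp add: scaleC_add_right sum.distrib)
qed

end

text \<open>A basis \<open>e\<close> of the Lie algebra whose members from \<open>e m\<close> on form a basis of \<open>p\<close>.\<close>

locale adapted_rep = adapted_basis e n co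
	for e :: "nat => 'g::lie_algebra" and n :: nat and co :: "'g => nat => complex" +
	fixes m :: nat and p :: "'g set" and W :: "'w::complex_vector set" and a :: "'g => 'w => 'w"
	assumes mn: "m \<le> n" and e_p: "m \<le> k ==> k < n ==> e k\<in>p" and co_p: "x\<in>p ==> k < m ==> co x k = 0"
		and rep: "lie_rep p W a"
begin

text \<open>The target is the expected induced module: functions from sorted words in the complement
  letters, those with index below \<open>m\<close>, to \<open>W\<close>. In a sorted word these
  letters come first and are recorded as \<open>s\<close>; the remaining letters belong to
  \<open>p\<close> and act on \<open>v\<close>.\<close>

definition Nf :: "nat list => 'w => nat list => 'w" where
	"Nf w = (\<lambda>v s. if s = takeWhile (\<lambda>k. k < m) w then foldr (\<lambda>k. a (e k)) (dropWhile (\<lambda>k. k < m) w) v else 0)"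

sublocale pbw e n co Nf by unfold_locales

sublocale rep: lie_rep p W a by (rule rep)

lemma foldr_W: "set us\<subseteq>p ==> v\<in>W ==> foldr a us v\<in>W"
	by (induction us) (auto intro: rep.closed)

lemma foldr_lin: "set us\<subseteq>p ==> lin_on W (foldr a us)"
proof (induction us)
	case (Cons x us)
	then have "lin_on W (foldr a us)" "lin_on W (a x)" "\<And>v. v\<in>W ==> foldr a us v\<in>W"
		using rep.lin foldr_W[of us] by auto
	then show ?case by (auto simp: lin_on_def)
qed (simp add: lin_on_def)

lemma foldr_e: "foldr (\<lambda>k. a (e k)) q v = foldr a (map e q) v" by (simp add: foldr_map o_def)

lemma e_p_list: "set q\<subseteq>{m..<n} ==> set (map e q)\<subseteq>p" using e_p by auto

lemma p_expand: "x\<in>p ==> x = (\<Sum>k\<in>{m..<n}. co x k *c e k)"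
proof -
	assume x: "x\<in>p"
	have "(\<Sum>k<n. co x k *c e k) = (\<Sum>k\<in>{m..<n}. co x k *c e k)"
		by (rule sum.mono_neutral_right) (auto simp: co_p[OF x])
	then show ?thesis using expand[of x] by simp
qed

lemma p_act: assumes "x\<in>p" "v\<in>W" shows "a x v = (\<Sum>k\<in>{m..<n}. co x k *c a (e k) v)"
proof -
	have "a (\<Sum>k\<in>{m..<n}. co x k *c e k) v = (\<Sum>k\<in>{m..<n}. co x k *c a (e k) v)"
		by (rule lin_on_comb[OF _ rep.lin_left[OF assms(2)]]) (use e_p subalg_csub[OF rep.L] in auto)
	then show ?thesis using p_expand[OF assms(1)] by simp
qed

text \<open>The tail \<open>q\<close> need not be sorted. Sorting it creates only letters of
  \<open>p\<close>, as \<open>p\<close> is a subalgebra, so the prefix \<open>c\<close> is never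
  touched, and the representation obeys the same commutation rule.\<close>

lemma L_split:
	assumes c: "sorted c" "set c\<subseteq>{..<m}" and q: "set q\<subseteq>{m..<n}" and v: "v\<in>W"
	shows "L (c @ q) v = (\<lambda>s. if s = c then foldr a (map e q) v else 0)"
	using q
proof (induction q rule: sorting_induct)
	case (sorted q)
	have "takeWhile (\<lambda>k. k < m) (c @ q) = c" "dropWhile (\<lambda>k. k < m) (c @ q) = q"
		using c(2) sorted(1) by (cases q; auto simp: takeWhile_append2 dropWhile_append2 subset_iff)+
	moreover have "sorted (c @ q)" using c sorted by (force simp: sorted_append)
	then have "L (c @ q) = Nf (c @ q)" by (rule L_sorted)
	ultimately show ?case unfolding foldr_e[symmetric] by (simp add: Nf_def[of "c @ q"] del: dropWhile_append cong: if_cong)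
next
	case (swap A i j C)
	let ?b = "bracket (e i) (e j)"
	have ij: "e i\<in>p" "e j\<in>p" and A: "set (map e A)\<subseteq>p" and C: "set (map e C)\<subseteq>p" using swap e_p_list e_p by auto
	have b: "?b\<in>p" by (rule subalg_bracket[OF rep.L ij])
	define x where "x = foldr a (map e C) v"
	have x: "x\<in>W" unfolding x_def by (rule foldr_W[OF C v])
	have "L (c @ A @ i # j # C) v = L (c @ A @ j # i # C) v + (\<Sum>k<n. co ?b k *c L (c @ A @ k # C) v)"
		using L_swap[of "c @ A" i j C] by (simp add: sum_apply)
	also have "(\<Sum>k<n. co ?b k *c L (c @ A @ k # C) v) = (\<Sum>k\<in>{m..<n}. co ?b k *c L (c @ A @ k # C) v)"
		by (rule sum.mono_neutral_right) (auto simp: co_p[OF b])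
	also have "... = (\<Sum>k\<in>{m..<n}. co ?b k *c (\<lambda>s. if s = c then foldr a (map e (A @ k # C)) v else 0))"
		by (rule sum.cong[OF refl]) (use swap.IH(2) in auto)
	also have "L (c @ A @ j # i # C) v + ... = (\<lambda>s. if s = c then foldr a (map e (A @ i # j # C)) v else 0)"
	proof
		fix s
		have "foldr a (map e A) (\<Sum>k\<in>{m..<n}. co ?b k *c a (e k) x) = (\<Sum>k\<in>{m..<n}. co ?b k *c foldr a (map e A) (a (e k) x))"
			by (rule lin_on_comb[OF rep.W foldr_lin[OF A]]) (use e_p x rep.closed in auto)
		then have "foldr a (map e A) (a (e i) (a (e j) x)) = foldr a (map e A) (a (e j) (a (e i) x)) +
			(\<Sum>k\<in>{m..<n}. co ?b k *c foldr a (map e A) (a (e k) x))"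
			using lin_on_add[OF foldr_lin[OF A], of "a (e j) (a (e i) x)" "a ?b x"] rep.comm[OF ij x] rep.closed[OF ij(1)] rep.closed[OF ij(2)]
				rep.closed[OF b x] x p_act[OF b x] by simp
		then show "(L (c @ A @ j # i # C) v + (\<Sum>k\<in>{m..<n}. co ?b k *c (\<lambda>s. if s = c then foldr a (map e (A @ k # C)) v else 0))) s =
			(if s = c then foldr a (map e (A @ i # j # C)) v else 0)"
			using swap.IH(1) by (simp add: sum_apply x_def)
	qed
	finally show ?case .
qed

lemma split_sorted:
	assumes "sorted w" "set w\<subseteq>{..<n}"
	obtains c q where "w = c @ q" "sorted c" "set c\<subseteq>{..<m}" "set q\<subseteq>{m..<n}"
proof
	let ?P = "\<lambda>k. k < m"
	show "w = takeWhile ?P w @ dropWhile ?P w" by simp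
	show "sorted (takeWhile ?P w)" using assms(1) by (rule sorted_takeWhile)
	show "set (takeWhile ?P w)\<subseteq>{..<m}" by (auto dest: set_takeWhileD)
	show "set (dropWhile ?P w)\<subseteq>{m..<n}"
	proof (cases "dropWhile ?P w")
		case (Cons y t)
		have "\<not> y < m" using hd_dropWhile[of ?P w] Cons by auto
		moreover have "sorted (y # t)" using sorted_dropWhile[OF assms(1), of ?P] Cons by simp
		moreover have "set (y # t)\<subseteq>{..<n}" using assms(2) Cons set_dropWhileD[of _ ?P w] by auto
		ultimately show ?thesis unfolding Cons by fastforce
	next
		case Nil
		show ?thesis unfolding Nil by simp
	qed
qed

lemma L_lin: "set w\<subseteq>{..<n} ==> lin_on W (L w)"
proof (induction w rule: sorting_induct)
	case (sorted w)
	obtain c q where w: "w = c @ q" "sorted c" "set c\<subseteq>{..<m}" "set q\<subseteq>{m..<n}"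
		using split_sorted[OF sorted(2,1)] .
	show ?case
		unfolding lin_on_def w(1)
		using lin_on_add[OF foldr_lin[OF e_p_list[OF w(4)]]] lin_on_scale[OF foldr_lin[OF e_p_list[OF w(4)]]]
		by (auto simp: L_split[OF w(2-4)] csub_add[OF rep.W] csub_scale[OF rep.W] fun_eq_iff)
next
	case (swap A i j C)
	show ?case
		unfolding lin_on_def
		using lin_on_add[OF swap.IH(1)] lin_on_scale[OF swap.IH(1)] lin_on_add[OF swap.IH(2)] lin_on_scale[OF swap.IH(2)]
		by (simp add: L_swap[of A i j C] sum_apply scaleC_add_right sum.distrib scaleC_sum scaleC_scaleC mult.commute)
qed

text \<open>Rewriting inside \<open>w\<close> does not involve the last letter, so the claim reduces
  to sorted \<open>w\<close>; there the appended letter joins the tail in \<open>p\<close>.\<close>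

lemma L_append: "set w\<subseteq>{..<n} ==> m \<le> j ==> j < n ==> v\<in>W ==> L (w @ [j]) v = L w (a (e j) v)"
proof (induction w rule: sorting_induct)
	case (sorted w)
	obtain c q where w: "w = c @ q" "sorted c" "set c\<subseteq>{..<m}" "set q\<subseteq>{m..<n}"
		using split_sorted[OF sorted(2,1)] .
	have q: "set (q @ [j])\<subseteq>{m..<n}" using w(4) sorted by simp
	show ?case
		using L_split[OF w(2,3) q sorted(5)] L_split[OF w(2-4) rep.closed[OF e_p[OF sorted(3,4)] sorted(5)]] by (simp add: w(1) fun_eq_iff)
next
	case (swap A i j' C)
	then show ?case by (simp add: L_swap[of A i j'] sum_apply)
qed

lemma mext_lin: "(\<And>w. set w\<subseteq>{..<n} ==> lin_on W (F w)) ==> lin_on W (mext F us)"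
proof (induction us arbitrary: F)
	case (Cons x us)
	have l: "lin_on W (mext (\<lambda>w. F (k # w)) us)" if "k < n" for k by (rule Cons.IH) (use Cons.prems that in auto)
	show ?case
		unfolding lin_on_def
		by (simp add: sum_apply lin_on_add[OF l] lin_on_scale[OF l] scaleC_add_right sum.distrib scaleC_sum scaleC_scaleC mult.commute)
qed simp

lemma mext_append:
	assumes "\<And>w. set w\<subseteq>{..<n} ==> lin_on W (F w)"
		and "\<And>w j v. set w\<subseteq>{..<n} ==> m \<le> j ==> j < n ==> v\<in>W ==> F (w @ [j]) v = F w (a (e j) v)"
		and y: "y\<in>p" and v: "v\<in>W"
	shows "mext F (us @ [y]) v = mext F us (a y v)"
	using assms(1,2)
proof (induction us arbitrary: F)
	case Nil
	have "mext F [y] v = (\<Sum>k<n. co y k *c F [k] v)" by (simp add: sum_apply)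
	also have "... = (\<Sum>k\<in>{m..<n}. co y k *c F [k] v)" by (rule sum.mono_neutral_right) (auto simp: co_p[OF y])
	also have "... = (\<Sum>k\<in>{m..<n}. co y k *c F [] (a (e k) v))"
		by (rule sum.cong[OF refl]) (use Nil(2)[of "[]"] v in auto)
	also have "... = F [] (\<Sum>k\<in>{m..<n}. co y k *c a (e k) v)"
		by (rule lin_on_comb[symmetric, OF rep.W Nil(1)]) (use e_p v rep.closed in auto)
	finally show ?case by (simp add: p_act[OF y v])
next
	case (Cons x us)
	have "mext (\<lambda>w. F (k # w)) (us @ [y]) v = mext (\<lambda>w. F (k # w)) us (a y v)" if "k < n" for k
		by (rule Cons.IH) (use Cons.prems(1)[of "k # _"] Cons.prems(2)[of "k # _"] that in auto)
	then show ?case by (simp add: sum_apply)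
qed

lemma mext_append_word: "set q\<subseteq>p ==> v\<in>W ==> mext L (us @ q) v = mext L us (foldr a q v)"
proof (induction q arbitrary: v rule: rev_induct)
	case (snoc y q)
	then show ?case using mext_append[of L y v "us @ q", OF L_lin L_append] rep.closed[of y v] by simp
qed simp

text \<open>Before any quotient is taken, the map sending \<open>u\<close> tensored with
  \<open>v\<close> to its coefficients on sorted words.\<close>

definition Lam :: "'g free_algebra => 'w => nat list => 'w" where "Lam = lext (\<lambda>w. mext L (letters w))"

lemma Lam_word: "Lam (word u) = mext L u" by (simp add: Lam_def word_def)
lemma Lam_add: "Lam (x + y) = Lam x + Lam y" and Lam_scale: "Lam (c *c x) = c *c Lam x" and Lam_diff: "Lam (x - y) = Lam x - Lam y"
	by (simp_all add: Lam_def lext_add lext_scale lext_diff)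
lemma Lam_lin [simp]: "lin_on UNIV Lam" by (simp add: Lam_def)

lemma Lam_lin_W: "lin_on W (Lam u)"
proof -
	have "lin_on W (mext L us)" for us by (rule mext_lin[OF L_lin])
	then show ?thesis
		unfolding Lam_def lext_def lin_on_def
		by (simp add: sum_apply lin_on_add lin_on_scale scaleC_add_right sum.distrib scaleC_sum scaleC_scaleC mult.commute)
qed

definition pa :: "'g free_algebra => 'w => 'w" where "pa q v = lext (\<lambda>w. foldr a (letters w) v) q"

lemma pa_word: "pa (word u) v = foldr a u v" by (simp add: pa_def word_def)
lemma pa_add: "pa (x + y) v = pa x v + pa y v" and pa_scale: "pa (c *c x) v = c *c pa x v"
	and pa_diff: "pa (x - y) v = pa x v - pa y v" and pa_0: "pa 0 v = 0"
	by (simp_all add: pa_def lext_add lext_scale lext_diff)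

lemma pa_W: "q\<in>cspan (words p) ==> v\<in>W ==> pa q v\<in>W"
	by (rule lin_on_span[of UNIV "\<lambda>q. pa q v" "words p"])
		(auto simp: words_def pa_word foldr_W lin_on_def pa_add pa_scale rep.W)

text \<open>The balancing relation of the tensor product over the enveloping algebra of
  \<open>p\<close>: right factors over \<open>p\<close> may act on \<open>v\<close> instead.\<close>

lemma Lam_mult: assumes q: "q\<in>cspan (words p)" and v: "v\<in>W" shows "Lam (u * q) v = Lam u (pa q v)"
proof -
	have 1: "Lam (word us * q) v = Lam (word us) (pa q v)" for us
	proof -
		have "q\<in>cspan (words p) \<and> Lam (word us * q) v = Lam (word us) (pa q v)"
			using q
		proof (induction rule: cspan_induct)
			case zero
			show ?case using lin_on_0[OF rep.W Lam_lin_W] lin_on_0[OF _ Lam_lin] by (simp add: pa_0 cspan_0)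
		next
			case (base x)
			then show ?case
				using v by (auto simp: words_def word_mult Lam_word pa_word mext_append_word intro: word_carrier[unfolded words_def])
		next
			case (add x y)
			then show ?case using lin_on_add[OF Lam_lin_W pa_W[OF _ v] pa_W[OF _ v]]
				by (auto simp: distrib_left Lam_add pa_add cspan_add)
		next
			case (scale c x)
			then show ?case using lin_on_scale[OF Lam_lin_W pa_W[OF _ v]]
				by (auto simp: scaleC_mult_right Lam_scale pa_scale cspan_scale)
		qed
		then show ?thesis by simp
	qed
	show ?thesis
		using in_words_UNIV[of u]
	proof (induction rule: cspan_induct)
		case zero
		show ?case using lin_on_0[OF _ Lam_lin] by simp
	next
		case (base x)
		then show ?case using 1 by (auto simp: words_def)
	qed (simp_all add: distrib_right scaleC_mult_left Lam_add Lam_scale)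
qed

lemma Lam_sorted: "sorted c ==> set c\<subseteq>{..<m} ==> v\<in>W ==> Lam (word (map e c)) v = (\<lambda>s. if s = c then v else 0)"
proof -
	assume c: "sorted c" "set c\<subseteq>{..<m}" "v\<in>W"
	then have "set c\<subseteq>{..<n}" using mn by auto
	then show ?thesis using L_split[of c "[]" v] mext_e[of c L] c by (simp add: Lam_word cong: if_cong)
qed

end

section \<open>The ideal of the enveloping algebra and adapted bases\<close>

definition env_rels :: "'g::lie_algebra free_algebra set" where
	"env_rels = linear_rels (adjoint_module UNIV)\<union>{gen x * gen y - gen y * gen x - gen (bracket x y) | x y. True}"

lemma env_ideal_span: "env_ideal = cspan {word u * g * word v | u g v. g\<in>env_rels}"
	using genideal_free_ring[of env_rels UNIV] unfolding env_ideal_def env_rels_def[symmetric]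
	by (simp add: free_ring_def)

lemma env_rels_cases:
	assumes "g\<in>env_rels"
	obtains x y where "g = word [x + y] - word [x] - word [y]" | c x where "g = word [c *c x] - c *c word [x]"
		| x y where "g = word [x, y] - word [y, x] - word [bracket x y]"
	using assms unfolding env_rels_def linear_rels_def adjoint_module_def by (auto simp: gen_word word_mult const_mult)

text \<open>The linear relations vanish because the extension is multilinear, the bracket relations
  because \<open>L\<close> obeys the commutation rule at every place.\<close>

lemma (in adapted_rep) Lam_env_ideal: assumes "q\<in>env_ideal" shows "Lam q = 0"
proof -
	have "Lam q\<in>{0}"
	proof (rule lin_on_span[OF Lam_lin _ _ _ _ assms[unfolded env_ideal_span]])
		fix s :: "'g free_algebra" assume "s\<in>{word u * g * word v | u g v. g\<in>env_rels}"
		then obtain u g v where s: "s = word u * g * word v" "g\<in>env_rels" by blast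
		show "Lam s\<in>{0}"
			using s(2)
		proof (cases rule: env_rels_cases)
			case (1 x y)
			have "s = word (u @ (x + y) # v) - word (u @ x # v) - word (u @ y # v)"
				by (simp add: s 1 left_diff_distrib right_diff_distrib word_mult)
			then show ?thesis by (simp add: Lam_diff Lam_word mext_add)
		next
			case (2 c x)
			have "s = word (u @ (c *c x) # v) - c *c word (u @ x # v)"
				by (simp add: s 2 left_diff_distrib right_diff_distrib word_mult scaleC_mult_left scaleC_mult_right)
			then show ?thesis by (simp add: Lam_diff Lam_scale Lam_word mext_scale)
		next
			case (3 x y)
			have "s = word (u @ x # y # v) - word (u @ y # x # v) - word (u @ bracket x y # v)"
				by (simp add: s 3 left_diff_distrib right_diff_distrib word_mult)
			then show ?thesis using mext_bracket[of L u x y v, OF L_swap] by (simp add: Lam_diff Lam_word)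
		qed
	qed (auto simp: csub_def)
	then show ?thesis by simp
qed

text \<open>Relations over the whole algebra impose nothing new on a module of \<open>p\<close>:
  moving \<open>q\<close> onto \<open>v\<close> and reading the coefficient of the empty word gives
  \<open>pa q v\<close>. This makes the action in \<open>env_act\<close> well defined.\<close>

lemma (in adapted_rep) env_ideal_acts_zero:
	assumes "q\<in>env_ideal" "q\<in>cspan (words p)" "v\<in>W" shows "pa q v = 0"
proof -
	have "Lam (1 * q) v = Lam 1 (pa q v)" by (rule Lam_mult[OF assms(2,3)])
	moreover have "Lam 1 (pa q v) = (\<lambda>s. if s = [] then pa q v else 0)"
		using Lam_sorted[of "[]" "pa q v"] pa_W[OF assms(2,3)] by (simp add: word_Nil)
	ultimately show ?thesis using Lam_env_ideal[OF assms(1)] by (auto dest: fun_cong[of _ _ "[]"])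
qed

text \<open>The order is: a complement of \<open>K \<inter> p\<close> in \<open>K\<close>, then
  \<open>K \<inter> p\<close>, then a complement of \<open>K\<close> chosen inside \<open>p\<close>,
  which is possible because \<open>K\<close> and \<open>p\<close> span everything. So
  \<open>p\<close> begins at index \<open>m\<close> and \<open>K\<close> ends before
  \<open>m'\<close>.\<close>

lemma adapted_basis_exists:
	fixes K p :: "'g::fin_dim_lie_algebra set"
	assumes K: "csub K" and p: "csub p" and sum: "\<And>x. \<exists>z\<in>K. \<exists>y\<in>p. x = z + y"
	obtains e n m m' and co :: "'g => nat => complex" where "adapted_basis e n co" "m \<le> m'" "m' \<le> n"
		"\<And>k. m \<le> k ==> k < n ==> e k\<in>p" "\<And>x k. x\<in>p ==> k < m ==> co x k = 0"
		"\<And>k. k < m' ==> e k\<in>K" "\<And>x k. x\<in>K ==> m' \<le> k ==> k < n ==> co x k = 0"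
proof -
	have Kps: "csub (K\<inter>p)" using K p by (rule csub_Int)
	obtain B0 where B0: "finite B0" "cindep B0" "cspan B0 = K\<inter>p" using fin_dim_basis[OF _ Kps] by auto
	have B0K: "B0\<subseteq>K" "B0\<subseteq>p" using cspan_superset[of B0] B0(3) by auto
	obtain B1 where B1: "B0\<subseteq>B1" "cindep B1" "cspan B1 = K" using basis_extend[OF B0(2) B0K(1) K] .
	have B1K: "B1\<subseteq>K" using cspan_superset[of B1] B1(3) by auto
	obtain B where B: "B1\<subseteq>B" "B\<subseteq>B1\<union>p" "cindep B" "B1\<union>p\<subseteq>cspan B"
		using complex_vector.maximal_independent_subset_extend[of B1 "B1\<union>p"] B1(2) by auto
	have B_span: "x\<in>cspan B" for x
	proof -
		obtain z y where zy: "z\<in>K" "y\<in>p" "x = z + y" using sum by blast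
		have "z\<in>cspan B" using zy(1) B1(3) cspan_mono[OF B(1)] by auto
		then show ?thesis using zy B(4) cspan_add by blast
	qed
	have Bfin: "finite B" by (rule fin_dim_indep[of UNIV]) (use B in auto)
	define D where "D = B - B1"
	have D: "D\<subseteq>p" using B(2) by (auto simp: D_def)
	have fins: "finite B1" "finite D" using finite_subset[OF B(1) Bfin] Bfin by (auto simp: D_def)
	\<comment> \<open>Subtracting from \<open>x\<close> its part along \<open>D\<close>, which is in
	  \<open>p\<close>, leaves an element of both \<open>K\<close> and \<open>p\<close>.\<close>
	have p_sub: "p\<subseteq>cspan (B0\<union>D)"
	proof
		fix x assume x: "x\<in>p"
		have "x\<in>cspan (B1\<union>D)" using B_span B(1) by (simp add: D_def Un_absorb1)
		then obtain z y where zy: "z\<in>cspan B1" "y\<in>cspan D" "x = z + y" unfolding cspan_Un by blast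
		have "y\<in>p" using cspan_least[OF D p] zy(2) by blast
		then have "z\<in>p" using csub_diff[OF p x] zy(3) by (metis add_diff_cancel_right')
		then have "z\<in>cspan B0" using zy(1) B1(3) B0(3) by simp
		then show "x\<in>cspan (B0\<union>D)" using zy unfolding cspan_Un by blast
	qed
	obtain xs where xs: "set xs = B1 - B0" "distinct xs" using finite_distinct_list[of "B1 - B0"] fins by auto
	obtain ys where ys: "set ys = B0" "distinct ys" using finite_distinct_list[OF B0(1)] by auto
	obtain zs where zs: "set zs = D" "distinct zs" using finite_distinct_list[OF fins(2)] by auto
	define l where "l = xs @ ys @ zs"
	define e where "e = nth l"
	have ld: "distinct l" and ls: "set l = B"
		using xs ys zs B1(1) B(1) by (auto simp: l_def D_def)
	define co where "co x k = coord B x (e k)" for x k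
	let ?m = "length xs" and ?m' = "length xs + length ys" and ?n = "length l"
	have eB: "e k\<in>B" if "k < ?n" for k using that ls by (auto simp: e_def)
	have e_inj: "e j = e k \<longleftrightarrow> j = k" if "j < ?n" "k < ?n" for j k
		using that nth_eq_iff_index_eq[OF ld] by (simp add: e_def)
	have e1: "e k\<in>B1 - B0" if "k < ?m" for k using that xs(1) nth_mem[of k xs] by (simp add: e_def l_def nth_append)
	have e2: "e k\<in>B0" if "?m \<le> k" "k < ?m'" for k
		using that ys(1) nth_mem[of "k - ?m" ys] by (auto simp: e_def l_def nth_append)
	have e3: "e k\<in>D" if "?m' \<le> k" "k < ?n" for k
		using that zs(1) nth_mem[of "k - ?m'" zs] by (auto simp: e_def l_def nth_append)
	show thesis
	proof (rule that[of e ?n co ?m ?m'])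
		show "adapted_basis e ?n co"
		proof
			show "co (x + y) k = co x k + co y k" "co (c *c x) k = c * co x k" for x y c k
				by (simp_all add: co_def coord_add[OF B(3) B_span B_span] coord_scale[OF B(3) B_span])
			show "co (e j) k = (if j = k then 1 else 0)" if "j < ?n" "k < ?n" for j k
				using coord_basis[OF B(3) eB[OF that(1)]] e_inj[OF that] by (auto simp: co_def)
			show "x = (\<Sum>k<?n. co x k *c e k)" for x
			proof -
				have "bij_betw e {..<?n} B" using bij_betw_nth[OF ld refl ls[symmetric]] by (simp add: e_def)
				then have "(\<Sum>k<?n. coord B x (e k) *c e k) = (\<Sum>b\<in>B. coord B x b *c b)" by (rule sum.reindex_bij_betw)
				then show ?thesis using coord_expand[OF B(3) Bfin B_span] by (simp add: co_def)
			qed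
		qed
		show "e k\<in>p" if "?m \<le> k" "k < ?n" for k
			using e2[OF that(1)] e3[OF _ that(2)] D B0K by (cases "k < ?m'") auto
		show "e k\<in>K" if "k < ?m'" for k using e1[of k] e2[of k] that B1K B1(1) by (cases "k < ?m") auto
		show "co x k = 0" if "x\<in>p" "k < ?m" for x k
			unfolding co_def
		proof (rule coord_span_subset[OF B(3)])
			show "B0\<union>D\<subseteq>B" using B1 B by (auto simp: D_def)
			show "x\<in>cspan (B0\<union>D)" using that p_sub by auto
			show "e k \<notin> B0\<union>D" using e1[OF that(2)] by (auto simp: D_def)
		qed
		show "co x k = 0" if "x\<in>K" "?m' \<le> k" "k < ?n" for x k
			unfolding co_def
			by (rule coord_span_subset[OF B(3) B(1)]) (use that B1(3) e3[OF that(2,3)] in \<open>auto simp: D_def\<close>)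
	qed (auto simp: l_def)
qed

section \<open>Induced modules\<close>

lemma env_ideal_csub [simp]: "csub env_ideal" by (simp add: env_ideal_span)

lemma env_ideal_ideal: "ideal (env_ideal :: 'g::lie_algebra free_algebra set) (free_ring UNIV)"
proof -
	interpret ring "free_ring (UNIV :: 'g set)" by (rule free_ring_ring)
	show ?thesis unfolding env_ideal_def by (rule genideal_ideal) (simp add: free_ring_def)
qed

lemma env_class_cs: "env_class x = cs env_ideal x"
	unfolding env_class_def by (rule cs_a_r_coset) simp

lemma env_class_eq: "env_class x = env_class y \<longleftrightarrow> x - y\<in>env_ideal"
	by (simp add: env_class_cs cs_eq_iff)

lemma env_ring_simps:
	"env_class x \<otimes>\<^bsub>env_ring\<^esub> env_class y = env_class (x * y)"
	"env_class x \<oplus>\<^bsub>env_ring\<^esub> env_class y = env_class (x + y)"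
proof -
	have "carrier (free_ring (UNIV :: 'a set)) = UNIV" by (simp add: free_ring_def)
	then show "env_class x \<otimes>\<^bsub>env_ring\<^esub> env_class y = env_class (x * y)"
		using ideal.rcoset_mult_add[OF env_ideal_ideal, of x y] by (simp add: env_ring_def FactRing_def env_class_def)
	show "env_class x \<oplus>\<^bsub>env_ring\<^esub> env_class y = env_class (x + y)"
		by (simp add: env_ring_def FactRing_def env_class_cs cs_set_add)
qed

lemma env_module_simps:
	"carrier (env_module A) = A" "env_class x \<oplus>\<^bsub>env_module A\<^esub> env_class y = env_class (x + y)"
	"c \<odot>\<^bsub>env_module A\<^esub> env_class x = env_class (c *c x)"
	by (simp_all add: env_module_def env_ring_simps const_mult)

lemma env_rel_in_ideal:
	assumes "g\<in>env_rels" shows "word u * g * word t\<in>env_ideal"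
	unfolding env_ideal_span using assms by (intro cspan_base) blast

lemma env_add: "word (u @ (x + y) # t) - word (u @ x # t) - word (u @ y # t)\<in>env_ideal"
proof -
	have "word [x + y] - word [x] - word [y]\<in>env_rels"
		unfolding env_rels_def linear_rels_def adjoint_module_def by (auto simp: gen_word)
	from env_rel_in_ideal[OF this, of u t] show ?thesis by (simp add: left_diff_distrib right_diff_distrib word_mult)
qed

lemma env_scale: "word (u @ (c *c x) # t) - c *c word (u @ x # t)\<in>env_ideal"
proof -
	have "word [c *c x] - c *c word [x]\<in>env_rels"
		unfolding env_rels_def linear_rels_def adjoint_module_def by (auto simp: gen_word const_mult)
	from env_rel_in_ideal[OF this, of u t] show ?thesis
		by (simp add: left_diff_distrib right_diff_distrib word_mult scaleC_mult_left scaleC_mult_right)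
qed

lemma env_bracket: "word (u @ x # y # t) - word (u @ y # x # t) - word (u @ bracket x y # t)\<in>env_ideal"
proof -
	have "word [x, y] - word [y, x] - word [bracket x y] = gen x * gen y - gen y * gen x - gen (bracket x y)"
		by (simp add: gen_word word_mult)
	then have "word [x, y] - word [y, x] - word [bracket x y]\<in>env_rels" unfolding env_rels_def by auto
	from env_rel_in_ideal[OF this, of u t] show ?thesis by (simp add: left_diff_distrib right_diff_distrib word_mult)
qed

lemma env_sum: "word (u @ (\<Sum>k\<in>A. c k *c f k) # t) - (\<Sum>k\<in>A. c k *c word (u @ f k # t))\<in>env_ideal"
proof (induction A rule: infinite_finite_induct)
	case (insert a A)
	let ?s = "\<Sum>k\<in>A. c k *c f k"
	have "word (u @ (\<Sum>k\<in>insert a A. c k *c f k) # t) - (\<Sum>k\<in>insert a A. c k *c word (u @ f k # t)) =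
		(word (u @ (c a *c f a + ?s) # t) - word (u @ (c a *c f a) # t) - word (u @ ?s # t)) +
		(word (u @ (c a *c f a) # t) - c a *c word (u @ f a # t)) + (word (u @ ?s # t) - (\<Sum>k\<in>A. c k *c word (u @ f k # t)))"
		using insert.hyps by simp
	also have "...\<in>env_ideal" by (intro csub_add env_ideal_csub env_add env_scale insert.IH)
	finally show ?case .
qed (use env_scale[of u 0 "0" t] in simp_all)

definition ES :: "'g::lie_algebra set => 'g free_algebra set set" where "ES S = env_class ` cspan (words S)"

lemma env_sub_ES: "env_sub S = ES S" by (simp add: env_sub_def ES_def free_ring_carrier)

lemma ES_mono: "S\<subseteq>S' ==> ES S\<subseteq>ES S'"
	unfolding ES_def by (intro image_mono cspan_mono) (auto simp: words_def)

definition ET :: "'g::lie_algebra => ('g free_algebra set \<times> 'v \<Rightarrow>\<^sub>0 complex) => ('g free_algebra set \<times> 'v \<Rightarrow>\<^sub>0 complex)" where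
	"ET x = lext (\<lambda>(A, v). sg (env_class (gen x) \<otimes>\<^bsub>env_ring\<^esub> A, v))"

lemma ET_sg: "ET x (sg (env_class u, v)) = sg (env_class (word [x] * u), v)"
	by (simp add: ET_def env_ring_simps gen_word)
lemma ET_lin [simp]: "lin_on U (ET x)" by (simp add: ET_def)
lemma ET_add: "ET x (p + q) = ET x p + ET x q" by (simp add: ET_def lext_add)
lemma ET_diff: "ET x (p - q) = ET x p - ET x q" by (simp add: ET_def lext_diff)
lemma ET_scale: "ET x (c *c p) = c *c ET x p" by (simp add: ET_def lext_scale)

locale induced = adapted_rep e n co m p W a + lmodel V W \<phi>
	for e :: "nat => 'g::lie_algebra" and n co m and p :: "'g set" and W :: "'w::complex_vector set" and a
		and V :: "('g, 'v) lie_module" and \<phi> +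
	assumes phi_act: "x\<in>p ==> v\<in>carrier V ==> act V x v\<in>carrier V \<and> \<phi> (act V x v) = a x (\<phi> v)"
begin

lemma foldr_act: "set us\<subseteq>p ==> v\<in>carrier V ==> foldr (act V) us v\<in>carrier V \<and> \<phi> (foldr (act V) us v) = foldr a us (\<phi> v)"
	by (induction us) (use phi_act in auto)

lemma free_act:
	assumes q: "q\<in>cspan (words p)" and v: "v\<in>carrier V"
	shows "free_act V q v\<in>carrier V \<and> \<phi> (free_act V q v) = pa q (\<phi> v)"
proof -
	have "set (letters w)\<subseteq>p" if "w\<in>keys q" for w
		using q that unfolding free_ring_carrier[symmetric] by (simp add: free_ring_def)
	then have c: "foldr (act V) (letters w) v\<in>carrier V \<and> \<phi> (foldr (act V) (letters w) v) = foldr a (letters w) (\<phi> v)"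
		if "w\<in>keys q" for w using foldr_act v that by blast
	then show ?thesis
		unfolding free_act_def pa_def lext_def by (auto simp: finsum_c phi_finsum intro!: sum.cong finsum_c)
qed

text \<open>Two representatives over \<open>p\<close> differ by an element of the ideal that is
  itself written over \<open>p\<close>, and this acts by zero.\<close>

lemma env_act:
	assumes q: "q\<in>cspan (words p)" and v: "v\<in>carrier V"
	shows "env_act p V (env_class q) v\<in>carrier V \<and> \<phi> (env_act p V (env_class q) v) = pa q (\<phi> v)"
proof -
	have eq: "free_act V q' v = free_act V q v" if q': "q'\<in>env_class q" "q'\<in>cspan (words p)" for q'
	proof -
		obtain z where z: "z\<in>env_ideal" "q' = z + q" using q'(1) by (auto simp: env_class_cs cs_def)
		then have "z\<in>cspan (words p)" using cspan_diff[OF q'(2) q] by simp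
		then have "pa z (\<phi> v) = 0" using env_ideal_acts_zero z(1) v by simp
		then show ?thesis using free_act[OF q v] free_act[OF q'(2) v] phi_inj z(2) by (simp add: pa_add)
	qed
	have "q\<in>env_class q\<inter>cspan (words p)" using q by (simp add: env_class_cs cs_self)
	then have "(\<lambda>q. free_act V q v) ` (env_class q\<inter>carrier (free_ring p)) = {free_act V q v}"
		unfolding free_ring_carrier using eq by blast
	then show ?thesis using free_act[OF q v] by (simp add: env_act_def)
qed

definition EF where "EF S = {q :: 'g free_algebra set \<times> 'v \<Rightarrow>\<^sub>0 complex. keys q\<subseteq>ES S \<times> carrier V}"
text \<open>The subalgebra \<open>S\<close> is a parameter: the range of \<open>i\<close> gives the
  top level module, the whole algebra gives the generalized Verma module.\<close>

definition erels where "erels S = bilinear_rels (env_module (ES S)) V \<union>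
	{sg (A \<otimes>\<^bsub>env_ring\<^esub> r, v) - sg (A, env_act p V r v) | A r v. A\<in>ES S \<and> r\<in>ES (S\<inter>p) \<and> v\<in>carrier V}"
definition EK where "EK S = cspan (erels S)"

lemma EF_subspace [simp]: "csub (EF S)" by (simp add: EF_def)
lemma EK_subspace [simp]: "csub (EK S)" by (simp add: EK_def)
lemma EF_span: "EF S = cspan (sg ` (ES S \<times> carrier V))" unfolding EF_def by (rule keys_span)
lemma EF_mono: "S\<subseteq>S' ==> EF S\<subseteq>EF S'" unfolding EF_def using ES_mono by blast

lemma erels_cases:
	assumes "q\<in>erels S"
	obtains x y v where "q = sg (env_class (x + y), v) - sg (env_class x, v) - sg (env_class y, v)"
			"x\<in>cspan (words S)" "y\<in>cspan (words S)" "v\<in>carrier V"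
		| x v w where "q = sg (env_class x, v \<oplus>\<^bsub>V\<^esub> w) - sg (env_class x, v) - sg (env_class x, w)"
			"x\<in>cspan (words S)" "v\<in>carrier V" "w\<in>carrier V"
		| c x v where "q = sg (env_class (c *c x), v) - c *c sg (env_class x, v)" "x\<in>cspan (words S)" "v\<in>carrier V"
		| c x v where "q = sg (env_class x, c \<odot>\<^bsub>V\<^esub> v) - c *c sg (env_class x, v)" "x\<in>cspan (words S)" "v\<in>carrier V"
		| x r v where "q = sg (env_class (x * r), v) - sg (env_class x, env_act p V (env_class r) v)"
			"x\<in>cspan (words S)" "r\<in>cspan (words (S\<inter>p))" "v\<in>carrier V"
proof -
	note q = assms[unfolded erels_def bilinear_rels_def env_module_simps(1)]
	have s: "Poly_Mapping.single z c = c *c sg z" for z :: "'g free_algebra set \<times> 'v" and c by (rule single_scaleC)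
	from q consider
		(1) A B v where "q = sg (A \<oplus>\<^bsub>env_module (ES S)\<^esub> B, v) - sg (A, v) - sg (B, v)" "A\<in>ES S" "B\<in>ES S" "v\<in>carrier V"
		| (2) A v w where "q = sg (A, v \<oplus>\<^bsub>V\<^esub> w) - sg (A, v) - sg (A, w)" "A\<in>ES S" "v\<in>carrier V" "w\<in>carrier V"
		| (3) c A v where "q = sg (c \<odot>\<^bsub>env_module (ES S)\<^esub> A, v) - Poly_Mapping.single (A, v) c" "A\<in>ES S" "v\<in>carrier V"
		| (4) c A v where "q = sg (A, c \<odot>\<^bsub>V\<^esub> v) - Poly_Mapping.single (A, v) c" "A\<in>ES S" "v\<in>carrier V"
		| (5) A r v where "q = sg (A \<otimes>\<^bsub>env_ring\<^esub> r, v) - sg (A, env_act p V r v)" "A\<in>ES S" "r\<in>ES (S\<inter>p)" "v\<in>carrier V"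
		by blast
	then show thesis
	proof cases
		case 1
		then obtain x y where "A = env_class x" "B = env_class y" "x\<in>cspan (words S)" "y\<in>cspan (words S)" by (auto simp: ES_def)
		then show thesis using that(1)[of x y v] 1 by (simp add: env_module_simps)
	next
		case 2
		then obtain x where "A = env_class x" "x\<in>cspan (words S)" by (auto simp: ES_def)
		then show thesis using that(2)[of x v w] 2 by simp
	next
		case 3
		then obtain x where "A = env_class x" "x\<in>cspan (words S)" by (auto simp: ES_def)
		then show thesis using that(3)[of c x v] 3 s[of "(A, v)" c] by (simp only: env_module_simps)
	next
		case 4
		then obtain x where "A = env_class x" "x\<in>cspan (words S)" by (auto simp: ES_def)
		then show thesis using that(4)[of x c v] 4 s[of "(A, v)" c] by (simp only:)
	next
		case 5
		then obtain x y where "A = env_class x" "r = env_class y" "x\<in>cspan (words S)" "y\<in>cspan (words (S\<inter>p))" by (auto simp: ES_def)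
		then show thesis using that(5)[of x y v] 5 by (simp add: env_ring_simps)
	qed
qed

lemma ES_I: "x\<in>cspan (words S) ==> env_class x\<in>ES S" by (simp add: ES_def)

lemma rel1: "x\<in>cspan (words S) ==> y\<in>cspan (words S) ==> v\<in>carrier V ==>
		sg (env_class (x + y), v) - sg (env_class x, v) - sg (env_class y, v)\<in>EK S"
	and rel2: "x\<in>cspan (words S) ==> v\<in>carrier V ==> w\<in>carrier V ==>
		sg (env_class x, v \<oplus>\<^bsub>V\<^esub> w) - sg (env_class x, v) - sg (env_class x, w)\<in>EK S"
	and rel3: "x\<in>cspan (words S) ==> v\<in>carrier V ==> sg (env_class (c *c x), v) - c *c sg (env_class x, v)\<in>EK S"
	and rel4: "x\<in>cspan (words S) ==> v\<in>carrier V ==> sg (env_class x, c \<odot>\<^bsub>V\<^esub> v) - c *c sg (env_class x, v)\<in>EK S"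
	and rel5: "x\<in>cspan (words S) ==> r\<in>cspan (words (S\<inter>p)) ==> v\<in>carrier V ==>
		sg (env_class (x * r), v) - sg (env_class x, env_act p V (env_class r) v)\<in>EK S"
	unfolding EK_def erels_def bilinear_rels_def env_module_simps(1) single_scaleC[of _ c, symmetric]
			env_module_simps(2)[where A = "ES S", symmetric] env_module_simps(3)[where A = "ES S", symmetric] env_ring_simps(1)[symmetric]
	by (rule cspan_base, use ES_I in blast)+

lemma EK_EF: "(S\<inter>p)\<subseteq>S ==> EK S\<subseteq>EF S"
	unfolding EK_def
proof (rule cspan_least)
	have s: "sg (env_class x, v)\<in>EF S" if "x\<in>cspan (words S)" "v\<in>carrier V" for x v
		using that by (simp add: EF_def ES_I)
	have m: "cspan (words (S\<inter>p))\<subseteq>cspan (words p)" "cspan (words (S\<inter>p))\<subseteq>cspan (words S)"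
		by (intro cspan_mono; force simp: words_def)+
	show "erels S\<subseteq>EF S"
	proof
		fix q assume "q\<in>erels S"
		then show "q\<in>EF S"
		proof (cases rule: erels_cases)
			case (5 x r v)
			then show ?thesis using env_act[of r v] m by (auto intro!: csub_diff s words_mult)
		qed (auto intro!: csub_diff csub_scale s cspan_add cspan_scale)
	qed
qed simp

lemma EK_mono: "S\<subseteq>S' ==> EK S\<subseteq>EK S'"
	unfolding EK_def[of S]
proof (rule cspan_least)
	assume S: "S\<subseteq>S'"
	have m: "cspan (words S)\<subseteq>cspan (words S')" "cspan (words (S\<inter>p))\<subseteq>cspan (words (S'\<inter>p))"
		using S by (intro cspan_mono; force simp: words_def)+
	show "erels S\<subseteq>EK S'"
	proof
		fix q assume "q\<in>erels S"
		then show "q\<in>EK S'" by (cases rule: erels_cases) (use m rel1 rel2 rel3 rel4 rel5 in \<open>auto simp: subset_iff\<close>)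
	qed
qed simp

lemma word_x: "x\<in>S ==> y\<in>cspan (words S) ==> word [x] * y\<in>cspan (words S)"
	by (rule words_mult) (simp_all add: word_carrier)

lemma ET_EK: "x\<in>S ==> q\<in>EK S ==> ET x q\<in>EK S"
	unfolding EK_def[of S]
proof (rule lin_on_span[OF ET_lin[of UNIV], of "erels S"])
	fix s assume x: "x\<in>S" and "s\<in>erels S"
	note w = word_x[OF x]
	from \<open>s\<in>erels S\<close> show "ET x s\<in>cspan (erels S)"
		unfolding EK_def[symmetric]
	proof (cases rule: erels_cases)
		case (1 y z v)
		then show "ET x s\<in>EK S" using rel1[OF w w, of y z v] by (simp add: ET_diff ET_sg distrib_left)
	next
		case (2 y v z)
		then show "ET x s\<in>EK S" using rel2[OF w, of y v z] by (simp add: ET_diff ET_sg)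
	next
		case (3 c y v)
		then show "ET x s\<in>EK S" using rel3[OF w, of y v c] by (simp add: ET_diff ET_scale ET_sg scaleC_mult_right)
	next
		case (4 c y v)
		then show "ET x s\<in>EK S" using rel4[OF w, of y v c] by (simp add: ET_diff ET_scale ET_sg)
	next
		case (5 y r v)
		then show "ET x s\<in>EK S" using rel5[OF w, of y r v] by (simp add: ET_diff ET_sg mult.assoc)
	qed
qed auto

lemma env_tensor_eq: "env_tensor (env_sub S) (env_sub (S\<inter>p)) p V = quotient_module (tl_module (EF S) ET) (EK S)"
proof -
	have "(\<lambda>x. lin_ext (\<lambda>(b, v). Poly_Mapping.single (env_class (gen x) \<otimes>\<^bsub>env_ring\<^esub> b, v) 1)) = (ET :: 'g => ('g free_algebra set \<times> 'v \<Rightarrow>\<^sub>0 complex) => _)"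
		by (rule ext) (simp add: ET_def lin_ext_lext)
	moreover have "vspan (tl_module (EF S) ET) (erels S) = EK S"
		using vspan_tl[OF EF_subspace, of "erels S" S ET] EK_EF[of S] cspan_superset[of "erels S"] by (auto simp: EK_def)
	ultimately show ?thesis
		unfolding env_tensor_def Let_def env_sub_ES free_module_tl EF_def[symmetric] erels_def[symmetric] by simp
qed

lemma env_tensor_cs:
	defines "Q S \<equiv> env_tensor (env_sub S) (env_sub (S\<inter>p)) p V"
	shows "carrier (Q S) = cs (EK S) ` EF S" "zero (Q S) = EK S"
		"cs (EK S) x \<oplus>\<^bsub>Q S\<^esub> cs (EK S) y = cs (EK S) (x + y)"
		"c \<odot>\<^bsub>Q S\<^esub> cs (EK S) x = cs (EK S) (c *c x)"
		"z\<in>S ==> act (Q S) z (cs (EK S) x) = cs (EK S) (ET z x)"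
	unfolding Q_def env_tensor_eq using quot_cs[OF EF_subspace EK_subspace EK_EF, of S "tl_module (EF S) ET"]
	by (simp_all add: cs_set_add ET_add ET_EK)

text \<open>The canonical map of the induced module to the functions on sorted words.\<close>

definition Th :: "('g free_algebra set \<times> 'v \<Rightarrow>\<^sub>0 complex) => nat list => 'w" where
	"Th = lext (\<lambda>(A, v). the_elem (Lam ` A) (\<phi> v))"

lemma Th_sg: "Th (sg (env_class x, v)) = Lam x (\<phi> v)"
proof -
	have "Lam ` env_class x = {Lam x}"
		using cs_self[OF env_ideal_csub, of x] Lam_env_ideal by (auto simp: env_class_cs cs_def Lam_add image_iff)
	then show ?thesis by (simp add: Th_def)
qed
lemma Th_add: "Th (x + y) = Th x + Th y" and Th_scale: "Th (c *c x) = c *c Th x" and Th_diff: "Th (x - y) = Th x - Th y"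
	and Th_0: "Th 0 = 0"
	by (simp_all add: Th_def lext_add lext_scale lext_diff)
lemma Th_lin [simp]: "lin_on U Th" by (simp add: Th_def)

text \<open>The only relation beyond linearity moves a factor over \<open>p\<close> through the
  tensor sign, which is \<open>Lam_mult\<close>.\<close>

lemma Th_EK: assumes "q\<in>EK S" shows "Th q = 0"
proof -
	have "Th q\<in>{0}"
	proof (rule lin_on_span[OF Th_lin[of UNIV] _ _ _ _ assms[unfolded EK_def]])
		fix s assume "s\<in>erels S"
		then show "Th s\<in>{0}"
		proof (cases rule: erels_cases)
			case (5 x r v)
			have "cspan (words (S\<inter>p))\<subseteq>cspan (words p)" by (intro cspan_mono) (force simp: words_def)
			then have "r\<in>cspan (words p)" using 5 by auto
			then show ?thesis using Lam_mult[of r "\<phi> v" x] env_act[of r v] 5 by (simp add: Th_diff Th_sg)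
		qed (simp_all add: Th_diff Th_scale Th_sg Lam_add Lam_scale lin_on_add[OF Lam_lin_W] lin_on_scale[OF Lam_lin_W])
	qed (auto simp: csub_def)
	then show ?thesis by simp
qed

definition SC :: "nat list set" where "SC = {c. sorted c \<and> set c\<subseteq>{..<m}}"
text \<open>The same set generates the induced modules for both choices of \<open>S\<close>, since
  it uses only letters below \<open>m\<close>.\<close>

definition GS :: "('g free_algebra set \<times> 'v \<Rightarrow>\<^sub>0 complex) set" where
	"GS = {sg (env_class (word (map e c)), v) | c v. c\<in>SC \<and> v\<in>carrier V}"

section \<open>Induced modules over a subalgebra spanned by the basis vectors with index in
  \<open>J\<close>\<close>

context
	fixes S :: "'g set" and J :: "nat set"
	assumes S: "subalgebra S" and J: "J\<subseteq>{..<n}" "{..<m}\<subseteq>J" and e_S: "\<And>k. k\<in>J ==> e k\<in>S"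
		and co_S: "\<And>x k. x\<in>S ==> k < n ==> k \<notin> J ==> co x k = 0"
begin

lemma S_expand: "x\<in>S ==> x = (\<Sum>k\<in>J. co x k *c e k)"
proof -
	assume x: "x\<in>S"
	have "(\<Sum>k<n. co x k *c e k) = (\<Sum>k\<in>J. co x k *c e k)"
		by (rule sum.mono_neutral_right) (use J co_S[OF x] in auto)
	then show ?thesis using expand[of x] by simp
qed

lemma map_e_S: "set w\<subseteq>J ==> set (map e w)\<subseteq>S" using e_S by auto

text \<open>Sorting within \<open>S\<close> moves the letters of \<open>p\<close> to the right,
  where they are absorbed into the vector of \<open>V\<close>. This is the spanning half of the
  comparison.\<close>

lemma reduction: "EF S\<subseteq>cspan (GS\<union>EK S)"
proof -
	let ?R = "cspan (GS\<union>EK S)"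
	have KR: "EK S\<subseteq>?R" and GR: "GS\<subseteq>?R" by (auto intro: cspan_base)
	\<comment> \<open>The claim for \<open>x\<close> is made for all \<open>v\<close> at once, because
	  absorbing letters of \<open>p\<close> changes \<open>v\<close>.\<close>
	define U where "U = {x\<in>cspan (words S). \<forall>v\<in>carrier V. sg (env_class x, v)\<in>?R}"
	have Us: "csub U"
	proof (rule csubI)
		show "0\<in>U"
			using rel3[of 0 S _ 0] KR by (auto simp: U_def cspan_0)
		fix x y assume xy: "x\<in>U" "y\<in>U"
		have "sg (env_class (x + y), v)\<in>?R" if v: "v\<in>carrier V" for v
		proof -
			have "(sg (env_class (x + y), v) - sg (env_class x, v) - sg (env_class y, v)) + (sg (env_class x, v) + sg (env_class y, v))\<in>?R"
				using rel1[of x S y v] KR xy v by (intro cspan_add) (auto simp: U_def)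
			then show ?thesis by simp
		qed
		then show "x + y\<in>U" using xy by (auto simp: U_def cspan_add)
	next
		fix c x assume x: "x\<in>U"
		have "sg (env_class (c *c x), v)\<in>?R" if v: "v\<in>carrier V" for v
		proof -
			have "(sg (env_class (c *c x), v) - c *c sg (env_class x, v)) + c *c sg (env_class x, v)\<in>?R"
				using rel3[of x S v c] KR x v by (intro cspan_add cspan_scale) (auto simp: U_def)
			then show ?thesis by simp
		qed
		then show "c *c x\<in>U" using x by (auto simp: U_def cspan_scale)
	qed
	have Ueq: "y\<in>U" if "x\<in>U" "y\<in>cspan (words S)" "y - x\<in>env_ideal" for x y
		using that env_class_eq[of y x] by (auto simp: U_def)
	have basis: "word (map e w)\<in>U" if "set w\<subseteq>J" for w
		using that
	proof (induction w rule: sorting_induct)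
		case (sorted w)
		obtain c q where w: "w = c @ q" "sorted c" "set c\<subseteq>{..<m}" "set q\<subseteq>{m..<n}"
			using split_sorted[OF sorted(2)] sorted(1) J(1) by blast
		have "set (map e q)\<subseteq>S\<inter>p" using map_e_S[of q] e_p_list[OF w(4)] sorted(1) w(1) by auto
		then have q: "word (map e q)\<in>cspan (words (S\<inter>p))" "word (map e q)\<in>cspan (words p)" by (simp_all add: word_carrier)
		have c: "word (map e c)\<in>cspan (words S)" using map_e_S[of c] sorted(1) w(1) by (intro word_carrier) auto
		have "sg (env_class (word (map e w)), v)\<in>?R" if v: "v\<in>carrier V" for v
		proof -
			have "sg (env_class (word (map e c)), env_act p V (env_class (word (map e q))) v)\<in>GS"
				unfolding GS_def SC_def using w env_act[OF q(2) v] by blast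
			then have "(sg (env_class (word (map e c) * word (map e q)), v) - sg (env_class (word (map e c)), env_act p V (env_class (word (map e q))) v))
				+ sg (env_class (word (map e c)), env_act p V (env_class (word (map e q))) v)\<in>?R"
				using rel5[OF c q(1) v] KR GR by (intro cspan_add) auto
			then show ?thesis by (simp add: w(1) word_mult)
		qed
		then show ?case using word_carrier[OF map_e_S[OF sorted(1)]] by (simp add: U_def)
	next
		case (swap A i j C)
		let ?b = "bracket (e i) (e j)"
		have "?b\<in>S" using e_S swap.hyps(1) by (intro subalg_bracket[OF S]) auto
		note ex = S_expand[OF this]
		have U: "word (map e (A @ j # i # C)) + (\<Sum>k\<in>J. co ?b k *c word (map e (A @ k # C)))\<in>U"
			using swap.IH by (intro csub_add csub_sum csub_scale Us) auto
		have "word (map e A @ ?b # map e C) - (\<Sum>k\<in>J. co ?b k *c word (map e A @ e k # map e C))\<in>env_ideal"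
			using env_sum[of "map e A" "co ?b" e J "map e C"] ex by simp
		with env_bracket[of "map e A" "e i" "e j" "map e C"]
		have "(word (map e A @ e i # e j # map e C) - word (map e A @ e j # e i # map e C) - word (map e A @ ?b # map e C)) +
			(word (map e A @ ?b # map e C) - (\<Sum>k\<in>J. co ?b k *c word (map e A @ e k # map e C)))\<in>env_ideal"
			by (intro csub_add env_ideal_csub)
		then have "word (map e (A @ i # j # C)) - (word (map e (A @ j # i # C)) + (\<Sum>k\<in>J. co ?b k *c word (map e (A @ k # C))))\<in>env_ideal"
			by (simp add: algebra_simps)
		then show ?case by (rule Ueq[OF U word_carrier[OF map_e_S[OF swap.hyps(1)]]])
	qed
	\<comment> \<open>The letters of a general word are expanded in the basis from left to right;
	  \<open>w\<close> collects the part already expanded.\<close>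
	have all: "word (map e w @ xs)\<in>U" if "set xs\<subseteq>S" "set w\<subseteq>J" for w xs
		using that
	proof (induction xs arbitrary: w)
		case Nil
		then show ?case using basis by simp
	next
		case (Cons x xs)
		have x: "x\<in>S" using Cons.prems by simp
		have U: "(\<Sum>k\<in>J. co x k *c word (map e w @ e k # xs))\<in>U"
		proof (intro csub_sum csub_scale Us)
			fix k assume "k\<in>J"
			then show "word (map e w @ e k # xs)\<in>U" using Cons.IH[of "w @ [k]"] Cons.prems by simp
		qed
		have "word (map e w @ x # xs)\<in>cspan (words S)" using Cons.prems map_e_S[of w] by (intro word_carrier) auto
		then show ?case using Ueq[OF U] env_sum[of "map e w" "co x" e J xs] S_expand[OF x] by simp
	qed
	have UU: "cspan (words S)\<subseteq>U"
		by (rule cspan_least[OF _ Us]) (use all[of _ "[]"] in \<open>auto simp: words_def\<close>)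
	show ?thesis
		unfolding EF_span
	proof (rule cspan_least)
		show "sg ` (ES S \<times> carrier V)\<subseteq>?R"
		proof clarify
			fix A v assume A: "A\<in>ES S" and v: "v\<in>carrier V"
			then obtain x where x: "A = env_class x" "x\<in>cspan (words S)" by (auto simp: ES_def)
			then have "x\<in>U" using UU by auto
			then show "sg (A, v)\<in>?R" using x v by (simp add: U_def)
		qed
	qed simp
qed

text \<open>Modulo the relations over \<open>S\<close> alone, an element of the span of
  \<open>GS\<close> equals the sum of \<open>tm c (Th g c)\<close> over finitely many sorted words.
  If \<open>Th g\<close> vanishes, the summands are relations as well.\<close>

lemma kernel: assumes g: "g\<in>cspan GS" "Th g = 0" shows "g\<in>EK S"
proof -
	define tm where "tm c w = sg (env_class (word (map e c)), inv_model w)" for c w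
	have cS: "word (map e c)\<in>cspan (words S)" if "c\<in>SC" for c
		by (rule word_carrier[OF map_e_S]) (use that J in \<open>auto simp: SC_def\<close>)
	have inv_add: "inv_model (x + y) = inv_model x \<oplus>\<^bsub>V\<^esub> inv_model y" if "x\<in>W" "y\<in>W" for x y
		by (rule phi_inj) (use that inv_model csub_add[OF Ws] in auto)
	have inv_scale: "inv_model (c *c x) = c \<odot>\<^bsub>V\<^esub> inv_model x" if "x\<in>W" for x c
		by (rule phi_inj) (use that inv_model csub_scale[OF Ws] in auto)
	have tm_add: "tm c (x + y) - tm c x - tm c y\<in>EK S" if "c\<in>SC" "x\<in>W" "y\<in>W" for c x y
		using rel2[OF cS[OF that(1)]] inv_model(1) that by (simp add: tm_def inv_add)
	have tm_scale: "tm c (k *c x) - k *c tm c x\<in>EK S" if "c\<in>SC" "x\<in>W" for c k x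
		using rel4[OF cS[OF that(1)]] inv_model(1) that by (simp add: tm_def inv_scale)
	have tm_0: "tm c 0\<in>EK S" if "c\<in>SC" for c
		using tm_scale[OF that csub_0[OF Ws], of 0] by simp
	\<comment> \<open>The representation is claimed for every finite set above \<open>C\<close>, so
	  that the supports of two summands can be merged.\<close>
	define Cl where "Cl g C \<longleftrightarrow> C\<subseteq>SC \<and> finite C \<and> (\<forall>c. Th g c\<in>W) \<and>
		(\<forall>D. finite D \<longrightarrow> C\<subseteq>D \<longrightarrow> D\<subseteq>SC \<longrightarrow> g - (\<Sum>c\<in>D. tm c (Th g c))\<in>EK S)" for g C
	have "\<exists>C. Cl g C"
		using g(1)
	proof (induction rule: cspan_induct)
		case zero
		have "- (\<Sum>c\<in>D. tm c 0)\<in>EK S" if "D\<subseteq>SC" for D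
			using that tm_0 by (intro csub_neg csub_sum EK_subspace) auto
		then show ?case by (intro exI[of _ "{}"]) (auto simp: Cl_def Th_0 csub_0)
	next
		case (base g)
		then obtain c v where cv: "g = sg (env_class (word (map e c)), v)" "c\<in>SC" "v\<in>carrier V" by (auto simp: GS_def)
		have T: "Th g = (\<lambda>s. if s = c then \<phi> v else 0)"
			using Lam_sorted[of c "\<phi> v"] cv by (simp add: Th_sg SC_def)
		have "g - (\<Sum>d\<in>D. tm d (Th g d))\<in>EK S" if D: "finite D" "{c}\<subseteq>D" "D\<subseteq>SC" for D
		proof -
			have "(\<Sum>d\<in>D. tm d (Th g d)) = tm c (Th g c) + (\<Sum>d\<in>D - {c}. tm d (Th g d))"
				using D by (intro sum.remove) auto
			moreover have "tm c (Th g c) = g" unfolding T using cv(3) by (simp add: cv(1) tm_def inv_phi)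
			moreover have "(\<Sum>d\<in>D - {c}. tm d (Th g d))\<in>EK S"
				using D tm_0 by (intro csub_sum EK_subspace) (auto simp: T)
			ultimately show ?thesis using csub_neg[OF EK_subspace] by simp
		qed
		moreover have "Th g d\<in>W" for d using cv(3) by (simp add: T csub_0)
		ultimately have "Cl g {c}" unfolding Cl_def using cv(2) by simp
		then show ?case ..
	next
		case (add x y)
		then obtain C C' where CC: "Cl x C" "Cl y C'" by blast
		note C = CC(1)[unfolded Cl_def] and C' = CC(2)[unfolded Cl_def]
		have "x + y - (\<Sum>c\<in>D. tm c (Th (x + y) c))\<in>EK S" if D: "finite D" "C\<union>C'\<subseteq>D" "D\<subseteq>SC" for D
		proof -
			have "x + y - (\<Sum>c\<in>D. tm c (Th (x + y) c)) = (x - (\<Sum>c\<in>D. tm c (Th x c))) + (y - (\<Sum>c\<in>D. tm c (Th y c)))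
				- (\<Sum>c\<in>D. tm c (Th x c + Th y c) - tm c (Th x c) - tm c (Th y c))"
				by (simp add: Th_add sum_subtractf)
			also have "...\<in>EK S"
			proof -
				have "x - (\<Sum>c\<in>D. tm c (Th x c))\<in>EK S" "y - (\<Sum>c\<in>D. tm c (Th y c))\<in>EK S" using D C C' by simp_all
				moreover have "(\<Sum>c\<in>D. tm c (Th x c + Th y c) - tm c (Th x c) - tm c (Th y c))\<in>EK S"
					by (rule csub_sum[OF EK_subspace], rule tm_add) (use D C C' in auto)
				ultimately show ?thesis using csub_diff[OF EK_subspace csub_add[OF EK_subspace]] by blast
			qed
			finally show ?thesis .
		qed
		moreover have "Th (x + y) d\<in>W" for d using C C' by (simp add: Th_add csub_add)
		ultimately have "Cl (x + y) (C\<union>C')" unfolding Cl_def using C C' by simp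
		then show ?case ..
	next
		case (scale k x)
		then obtain C where CC: "Cl x C" by blast
		note C = CC[unfolded Cl_def]
		have "k *c x - (\<Sum>c\<in>D. tm c (Th (k *c x) c))\<in>EK S" if D: "finite D" "C\<subseteq>D" "D\<subseteq>SC" for D
		proof -
			have "k *c x - (\<Sum>c\<in>D. tm c (Th (k *c x) c)) = k *c (x - (\<Sum>c\<in>D. tm c (Th x c)))
				- (\<Sum>c\<in>D. tm c (k *c Th x c) - k *c tm c (Th x c))"
				by (simp add: Th_scale sum_subtractf scaleC_diff_right scaleC_sum)
			also have "...\<in>EK S"
			proof -
				have "x - (\<Sum>c\<in>D. tm c (Th x c))\<in>EK S" using D C by simp
				moreover have "(\<Sum>c\<in>D. tm c (k *c Th x c) - k *c tm c (Th x c))\<in>EK S"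
					by (rule csub_sum[OF EK_subspace], rule tm_scale) (use D C in auto)
				ultimately show ?thesis using csub_diff[OF EK_subspace csub_scale[OF EK_subspace]] by blast
			qed
			finally show ?thesis .
		qed
		moreover have "Th (k *c x) d\<in>W" for d using C by (simp add: Th_scale csub_scale)
		ultimately have "Cl (k *c x) C" unfolding Cl_def using C by simp
		then show ?case ..
	qed
	then obtain C where "Cl g C" ..
	then have C: "C\<subseteq>SC" "finite C" "g - (\<Sum>c\<in>C. tm c 0)\<in>EK S" using g(2) by (auto simp: Cl_def)
	have "(g - (\<Sum>c\<in>C. tm c 0)) + (\<Sum>c\<in>C. tm c 0)\<in>EK S"
		using C tm_0 by (intro csub_add csub_sum EK_subspace) auto
	then show ?thesis by simp
qed

lemma GS_EF: "GS\<subseteq>EF S"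
proof
	fix g assume "g\<in>GS"
	then obtain c v where cv: "g = sg (env_class (word (map e c)), v)" "c\<in>SC" "v\<in>carrier V" by (auto simp: GS_def)
	have "word (map e c)\<in>cspan (words S)"
		by (rule word_carrier[OF map_e_S]) (use cv(2) J in \<open>auto simp: SC_def\<close>)
	then show "g\<in>EF S" using cv by (simp add: EF_def ES_I)
qed

end

end

section \<open>Inflation of a Levi module to the parabolic subalgebra\<close>

context reductive_parabolic
begin

definition lpart :: "'g => 'g" where "lpart x = (THE y. y\<in>L \<and> x - y\<in>N)"

lemma lpart_eq: "y\<in>L ==> x - y\<in>N ==> lpart x = y"
	unfolding lpart_def
proof (rule the_equality)
	fix z assume *: "y\<in>L" "x - y\<in>N" "z\<in>L \<and> x - z\<in>N"
	then have "z - y\<in>L" using csub_diff[OF L_subspace] by blast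
	moreover have "(x - y) - (x - z)\<in>N" using csub_diff[OF N_subspace] * by blast
	ultimately have "z - y\<in>L\<inter>N" by simp
	then show "z = y" using L_N by simp
qed simp

lemma lpart: "x\<in>P ==> lpart x\<in>L \<and> x - lpart x\<in>N"
proof -
	assume "x\<in>P"
	then have "x\<in>{x + y | x y. x\<in>L \<and> y\<in>N}" using P_eq by blast
	then obtain y z where "x = y + z" "y\<in>L" "z\<in>N" by blast
	then show ?thesis using lpart_eq[of y x] by simp
qed

lemma lpart_add: "x\<in>P ==> y\<in>P ==> lpart (x + y) = lpart x + lpart y"
proof (rule lpart_eq)
	assume xy: "x\<in>P" "y\<in>P"
	show "lpart x + lpart y\<in>L" using lpart xy csub_add[OF L_subspace] by blast
	have "(x - lpart x) + (y - lpart y)\<in>N" using lpart xy csub_add[OF N_subspace] by blast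
	then show "x + y - (lpart x + lpart y)\<in>N" by (simp add: algebra_simps)
qed

lemma lpart_scale: "x\<in>P ==> lpart (c *c x) = c *c lpart x"
	using lpart_eq lpart csub_scale L_subspace N_subspace scaleC_diff_right by metis

text \<open>\<open>N\<close> is an ideal of \<open>P\<close>, so the projection to the Levi part is
  a homomorphism; this makes the inflated action a representation.\<close>

lemma lpart_bracket: "x\<in>P ==> y\<in>P ==> lpart (bracket x y) = bracket (lpart x) (lpart y)"
proof (rule lpart_eq)
	assume xy: "x\<in>P" "y\<in>P"
	note l = lpart[OF xy(1)] lpart[OF xy(2)]
	show "bracket (lpart x) (lpart y)\<in>L" using l subalg_bracket[OF L_subalg] by blast
	have "bracket x (y - lpart y)\<in>N" using N_stable[OF xy(1)] l by blast
	moreover have "bracket (lpart y) (x - lpart x)\<in>N" using N_stable l L_P by blast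
	ultimately have "bracket x (y - lpart y) - bracket (lpart y) (x - lpart x)\<in>N" by (rule csub_diff[OF N_subspace])
	then show "bracket x y - bracket (lpart x) (lpart y)\<in>N"
		using bracket_anti[of "lpart y" x] bracket_anti[of "lpart y" "lpart x"] by (simp add: bracket_diff_right algebra_simps)
qed

lemma inflate_eq: "inflate P L V = V\<lparr>act := (\<lambda>x. act V (lpart x))\<rparr>"
	by (simp add: inflate_def lpart_def N_def)

lemma inflate_rep: "lie_rep L W a ==> lie_rep P W (\<lambda>x. a (lpart x))"
proof -
	assume "lie_rep L W a"
	then interpret lie_rep L W a .
	show ?thesis
		by unfold_locales
			(auto simp: P W lpart closed lin comm lpart_bracket lin_on_def lpart_add lpart_scale
				lin_on_add[OF lin_left] lin_on_scale[OF lin_left] lin_on_add[OF lin] lin_on_scale[OF lin])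
qed

end

text \<open>\<open>GS\<close> spans both modules modulo their relations, which gives surjectivity.
  \<open>Th\<close> kills the relations over the whole algebra and detects elements of the span of
  \<open>GS\<close> modulo the relations over \<open>S\<close>, which gives injectivity.\<close>

lemma (in induced) comparison_isomorphism:
	assumes S: "subalgebra S" and J: "J\<subseteq>{..<n}" "{..<m}\<subseteq>J" and e_S: "\<And>k. k\<in>J ==> e k\<in>S"
		and co_S: "\<And>x k. x\<in>S ==> k < n ==> k \<notin> J ==> co x k = 0" and i: "range i\<subseteq>S"
	shows "lie_isomorphic UNIV (pullback i (env_tensor (env_sub S) (env_sub (S\<inter>p)) p V))
		(pullback i (env_tensor (env_sub UNIV) (env_sub p) p V))"
proof -
	let ?Q = "env_tensor (env_sub S) (env_sub (S\<inter>p)) p V" and ?M = "env_tensor (env_sub UNIV) (env_sub p) p V"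
	let ?K1 = "EK S" and ?K2 = "EK UNIV"
	note Q = env_tensor_cs[where S = S] and M = env_tensor_cs[where S = UNIV, unfolded Int_UNIV_left]
	have U: "subalgebra (UNIV :: 'g set)" by (simp add: subalgebra_def)
	have red1: "EF S\<subseteq>cspan (GS\<union>?K1)" and GS1: "GS\<subseteq>EF S" and ker: "\<And>g. g\<in>cspan GS ==> Th g = 0 ==> g\<in>?K1"
		using reduction[OF S J] GS_EF[OF S J] kernel[OF S J] e_S co_S by blast+
	have red2: "EF UNIV\<subseteq>cspan (GS\<union>?K2)" by (rule reduction[OF U, of "{..<n}"]) (use mn in auto)
	have K12: "?K1\<subseteq>?K2" and F12: "EF S\<subseteq>EF UNIV" using EK_mono EF_mono by auto
	\<comment> \<open>The reduction over \<open>S\<close> leaves an element \<open>g\<close> in the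
	  span of \<open>GS\<close>. As \<open>x\<close> is a relation over the whole algebra,
	  \<open>Th\<close> vanishes on \<open>g\<close>, which is therefore a relation over
	  \<open>S\<close>.\<close>
	have inj: "x\<in>?K1" if x: "x\<in>EF S" "x\<in>?K2" for x
	proof -
		have "x\<in>cspan (GS\<union>?K1)" using red1 x(1) by blast
		then obtain g k where gk: "g\<in>cspan GS" "k\<in>?K1" "x = g + k"
			using cspan_eq[OF EK_subspace, of S] unfolding cspan_Un by auto
		have "Th x = 0" "Th k = 0" using Th_EK x(2) gk(2) by auto
		then have "Th g = 0" using gk(3) by (simp add: Th_add)
		then show ?thesis using ker[OF gk(1)] gk csub_add[OF EK_subspace] by blast
	qed
	have surj: "\<exists>y\<in>EF S. x - y\<in>?K2" if x: "x\<in>EF UNIV" for x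
	proof -
		have "x\<in>cspan (GS\<union>?K2)" using red2 x by blast
		then obtain g k where gk: "g\<in>cspan GS" "k\<in>?K2" "x = g + k"
			using cspan_eq[OF EK_subspace, of UNIV] unfolding cspan_Un by auto
		have "g\<in>EF S" using cspan_least[OF GS1 EF_subspace] gk(1) by blast
		then show ?thesis using gk(2,3) by (intro bexI[of _ g]) simp_all
	qed
	\<comment> \<open>The relations over \<open>S\<close> are contained in those over the whole
	  algebra, so this union is the one larger coset.\<close>
	define f where "f C = (\<Union>x\<in>C. cs ?K2 x)" for C
	have f: "f (cs ?K1 x) = cs ?K2 x" for x
	proof -
		have "cs ?K2 y = cs ?K2 x" if y: "y\<in>cs ?K1 x" for y
		proof -
			obtain k where "k\<in>?K1" "y = k + x" using y by (auto simp: cs_def)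
			then show ?thesis using K12 by (simp add: cs_eq_iff subset_iff)
		qed
		then show ?thesis unfolding f_def using cs_self[OF EK_subspace, of x S] by blast
	qed
	have "bij_betw f (carrier ?Q) (carrier ?M)"
		unfolding bij_betw_def Q(1) M(1)
	proof
		show "inj_on f (cs ?K1 ` EF S)"
		proof (rule inj_onI)
			fix A B assume "A\<in>cs ?K1 ` EF S" "B\<in>cs ?K1 ` EF S" "f A = f B"
			then obtain x y where xy: "x\<in>EF S" "y\<in>EF S" "A = cs ?K1 x" "B = cs ?K1 y" "cs ?K2 x = cs ?K2 y" using f by auto
			then have "x - y\<in>?K1" using inj[OF csub_diff[OF EF_subspace]] by (simp add: cs_eq_iff)
			then show "A = B" using xy by (simp add: cs_eq_iff)
		qed
		have "cs ?K2 x\<in>f ` cs ?K1 ` EF S" if x: "x\<in>EF UNIV" for x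
		proof -
			obtain y where y: "y\<in>EF S" "x - y\<in>?K2" using surj[OF x] by blast
			then have "cs ?K2 x = f (cs ?K1 y)" by (simp add: f cs_eq_iff)
			then show ?thesis using y(1) by blast
		qed
		then show "f ` cs ?K1 ` EF S = cs ?K2 ` EF UNIV" using F12 f by (auto simp: image_iff subset_iff)
	qed
	moreover have "f (act ?Q (i z) C) = act ?M (i z) (f C)" if C: "C\<in>carrier ?Q" for z C
	proof -
		obtain x where x: "C = cs ?K1 x" using C unfolding Q(1) by blast
		have "i z\<in>S" using i by auto
		then show ?thesis by (simp add: x Q(5) M(5) f)
	qed
	ultimately show ?thesis
		unfolding lie_isomorphic_def
		by (intro exI[of _ f]) (auto simp: Q(1,3,4) M(3,4) f)
qed

theorem proposition4p3:
  fixes i :: "'k::fin_dim_lie_algebra \<Rightarrow> 'g::fin_dim_lie_algebra"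
    and hbar bbar pbar lbar :: "'k set"
    and h b p l N :: "'g set"
    and B :: "'g \<Rightarrow> 'g \<Rightarrow> complex"
    and lam :: "'g \<Rightarrow> complex"
    and V :: "('g, 'v) lie_module"
  assumes "reductive (UNIV :: 'k set)" and "reductive (UNIV :: 'g set)"
    and "lie_hom i" and "inj i" and "reductive_in i"
    and "cartan_subalgebra hbar" and "cartan_subalgebra h" and "i ` hbar \<subseteq> h"
    and "borel_subalgebra bbar" and "hbar \<subseteq> bbar"
    and "borel_subalgebra b" and "h \<subseteq> b" and "i ` bbar \<subseteq> b"
    and "subalgebra p" and "b \<subseteq> p"
    and "pbar = i -` (range i \<inter> p)"
    and "levi_part h p l" and "levi_part hbar pbar lbar"
    and "i ` lbar = l \<inter> range i"
    and "invariant_form B"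
    and "lie_submodule lbar N (pullback i (adjoint_module (opposite_nilradical h p)))"
    and "lie_isomorphic lbar (pullback i (adjoint_module N))
           (adjoint_module (opposite_nilradical hbar pbar))"
    and "finite_branching i hbar bbar lbar B h b p l N"
    and "lam \<in> dual_space h" and "dominant_integral B h b l lam"
    and "irreducible_highest_weight h b l lam V"
  shows "lie_isomorphic UNIV (top_level_module i pbar p l V)
           (pullback i (gen_verma_module p l V))"
proof -
	have pbar: "pbar = i -` p" using assms(16) by auto
	have hom: "i (x + y) = i x + i y" "i (c *c x) = c *c i x" "i (bracket x y) = bracket (i x) (i y)" for x y c
		using assms(3) by (auto simp: lie_hom_def)
	have i0: "i 0 = 0" using hom(2)[of 0 0] by simp
	have ps: "csub p" using assms(14) by (rule subalg_csub)
	have "subalgebra pbar"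
		unfolding subalgebra_def pbar
		by (intro conjI csubI ballI)
			(auto simp: hom i0 csub_0[OF ps] csub_add[OF ps] csub_scale[OF ps] subalg_bracket[OF assms(14)])
	moreover have "bbar\<subseteq>pbar" using assms(13,15) by (auto simp: pbar)
	ultimately interpret branching_pair h b p l hbar bbar pbar lbar i
		by (intro branching_pair.intro branching_pair_axioms.intro reductive_parabolic.intro reductive_parabolic_axioms.intro
				reductive_borel.intro reductive_borel_axioms.intro reductive_cartan.intro assms(1-4,6,7,9-12,14,15,17-19) pbar)
	\<comment> \<open>The finite branching problem is used here, for the given \<open>lam\<close>,
	  whose simple module exists because \<open>V\<close> is one.\<close>
	have N: "N = g.NM"
		using finite_branching_whole assms(21,23-26) by (simp add: g.NM_def)
	have sum: "\<exists>z\<in>range i. \<exists>y\<in>p. x = z + y" for x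
		using range_plus_parabolic[of x] assms(22) N by (auto simp: g.NM_def k.NM_def)
	have "csub (range i)" by (rule csub_image) (auto simp: i_lin)
	then have K: "subalgebra (range i)" by (auto simp: subalgebra_def simp flip: i_bracket)
	obtain e n m m' and co :: "'g => nat => complex" where basis: "adapted_basis e n co" "m \<le> m'" "m' \<le> n"
		"\<And>k. m \<le> k ==> k < n ==> e k\<in>p" "\<And>x k. x\<in>p ==> k < m ==> co x k = 0"
		"\<And>k. k < m' ==> e k\<in>range i" "\<And>x k. x\<in>range i ==> m' \<le> k ==> k < n ==> co x k = 0"
		by (rule adapted_basis_exists[OF subalg_csub[OF K] ps sum]) (rule that)
	have Vmod: "is_lie_module l V" using assms(26) by (simp add: irreducible_highest_weight_def)
	then obtain W :: "('v \<Rightarrow>\<^sub>0 complex) set" and \<phi> where m: "lin_model V W \<phi>"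
		using lin_model_exists[of V] by (auto simp: is_lie_module_def)
	have rep: "lie_rep p W (\<lambda>x. model_act V \<phi> (g.lpart x))"
		by (rule g.inflate_rep[OF module_lie_rep[OF Vmod m g.L_subalg]])
	have m': "lin_model (inflate p l V) W \<phi>" using m by (simp add: lin_model_def g.inflate_eq)
	interpret induced e n co m p W "\<lambda>x. model_act V \<phi> (g.lpart x)" "inflate p l V" \<phi>
	proof (intro induced.intro adapted_rep.intro adapted_rep_axioms.intro induced_axioms.intro lmodel.intro m' rep basis(1))
		show "m \<le> n" using basis(2,3) by simp
		show "e k\<in>p" if "m \<le> k" "k < n" for k using basis(4) that by blast
		show "co x k = 0" if "x\<in>p" "k < m" for x k using basis(5) that by blast
		show "act (inflate p l V) x v\<in>carrier (inflate p l V) \<and> \<phi> (act (inflate p l V) x v) = model_act V \<phi> (g.lpart x) (\<phi> v)"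
			if "x\<in>p" "v\<in>carrier (inflate p l V)" for x v
			using that Vmod g.lpart[OF that(1)] by (simp add: g.inflate_eq model_act_phi[OF m] is_lie_module_def)
	qed
	\<comment> \<open>So the top level module is the tensor product over the elements of
	  \<open>range i\<close> that lie in \<open>p\<close>, the form required by the comparison with
	  \<open>S = range i\<close>; the indices belonging to \<open>S\<close> are those below
	  \<open>m'\<close>.\<close>
	have "i ` pbar = range i\<inter>p" by (auto simp: pbar)
	then show ?thesis
		unfolding top_level_module_def gen_verma_module_def
		using comparison_isomorphism[OF K, of "{..<m'}" i] basis by (auto simp: not_less)
qed

end
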